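(* For any $gt$-model $(Y,T^*_{Y,-})$ and any $b$, one has a containment of images $$\mathrm{im}\,\big(\Theta(T^*_{Y,-}),-\big)_*^{\{1,b\}}\subseteq\mathrm{im}\,\partial^{\{1,b\}},$$ where both maps are regarded as maps $\mathbf H_p^{1,b}(Y,T^*_{Y,-})\to\mathbf H_{p+1}^{0,b+1}(Y,T^*_{Y,-})$ for each cohomological degree $p$.
   Context: A model $(Y,T^*_{Y,-})$ is a complex manifold $Y$ with a holomorphic vector bundle $T^*_{Y,-}$; $T^*_{Y,(\pm)^{j}}$ is $T^*_Y$ if $j$ is even and $T^*_{Y,-}$ if $j$ is odd. It is a $gt$-model over $(B,T^*_{B,-})$ with fiber $(X,T^*_{X,-})$ if $Y=X\times B$ for complex manifolds $X,B$ (projections $p_X,p_B$) and there is a short exact sequence $0\to p_B^*T^*_{B,-}\to T^*_{Y,-}\to p_X^*T^*_{X,-}\to0$ with $T^*_{B,-},T^*_{X,-}$ locally free (pullbacks are omitted from notation). The model class $\Theta(T^*_{Y,-})\in\mathrm{Ext}^1_{\mathcal O_Y}(T^*_{X,-},T^*_{B,-})\cong H^1(Y,\mathcal Hom_{\mathcal O_Y}(T^*_{X,-},T^*_{B,-}))$ is the class of this extension. $\wedge^{j'}T^*_{Y,-}$ is filtered by $0\subset F^{\,j'}_{j'}\subset\cdots\subset F^{\,j'}_0=\wedge^{j'}T^*_{Y,-}$, $F_k^{\,j'}$ being the image of $\wedge^kT^*_{B,-}\otimes\wedge^{j'-k}T^*_{Y,-}$ under wedge product, with $F_k^{\,j'}/F_{k+1}^{\,j'}\cong\wedge^kT^*_{B,-}\boxtimes\wedge^{j'-k}T^*_{X,-}$.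 Put $\mathbf H_n^{a,b}(Y,T^*_{Y,-})=H^n(Y,\mathcal Hom_{\mathcal O_Y}(T^*_{Y,(\pm)^{a+b}},\wedge^bT^*_{B,-}\boxtimes\wedge^aT^*_{X,-}))$. With $j'=a+b$, $\partial^{\{a,b\}}=\partial_p^{\{a,b\}}:\mathbf H_p^{a,b}(Y,T^*_{Y,-})\to\mathbf H_{p+1}^{a-1,b+1}(Y,T^*_{Y,-})$ is the connecting homomorphism to $H^{p+1}(Y,\mathcal Hom_{\mathcal O_Y}(T^*_{Y,(\pm)^{j'}},F_{b+1}^{\,j'}))$ of $0\to F_{b+1}^{\,j'}\to F_b^{\,j'}\to F_b^{\,j'}/F_{b+1}^{\,j'}\to0$ (after applying $\mathcal Hom_{\mathcal O_Y}(T^*_{Y,(\pm)^{j'}},-)$), followed by the map induced by $F_{b+1}^{\,j'}\to F_{b+1}^{\,j'}/F_{b+2}^{\,j'}$. The model class map for $a=1$, $\big(\Theta(T^*_{Y,-}),-\big)_*^{\{1,b\}}:\mathbf H_p^{1,b}(Y,T^*_{Y,-})\to\mathbf H_{p+1}^{0,b+1}(Y,T^*_{Y,-})$, sends $\nu$ to the image of the cup product $\Theta(T^*_{Y,-})\smile\nu$ under the map on $H^{p+1}$ induced by the sheaf morphism $$\mathcal Hom(T^*_{X,-},T^*_{B,-})\otimes\mathcal Hom(T^*_{Y,(\pm)^{b+1}},\wedge^bT^*_{B,-}\boxtimes T^*_{X,-})\to\mathcal Hom(T^*_{Y,(\pm)^{b+1}},\wedge^{b+1}T^*_{B,-}),\quad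 f\otimes g\mapsto m\circ(\mathbf 1\otimes f)\circ g,$$ where $m:\wedge^bT^*_{B,-}\otimes T^*_{B,-}\to\wedge^{b+1}T^*_{B,-}$ is the wedge product. *)

theory Defs
  imports
    "HOL-Analysis.Analysis"
    "HOL-Algebra.Module"
    "HOL-Algebra.Algebraic_Closure_Type"
    "HOL-Library.Poly_Mapping"
begin

section \<open>Complex vector spaces\<close>

text \<open>A complex vector space is a module over the ring of complex numbers; the fields
  \<open>mult\<close> and \<open>one\<close> of the record play no role.\<close>

type_synonym 'v cvs = "(complex, 'v) module"

abbreviation complex_vs :: "'v cvs \<Rightarrow> bool" where
  "complex_vs V \<equiv> module (ring_of_type_algebra :: complex ring) V"

definition complex_line :: "complex cvs" where
  "complex_line = \<lparr>carrier = UNIV, mult = (*), one = 1, zero = 0, add = (+), smult = (*)\<rparr>"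

definition linear_maps :: "'v cvs \<Rightarrow> 'w cvs \<Rightarrow> ('v \<Rightarrow> 'w) set" where
  "linear_maps V W = {f \<in> carrier V \<rightarrow>\<^sub>E carrier W.
     (\<forall>v\<in>carrier V. \<forall>v'\<in>carrier V. f (v \<oplus>\<^bsub>V\<^esub> v') = f v \<oplus>\<^bsub>W\<^esub> f v') \<and>
     (\<forall>a. \<forall>v\<in>carrier V. f (a \<odot>\<^bsub>V\<^esub> v) = a \<odot>\<^bsub>W\<^esub> f v)}"

definition hom_space :: "'v cvs \<Rightarrow> 'w cvs \<Rightarrow> ('v \<Rightarrow> 'w) cvs" where
  "hom_space V W = \<lparr>carrier = linear_maps V W, mult = undefined, one = undefined,
     zero = (\<lambda>v\<in>carrier V. \<zero>\<^bsub>W\<^esub>),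
     add = (\<lambda>f g. \<lambda>v\<in>carrier V. f v \<oplus>\<^bsub>W\<^esub> g v),
     smult = (\<lambda>a f. \<lambda>v\<in>carrier V. a \<odot>\<^bsub>W\<^esub> f v)\<rparr>"

subsection \<open>Vector spaces given by generators and relations\<close>

definition fscale :: "complex \<Rightarrow> ('g \<Rightarrow>\<^sub>0 complex) \<Rightarrow> ('g \<Rightarrow>\<^sub>0 complex)" where
  "fscale a c = Poly_Mapping.map (\<lambda>z. a * z) c"

text \<open>The quotient of the free vector space on \<open>S\<close> by the span of \<open>R\<close>; its elements are
  cosets. It is used only for sets \<open>R\<close> of combinations of elements of \<open>S\<close>.\<close>

definition presented :: "'g set \<Rightarrow> ('g \<Rightarrow>\<^sub>0 complex) set \<Rightarrow> ('g \<Rightarrow>\<^sub>0 complex) set cvs" where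
  "presented S R = (let N = module.span fscale R in
     \<lparr>carrier = {(+) c ` N | c. Poly_Mapping.keys c \<subseteq> S}, mult = undefined, one = undefined,
      zero = N,
      add = (\<lambda>P Q. {x + y | x y. x \<in> P \<and> y \<in> Q}),
      smult = (\<lambda>a P. {fscale a x + n | x n. x \<in> P \<and> n \<in> N})\<rparr>)"

definition presented_gen :: "('g \<Rightarrow>\<^sub>0 complex) set \<Rightarrow> 'g \<Rightarrow> ('g \<Rightarrow>\<^sub>0 complex) set" where
  "presented_gen R g = (+) (Poly_Mapping.single g 1) ` module.span fscale R"

text \<open>The linear map to \<open>W\<close> with prescribed values \<open>f\<close> on the generators; meaningful when
  \<open>f\<close> respects the relations.\<close>

definition presented_lift ::
    "'g set \<Rightarrow> ('g \<Rightarrow>\<^sub>0 complex) set \<Rightarrow> 'w cvs \<Rightarrow> ('g \<Rightarrow> 'w) \<Rightarrow> ('g \<Rightarrow>\<^sub>0 complex) set \<Rightarrow> 'w" where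
  "presented_lift S R W f = (\<lambda>P\<in>carrier (presented S R).
     THE w. \<exists>c\<in>P. w = (\<Oplus>\<^bsub>W\<^esub> g\<in>Poly_Mapping.keys c. Poly_Mapping.lookup c g \<odot>\<^bsub>W\<^esub> f g))"

subsection \<open>Tensor products\<close>

definition tensor_rels :: "'v cvs \<Rightarrow> 'w cvs \<Rightarrow> ('v \<times> 'w \<Rightarrow>\<^sub>0 complex) set" where
  "tensor_rels V W =
     {Poly_Mapping.single (v \<oplus>\<^bsub>V\<^esub> v', w) 1 - Poly_Mapping.single (v, w) 1
        - Poly_Mapping.single (v', w) 1
      | v v' w. v \<in> carrier V \<and> v' \<in> carrier V \<and> w \<in> carrier W} \<union>
     {Poly_Mapping.single (v, w \<oplus>\<^bsub>W\<^esub> w') 1 - Poly_Mapping.single (v, w) 1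
        - Poly_Mapping.single (v, w') 1
      | v w w'. v \<in> carrier V \<and> w \<in> carrier W \<and> w' \<in> carrier W} \<union>
     {Poly_Mapping.single (a \<odot>\<^bsub>V\<^esub> v, w) 1 - Poly_Mapping.single (v, w) a
      | a v w. v \<in> carrier V \<and> w \<in> carrier W} \<union>
     {Poly_Mapping.single (v, a \<odot>\<^bsub>W\<^esub> w) 1 - Poly_Mapping.single (v, w) a
      | a v w. v \<in> carrier V \<and> w \<in> carrier W}"

definition tensor_space :: "'v cvs \<Rightarrow> 'w cvs \<Rightarrow> ('v \<times> 'w \<Rightarrow>\<^sub>0 complex) set cvs" where
  "tensor_space V W = presented (carrier V \<times> carrier W) (tensor_rels V W)"

definition tensor_elem :: "'v cvs \<Rightarrow> 'w cvs \<Rightarrow> 'v \<Rightarrow> 'w \<Rightarrow> ('v \<times> 'w \<Rightarrow>\<^sub>0 complex) set" where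
  "tensor_elem V W v w = presented_gen (tensor_rels V W) (v, w)"

definition tensor_lift ::
    "'v cvs \<Rightarrow> 'w cvs \<Rightarrow> 'z cvs \<Rightarrow> ('v \<times> 'w \<Rightarrow> 'z) \<Rightarrow> ('v \<times> 'w \<Rightarrow>\<^sub>0 complex) set \<Rightarrow> 'z" where
  "tensor_lift V W Z f = presented_lift (carrier V \<times> carrier W) (tensor_rels V W) Z f"

subsection \<open>Exterior powers\<close>

text \<open>The list \<open>[v\<^sub>1, \<dots>, v\<^sub>k]\<close> stands for \<open>v\<^sub>1 \<and> \<dots> \<and> v\<^sub>k\<close>.\<close>

definition ext_gens :: "nat \<Rightarrow> 'v cvs \<Rightarrow> 'v list set" where
  "ext_gens k V = {vs. length vs = k \<and> set vs \<subseteq> carrier V}"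

definition ext_rels :: "nat \<Rightarrow> 'v cvs \<Rightarrow> ('v list \<Rightarrow>\<^sub>0 complex) set" where
  "ext_rels k V =
     {Poly_Mapping.single (us @ (v \<oplus>\<^bsub>V\<^esub> v') # ws) 1 - Poly_Mapping.single (us @ v # ws) 1
        - Poly_Mapping.single (us @ v' # ws) 1
      | us v v' ws. us @ v # ws \<in> ext_gens k V \<and> v' \<in> carrier V} \<union>
     {Poly_Mapping.single (us @ (a \<odot>\<^bsub>V\<^esub> v) # ws) 1 - Poly_Mapping.single (us @ v # ws) a
      | us a v ws. us @ v # ws \<in> ext_gens k V} \<union>
     {Poly_Mapping.single vs 1 | vs. vs \<in> ext_gens k V \<and> \<not> distinct vs}"

definition ext_power :: "nat \<Rightarrow> 'v cvs \<Rightarrow> ('v list \<Rightarrow>\<^sub>0 complex) set cvs" where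
  "ext_power k V = presented (ext_gens k V) (ext_rels k V)"

definition ext_elem :: "nat \<Rightarrow> 'v cvs \<Rightarrow> 'v list \<Rightarrow> ('v list \<Rightarrow>\<^sub>0 complex) set" where
  "ext_elem k V vs = presented_gen (ext_rels k V) vs"

definition ext_lift ::
    "nat \<Rightarrow> 'v cvs \<Rightarrow> 'w cvs \<Rightarrow> ('v list \<Rightarrow> 'w) \<Rightarrow> ('v list \<Rightarrow>\<^sub>0 complex) set \<Rightarrow> 'w" where
  "ext_lift k V W f = presented_lift (ext_gens k V) (ext_rels k V) W f"

definition ext_map :: "nat \<Rightarrow> 'v cvs \<Rightarrow> 'w cvs \<Rightarrow> ('v \<Rightarrow> 'w) \<Rightarrow>
    ('v list \<Rightarrow>\<^sub>0 complex) set \<Rightarrow> ('w list \<Rightarrow>\<^sub>0 complex) set" where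
  "ext_map k V W f = ext_lift k V (ext_power k W) (\<lambda>vs. ext_elem k W (map f vs))"

definition wedge :: "nat \<Rightarrow> nat \<Rightarrow> 'v cvs \<Rightarrow>
    ('v list \<Rightarrow>\<^sub>0 complex) set \<Rightarrow> ('v list \<Rightarrow>\<^sub>0 complex) set \<Rightarrow> ('v list \<Rightarrow>\<^sub>0 complex) set" where
  "wedge k l V \<beta> \<eta> =
     ext_lift k V (ext_power (k + l) V)
       (\<lambda>vs. ext_lift l V (ext_power (k + l) V) (\<lambda>ws. ext_elem (k + l) V (vs @ ws)) \<eta>) \<beta>"

section \<open>Complex manifolds\<close>

text \<open>Points of complex \<open>n\<close>-space are extensional functions on \<open>{..<n}\<close>, so that the
  dimension is a value rather than a type.\<close>

definition complex_space :: "nat \<Rightarrow> (nat \<Rightarrow> complex) topology" where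
  "complex_space n = product_topology (\<lambda>_. euclidean) {..<n}"

text \<open>Complex differentiability at every point of an open subset \<open>W\<close> of complex \<open>n\<close>-space.\<close>

definition holomorphic_in :: "nat \<Rightarrow> (nat \<Rightarrow> complex) set \<Rightarrow> ((nat \<Rightarrow> complex) \<Rightarrow> complex) \<Rightarrow> bool" where
  "holomorphic_in n W f \<longleftrightarrow> (\<forall>z\<in>W. \<exists>a :: nat \<Rightarrow> complex. \<forall>e>0. \<exists>d>0. \<forall>w\<in>W.
     (\<forall>i<n. cmod (w i - z i) < d) \<longrightarrow>
     cmod (f w - f z - (\<Sum>i<n. a i * (w i - z i))) \<le> e * (\<Sum>i<n. cmod (w i - z i)))"

record 'y manifold =
  mtop :: "'y topology"
  mdim :: nat
  atlas :: "('y set \<times> ('y \<Rightarrow> nat \<Rightarrow> complex)) set"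

abbreviation points :: "'y manifold \<Rightarrow> 'y set" where
  "points M \<equiv> topspace (mtop M)"

abbreviation mopen :: "'y manifold \<Rightarrow> 'y set \<Rightarrow> bool" where
  "mopen M \<equiv> openin (mtop M)"

definition complex_manifold :: "'y manifold \<Rightarrow> bool" where
  "complex_manifold M \<longleftrightarrow>
     Hausdorff_space (mtop M) \<and> second_countable (mtop M) \<and>
     (\<Union>(U, \<phi>)\<in>atlas M. U) = points M \<and>
     (\<forall>(U, \<phi>)\<in>atlas M. mopen M U \<and> openin (complex_space (mdim M)) (\<phi> ` U) \<and>
        homeomorphic_map (subtopology (mtop M) U)
          (subtopology (complex_space (mdim M)) (\<phi> ` U)) \<phi>) \<and>
     (\<forall>(U, \<phi>)\<in>atlas M. \<forall>(V, \<psi>)\<in>atlas M. \<forall>i<mdim M.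
        holomorphic_in (mdim M) (\<phi> ` (U \<inter> V)) (\<lambda>w. \<psi> (inv_into U \<phi> w) i))"

text \<open>The structure sheaf. Sections over \<open>U\<close>, here and below, are extensional functions
  on \<open>U\<close>.\<close>

definition hol :: "'y manifold \<Rightarrow> 'y set \<Rightarrow> ('y \<Rightarrow> complex) set" where
  "hol M U = {f \<in> extensional U. \<forall>(V, \<phi>)\<in>atlas M.
     holomorphic_in (mdim M) (\<phi> ` (U \<inter> V)) (\<lambda>w. f (inv_into V \<phi> w))}"

definition prod_manifold :: "'x manifold \<Rightarrow> 'b manifold \<Rightarrow> ('x \<times> 'b) manifold" where
  "prod_manifold M N = \<lparr>mtop = prod_topology (mtop M) (mtop N), mdim = mdim M + mdim N,
     atlas = {(U \<times> V, \<lambda>(x, b). \<lambda>i\<in>{..<mdim M + mdim N}.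
                         if i < mdim M then \<phi> x i else \<psi> b (i - mdim M))
              | U \<phi> V \<psi>. (U, \<phi>) \<in> atlas M \<and> (V, \<psi>) \<in> atlas N}\<rparr>"

section \<open>Holomorphic vector bundles\<close>

text \<open>A bundle is given by its fibres together with its sheaf of holomorphic sections. The
  constructions below produce the sheaf of modules attached to the corresponding operation on
  vector bundles. The sheaf generated by \<open>G\<close> consists of the sections that are locally
  finite holomorphic combinations of elements of \<open>G\<close>.\<close>

record ('y, 'e) vbundle =
  fib :: "'y \<Rightarrow> 'e cvs"
  sect :: "'y set \<Rightarrow> ('y \<Rightarrow> 'e) set"

definition generated_sect ::
    "'y manifold \<Rightarrow> ('y \<Rightarrow> 'e cvs) \<Rightarrow> ('y set \<Rightarrow> ('y \<Rightarrow> 'e) set) \<Rightarrow> 'y set \<Rightarrow> ('y \<Rightarrow> 'e) set" where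
  "generated_sect M F G U = {s \<in> (\<Pi>\<^sub>E y\<in>U. carrier (F y)). \<forall>y\<in>U. \<exists>V.
     mopen M V \<and> y \<in> V \<and> V \<subseteq> U \<and>
     (\<exists>(n::nat) f g. (\<forall>i<n. f i \<in> hol M V \<and> g i \<in> G V) \<and>
        (\<forall>z\<in>V. s z = (\<Oplus>\<^bsub>F z\<^esub> i\<in>{..<n}. f i z \<odot>\<^bsub>F z\<^esub> g i z)))}"

definition holomorphic_vector_bundle :: "'y manifold \<Rightarrow> ('y, 'e) vbundle \<Rightarrow> bool" where
  "holomorphic_vector_bundle M E \<longleftrightarrow>
     (\<forall>y\<in>points M. complex_vs (fib E y)) \<and>
     (\<forall>U. mopen M U \<longrightarrow> sect E U \<subseteq> (\<Pi>\<^sub>E y\<in>U. carrier (fib E y))) \<and>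
     (\<forall>U V s. mopen M U \<and> mopen M V \<and> V \<subseteq> U \<and> s \<in> sect E U \<longrightarrow> restrict s V \<in> sect E V) \<and>
     (\<forall>U s. mopen M U \<and> s \<in> extensional U \<and>
        (\<forall>y\<in>U. \<exists>V. mopen M V \<and> y \<in> V \<and> V \<subseteq> U \<and> restrict s V \<in> sect E V) \<longrightarrow> s \<in> sect E U) \<and>
     (\<forall>y\<in>points M. \<exists>U (r::nat) e. mopen M U \<and> y \<in> U \<and>
        (\<forall>z\<in>U. (\<forall>i<r. e i z \<in> carrier (fib E z)) \<and>
           (\<forall>v\<in>carrier (fib E z). \<exists>!c. c \<in> extensional {..<r} \<and>
              v = (\<Oplus>\<^bsub>fib E z\<^esub> i\<in>{..<r}. c i \<odot>\<^bsub>fib E z\<^esub> e i z))) \<and>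
        (\<forall>V. mopen M V \<and> V \<subseteq> U \<longrightarrow>
           sect E V = {\<lambda>z\<in>V. \<Oplus>\<^bsub>fib E z\<^esub> i\<in>{..<r}. f i z \<odot>\<^bsub>fib E z\<^esub> e i z
                       | f. \<forall>i<r. f i \<in> hol M V}))"

definition pullback ::
    "'y manifold \<Rightarrow> 'x manifold \<Rightarrow> ('y \<Rightarrow> 'x) \<Rightarrow> ('x, 'e) vbundle \<Rightarrow> ('y, 'e) vbundle" where
  "pullback M N p E = \<lparr>fib = (\<lambda>y. fib E (p y)),
     sect = generated_sect M (\<lambda>y. fib E (p y))
       (\<lambda>V. {\<lambda>y\<in>V. t (p y) | t W. mopen N W \<and> p ` V \<subseteq> W \<and> t \<in> sect E W})\<rparr>"

definition tensor_bundle :: "'y manifold \<Rightarrow> ('y, 'e) vbundle \<Rightarrow> ('y, 'f) vbundle \<Rightarrow>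
    ('y, ('e \<times> 'f \<Rightarrow>\<^sub>0 complex) set) vbundle" where
  "tensor_bundle M E G = \<lparr>fib = (\<lambda>y. tensor_space (fib E y) (fib G y)),
     sect = generated_sect M (\<lambda>y. tensor_space (fib E y) (fib G y))
       (\<lambda>V. {\<lambda>y\<in>V. tensor_elem (fib E y) (fib G y) (s y) (t y)
             | s t. s \<in> sect E V \<and> t \<in> sect G V})\<rparr>"

definition ext_bundle :: "'y manifold \<Rightarrow> nat \<Rightarrow> ('y, 'e) vbundle \<Rightarrow>
    ('y, ('e list \<Rightarrow>\<^sub>0 complex) set) vbundle" where
  "ext_bundle M k E = \<lparr>fib = (\<lambda>y. ext_power k (fib E y)),
     sect = generated_sect M (\<lambda>y. ext_power k (fib E y))
       (\<lambda>V. {\<lambda>y\<in>V. ext_elem k (fib E y) (map (\<lambda>s. s y) ss)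
             | ss. length ss = k \<and> set ss \<subseteq> sect E V})\<rparr>"

definition hom_bundle :: "'y manifold \<Rightarrow> ('y, 'e) vbundle \<Rightarrow> ('y, 'f) vbundle \<Rightarrow>
    ('y, 'e \<Rightarrow> 'f) vbundle" where
  "hom_bundle M E G = \<lparr>fib = (\<lambda>y. hom_space (fib E y) (fib G y)),
     sect = (\<lambda>U. {\<phi> \<in> (\<Pi>\<^sub>E y\<in>U. linear_maps (fib E y) (fib G y)).
        \<forall>V t. mopen M V \<and> V \<subseteq> U \<and> t \<in> sect E V \<longrightarrow> (\<lambda>y\<in>V. \<phi> y (t y)) \<in> sect G V})\<rparr>"

abbreviation bundle_morphisms ::
    "'y manifold \<Rightarrow> ('y, 'e) vbundle \<Rightarrow> ('y, 'f) vbundle \<Rightarrow> ('y \<Rightarrow> 'e \<Rightarrow> 'f) set" where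
  "bundle_morphisms M E G \<equiv> sect (hom_bundle M E G) (points M)"

definition image_bundle :: "'y manifold \<Rightarrow> ('y, 'e) vbundle \<Rightarrow> ('y, 'f) vbundle \<Rightarrow>
    ('y \<Rightarrow> 'e \<Rightarrow> 'f) \<Rightarrow> ('y, 'f) vbundle" where
  "image_bundle M E G \<phi> =
     \<lparr>fib = (\<lambda>y. (fib G y)\<lparr>carrier := \<phi> y ` carrier (fib E y)\<rparr>),
      sect = (\<lambda>U. {s \<in> extensional U. \<forall>y\<in>U. \<exists>V t. mopen M V \<and> y \<in> V \<and> V \<subseteq> U \<and>
         t \<in> sect E V \<and> (\<forall>z\<in>V. s z = \<phi> z (t z))})\<rparr>"

text \<open>Exactness as a sequence of sheaves; the last conjunct is surjectivity as a map of
  sheaves.\<close>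

definition short_exact :: "'y manifold \<Rightarrow> ('y, 'e) vbundle \<Rightarrow> ('y, 'f) vbundle \<Rightarrow> ('y, 'g) vbundle \<Rightarrow>
    ('y \<Rightarrow> 'e \<Rightarrow> 'f) \<Rightarrow> ('y \<Rightarrow> 'f \<Rightarrow> 'g) \<Rightarrow> bool" where
  "short_exact M E' E E'' i q \<longleftrightarrow>
     i \<in> bundle_morphisms M E' E \<and> q \<in> bundle_morphisms M E E'' \<and>
     (\<forall>U. mopen M U \<longrightarrow>
        inj_on (\<lambda>s. \<lambda>y\<in>U. i y (s y)) (sect E' U) \<and>
        {t \<in> sect E U. \<forall>y\<in>U. q y (t y) = \<zero>\<^bsub>fib E'' y\<^esub>} = (\<lambda>s. \<lambda>y\<in>U. i y (s y)) ` sect E' U \<and>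
        (\<forall>s\<in>sect E'' U. \<forall>y\<in>U. \<exists>V t. mopen M V \<and> y \<in> V \<and> V \<subseteq> U \<and> t \<in> sect E V \<and>
           (\<forall>z\<in>V. q z (t z) = s z)))"

subsection \<open>The holomorphic cotangent bundle\<close>

text \<open>Tangent vectors at \<open>y\<close> are the derivations at \<open>y\<close> of the ring of germs of holomorphic
  functions, regarded as functions of representatives of germs.\<close>

definition local_hol :: "'y manifold \<Rightarrow> 'y \<Rightarrow> ('y \<Rightarrow> complex) set" where
  "local_hol M y = {f. \<exists>U. mopen M U \<and> y \<in> U \<and> restrict f U \<in> hol M U}"

definition derivations :: "'y manifold \<Rightarrow> 'y \<Rightarrow> (('y \<Rightarrow> complex) \<Rightarrow> complex) set" where
  "derivations M y = {D \<in> extensional (local_hol M y).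
     \<forall>f\<in>local_hol M y. \<forall>g\<in>local_hol M y.
       ((\<exists>U. mopen M U \<and> y \<in> U \<and> (\<forall>z\<in>U. f z = g z)) \<longrightarrow> D f = D g) \<and>
       D (\<lambda>z. f z + g z) = D f + D g \<and>
       (\<forall>a. D (\<lambda>z. a * f z) = a * D f) \<and>
       D (\<lambda>z. f z * g z) = f y * D g + g y * D f}"

definition tangent_space :: "'y manifold \<Rightarrow> 'y \<Rightarrow> (('y \<Rightarrow> complex) \<Rightarrow> complex) cvs" where
  "tangent_space M y = \<lparr>carrier = derivations M y, mult = undefined, one = undefined,
     zero = (\<lambda>f\<in>local_hol M y. 0),
     add = (\<lambda>D D'. \<lambda>f\<in>local_hol M y. D f + D' f),
     smult = (\<lambda>a D. \<lambda>f\<in>local_hol M y. a * D f)\<rparr>"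

definition cotangent_bundle ::
    "'y manifold \<Rightarrow> ('y, (('y \<Rightarrow> complex) \<Rightarrow> complex) \<Rightarrow> complex) vbundle" where
  "cotangent_bundle M = \<lparr>fib = (\<lambda>y. hom_space (tangent_space M y) complex_line),
     sect = generated_sect M (\<lambda>y. hom_space (tangent_space M y) complex_line)
       (\<lambda>V. {\<lambda>y\<in>V. \<lambda>D\<in>derivations M y. D f | f. f \<in> hol M V})\<rparr>"

text \<open>Transport along an injection, used to put two bundles into a common type.\<close>

definition relabel_bundle :: "('e \<Rightarrow> 'f) \<Rightarrow> ('y, 'e) vbundle \<Rightarrow> ('y, 'f) vbundle" where
  "relabel_bundle h E = \<lparr>fib = (\<lambda>y.
       \<lparr>carrier = h ` carrier (fib E y), mult = undefined, one = undefined,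
        zero = h \<zero>\<^bsub>fib E y\<^esub>,
        add = (\<lambda>u v. h (inv_into UNIV h u \<oplus>\<^bsub>fib E y\<^esub> inv_into UNIV h v)),
        smult = (\<lambda>a v. h (a \<odot>\<^bsub>fib E y\<^esub> inv_into UNIV h v))\<rparr>),
     sect = (\<lambda>U. {\<lambda>y\<in>U. h (s y) | s. s \<in> sect E U})\<rparr>"

section \<open>Cohomology\<close>

text \<open>Cech cohomology in the limit over open covers, which is sheaf cohomology on a paracompact
  Hausdorff space. Only covers indexed by the points of the space, with \<open>y \<in> \<U> y\<close>, are
  used: every open cover has such a refinement, and between two of them refinement is a
  partial order with the identity as canonical refinement map. An element of the limit is a
  class of pairs of a cover and a cocycle.\<close>

type_synonym ('y, 'e) cochain = "'y list \<Rightarrow> 'y \<Rightarrow> 'e"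
type_synonym ('y, 'e) coclass = "(('y \<Rightarrow> 'y set) \<times> ('y, 'e) cochain) set"

definition is_cover :: "'y manifold \<Rightarrow> ('y \<Rightarrow> 'y set) \<Rightarrow> bool" where
  "is_cover M \<U> \<longleftrightarrow> (\<forall>y\<in>points M. mopen M (\<U> y) \<and> y \<in> \<U> y)"

definition simplices :: "'y manifold \<Rightarrow> nat \<Rightarrow> 'y list set" where
  "simplices M n = {ys. length ys = Suc n \<and> set ys \<subseteq> points M}"

definition overlap :: "('y \<Rightarrow> 'y set) \<Rightarrow> 'y list \<Rightarrow> 'y set" where
  "overlap \<U> ys = (\<Inter>y\<in>set ys. \<U> y)"

definition cochains :: "'y manifold \<Rightarrow> ('y, 'e) vbundle \<Rightarrow> nat \<Rightarrow> ('y \<Rightarrow> 'y set) \<Rightarrow>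
    ('y, 'e) cochain set" where
  "cochains M E n \<U> = (\<Pi>\<^sub>E ys\<in>simplices M n. sect E (overlap \<U> ys))"

definition zero_cochain :: "'y manifold \<Rightarrow> ('y, 'e) vbundle \<Rightarrow> nat \<Rightarrow> ('y \<Rightarrow> 'y set) \<Rightarrow>
    ('y, 'e) cochain" where
  "zero_cochain M E n \<U> = (\<lambda>ys\<in>simplices M n. \<lambda>z\<in>overlap \<U> ys. \<zero>\<^bsub>fib E z\<^esub>)"

definition coboundary :: "'y manifold \<Rightarrow> ('y, 'e) vbundle \<Rightarrow> nat \<Rightarrow> ('y \<Rightarrow> 'y set) \<Rightarrow>
    ('y, 'e) cochain \<Rightarrow> ('y, 'e) cochain" where
  "coboundary M E n \<U> c = (\<lambda>ys\<in>simplices M (Suc n). \<lambda>z\<in>overlap \<U> ys.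
     \<Oplus>\<^bsub>fib E z\<^esub> k\<in>{..Suc n}. ((-1) ^ k) \<odot>\<^bsub>fib E z\<^esub> c (take k ys @ drop (Suc k) ys) z)"

definition cocycles :: "'y manifold \<Rightarrow> ('y, 'e) vbundle \<Rightarrow> nat \<Rightarrow> ('y \<Rightarrow> 'y set) \<Rightarrow>
    ('y, 'e) cochain set" where
  "cocycles M E n \<U> =
     {c \<in> cochains M E n \<U>. coboundary M E n \<U> c = zero_cochain M E (Suc n) \<U>}"

fun coboundaries :: "'y manifold \<Rightarrow> ('y, 'e) vbundle \<Rightarrow> nat \<Rightarrow> ('y \<Rightarrow> 'y set) \<Rightarrow>
    ('y, 'e) cochain set" where
  "coboundaries M E 0 \<U> = {zero_cochain M E 0 \<U>}"
| "coboundaries M E (Suc n) \<U> = coboundary M E n \<U> ` cochains M E n \<U>"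

definition cohomologous :: "'y manifold \<Rightarrow> ('y, 'e) vbundle \<Rightarrow> nat \<Rightarrow>
    ('y \<Rightarrow> 'y set) \<Rightarrow> ('y, 'e) cochain \<Rightarrow> ('y \<Rightarrow> 'y set) \<Rightarrow> ('y, 'e) cochain \<Rightarrow> bool" where
  "cohomologous M E n \<U> c \<V> d \<longleftrightarrow> (\<exists>\<W>. is_cover M \<W> \<and> (\<forall>y\<in>points M. \<W> y \<subseteq> \<U> y \<inter> \<V> y) \<and>
     (\<lambda>ys\<in>simplices M n. \<lambda>z\<in>overlap \<W> ys. c ys z \<ominus>\<^bsub>fib E z\<^esub> d ys z) \<in> coboundaries M E n \<W>)"

definition coclass :: "'y manifold \<Rightarrow> ('y, 'e) vbundle \<Rightarrow> nat \<Rightarrow>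
    ('y \<Rightarrow> 'y set) \<Rightarrow> ('y, 'e) cochain \<Rightarrow> ('y, 'e) coclass" where
  "coclass M E n \<U> c =
     {(\<V>, d). is_cover M \<V> \<and> d \<in> cocycles M E n \<V> \<and> cohomologous M E n \<U> c \<V> d}"

definition cohomology :: "'y manifold \<Rightarrow> ('y, 'e) vbundle \<Rightarrow> nat \<Rightarrow> ('y, 'e) coclass set" where
  "cohomology M E n = {coclass M E n \<U> c | \<U> c. is_cover M \<U> \<and> c \<in> cocycles M E n \<U>}"

definition cochain_map :: "'y manifold \<Rightarrow> nat \<Rightarrow> ('y \<Rightarrow> 'e \<Rightarrow> 'f) \<Rightarrow> ('y \<Rightarrow> 'y set) \<Rightarrow>
    ('y, 'e) cochain \<Rightarrow> ('y, 'f) cochain" where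
  "cochain_map M n \<phi> \<U> c = (\<lambda>ys\<in>simplices M n. \<lambda>z\<in>overlap \<U> ys. \<phi> z (c ys z))"

definition cohomology_map :: "'y manifold \<Rightarrow> ('y, 'f) vbundle \<Rightarrow> ('y \<Rightarrow> 'e \<Rightarrow> 'f) \<Rightarrow> nat \<Rightarrow>
    ('y, 'e) coclass \<Rightarrow> ('y, 'f) coclass" where
  "cohomology_map M G \<phi> n \<xi> =
     (THE \<eta>. \<exists>\<U> c. (\<U>, c) \<in> \<xi> \<and> \<eta> = coclass M G n \<U> (cochain_map M n \<phi> \<U> c))"

text \<open>The connecting homomorphism of \<open>0 \<rightarrow> E' \<rightarrow> E \<rightarrow> E'' \<rightarrow> 0\<close> with maps \<open>i\<close> and \<open>q\<close>.\<close>

definition connecting :: "'y manifold \<Rightarrow> ('y, 'e) vbundle \<Rightarrow> ('y, 'f) vbundle \<Rightarrow>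
    ('y \<Rightarrow> 'e \<Rightarrow> 'f) \<Rightarrow> ('y \<Rightarrow> 'f \<Rightarrow> 'g) \<Rightarrow> nat \<Rightarrow> ('y, 'g) coclass \<Rightarrow> ('y, 'e) coclass" where
  "connecting M E' E i q n \<xi> =
     (THE \<eta>. \<exists>\<U> c'' c c'. (\<U>, c'') \<in> \<xi> \<and>
        c \<in> cochains M E n \<U> \<and> cochain_map M n q \<U> c = c'' \<and>
        c' \<in> cocycles M E' (Suc n) \<U> \<and>
        cochain_map M (Suc n) i \<U> c' = coboundary M E n \<U> c \<and>
        \<eta> = coclass M E' (Suc n) \<U> c')"

definition cup :: "'y manifold \<Rightarrow> ('y, 'e) vbundle \<Rightarrow> ('y, 'f) vbundle \<Rightarrow> nat \<Rightarrow> nat \<Rightarrow>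
    ('y, 'e) coclass \<Rightarrow> ('y, 'f) coclass \<Rightarrow> ('y, ('e \<times> 'f \<Rightarrow>\<^sub>0 complex) set) coclass" where
  "cup M E G m n \<xi> \<zeta> =
     (THE \<eta>. \<exists>\<U> c d. (\<U>, c) \<in> \<xi> \<and> (\<U>, d) \<in> \<zeta> \<and>
        \<eta> = coclass M (tensor_bundle M E G) (m + n) \<U>
          (\<lambda>ys\<in>simplices M (m + n). \<lambda>z\<in>overlap \<U> ys.
             tensor_elem (fib E z) (fib G z) (c (take (Suc m) ys) z) (d (drop m ys) z)))"

text \<open>The morphism \<open>Hom(T, E) \<rightarrow> Hom(T, G)\<close> given by composition with \<open>\<phi> : E \<rightarrow> G\<close>.\<close>

definition hom_post :: "('y, 't) vbundle \<Rightarrow> ('y, 'e) vbundle \<Rightarrow> ('y \<Rightarrow> 'e \<Rightarrow> 'f) \<Rightarrow>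
    'y \<Rightarrow> ('t \<Rightarrow> 'e) \<Rightarrow> ('t \<Rightarrow> 'f)" where
  "hom_post T E \<phi> = (\<lambda>y. \<lambda>g\<in>linear_maps (fib T y) (fib E y). compose (carrier (fib T y)) (\<phi> y) g)"

section \<open>gt-models\<close>

text \<open>The fields \<open>fiber_odd\<close>, \<open>base_odd\<close> and \<open>total_odd\<close> are the bundles with subscript
  minus on the fiber \<open>X\<close>, on the base \<open>B\<close> and on \<open>Y = X \<times> B\<close>; the fields \<open>odd_incl\<close> and
  \<open>odd_proj\<close> are the maps of the defining extension.\<close>

record ('x, 'b, 'u, 'w, 'e) gt_data =
  fiber :: "'x manifold"
  base :: "'b manifold"
  fiber_odd :: "('x, 'u) vbundle"
  base_odd :: "('b, 'w) vbundle"
  total_odd :: "('x \<times> 'b, 'e) vbundle"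
  odd_incl :: "'x \<times> 'b \<Rightarrow> 'w \<Rightarrow> 'e"
  odd_proj :: "'x \<times> 'b \<Rightarrow> 'e \<Rightarrow> 'u"

definition total :: "('x, 'b, 'u, 'w, 'e) gt_data \<Rightarrow> ('x \<times> 'b) manifold" where
  "total \<Y> = prod_manifold (fiber \<Y>) (base \<Y>)"

definition from_fiber :: "('x, 'b, 'u, 'w, 'e) gt_data \<Rightarrow> ('x, 'f) vbundle \<Rightarrow> ('x \<times> 'b, 'f) vbundle" where
  "from_fiber \<Y> = pullback (total \<Y>) (fiber \<Y>) fst"

definition from_base :: "('x, 'b, 'u, 'w, 'e) gt_data \<Rightarrow> ('b, 'f) vbundle \<Rightarrow> ('x \<times> 'b, 'f) vbundle" where
  "from_base \<Y> = pullback (total \<Y>) (base \<Y>) snd"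

definition gt_model :: "('x, 'b, 'u, 'w, 'e) gt_data \<Rightarrow> bool" where
  "gt_model \<Y> \<longleftrightarrow>
     complex_manifold (fiber \<Y>) \<and> complex_manifold (base \<Y>) \<and>
     holomorphic_vector_bundle (fiber \<Y>) (fiber_odd \<Y>) \<and>
     holomorphic_vector_bundle (base \<Y>) (base_odd \<Y>) \<and>
     holomorphic_vector_bundle (total \<Y>) (total_odd \<Y>) \<and>
     short_exact (total \<Y>) (from_base \<Y> (base_odd \<Y>)) (total_odd \<Y>)
       (from_fiber \<Y> (fiber_odd \<Y>)) (odd_incl \<Y>) (odd_proj \<Y>)"

text \<open>The cotangent bundle for even \<open>j\<close> and the odd bundle for odd \<open>j\<close>.\<close>

definition parity_bundle :: "('x, 'b, 'u, 'w, 'e) gt_data \<Rightarrow> nat \<Rightarrow>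
    ('x \<times> 'b, (((('x \<times> 'b) \<Rightarrow> complex) \<Rightarrow> complex) \<Rightarrow> complex) + 'e) vbundle" where
  "parity_bundle \<Y> j = (if even j then relabel_bundle Inl (cotangent_bundle (total \<Y>))
                        else relabel_bundle Inr (total_odd \<Y>))"

text \<open>The class of the extension: the image of the identity under
  \<open>H\<^sup>0(Hom(T\<^sub>X, T\<^sub>X)) \<rightarrow> H\<^sup>1(Hom(T\<^sub>X, T\<^sub>B))\<close>.\<close>

definition model_class :: "('x, 'b, 'u, 'w, 'e) gt_data \<Rightarrow> ('x \<times> 'b, 'u \<Rightarrow> 'w) coclass" where
  "model_class \<Y> = (let Y = total \<Y>; TX = from_fiber \<Y> (fiber_odd \<Y>);
       TB = from_base \<Y> (base_odd \<Y>); TY = total_odd \<Y> in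
     connecting Y (hom_bundle Y TX TB) (hom_bundle Y TX TY)
       (hom_post TX TB (odd_incl \<Y>)) (hom_post TX TY (odd_proj \<Y>)) 0
       (coclass Y (hom_bundle Y TX TX) 0 (\<lambda>_. points Y)
          (\<lambda>ys\<in>simplices Y 0. \<lambda>z\<in>points Y. \<lambda>v\<in>carrier (fib TX z). v)))"

text \<open>The bundle with \<open>b\<close>-th exterior power from the base and \<open>a\<close>-th from the fiber.\<close>

definition graded_bundle :: "('x, 'b, 'u, 'w, 'e) gt_data \<Rightarrow> nat \<Rightarrow> nat \<Rightarrow>
    ('x \<times> 'b, (('w list \<Rightarrow>\<^sub>0 complex) set \<times> ('u list \<Rightarrow>\<^sub>0 complex) set \<Rightarrow>\<^sub>0 complex) set) vbundle" where
  "graded_bundle \<Y> a b = tensor_bundle (total \<Y>)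
     (from_base \<Y> (ext_bundle (base \<Y>) b (base_odd \<Y>)))
     (from_fiber \<Y> (ext_bundle (fiber \<Y>) a (fiber_odd \<Y>)))"

definition H_group :: "('x, 'b, 'u, 'w, 'e) gt_data \<Rightarrow> nat \<Rightarrow> nat \<Rightarrow> nat \<Rightarrow>
    ('x \<times> 'b, (((('x \<times> 'b) \<Rightarrow> complex) \<Rightarrow> complex) \<Rightarrow> complex) + 'e \<Rightarrow>
      (('w list \<Rightarrow>\<^sub>0 complex) set \<times> ('u list \<Rightarrow>\<^sub>0 complex) set \<Rightarrow>\<^sub>0 complex) set) coclass set" where
  "H_group \<Y> n a b = cohomology (total \<Y>)
     (hom_bundle (total \<Y>) (parity_bundle \<Y> (a + b)) (graded_bundle \<Y> a b)) n"

subsection \<open>The filtration and the boundary map\<close>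

text \<open>The filtration is used only for \<open>k \<le> j\<close>.\<close>

definition filt_source :: "('x, 'b, 'u, 'w, 'e) gt_data \<Rightarrow> nat \<Rightarrow> nat \<Rightarrow>
    ('x \<times> 'b, (('w list \<Rightarrow>\<^sub>0 complex) set \<times> ('e list \<Rightarrow>\<^sub>0 complex) set \<Rightarrow>\<^sub>0 complex) set) vbundle" where
  "filt_source \<Y> j k = tensor_bundle (total \<Y>)
     (from_base \<Y> (ext_bundle (base \<Y>) k (base_odd \<Y>)))
     (ext_bundle (total \<Y>) (j - k) (total_odd \<Y>))"

definition filt_wedge :: "('x, 'b, 'u, 'w, 'e) gt_data \<Rightarrow> nat \<Rightarrow> nat \<Rightarrow> 'x \<times> 'b \<Rightarrow>
    (('w list \<Rightarrow>\<^sub>0 complex) set \<times> ('e list \<Rightarrow>\<^sub>0 complex) set \<Rightarrow>\<^sub>0 complex) set \<Rightarrow>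
    ('e list \<Rightarrow>\<^sub>0 complex) set" where
  "filt_wedge \<Y> j k y = (let V = fib (base_odd \<Y>) (snd y); E = fib (total_odd \<Y>) y in
     tensor_lift (ext_power k V) (ext_power (j - k) E) (ext_power j E)
       (\<lambda>(\<beta>, \<eta>). wedge k (j - k) E (ext_map k V E (odd_incl \<Y> y) \<beta>) \<eta>))"

definition filt :: "('x, 'b, 'u, 'w, 'e) gt_data \<Rightarrow> nat \<Rightarrow> nat \<Rightarrow>
    ('x \<times> 'b, ('e list \<Rightarrow>\<^sub>0 complex) set) vbundle" where
  "filt \<Y> j k = image_bundle (total \<Y>) (filt_source \<Y> j k)
     (ext_bundle (total \<Y>) j (total_odd \<Y>)) (filt_wedge \<Y> j k)"

definition filt_incl :: "('x, 'b, 'u, 'w, 'e) gt_data \<Rightarrow> nat \<Rightarrow> nat \<Rightarrow> 'x \<times> 'b \<Rightarrow>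
    ('e list \<Rightarrow>\<^sub>0 complex) set \<Rightarrow> ('e list \<Rightarrow>\<^sub>0 complex) set" where
  "filt_incl \<Y> j k y = (\<lambda>v\<in>carrier (fib (filt \<Y> j k) y). v)"

text \<open>The quotient map from the \<open>k\<close>-th step of the filtration, followed by the canonical
  isomorphism of the quotient by the next step with \<^const>\<open>graded_bundle\<close>: it sends
  \<open>\<beta> \<and> \<eta>\<close>, with \<open>\<beta>\<close> from the base, to \<open>\<beta>\<close> tensor the image of \<open>\<eta>\<close>.\<close>

definition filt_quot :: "('x, 'b, 'u, 'w, 'e) gt_data \<Rightarrow> nat \<Rightarrow> nat \<Rightarrow> 'x \<times> 'b \<Rightarrow>
    ('e list \<Rightarrow>\<^sub>0 complex) set \<Rightarrow>
    (('w list \<Rightarrow>\<^sub>0 complex) set \<times> ('u list \<Rightarrow>\<^sub>0 complex) set \<Rightarrow>\<^sub>0 complex) set" where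
  "filt_quot \<Y> j k y = (let V = fib (base_odd \<Y>) (snd y); E = fib (total_odd \<Y>) y;
       W = fib (fiber_odd \<Y>) (fst y) in
     (\<lambda>v\<in>carrier (fib (filt \<Y> j k) y).
       THE w. \<exists>t\<in>carrier (fib (filt_source \<Y> j k) y). filt_wedge \<Y> j k y t = v \<and>
         w = tensor_lift (ext_power k V) (ext_power (j - k) E)
               (tensor_space (ext_power k V) (ext_power (j - k) W))
               (\<lambda>(\<beta>, \<eta>). tensor_elem (ext_power k V) (ext_power (j - k) W)
                  \<beta> (ext_map (j - k) E W (odd_proj \<Y> y) \<eta>)) t))"

text \<open>Meaningful for \<open>a \<ge> 1\<close>, from degree \<open>p\<close>, index \<open>(a, b)\<close> to degree \<open>p + 1\<close>,
  index \<open>(a - 1, b + 1)\<close>.\<close>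

definition boundary_map :: "('x, 'b, 'u, 'w, 'e) gt_data \<Rightarrow> nat \<Rightarrow> nat \<Rightarrow> nat \<Rightarrow>
    ('x \<times> 'b, (((('x \<times> 'b) \<Rightarrow> complex) \<Rightarrow> complex) \<Rightarrow> complex) + 'e \<Rightarrow>
      (('w list \<Rightarrow>\<^sub>0 complex) set \<times> ('u list \<Rightarrow>\<^sub>0 complex) set \<Rightarrow>\<^sub>0 complex) set) coclass \<Rightarrow>
    ('x \<times> 'b, (((('x \<times> 'b) \<Rightarrow> complex) \<Rightarrow> complex) \<Rightarrow> complex) + 'e \<Rightarrow>
      (('w list \<Rightarrow>\<^sub>0 complex) set \<times> ('u list \<Rightarrow>\<^sub>0 complex) set \<Rightarrow>\<^sub>0 complex) set) coclass" where
  "boundary_map \<Y> p a b \<nu> = (let Y = total \<Y>; j = a + b; T = parity_bundle \<Y> j in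
     cohomology_map Y (hom_bundle Y T (graded_bundle \<Y> (a - 1) (b + 1)))
       (hom_post T (filt \<Y> j (b + 1)) (filt_quot \<Y> j (b + 1))) (p + 1)
       (connecting Y (hom_bundle Y T (filt \<Y> j (b + 1))) (hom_bundle Y T (filt \<Y> j b))
          (hom_post T (filt \<Y> j (b + 1)) (filt_incl \<Y> j (b + 1)))
          (hom_post T (filt \<Y> j b) (filt_quot \<Y> j b)) p \<nu>))"

subsection \<open>The model class map\<close>

text \<open>For \<open>f : T\<^sub>X \<rightarrow> T\<^sub>B\<close> in the fibre over \<open>y\<close>, the map \<open>m \<circ> (1 \<otimes> f)\<close>. First and
  zeroth exterior powers are kept, since they occur in \<^const>\<open>graded_bundle\<close>: \<open>f\<close> acts
  on first exterior powers, and the result is tensored with the unit of the zeroth one.\<close>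

definition contract :: "('x, 'b, 'u, 'w, 'e) gt_data \<Rightarrow> nat \<Rightarrow> 'x \<times> 'b \<Rightarrow> ('u \<Rightarrow> 'w) \<Rightarrow>
    (('w list \<Rightarrow>\<^sub>0 complex) set \<times> ('u list \<Rightarrow>\<^sub>0 complex) set \<Rightarrow>\<^sub>0 complex) set \<Rightarrow>
    (('w list \<Rightarrow>\<^sub>0 complex) set \<times> ('u list \<Rightarrow>\<^sub>0 complex) set \<Rightarrow>\<^sub>0 complex) set" where
  "contract \<Y> b y f = (let V = fib (base_odd \<Y>) (snd y); W = fib (fiber_odd \<Y>) (fst y) in
     tensor_lift (ext_power b V) (ext_power 1 W) (tensor_space (ext_power (b + 1) V) (ext_power 0 W))
       (\<lambda>(\<beta>, \<xi>). tensor_elem (ext_power (b + 1) V) (ext_power 0 W)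
          (wedge b 1 V \<beta> (ext_map 1 W V f \<xi>)) (ext_elem 0 W [])))"

definition model_class_map :: "('x, 'b, 'u, 'w, 'e) gt_data \<Rightarrow> nat \<Rightarrow> nat \<Rightarrow>
    ('x \<times> 'b, (((('x \<times> 'b) \<Rightarrow> complex) \<Rightarrow> complex) \<Rightarrow> complex) + 'e \<Rightarrow>
      (('w list \<Rightarrow>\<^sub>0 complex) set \<times> ('u list \<Rightarrow>\<^sub>0 complex) set \<Rightarrow>\<^sub>0 complex) set) coclass \<Rightarrow>
    ('x \<times> 'b, (((('x \<times> 'b) \<Rightarrow> complex) \<Rightarrow> complex) \<Rightarrow> complex) + 'e \<Rightarrow>
      (('w list \<Rightarrow>\<^sub>0 complex) set \<times> ('u list \<Rightarrow>\<^sub>0 complex) set \<Rightarrow>\<^sub>0 complex) set) coclass" where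
  "model_class_map \<Y> p b \<nu> = (let Y = total \<Y>; T = parity_bundle \<Y> (b + 1);
       A = hom_bundle Y (from_fiber \<Y> (fiber_odd \<Y>)) (from_base \<Y> (base_odd \<Y>));
       C = hom_bundle Y T (graded_bundle \<Y> 1 b);
       D = hom_bundle Y T (graded_bundle \<Y> 0 (b + 1)) in
     cohomology_map Y D
       (\<lambda>y. tensor_lift (fib A y) (fib C y) (fib D y)
          (\<lambda>(f, g). compose (carrier (fib T y)) (contract \<Y> b y f) g)) (1 + p)
       (cup Y A C 1 p (model_class \<Y>) \<nu>))"

end

(* Over small neighbourhoods the odd extension splits: choose sections s_y of the projection and the
 matching retractions r_y. For indices (y0, y1) the map r_y0 o s_y1 is a Cech cocycle representing the
 model class. The same s_y and r_y split the step of the filtration of exterior powers used by the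
 boundary map, so both maps, applied to a cocycle c, give the cocycle m o (1 x (r_y0 o s_y1)) o c.
 Hence they agree, without a sign, which is more than the containment of images. *)
theory Submission
 imports Defs
begin

text \<open>The absence of a sign comes from the vertex conventions. If a cocycle \<open>c\<close>
  is lifted with the section at the first vertex, the coboundary of the lift at
  \<open>(y0, y1, ...)\<close> is \<open>s_y1 c - s_y0 c\<close> with \<open>c\<close> taken at the
  back face, and the splitting at \<open>y0\<close> rewrites this as the inclusion of
  \<open>r_y0 (s_y1 c)\<close>. A cup product with a degree one class on the left reads that class
  on \<open>(y0, y1)\<close> and \<open>c\<close> on the same back face, so the same pair of choices
  occurs on both sides. Two obstacles shape the proof. The maps on cohomology and the quotient map
  of the filtration are descriptions \<open>THE\<close> over all representatives, so each must be
  shown independent of them, also for covers over which nothing is known to split. And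
  \<open>short_exact\<close> speaks of sections over open sets, while wedges, contractions and
  retractions act on fibres; passing from one to the other takes local frames. As the total exterior
  degree is \<open>b + 1\<close>, only the complementary degrees 1 and 0 occur, where a linear map
  that recovers the quotient from the wedge can be written down.\<close>

abbreviation refines :: "'y manifold => ('y => 'y set) => ('y => 'y set) => bool" where
 "refines M \<W> \<U> \<equiv> (\<forall>y\<in>points M. \<W> y <= \<U> y)"
abbreviation "ext_tensor k V l W \<equiv> tensor_space (ext_power k V) (ext_power l W)"
abbreviation "ext_tensor_elem k V l W \<equiv> tensor_elem (ext_power k V) (ext_power l W)"

section \<open>Complex vector spaces and linear maps\<close>

text \<open>The ring parameter of \<open>module\<close> is fixed to
  \<open>ring_of_type_algebra\<close> and hidden, so that the scalar laws derived in the locale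
  carry no carrier conditions on scalars.\<close>

locale cvs = abelian_group V for V :: "'v cvs" (structure) +
 assumes complex_vs: "complex_vs V"

lemma cvs_iff: "cvs V \<longleftrightarrow> complex_vs V"
 by (auto simp: cvs_def cvs_axioms_def module_def)

lemma ring_of_complex_simps [simp]:
 "carrier (ring_of_type_algebra :: complex ring) = UNIV"
 "x \<oplus>\<^bsub>(ring_of_type_algebra :: complex ring)\<^esub> y = x + y"
 "x \<otimes>\<^bsub>(ring_of_type_algebra :: complex ring)\<^esub> y = x * y"
 "\<zero>\<^bsub>(ring_of_type_algebra :: complex ring)\<^esub> = 0"
 "\<one>\<^bsub>(ring_of_type_algebra :: complex ring)\<^esub> = 1"
 by (simp_all add: ring_of_type_algebra_def)

lemma complex_vsI:
 fixes V :: "'v cvs" (structure)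
 assumes "abelian_group V"
  and "!!a x. x \<in> carrier V ==> a \<odot> x \<in> carrier V"
  and "!!a b x. x \<in> carrier V ==> (a + b) \<odot> x = a \<odot> x \<oplus> b \<odot> x"
  and "!!a x y. x \<in> carrier V ==> y \<in> carrier V ==> a \<odot> (x \<oplus> y) = a \<odot> x \<oplus> a \<odot> y"
  and "!!a b x. x \<in> carrier V ==> (a * b) \<odot> x = a \<odot> (b \<odot> x)"
  and "!!x. x \<in> carrier V ==> 1 \<odot> x = x"
 shows "complex_vs V"
 by (rule moduleI) (simp_all add: assms cring_from_type_algebra)

context cvs
begin

interpretation mod: module "ring_of_type_algebra :: complex ring" V
 by (rule complex_vs)

lemma scale_closed [simp, intro]: "x \<in> carrier V ==> a \<odot> x \<in> carrier V"
 using mod.smult_closed[of a x] by simp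

lemma scale_add_left: "x \<in> carrier V ==> (a + b) \<odot> x = a \<odot> x \<oplus> b \<odot> x"
 using mod.smult_l_distr[of a b x] by simp

lemma scale_add_right: "x \<in> carrier V ==> y \<in> carrier V ==> a \<odot> (x \<oplus> y) = a \<odot> x \<oplus> a \<odot> y"
 using mod.smult_r_distr[of a x y] by simp

lemma scale_scale: "x \<in> carrier V ==> a \<odot> (b \<odot> x) = (a * b) \<odot> x"
 using mod.smult_assoc1[of a b x] by simp

lemma scale_one [simp]: "x \<in> carrier V ==> 1 \<odot> x = x"
 using mod.smult_one[of x] by simp

lemma scale_zero_left [simp]: "x \<in> carrier V ==> 0 \<odot> x = \<zero>"
 using mod.smult_l_null[of x] by simp

lemma scale_zero_right [simp]: "a \<odot> \<zero> = \<zero>"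
 using mod.smult_r_null[of a] by simp

lemma scale_minus_one: "x \<in> carrier V ==> (-1) \<odot> x = \<ominus> x"
proof -
 assume x: "x \<in> carrier V"
 have "(-1) \<odot> x \<oplus> x = (-1 + 1) \<odot> x"
  using x scale_add_left[of x "-1" 1] by simp
 then show ?thesis using x by (simp add: minus_equality)
qed

lemma minus_eq_scale: "x \<in> carrier V ==> y \<in> carrier V ==> x \<ominus> y = x \<oplus> (-1) \<odot> y"
 by (simp add: minus_eq scale_minus_one)

lemma scale_minus: "x \<in> carrier V ==> y \<in> carrier V ==> a \<odot> (x \<ominus> y) = a \<odot> x \<ominus> a \<odot> y"
 by (simp add: minus_eq_scale scale_add_right scale_scale)

lemma scale_neg: "x \<in> carrier V ==> (- a) \<odot> x = \<ominus> (a \<odot> x)"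
 using scale_scale[of x "-1" a] by (simp add: scale_minus_one)

lemma finsum_lessThan_Suc:
 "(!!i. i < Suc n ==> f i \<in> carrier V) ==> (\<Oplus>i\<in>{..<Suc n}. f i) = (\<Oplus>i\<in>{..<n}. f i) \<oplus> f n"
 by (simp add: lessThan_Suc a_comm finsum_closed)

lemma finsum_scale:
 "(!!i. i \<in> A ==> f i \<in> carrier V) ==> a \<odot> (\<Oplus>i\<in>A. f i) = (\<Oplus>i\<in>A. a \<odot> f i)"
 by (induction A rule: infinite_finite_induct) (auto simp: scale_add_right Pi_def)

lemma minus_eq_zero_iff:
 "x \<in> carrier V ==> y \<in> carrier V ==> x \<ominus> y = \<zero> \<longleftrightarrow> x = y"
 by (metis add.inv_closed add.inv_inv minus_eq minus_equality r_neg)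

lemma add_minus_cancel:
 "x \<in> carrier V ==> y \<in> carrier V ==> (x \<ominus> y) \<oplus> y = x"
 by (simp add: minus_eq a_assoc l_neg)

end

text \<open>Serves the fibres of \<open>image_bundle\<close>, which are the target space with a
  smaller carrier. Closure under negatives follows from closure under scalars, by multiplying with
  -1.\<close>

lemma complex_vs_restrict_carrier:
 assumes "complex_vs V" "C <= carrier V" "\<zero>\<^bsub>V\<^esub> \<in> C"
  and add: "!!x y. x \<in> C ==> y \<in> C ==> x \<oplus>\<^bsub>V\<^esub> y \<in> C"
  and smult: "!!a x. x \<in> C ==> a \<odot>\<^bsub>V\<^esub> x \<in> C"
 shows "complex_vs (V\<lparr>carrier := C\<rparr>)"
proof -
 interpret cvs V using assms(1) by (simp add: cvs_iff)
 have "x \<in> C ==> \<exists>y\<in>C. y \<oplus>\<^bsub>V\<^esub> x = \<zero>\<^bsub>V\<^esub>" for x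
  using smult[of x "-1"] assms(2) by (intro bexI[of _ "(-1) \<odot>\<^bsub>V\<^esub> x"]) (auto simp: scale_minus_one l_neg)
 then show ?thesis
  using assms(2) by (intro complex_vsI abelian_groupI)
  (auto intro: assms a_assoc a_comm simp: subsetD scale_add_left scale_add_right scale_scale)
qed

text \<open>Linearity without the extensionality that \<open>linear_maps\<close> demands: composites
  and plain lambda terms qualify as they stand, and the restriction to the carrier is made only when
  a \<open>hom_space\<close> is entered.\<close>

definition lin :: "'v cvs => 'w cvs => ('v => 'w) => bool" where
 "lin V W f \<longleftrightarrow> f \<in> carrier V \<rightarrow> carrier W \<and>
  (\<forall>x\<in>carrier V. \<forall>y\<in>carrier V. f (x \<oplus>\<^bsub>V\<^esub> y) = f x \<oplus>\<^bsub>W\<^esub> f y) \<and>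
  (\<forall>a. \<forall>x\<in>carrier V. f (a \<odot>\<^bsub>V\<^esub> x) = a \<odot>\<^bsub>W\<^esub> f x)"

lemma linI:
 assumes "!!x. x \<in> carrier V ==> f x \<in> carrier W"
  and "!!x y. x \<in> carrier V ==> y \<in> carrier V ==> f (x \<oplus>\<^bsub>V\<^esub> y) = f x \<oplus>\<^bsub>W\<^esub> f y"
  and "!!a x. x \<in> carrier V ==> f (a \<odot>\<^bsub>V\<^esub> x) = a \<odot>\<^bsub>W\<^esub> f x"
 shows "lin V W f"
 using assms by (auto simp: lin_def)

lemma lin_closed: "lin V W f ==> x \<in> carrier V ==> f x \<in> carrier W"
 by (auto simp: lin_def)

lemma lin_add: "lin V W f ==> x \<in> carrier V ==> y \<in> carrier V ==> f (x \<oplus>\<^bsub>V\<^esub> y) = f x \<oplus>\<^bsub>W\<^esub> f y"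
 by (auto simp: lin_def)

lemma lin_scale: "lin V W f ==> x \<in> carrier V ==> f (a \<odot>\<^bsub>V\<^esub> x) = a \<odot>\<^bsub>W\<^esub> f x"
 by (auto simp: lin_def)

lemma lin_zero: "lin V W f ==> complex_vs V ==> complex_vs W ==> f \<zero>\<^bsub>V\<^esub> = \<zero>\<^bsub>W\<^esub>"
proof -
 assume f: "lin V W f" and V: "complex_vs V" and W: "complex_vs W"
 interpret V: cvs V using V by (simp add: cvs_iff)
 interpret W: cvs W using W by (simp add: cvs_iff)
 show ?thesis using lin_scale[OF f, of "\<zero>\<^bsub>V\<^esub>" 0] lin_closed[OF f, of "\<zero>\<^bsub>V\<^esub>"] by simp
qed

lemma lin_minus:
 assumes "lin V W f" "complex_vs V" "complex_vs W" "x \<in> carrier V" "y \<in> carrier V"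
 shows "f (x \<ominus>\<^bsub>V\<^esub> y) = f x \<ominus>\<^bsub>W\<^esub> f y"
proof -
 interpret V: cvs V using assms by (simp add: cvs_iff)
 interpret W: cvs W using assms by (simp add: cvs_iff)
 show ?thesis using assms
  by (simp add: V.minus_eq_scale W.minus_eq_scale lin_add[OF assms(1)] lin_scale[OF assms(1)]
  lin_closed[OF assms(1)])
qed

lemma lin_finsum:
 assumes "lin V W f" "complex_vs V" "complex_vs W" "!!i. i \<in> A ==> g i \<in> carrier V"
 shows "f (\<Oplus>\<^bsub>V\<^esub> i\<in>A. g i) = (\<Oplus>\<^bsub>W\<^esub> i\<in>A. f (g i))"
proof -
 interpret V: cvs V using assms by (simp add: cvs_iff)
 interpret W: cvs W using assms by (simp add: cvs_iff)
 show ?thesis using assms(4)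
  by (induction A rule: infinite_finite_induct)
  (auto simp: lin_zero[OF assms(1-3)] lin_add[OF assms(1)] lin_closed[OF assms(1)] Pi_def)
qed

lemma lin_comp: "lin U V f ==> lin V W g ==> lin U W (%x. g (f x))"
 by (auto simp: lin_def Pi_iff)

lemma lin_cong: "(!!x. x \<in> carrier V ==> f x = g x) ==> complex_vs V ==> lin V W f \<longleftrightarrow> lin V W g"
proof -
 assume "!!x. x \<in> carrier V ==> f x = g x" "complex_vs V"
 moreover then interpret cvs V by (simp add: cvs_iff)
 show ?thesis unfolding lin_def using calculation by (auto simp: Pi_iff)
qed

lemma linear_maps_iff: "f \<in> linear_maps V W \<longleftrightarrow> f \<in> extensional (carrier V) \<and> lin V W f"
 by (auto simp: linear_maps_def lin_def PiE_def)

lemma lin_diff: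
 assumes "lin V W f" "lin V W g" "complex_vs W"
 shows "lin V W (%x. f x \<ominus>\<^bsub>W\<^esub> g x)"
proof -
 interpret W: cvs W using assms by (simp add: cvs_iff)
 note [simp] = lin_closed[OF assms(1)] lin_closed[OF assms(2)]
 show ?thesis
  by (rule linI) (simp_all add: lin_add[OF assms(1)] lin_add[OF assms(2)] lin_scale[OF assms(1)]
  lin_scale[OF assms(2)] W.minus_eq_scale W.scale_add_right W.scale_scale W.a_ac)
qed

subsection \<open>Generators and relations\<close>

lemma lookup_fscale [simp]: "Poly_Mapping.lookup (fscale a c) g = a * Poly_Mapping.lookup c g"
 by (simp add: fscale_def map.rep_eq when_def)

interpretation fs: vector_space fscale
 by unfold_locales (simp_all add: poly_mapping_eq_iff fun_eq_iff lookup_add algebra_simps)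

lemma keys_fscale: "Poly_Mapping.keys (fscale a c) <= Poly_Mapping.keys c"
 by (auto simp: in_keys_iff)

text \<open>The linear extension of \<open>f\<close> to the free vector space;
  \<open>presented_lift\<close> is its value on an arbitrary representative of a coset.\<close>

definition fcomb :: "'w cvs => ('g => 'w) => ('g \<Rightarrow>\<^sub>0 complex) => 'w" where
 "fcomb W f c = (\<Oplus>\<^bsub>W\<^esub> g\<in>Poly_Mapping.keys c. Poly_Mapping.lookup c g \<odot>\<^bsub>W\<^esub> f g)"

text \<open>Gives a name to the class of a representative, so that the set-theoretic operations of
  \<open>presented\<close> turn into operations on finitely supported functions.\<close>

definition rel_coset :: "('g \<Rightarrow>\<^sub>0 complex) set => ('g \<Rightarrow>\<^sub>0 complex) => ('g \<Rightarrow>\<^sub>0 complex) set" where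
 "rel_coset R c = (+) c ` fs.span R"

lemma rel_coset_eq_iff: "rel_coset R c = rel_coset R d \<longleftrightarrow> c - d \<in> fs.span R"
proof
 assume "rel_coset R c = rel_coset R d"
 then have "c + 0 \<in> rel_coset R d" unfolding rel_coset_def using fs.span_zero by blast
 then show "c - d \<in> fs.span R" by (auto simp: rel_coset_def)
next
 assume *: "c - d \<in> fs.span R"
 have "rel_coset R c <= rel_coset R d" if "c - d \<in> fs.span R" for c d
 proof
  fix x assume "x \<in> rel_coset R c"
  then obtain n where n: "n \<in> fs.span R" "x = c + n" by (auto simp: rel_coset_def)
  then have "x = d + ((c - d) + n)" by simp
  then show "x \<in> rel_coset R d" unfolding rel_coset_def using fs.span_add[OF that n(1)] by blast
 qed
 from this[of c d] this[of d c] * fs.span_neg[OF *] show "rel_coset R c = rel_coset R d"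
  by auto
qed

lemma mem_rel_coset: "c \<in> rel_coset R c"
 using fs.span_zero[of R] by (force simp: rel_coset_def)

lemma rel_coset_add:
 "{x + y | x y. x \<in> rel_coset R c \<and> y \<in> rel_coset R d} = rel_coset R (c + d)"
proof (intro equalityI subsetI)
 fix z assume "z \<in> {x + y | x y. x \<in> rel_coset R c \<and> y \<in> rel_coset R d}"
 then obtain m n where "m \<in> fs.span R" "n \<in> fs.span R" "z = (c + m) + (d + n)"
  by (auto simp: rel_coset_def)
 then have "m + n \<in> fs.span R" "z = (c + d) + (m + n)" by (auto intro: fs.span_add)
 then show "z \<in> rel_coset R (c + d)" by (auto simp: rel_coset_def)
next
 fix z assume "z \<in> rel_coset R (c + d)"
 then obtain m where "m \<in> fs.span R" "z = c + (d + m)" by (auto simp: rel_coset_def add.assoc)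
 then show "z \<in> {x + y | x y. x \<in> rel_coset R c \<and> y \<in> rel_coset R d}"
  using mem_rel_coset[of c R] by (auto simp: rel_coset_def)
qed

lemma rel_coset_scale:
 "{fscale a x + n | x n. x \<in> rel_coset R c \<and> n \<in> fs.span R} = rel_coset R (fscale a c)"
proof (intro equalityI subsetI)
 fix z assume "z \<in> {fscale a x + n | x n. x \<in> rel_coset R c \<and> n \<in> fs.span R}"
 then obtain m n where "m \<in> fs.span R" "n \<in> fs.span R" "z = fscale a (c + m) + n"
  by (auto simp: rel_coset_def)
 then have "fscale a m + n \<in> fs.span R" "z = fscale a c + (fscale a m + n)"
  by (auto intro: fs.span_add fs.span_scale simp: fs.scale_right_distrib)
 then show "z \<in> rel_coset R (fscale a c)" by (auto simp: rel_coset_def)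
next
 fix z assume "z \<in> rel_coset R (fscale a c)"
 then show "z \<in> {fscale a x + n | x n. x \<in> rel_coset R c \<and> n \<in> fs.span R}"
  using mem_rel_coset[of c R] by (auto simp: rel_coset_def)
qed

lemma presented_simps:
 "carrier (presented S R) = {rel_coset R c | c. Poly_Mapping.keys c <= S}"
 "\<zero>\<^bsub>presented S R\<^esub> = rel_coset R 0"
 "rel_coset R c \<oplus>\<^bsub>presented S R\<^esub> rel_coset R d = rel_coset R (c + d)"
 "a \<odot>\<^bsub>presented S R\<^esub> rel_coset R c = rel_coset R (fscale a c)"
proof -
 have "fs.span R = rel_coset R 0" by (simp add: rel_coset_def)
 then show "\<zero>\<^bsub>presented S R\<^esub> = rel_coset R 0" by (simp add: presented_def Let_def)
qed (simp_all add: presented_def Let_def rel_coset_add rel_coset_scale, simp add: rel_coset_def)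

lemma presented_carrierE:
 assumes "x \<in> carrier (presented S R)"
 obtains c where "x = rel_coset R c" "Poly_Mapping.keys c <= S"
 using assms by (auto simp: presented_simps)

lemma rel_coset_in_carrier: "Poly_Mapping.keys c <= S ==> rel_coset R c \<in> carrier (presented S R)"
 by (auto simp: presented_simps)

lemma complex_vs_presented: "complex_vs (presented S R)"
proof -
 have ex: "\<exists>c. x = rel_coset R c \<and> Poly_Mapping.keys c <= S" if "x \<in> carrier (presented S R)" for x
  using that by (auto elim: presented_carrierE)
 have add: "Poly_Mapping.keys (c + d) <= S" if "Poly_Mapping.keys c <= S" "Poly_Mapping.keys d <= S"
  for c d :: "'a \<Rightarrow>\<^sub>0 complex"
  using that keys_add[of c d] by blast
 have scale: "Poly_Mapping.keys (fscale a c) <= S" if "Poly_Mapping.keys c <= S" for a c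
  using that keys_fscale[of a c] by blast
 note [simp] = presented_simps(2-4) rel_coset_in_carrier add scale
 show ?thesis
 proof (intro complex_vsI abelian_groupI)
  show "\<zero>\<^bsub>presented S R\<^esub> \<in> carrier (presented S R)" by simp
 next
  fix x assume "x \<in> carrier (presented S R)"
  then obtain c where c: "x = rel_coset R c" "Poly_Mapping.keys c <= S" using ex by blast
  then have "rel_coset R (fscale (-1) c) \<in> carrier (presented S R)" by simp
  moreover have "rel_coset R (fscale (-1) c) \<oplus>\<^bsub>presented S R\<^esub> x = \<zero>\<^bsub>presented S R\<^esub>"
  using c by simp
  ultimately show "\<exists>y\<in>carrier (presented S R). y \<oplus>\<^bsub>presented S R\<^esub> x = \<zero>\<^bsub>presented S R\<^esub>" by blast
 qed ((drule ex)+, (elim exE conjE), simp add: fs.scale_right_distrib fs.scale_left_distrib ac_simps)+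
qed

lemma presented_gen_eq: "presented_gen R g = rel_coset R (Poly_Mapping.single g 1)"
 by (simp add: presented_gen_def rel_coset_def)

lemma presented_gen_closed: "g \<in> S ==> presented_gen R g \<in> carrier (presented S R)"
 by (auto simp: presented_gen_eq intro!: rel_coset_in_carrier split: if_splits)

text \<open>Induction on the support of a representative: deleting one key from \<open>c\<close>
  changes its class by a multiple of one generator.\<close>

lemma presented_induct [consumes 1, case_names zero add]:
 assumes x: "x \<in> carrier (presented S R)" and zero: "P \<zero>\<^bsub>presented S R\<^esub>"
  and add: "!!x a g. x \<in> carrier (presented S R) ==> P x ==> g \<in> S ==>
  P (x \<oplus>\<^bsub>presented S R\<^esub> a \<odot>\<^bsub>presented S R\<^esub> presented_gen R g)"
 shows "P x"
proof -
 have "P (rel_coset R c)" if "Poly_Mapping.keys c = K" "K <= S" "finite K" for K c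
  using that(3,1,2)
 proof (induction K arbitrary: c rule: finite_induct)
  case empty
  then have "c = 0" by simp
  then show ?case using zero by (simp add: presented_simps)
 next
  case (insert g K)
  define d where "d = c - Poly_Mapping.single g (Poly_Mapping.lookup c g)"
  have K: "Poly_Mapping.keys d = K"
  proof -
  have "h \<in> Poly_Mapping.keys d \<longleftrightarrow> h \<in> Poly_Mapping.keys c \<and> h \<noteq> g" for h
  by (auto simp: d_def in_keys_iff lookup_minus lookup_single when_def)
  then show ?thesis using insert by blast
  qed
  have 1: "P (rel_coset R d)" "rel_coset R d \<in> carrier (presented S R)"
  using insert K by (auto intro!: rel_coset_in_carrier)
  have "rel_coset R c = rel_coset R d \<oplus>\<^bsub>presented S R\<^esub> Poly_Mapping.lookup c g \<odot>\<^bsub>presented S R\<^esub> presented_gen R g"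
  proof -
  have "fscale (Poly_Mapping.lookup c g) (Poly_Mapping.single g 1) = Poly_Mapping.single g (Poly_Mapping.lookup c g)"
  by (simp add: poly_mapping_eq_iff fun_eq_iff lookup_single when_def)
  then show ?thesis by (simp add: presented_gen_eq presented_simps d_def)
  qed
  then show ?case using add[OF 1(2,1)] insert.prems by auto
 qed
 then show ?thesis using x by (auto elim!: presented_carrierE)
qed

text \<open>Uniqueness in the universal property of the quotient. All identities between maps on
  tensor products and exterior powers are reduced to generators through it.\<close>

lemma lin_eq_presented:
 assumes "lin (presented S R) W f" "lin (presented S R) W f'" "complex_vs W"
  and "!!g. g \<in> S ==> f (presented_gen R g) = f' (presented_gen R g)"
  and "x \<in> carrier (presented S R)"
 shows "f x = f' x"
proof -
 interpret P: cvs "presented S R" by (simp add: cvs_iff complex_vs_presented)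
 show ?thesis using assms(5)
  by (induction rule: presented_induct)
  (simp_all add: lin_zero[OF assms(1) complex_vs_presented assms(3)]
  lin_zero[OF assms(2) complex_vs_presented assms(3)] presented_gen_closed
  lin_add[OF assms(1)] lin_add[OF assms(2)] lin_scale[OF assms(1)] lin_scale[OF assms(2)] assms(4))
qed

context
 fixes W :: "'w cvs" and S :: "'g set" and f :: "'g => 'w"
 assumes W: "complex_vs W" and f: "f \<in> S \<rightarrow> carrier W"
begin

interpretation W: cvs W using W by (simp add: cvs_iff)

text \<open>Two combinations have different supports; summing over a common finite superset, where
  absent keys contribute zero, makes their values comparable.\<close>

lemma fcomb_superset:
 assumes "finite A" "Poly_Mapping.keys c <= A" "A <= S"
 shows "fcomb W f c = (\<Oplus>\<^bsub>W\<^esub> g\<in>A. Poly_Mapping.lookup c g \<odot>\<^bsub>W\<^esub> f g)"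
 unfolding fcomb_def
 by (rule W.add.finprod_mono_neutral_cong_left) (use assms f in \<open>auto simp: in_keys_iff Pi_iff subset_iff\<close>)

lemma fcomb_closed: "Poly_Mapping.keys c <= S ==> fcomb W f c \<in> carrier W"
 unfolding fcomb_def using f by (intro W.finsum_closed) auto

lemma fcomb_zero: "fcomb W f 0 = \<zero>\<^bsub>W\<^esub>"
 by (simp add: fcomb_def)

lemma fcomb_add:
 assumes "Poly_Mapping.keys c <= S" "Poly_Mapping.keys d <= S"
 shows "fcomb W f (c + d) = fcomb W f c \<oplus>\<^bsub>W\<^esub> fcomb W f d"
proof -
 let ?A = "Poly_Mapping.keys c \<union> Poly_Mapping.keys d"
 have fA: "f g \<in> carrier W" if "g \<in> ?A" for g using f assms that by auto
 have "fcomb W f (c + d) = (\<Oplus>\<^bsub>W\<^esub> g\<in>?A. Poly_Mapping.lookup (c + d) g \<odot>\<^bsub>W\<^esub> f g)"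
  using assms keys_add[of c d] by (intro fcomb_superset) auto
 also have "... = (\<Oplus>\<^bsub>W\<^esub> g\<in>?A. Poly_Mapping.lookup c g \<odot>\<^bsub>W\<^esub> f g \<oplus>\<^bsub>W\<^esub> Poly_Mapping.lookup d g \<odot>\<^bsub>W\<^esub> f g)"
  using fA by (intro W.finsum_cong') (auto simp: lookup_add W.scale_add_left)
 also have "... = (\<Oplus>\<^bsub>W\<^esub> g\<in>?A. Poly_Mapping.lookup c g \<odot>\<^bsub>W\<^esub> f g) \<oplus>\<^bsub>W\<^esub> (\<Oplus>\<^bsub>W\<^esub> g\<in>?A. Poly_Mapping.lookup d g \<odot>\<^bsub>W\<^esub> f g)"
  using fA by (intro W.finsum_addf) auto
 also have "... = fcomb W f c \<oplus>\<^bsub>W\<^esub> fcomb W f d"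
  using assms by (subst (1 2) fcomb_superset[of ?A]) auto
 finally show ?thesis .
qed

lemma fcomb_scale:
 assumes "Poly_Mapping.keys c <= S"
 shows "fcomb W f (fscale a c) = a \<odot>\<^bsub>W\<^esub> fcomb W f c"
proof -
 have fc: "f g \<in> carrier W" if "g \<in> Poly_Mapping.keys c" for g using f assms that by auto
 have "fcomb W f (fscale a c) = (\<Oplus>\<^bsub>W\<^esub> g\<in>Poly_Mapping.keys c. Poly_Mapping.lookup (fscale a c) g \<odot>\<^bsub>W\<^esub> f g)"
  using assms keys_fscale[of a c] by (intro fcomb_superset) auto
 also have "... = (\<Oplus>\<^bsub>W\<^esub> g\<in>Poly_Mapping.keys c. a \<odot>\<^bsub>W\<^esub> (Poly_Mapping.lookup c g \<odot>\<^bsub>W\<^esub> f g))"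
  using fc by (intro W.finsum_cong') (auto simp: W.scale_scale)
 also have "... = a \<odot>\<^bsub>W\<^esub> fcomb W f c"
  using fc by (simp add: W.finsum_scale fcomb_def)
 finally show ?thesis .
qed

lemma fcomb_single: "g \<in> S ==> fcomb W f (Poly_Mapping.single g a) = a \<odot>\<^bsub>W\<^esub> f g"
 using f by (cases "a = 0") (auto simp: fcomb_def Pi_iff)

lemma fcomb_diff:
 assumes "Poly_Mapping.keys c <= S" "Poly_Mapping.keys d <= S"
 shows "fcomb W f (c - d) = fcomb W f c \<ominus>\<^bsub>W\<^esub> fcomb W f d"
proof -
 have eq: "c - d = c + fscale (-1) d" by (simp add: poly_mapping_eq_iff fun_eq_iff lookup_minus lookup_add)
 moreover have "Poly_Mapping.keys (fscale (-1) d) <= S" using assms keys_fscale[of "-1" d] by auto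
 ultimately have "fcomb W f (c - d) = fcomb W f c \<oplus>\<^bsub>W\<^esub> (-1) \<odot>\<^bsub>W\<^esub> fcomb W f d"
  using assms by (simp only: eq fcomb_add fcomb_scale)
 then show ?thesis using assms by (simp add: W.minus_eq_scale fcomb_closed)
qed

text \<open>The support condition has to be carried through the span induction, because
  \<open>fcomb\<close> is additive only on combinations supported in \<open>S\<close>.\<close>

lemma fcomb_span:
 assumes "!!r. r \<in> R ==> Poly_Mapping.keys r <= S" "!!r. r \<in> R ==> fcomb W f r = \<zero>\<^bsub>W\<^esub>" "x \<in> fs.span R"
 shows "Poly_Mapping.keys x <= S \<and> fcomb W f x = \<zero>\<^bsub>W\<^esub>"
 using assms(3)
proof (induction rule: fs.span_induct_alt)
 case base
 then show ?case by (simp add: fcomb_zero)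
next
 case (step c x y)
 have "Poly_Mapping.keys (fscale c x) <= S" using assms(1)[OF step(1)] keys_fscale[of c x] by auto
 then show ?case using step assms(1)[OF step(1)] assms(2)[OF step(1)] keys_add[of "fscale c x" y]
  by (auto simp: fcomb_add fcomb_scale)
qed

context
 fixes R :: "('g \<Rightarrow>\<^sub>0 complex) set"
 assumes R: "!!r. r \<in> R ==> Poly_Mapping.keys r <= S" and fR: "!!r. r \<in> R ==> fcomb W f r = \<zero>\<^bsub>W\<^esub>"
begin

text \<open>Well-definedness of the lift: two representatives differ by an element of the span of
  \<open>R\<close>, on which \<open>fcomb\<close> vanishes, so the description in
  \<open>presented_lift\<close> has exactly one solution.\<close>

lemma presented_lift_coset:
 assumes "Poly_Mapping.keys c <= S"
 shows "presented_lift S R W f (rel_coset R c) = fcomb W f c"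
proof -
 have "fcomb W f d = fcomb W f c" if d: "d \<in> rel_coset R c" for d
 proof -
  obtain n where n: "n \<in> fs.span R" "d = c + n" using d unfolding rel_coset_def by blast
  with fcomb_span[OF R fR n(1)] show ?thesis using assms by (simp add: fcomb_add fcomb_closed)
 qed
 then have "(THE w. \<exists>d\<in>rel_coset R c. w = fcomb W f d) = fcomb W f c"
  using mem_rel_coset[of c R] by (intro the_equality) blast+
 then show ?thesis using rel_coset_in_carrier[OF assms, of R]
  by (simp add: presented_lift_def fcomb_def)
qed

lemma presented_lift_gen: "g \<in> S ==> presented_lift S R W f (presented_gen R g) = f g"
 using f by (auto simp: presented_gen_eq presented_lift_coset fcomb_single Pi_iff)

lemma lin_presented_lift: "lin (presented S R) W (presented_lift S R W f)"
proof (rule linI)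
 fix x y a
 assume "x \<in> carrier (presented S R)"
 then obtain c where c: "x = rel_coset R c" "Poly_Mapping.keys c <= S" by (rule presented_carrierE)
 show "presented_lift S R W f x \<in> carrier W"
  using c by (simp add: presented_lift_coset fcomb_closed)
 show "presented_lift S R W f (a \<odot>\<^bsub>presented S R\<^esub> x) = a \<odot>\<^bsub>W\<^esub> presented_lift S R W f x"
  using c subset_trans[OF keys_fscale[of a c] c(2)]
  by (simp add: presented_lift_coset presented_simps(2-4) fcomb_scale)
 assume "y \<in> carrier (presented S R)"
 then obtain d where d: "y = rel_coset R d" "Poly_Mapping.keys d <= S" by (rule presented_carrierE)
 show "presented_lift S R W f (x \<oplus>\<^bsub>presented S R\<^esub> y) = presented_lift S R W f x \<oplus>\<^bsub>W\<^esub> presented_lift S R W f y"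
  using c d subset_trans[OF keys_add[of c d] Un_least[OF c(2) d(2)]]
  by (simp add: presented_lift_coset presented_simps(2-4) fcomb_add)
qed

end

end

lemma lin_sum_map:
 assumes "lin V W f" "lin V W g" "complex_vs W"
 shows "lin V W (%x. f x \<oplus>\<^bsub>W\<^esub> g x)"
proof -
 interpret W: cvs W using assms by (simp add: cvs_iff)
 note [simp] = lin_closed[OF assms(1)] lin_closed[OF assms(2)]
 show ?thesis
  by (rule linI) (simp_all add: lin_add[OF assms(1)] lin_add[OF assms(2)] lin_scale[OF assms(1)]
  lin_scale[OF assms(2)] W.scale_add_right W.a_ac)
qed

lemma lin_scale_map:
 assumes "lin V W f" "complex_vs W"
 shows "lin V W (%x. a \<odot>\<^bsub>W\<^esub> f x)"
proof -
 interpret W: cvs W using assms by (simp add: cvs_iff)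
 note [simp] = lin_closed[OF assms(1)]
 show ?thesis
  by (rule linI) (simp_all add: lin_add[OF assms(1)] lin_scale[OF assms(1)]
  W.scale_add_right W.scale_scale mult.commute)
qed

lemma lin_zero_map: "complex_vs W ==> lin V W (%x. \<zero>\<^bsub>W\<^esub>)"
proof -
 assume "complex_vs W"
 then interpret W: cvs W by (simp add: cvs_iff)
 show ?thesis by (rule linI) simp_all
qed

text \<open>Apart from the vanishing of repeated entries, the relations of tensor products and
  exterior powers have two shapes: \<open>g - a h\<close> for homogeneity and
  \<open>g - h - k\<close> for additivity. The \<open>rel2\<close> and \<open>rel3\<close> lemmas
  treat these shapes once for both constructions.\<close>

lemma keys_rel2:
 "g \<in> S ==> h \<in> S ==> Poly_Mapping.keys (Poly_Mapping.single g 1 - Poly_Mapping.single h (a :: complex)) <= S"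
 using keys_diff[of "Poly_Mapping.single g 1" "Poly_Mapping.single h a"] by (auto split: if_splits)

lemma keys_rel3:
 "g \<in> S ==> h \<in> S ==> k \<in> S ==> Poly_Mapping.keys (Poly_Mapping.single g 1 -
  Poly_Mapping.single h 1 - Poly_Mapping.single k (1 :: complex)) <= S"
 using keys_diff[of "Poly_Mapping.single g 1 - Poly_Mapping.single h 1" "Poly_Mapping.single k (1 :: complex)"]
  keys_rel2[of g S h 1] by (auto split: if_splits)

lemma fcomb_rel2:
 assumes "complex_vs W" "f \<in> S \<rightarrow> carrier W" "g \<in> S" "h \<in> S" "f g = a \<odot>\<^bsub>W\<^esub> f h"
 shows "fcomb W f (Poly_Mapping.single g 1 - Poly_Mapping.single h a) = \<zero>\<^bsub>W\<^esub>"
proof -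
 interpret W: cvs W using assms by (simp add: cvs_iff)
 have "f g \<in> carrier W" "f h \<in> carrier W" using assms by auto
 then show ?thesis using assms
  by (subst fcomb_diff[OF assms(1,2)]) (auto simp: fcomb_single[OF assms(1,2)] W.minus_eq_zero_iff)
qed

lemma fcomb_rel3:
 assumes "complex_vs W" "f \<in> S \<rightarrow> carrier W" "g \<in> S" "h \<in> S" "k \<in> S" "f g = f h \<oplus>\<^bsub>W\<^esub> f k"
 shows "fcomb W f (Poly_Mapping.single g 1 - Poly_Mapping.single h 1 - Poly_Mapping.single k 1) = \<zero>\<^bsub>W\<^esub>"
proof -
 interpret W: cvs W using assms by (simp add: cvs_iff)
 have *: "f g \<in> carrier W" "f h \<in> carrier W" "f k \<in> carrier W" using assms by auto
 have "fcomb W f (Poly_Mapping.single g 1 - Poly_Mapping.single h 1 - Poly_Mapping.single k 1)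
  = fcomb W f (Poly_Mapping.single g 1 - Poly_Mapping.single h 1) \<ominus>\<^bsub>W\<^esub> fcomb W f (Poly_Mapping.single k 1)"
  by (rule fcomb_diff[OF assms(1,2)]) (use assms keys_rel2[of g S h 1] in auto)
 also have "fcomb W f (Poly_Mapping.single g 1 - Poly_Mapping.single h 1)
  = fcomb W f (Poly_Mapping.single g 1) \<ominus>\<^bsub>W\<^esub> fcomb W f (Poly_Mapping.single h 1)"
  by (rule fcomb_diff[OF assms(1,2)]) (use assms in auto)
 also have "... \<ominus>\<^bsub>W\<^esub> fcomb W f (Poly_Mapping.single k 1) = f h \<oplus>\<^bsub>W\<^esub> f k \<ominus>\<^bsub>W\<^esub> f h \<ominus>\<^bsub>W\<^esub> f k"
  using * assms(3-6) by (simp add: fcomb_single[OF assms(1,2)])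
 also have "... = (f k \<oplus>\<^bsub>W\<^esub> (f h \<ominus>\<^bsub>W\<^esub> f h)) \<ominus>\<^bsub>W\<^esub> f k" using * by (simp add: W.minus_eq W.a_ac)
 also have "... = \<zero>\<^bsub>W\<^esub>" using * by (simp add: W.minus_eq W.r_neg)
 finally show ?thesis .
qed

lemma presented_gen_rel2:
 assumes "Poly_Mapping.single g 1 - Poly_Mapping.single h a \<in> R"
 shows "presented_gen R g = a \<odot>\<^bsub>presented S R\<^esub> presented_gen R h"
proof -
 have "fscale a (Poly_Mapping.single h 1) = Poly_Mapping.single h a"
  by (simp add: poly_mapping_eq_iff fun_eq_iff lookup_single when_def)
 then show ?thesis using fs.span_base[OF assms]
  by (simp add: presented_gen_eq presented_simps rel_coset_eq_iff)
qed

lemma presented_gen_rel3: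
 assumes "Poly_Mapping.single g 1 - Poly_Mapping.single h 1 - Poly_Mapping.single k 1 \<in> R"
 shows "presented_gen R g = presented_gen R h \<oplus>\<^bsub>presented S R\<^esub> presented_gen R k"
 using fs.span_base[OF assms]
 by (simp add: presented_gen_eq presented_simps rel_coset_eq_iff algebra_simps)

subsection \<open>Tensor products\<close>

definition bilin :: "'v cvs => 'w cvs => 'z cvs => ('v => 'w => 'z) => bool" where
 "bilin V W Z f \<longleftrightarrow> (\<forall>v\<in>carrier V. lin W Z (f v)) \<and> (\<forall>w\<in>carrier W. lin V Z (%v. f v w))"

lemma bilinI:
 "(!!v. v \<in> carrier V ==> lin W Z (f v)) ==> (!!w. w \<in> carrier W ==> lin V Z (%v. f v w)) ==> bilin V W Z f"
 by (simp add: bilin_def)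

lemma bilin_left: "bilin V W Z f ==> w \<in> carrier W ==> lin V Z (%v. f v w)"
 by (simp add: bilin_def)

lemma bilin_right: "bilin V W Z f ==> v \<in> carrier V ==> lin W Z (f v)"
 by (simp add: bilin_def)

lemma bilin_closed: "bilin V W Z f ==> v \<in> carrier V ==> w \<in> carrier W ==> f v w \<in> carrier Z"
 by (auto simp: bilin_def lin_def)

lemma bilin_comp:
 "bilin V' W' Z f ==> lin V V' g ==> lin W W' h ==> bilin V W Z (%v w. f (g v) (h w))"
 by (intro bilinI)
  (auto intro: lin_comp[of V V' g Z "%v. f v _"] lin_comp[of W W' h Z] bilin_left bilin_right lin_closed)

lemma bilin_lin_comp: "bilin V W Z f ==> lin Z Z' g ==> bilin V W Z' (%v w. g (f v w))"
 by (intro bilinI) (auto intro: lin_comp bilin_left bilin_right)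

lemma cvs_tensor: "complex_vs (tensor_space V W)"
 by (simp add: tensor_space_def complex_vs_presented)

lemma tensor_elem_closed:
 "v \<in> carrier V ==> w \<in> carrier W ==> tensor_elem V W v w \<in> carrier (tensor_space V W)"
 by (simp add: tensor_elem_def tensor_space_def presented_gen_closed)

lemma bilin_tensor_elem: "bilin V W (tensor_space V W) (tensor_elem V W)"
proof (intro bilinI linI)
 fix v v' a w assume v: "v \<in> carrier V" and w: "w \<in> carrier W"
 show "tensor_elem V W v w \<in> carrier (tensor_space V W)" by (rule tensor_elem_closed[OF v w])
 then show "tensor_elem V W v w \<in> carrier (tensor_space V W)" .
 show "tensor_elem V W (a \<odot>\<^bsub>V\<^esub> v) w = a \<odot>\<^bsub>tensor_space V W\<^esub> tensor_elem V W v w"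
  unfolding tensor_elem_def tensor_space_def
  by (rule presented_gen_rel2) (unfold tensor_rels_def, use v w in blast)
 show "tensor_elem V W v (a \<odot>\<^bsub>W\<^esub> w) = a \<odot>\<^bsub>tensor_space V W\<^esub> tensor_elem V W v w"
  unfolding tensor_elem_def tensor_space_def
  by (rule presented_gen_rel2) (unfold tensor_rels_def, use v w in blast)
 show "tensor_elem V W (v \<oplus>\<^bsub>V\<^esub> v') w = tensor_elem V W v w \<oplus>\<^bsub>tensor_space V W\<^esub> tensor_elem V W v' w"
  if "v' \<in> carrier V"
  unfolding tensor_elem_def tensor_space_def
  by (rule presented_gen_rel3) (unfold tensor_rels_def, use v w that in blast)
 show "tensor_elem V W v (w \<oplus>\<^bsub>W\<^esub> w') = tensor_elem V W v w \<oplus>\<^bsub>tensor_space V W\<^esub> tensor_elem V W v w'"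
  if "w' \<in> carrier W" for w'
  unfolding tensor_elem_def tensor_space_def
  by (rule presented_gen_rel3) (unfold tensor_rels_def, use v w that in blast)
qed

lemma lin_eq_tensor:
 assumes "lin (tensor_space V W) Z f" "lin (tensor_space V W) Z f'" "complex_vs Z"
  and "!!v w. v \<in> carrier V ==> w \<in> carrier W ==> f (tensor_elem V W v w) = f' (tensor_elem V W v w)"
  and "x \<in> carrier (tensor_space V W)"
 shows "f x = f' x"
 by (rule lin_eq_presented[OF assms(1,2)[unfolded tensor_space_def] assms(3) _ assms(5)[unfolded tensor_space_def]])
  (use assms(4) in \<open>auto simp: tensor_elem_def\<close>)

context
 fixes V :: "'v cvs" and W :: "'w cvs" and Z :: "'z cvs" and f :: "'v => 'w => 'z"
 assumes V: "complex_vs V" and W: "complex_vs W" and Z: "complex_vs Z" and f: "bilin V W Z f"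
begin

interpretation V: cvs V using V by (simp add: cvs_iff)
interpretation W: cvs W using W by (simp add: cvs_iff)

lemma tensor_lift_aux:
 "(%(v, w). f v w) \<in> carrier V \<times> carrier W \<rightarrow> carrier Z"
 "r \<in> tensor_rels V W ==> Poly_Mapping.keys r <= carrier V \<times> carrier W"
 "r \<in> tensor_rels V W ==> fcomb Z (%(v, w). f v w) r = \<zero>\<^bsub>Z\<^esub>"
proof -
 show 1: "(%(v, w). f v w) \<in> carrier V \<times> carrier W \<rightarrow> carrier Z"
  using f by (auto simp: bilin_closed)
 assume r: "r \<in> tensor_rels V W"
 show "Poly_Mapping.keys r <= carrier V \<times> carrier W"
  using r unfolding tensor_rels_def by (elim UnE CollectE exE conjE; hypsubst)
  (intro keys_rel2 keys_rel3; simp)+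
 show "fcomb Z (%(v, w). f v w) r = \<zero>\<^bsub>Z\<^esub>"
  using r unfolding tensor_rels_def by (elim UnE CollectE exE conjE; hypsubst)
  ((rule fcomb_rel2[OF Z 1] fcomb_rel3[OF Z 1]; simp add: lin_add[OF bilin_left[OF f]]
  lin_add[OF bilin_right[OF f]] lin_scale[OF bilin_left[OF f]] lin_scale[OF bilin_right[OF f]])+)
qed

lemma tensor_lift_elem:
 "v \<in> carrier V ==> w \<in> carrier W ==>
  tensor_lift V W Z (%(v, w). f v w) (tensor_elem V W v w) = f v w"
 unfolding tensor_lift_def tensor_elem_def
 by (subst presented_lift_gen[OF Z tensor_lift_aux(1)]) (auto simp: tensor_lift_aux)

lemma lin_tensor_lift: "lin (tensor_space V W) Z (tensor_lift V W Z (%(v, w). f v w))"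
 unfolding tensor_lift_def tensor_space_def
 by (rule lin_presented_lift[OF Z tensor_lift_aux(1)]) (auto simp: tensor_lift_aux)

end

subsection \<open>Exterior powers\<close>

text \<open>The three closing conditions mirror the three families of \<open>ext_rels\<close>, so
  that this is precisely what a lift from the exterior power requires.\<close>

definition alternating :: "nat => 'v cvs => 'w cvs => ('v list => 'w) => bool" where
 "alternating k V W f \<longleftrightarrow> f \<in> ext_gens k V \<rightarrow> carrier W \<and>
  (\<forall>us v v' ws. us @ v # ws \<in> ext_gens k V \<and> v' \<in> carrier V -->
  f (us @ (v \<oplus>\<^bsub>V\<^esub> v') # ws) = f (us @ v # ws) \<oplus>\<^bsub>W\<^esub> f (us @ v' # ws)) \<and>
  (\<forall>us a v ws. us @ v # ws \<in> ext_gens k V --> f (us @ (a \<odot>\<^bsub>V\<^esub> v) # ws) = a \<odot>\<^bsub>W\<^esub> f (us @ v # ws)) \<and>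
  (\<forall>vs. vs \<in> ext_gens k V \<and> \<not> distinct vs --> f vs = \<zero>\<^bsub>W\<^esub>)"

lemma alternatingI:
 assumes "!!vs. vs \<in> ext_gens k V ==> f vs \<in> carrier W"
  and "!!us v v' ws. us @ v # ws \<in> ext_gens k V ==> v' \<in> carrier V ==>
  f (us @ (v \<oplus>\<^bsub>V\<^esub> v') # ws) = f (us @ v # ws) \<oplus>\<^bsub>W\<^esub> f (us @ v' # ws)"
  and "!!us a v ws. us @ v # ws \<in> ext_gens k V ==> f (us @ (a \<odot>\<^bsub>V\<^esub> v) # ws) = a \<odot>\<^bsub>W\<^esub> f (us @ v # ws)"
  and "!!vs. vs \<in> ext_gens k V ==> \<not> distinct vs ==> f vs = \<zero>\<^bsub>W\<^esub>"
 shows "alternating k V W f"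
 using assms unfolding alternating_def by blast

lemma alternating_closed: "alternating k V W f ==> vs \<in> ext_gens k V ==> f vs \<in> carrier W"
 and alternating_add: "alternating k V W f ==> us @ v # ws \<in> ext_gens k V ==> v' \<in> carrier V ==>
  f (us @ (v \<oplus>\<^bsub>V\<^esub> v') # ws) = f (us @ v # ws) \<oplus>\<^bsub>W\<^esub> f (us @ v' # ws)"
 and alternating_scale: "alternating k V W f ==> us @ v # ws \<in> ext_gens k V ==>
  f (us @ (a \<odot>\<^bsub>V\<^esub> v) # ws) = a \<odot>\<^bsub>W\<^esub> f (us @ v # ws)"
 and alternating_repeat: "alternating k V W f ==> vs \<in> ext_gens k V ==> \<not> distinct vs ==> f vs = \<zero>\<^bsub>W\<^esub>"
 unfolding alternating_def by blast+

text \<open>Polarisation: the value with \<open>x + y\<close> in both adjacent slots vanishes, and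
  so do the two diagonal terms of its expansion.\<close>

lemma alternating_swap:
 assumes f: "alternating k V W f" and W: "complex_vs W" and V: "complex_vs V"
  and vs: "us @ x # y # ws \<in> ext_gens k V"
 shows "f (us @ x # y # ws) = (-1) \<odot>\<^bsub>W\<^esub> f (us @ y # x # ws)"
proof -
 interpret W: cvs W using W by (simp add: cvs_iff)
 interpret V: cvs V using V by (simp add: cvs_iff)
 have xy: "x \<in> carrier V" "y \<in> carrier V" and us: "set us <= carrier V" "set ws <= carrier V"
  and k: "k = length us + length ws + 2"
  using vs by (auto simp: ext_gens_def)
 have g: "us @ u # v # ws \<in> ext_gens k V" "(us @ [u]) @ v # ws \<in> ext_gens k V"
  if "u \<in> carrier V" "v \<in> carrier V" for u v
  using that us k by (auto simp: ext_gens_def)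
 let ?z = "x \<oplus>\<^bsub>V\<^esub> y"
 have z: "?z \<in> carrier V" using xy by simp
 have "\<zero>\<^bsub>W\<^esub> = f (us @ ?z # ?z # ws)"
  using alternating_repeat[OF f g(1)[OF z z]] by simp
 also have "... = f (us @ x # ?z # ws) \<oplus>\<^bsub>W\<^esub> f (us @ y # ?z # ws)"
  using alternating_add[OF f g(1)[OF xy(1) z] xy(2)] by simp
 also have "f (us @ x # ?z # ws) = f (us @ x # x # ws) \<oplus>\<^bsub>W\<^esub> f (us @ x # y # ws)"
  using alternating_add[OF f g(2)[OF xy(1) xy(1)] xy(2)] by simp
 also have "f (us @ y # ?z # ws) = f (us @ y # x # ws) \<oplus>\<^bsub>W\<^esub> f (us @ y # y # ws)"
  using alternating_add[OF f g(2)[OF xy(2) xy(1)] xy(2)] by simp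
 also have "f (us @ x # x # ws) = \<zero>\<^bsub>W\<^esub>" using alternating_repeat[OF f g(1)[OF xy(1) xy(1)]] by simp
 also have "f (us @ y # y # ws) = \<zero>\<^bsub>W\<^esub>" using alternating_repeat[OF f g(1)[OF xy(2) xy(2)]] by simp
 finally have "f (us @ x # y # ws) \<oplus>\<^bsub>W\<^esub> f (us @ y # x # ws) = \<zero>\<^bsub>W\<^esub>"
  using alternating_closed[OF f g(1)] xy by simp
 then show ?thesis
  using alternating_closed[OF f g(1)] xy by (simp add: W.scale_minus_one W.minus_equality)
qed

text \<open>Iterates adjacent swaps, with one sign for each entry of \<open>ys\<close>. This sign
  produces the cancellation of repeated entries in \<open>alternating_shuffle\<close>.\<close>

lemma alternating_move:
 assumes f: "alternating k V W f" and W: "complex_vs W" and V: "complex_vs V"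
  and vs: "us @ x # ys @ ws \<in> ext_gens k V"
 shows "f (us @ x # ys @ ws) = (-1) ^ length ys \<odot>\<^bsub>W\<^esub> f (us @ ys @ x # ws)"
 using vs
proof (induction ys arbitrary: us)
 case Nil
 interpret W: cvs W using W by (simp add: cvs_iff)
 show ?case using Nil alternating_closed[OF f] by simp
next
 case (Cons y ys)
 interpret W: cvs W using W by (simp add: cvs_iff)
 have 1: "(us @ [y]) @ x # ys @ ws \<in> ext_gens k V" "us @ y # ys @ x # ws \<in> ext_gens k V"
  using Cons.prems by (auto simp: ext_gens_def)
 have "f (us @ x # y # ys @ ws) = (-1) \<odot>\<^bsub>W\<^esub> f (us @ y # x # ys @ ws)"
  using alternating_swap[OF f W V] Cons.prems by simp
 also have "... = (-1) \<odot>\<^bsub>W\<^esub> ((-1) ^ length ys \<odot>\<^bsub>W\<^esub> f (us @ y # ys @ x # ws))"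
  using Cons.IH[OF 1(1)] by simp
 finally show ?case using alternating_closed[OF f 1(2)] by (simp add: W.scale_scale)
qed

lemma cvs_ext: "complex_vs (ext_power k V)"
 by (simp add: ext_power_def complex_vs_presented)

lemma ext_elem_closed: "vs \<in> ext_gens k V ==> ext_elem k V vs \<in> carrier (ext_power k V)"
 by (simp add: ext_elem_def ext_power_def presented_gen_closed)

lemma alternating_ext_elem: "alternating k V (ext_power k V) (ext_elem k V)"
proof (rule alternatingI)
 fix vs assume "vs \<in> ext_gens k V" "\<not> distinct vs"
 then have "Poly_Mapping.single vs 1 \<in> ext_rels k V" unfolding ext_rels_def by blast
 then show "ext_elem k V vs = \<zero>\<^bsub>ext_power k V\<^esub>"
  using fs.span_base
  by (auto simp: ext_elem_def presented_gen_eq ext_power_def presented_simps rel_coset_eq_iff)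
next
 fix us v v' ws assume "us @ v # ws \<in> ext_gens k V" "v' \<in> carrier V"
 then show "ext_elem k V (us @ (v \<oplus>\<^bsub>V\<^esub> v') # ws) =
  ext_elem k V (us @ v # ws) \<oplus>\<^bsub>ext_power k V\<^esub> ext_elem k V (us @ v' # ws)"
  unfolding ext_elem_def ext_power_def
  by (intro presented_gen_rel3) (unfold ext_rels_def, blast)
next
 fix us a v ws assume "us @ v # ws \<in> ext_gens k V"
 then show "ext_elem k V (us @ (a \<odot>\<^bsub>V\<^esub> v) # ws) = a \<odot>\<^bsub>ext_power k V\<^esub> ext_elem k V (us @ v # ws)"
  unfolding ext_elem_def ext_power_def
  by (intro presented_gen_rel2) (unfold ext_rels_def, blast)
qed (rule ext_elem_closed)

lemma lin_eq_ext:
 assumes "lin (ext_power k V) Z f" "lin (ext_power k V) Z f'" "complex_vs Z"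
  and "!!vs. vs \<in> ext_gens k V ==> f (ext_elem k V vs) = f' (ext_elem k V vs)"
  and "x \<in> carrier (ext_power k V)"
 shows "f x = f' x"
 by (rule lin_eq_presented[OF assms(1,2)[unfolded ext_power_def] assms(3) _ assms(5)[unfolded ext_power_def]])
  (use assms(4) in \<open>auto simp: ext_elem_def\<close>)

text \<open>Fixing one factor at a time reduces first to a decomposable left factor and then to a
  decomposable right one. The fibrewise identities below are therefore checked on lists of
  vectors.\<close>

lemma lin_eq_tensor_ext:
 assumes f: "lin (ext_tensor k V l W) Z f"
  "lin (ext_tensor k V l W) Z f'" "complex_vs Z"
  and eq: "!!vs ws. vs \<in> ext_gens k V ==> ws \<in> ext_gens l W ==>
  f (ext_tensor_elem k V l W (ext_elem k V vs) (ext_elem l W ws)) =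
  f' (ext_tensor_elem k V l W (ext_elem k V vs) (ext_elem l W ws))"
  and "x \<in> carrier (ext_tensor k V l W)"
 shows "f x = f' x"
proof (rule lin_eq_tensor[OF f _ assms(5)])
 fix v w assume v: "v \<in> carrier (ext_power k V)" and w: "w \<in> carrier (ext_power l W)"
 note b = bilin_lin_comp[OF bilin_tensor_elem f(1)] bilin_lin_comp[OF bilin_tensor_elem f(2)]
 show "f (ext_tensor_elem k V l W v w) =
  f' (ext_tensor_elem k V l W v w)"
  by (rule lin_eq_ext[OF bilin_left[OF b(1) w] bilin_left[OF b(2) w] f(3) _ v],
  rule lin_eq_ext[OF bilin_right[OF b(1)] bilin_right[OF b(2)] f(3) _ w])
  (auto intro: ext_elem_closed eq)
qed

context
 fixes k :: nat and V :: "'v cvs" and Z :: "'z cvs" and f :: "'v list => 'z"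
 assumes V: "complex_vs V" and Z: "complex_vs Z" and f: "alternating k V Z f"
begin

interpretation V: cvs V using V by (simp add: cvs_iff)
interpretation Z: cvs Z using Z by (simp add: cvs_iff)

lemma ext_lift_aux:
 "f \<in> ext_gens k V \<rightarrow> carrier Z"
 "r \<in> ext_rels k V ==> Poly_Mapping.keys r <= ext_gens k V"
 "r \<in> ext_rels k V ==> fcomb Z f r = \<zero>\<^bsub>Z\<^esub>"
proof -
 show 1: "f \<in> ext_gens k V \<rightarrow> carrier Z"
  using f by (auto simp: alternating_closed)
 have g: "us @ v' # ws \<in> ext_gens k V" if "us @ v # ws \<in> ext_gens k V" "v' \<in> carrier V" for us v v' ws
  using that by (auto simp: ext_gens_def)
 have c: "v \<in> carrier V" if "us @ v # ws \<in> ext_gens k V" for us v ws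
  using that by (auto simp: ext_gens_def)
 assume "r \<in> ext_rels k V"
 then consider (add) us v v' ws where "us @ v # ws \<in> ext_gens k V" "v' \<in> carrier V"
  "r = Poly_Mapping.single (us @ (v \<oplus>\<^bsub>V\<^esub> v') # ws) 1 - Poly_Mapping.single (us @ v # ws) 1
  - Poly_Mapping.single (us @ v' # ws) 1"
  | (scale) us a v ws where "us @ v # ws \<in> ext_gens k V"
  "r = Poly_Mapping.single (us @ (a \<odot>\<^bsub>V\<^esub> v) # ws) 1 - Poly_Mapping.single (us @ v # ws) a"
  | (repeat) vs where "vs \<in> ext_gens k V" "\<not> distinct vs" "r = Poly_Mapping.single vs 1"
  unfolding ext_rels_def by blast
 then have "Poly_Mapping.keys r <= ext_gens k V \<and> fcomb Z f r = \<zero>\<^bsub>Z\<^esub>"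
 proof cases
  case add
  then show ?thesis using c[OF add(1)]
  by (auto simp: g[OF add(1)] alternating_add[OF f] intro!: keys_rel3 fcomb_rel3[OF Z 1] del: subsetI)
 next
  case scale
  then show ?thesis using c[OF scale(1)]
  by (auto simp: g[OF scale(1)] alternating_scale[OF f] intro!: keys_rel2 fcomb_rel2[OF Z 1] del: subsetI)
 next
  case repeat
  then show ?thesis by (auto simp: alternating_repeat[OF f] fcomb_single[OF Z 1])
 qed
 then show "Poly_Mapping.keys r <= ext_gens k V" "fcomb Z f r = \<zero>\<^bsub>Z\<^esub>" by blast+
qed

lemma ext_lift_elem: "vs \<in> ext_gens k V ==> ext_lift k V Z f (ext_elem k V vs) = f vs"
 unfolding ext_lift_def ext_elem_def
 by (subst presented_lift_gen[OF Z ext_lift_aux(1)]) (auto simp: ext_lift_aux)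

lemma lin_ext_lift: "lin (ext_power k V) Z (ext_lift k V Z f)"
 unfolding ext_lift_def ext_power_def
 by (rule lin_presented_lift[OF Z ext_lift_aux(1)]) (auto simp: ext_lift_aux)

end

lemma ext_gens_map: "lin V W f ==> vs \<in> ext_gens k V ==> map f vs \<in> ext_gens k W"
 by (auto simp: ext_gens_def intro: lin_closed)

lemma alternating_map:
 assumes f: "lin V W f" and h: "alternating k W Z h"
 shows "alternating k V Z (%vs. h (map f vs))"
proof (rule alternatingI)
 show "h (map f vs) \<in> carrier Z" if "vs \<in> ext_gens k V" for vs
  using that by (intro alternating_closed[OF h] ext_gens_map[OF f])
 show "h (map f vs) = \<zero>\<^bsub>Z\<^esub>" if "vs \<in> ext_gens k V" "\<not> distinct vs" for vs
  using that by (intro alternating_repeat[OF h] ext_gens_map[OF f]) (auto simp: distinct_map)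
 fix us v ws assume g: "us @ v # ws \<in> ext_gens k V"
 then have v: "v \<in> carrier V" by (auto simp: ext_gens_def)
 show "h (map f (us @ (a \<odot>\<^bsub>V\<^esub> v) # ws)) = a \<odot>\<^bsub>Z\<^esub> h (map f (us @ v # ws))" for a
  using alternating_scale[OF h, of "map f us" "f v" "map f ws"] ext_gens_map[OF f g] v
  by (simp add: lin_scale[OF f])
 fix v' assume v': "v' \<in> carrier V"
 show "h (map f (us @ (v \<oplus>\<^bsub>V\<^esub> v') # ws)) = h (map f (us @ v # ws)) \<oplus>\<^bsub>Z\<^esub> h (map f (us @ v' # ws))"
  using alternating_add[OF h, of "map f us" "f v" "map f ws" "f v'"] ext_gens_map[OF f g] v v'
  by (simp add: lin_add[OF f] lin_closed[OF f])
qed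

lemma ext_map_elem:
 assumes "lin V W f" "complex_vs V" "vs \<in> ext_gens k V"
 shows "ext_map k V W f (ext_elem k V vs) = ext_elem k W (map f vs)"
 unfolding ext_map_def
 by (rule ext_lift_elem[OF assms(2) cvs_ext alternating_map[OF assms(1) alternating_ext_elem] assms(3)])

lemma lin_ext_map:
 assumes "lin V W f" "complex_vs V"
 shows "lin (ext_power k V) (ext_power k W) (ext_map k V W f)"
 unfolding ext_map_def
 by (rule lin_ext_lift[OF assms(2) cvs_ext alternating_map[OF assms(1) alternating_ext_elem]])

lemma alternating_append_right:
 assumes "alternating (k + l) V Z h" "vs \<in> ext_gens k V"
 shows "alternating l V Z (%ws. h (vs @ ws))"
proof -
 have g: "vs @ ws \<in> ext_gens (k + l) V" if "ws \<in> ext_gens l V" for ws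
  using assms(2) that by (auto simp: ext_gens_def)
 show ?thesis
  using g alternating_add[OF assms(1), of "vs @ _"] alternating_scale[OF assms(1), of "vs @ _"]
  alternating_repeat[OF assms(1)]
  by (intro alternatingI alternating_closed[OF assms(1)]) fastforce+
qed

lemma alternating_append_left:
 assumes "alternating (k + l) V Z h" "ws \<in> ext_gens l V"
 shows "alternating k V Z (%vs. h (vs @ ws))"
proof -
 have g: "vs @ ws \<in> ext_gens (k + l) V" if "vs \<in> ext_gens k V" for vs
  using assms(2) that by (auto simp: ext_gens_def)
 show ?thesis
  using g alternating_add[OF assms(1), of _ _ "_ @ ws"] alternating_scale[OF assms(1), of _ _ "_ @ ws"]
  alternating_repeat[OF assms(1)]
  by (intro alternatingI alternating_closed[OF assms(1)]) fastforce+
qed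

text \<open>The inner one of the two nested lifts in \<open>wedge\<close>: multiplication from the
  left by the decomposable element of \<open>vs\<close>. The two lifts are justified
  separately.\<close>

definition left_factor :: "nat => nat => 'v cvs => 'v list => ('v list \<Rightarrow>\<^sub>0 complex) set => ('v list \<Rightarrow>\<^sub>0 complex) set" where
 "left_factor k l V vs = ext_lift l V (ext_power (k + l) V) (%ws. ext_elem (k + l) V (vs @ ws))"

context
 fixes k l :: nat and V :: "'v cvs"
 assumes V: "complex_vs V"
begin

lemma left_factor_elem:
 "vs \<in> ext_gens k V ==> ws \<in> ext_gens l V ==> left_factor k l V vs (ext_elem l V ws) = ext_elem (k + l) V (vs @ ws)"
 unfolding left_factor_def by (rule ext_lift_elem[OF V cvs_ext alternating_append_right[OF alternating_ext_elem]])

lemma lin_left_factor: "vs \<in> ext_gens k V ==> lin (ext_power l V) (ext_power (k + l) V) (left_factor k l V vs)"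
 unfolding left_factor_def by (rule lin_ext_lift[OF V cvs_ext alternating_append_right[OF alternating_ext_elem]])

text \<open>Both sides of each alternation law are linear in \<eta>, so it suffices to take \<eta>
  decomposable, where the law is one for concatenated lists. This justifies the outer lift of
  \<open>wedge\<close>.\<close>

lemma alternating_left_factor:
 assumes \<eta>: "\<eta> \<in> carrier (ext_power l V)"
 shows "alternating k V (ext_power (k + l) V) (%vs. left_factor k l V vs \<eta>)"
proof (rule alternatingI)
 interpret V: cvs V using V by (simp add: cvs_iff)
 note al = alternating_append_left[OF alternating_ext_elem[of "k + l" V]]
 show "left_factor k l V vs \<eta> \<in> carrier (ext_power (k + l) V)" if "vs \<in> ext_gens k V" for vs
  using lin_closed[OF lin_left_factor[OF that] \<eta>] .
 show "left_factor k l V vs \<eta> = \<zero>\<^bsub>ext_power (k + l) V\<^esub>" if vs: "vs \<in> ext_gens k V" "\<not> distinct vs" for vs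
  by (rule lin_eq_ext[OF lin_left_factor[OF vs(1)] lin_zero_map[OF cvs_ext] cvs_ext _ \<eta>])
  (simp add: left_factor_elem vs alternating_repeat[OF al])
 fix us v ws assume g: "us @ v # ws \<in> ext_gens k V"
 then have v: "v \<in> carrier V" by (auto simp: ext_gens_def)
 have g': "us @ v' # ws \<in> ext_gens k V" if "v' \<in> carrier V" for v'
  using g that by (auto simp: ext_gens_def)
 show "left_factor k l V (us @ (a \<odot>\<^bsub>V\<^esub> v) # ws) \<eta> = a \<odot>\<^bsub>ext_power (k + l) V\<^esub> left_factor k l V (us @ v # ws) \<eta>" for a
  by (rule lin_eq_ext[OF lin_left_factor[OF g'] lin_scale_map[OF lin_left_factor[OF g]] cvs_ext _ \<eta>])
  (use alternating_scale[OF al g] in \<open>simp_all add: left_factor_elem g g' v cvs_ext\<close>)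
 fix v' assume v': "v' \<in> carrier V"
 show "left_factor k l V (us @ (v \<oplus>\<^bsub>V\<^esub> v') # ws) \<eta> =
  left_factor k l V (us @ v # ws) \<eta> \<oplus>\<^bsub>ext_power (k + l) V\<^esub> left_factor k l V (us @ v' # ws) \<eta>"
  by (rule lin_eq_ext[OF lin_left_factor[OF g'] lin_sum_map[OF lin_left_factor[OF g] lin_left_factor[OF g']] cvs_ext _ \<eta>])
  (use alternating_add[OF al g v'] in \<open>simp_all add: left_factor_elem g g' v v' cvs_ext\<close>)
qed

lemma wedge_eq:
 "wedge k l V \<beta> \<eta> = ext_lift k V (ext_power (k + l) V) (%vs. left_factor k l V vs \<eta>) \<beta>"
 by (simp add: wedge_def left_factor_def)

lemma wedge_elem_left:
 "vs \<in> ext_gens k V ==> \<eta> \<in> carrier (ext_power l V) ==> wedge k l V (ext_elem k V vs) \<eta> = left_factor k l V vs \<eta>"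
 unfolding wedge_eq by (rule ext_lift_elem[OF V cvs_ext alternating_left_factor])

lemma wedge_elem:
 "vs \<in> ext_gens k V ==> ws \<in> ext_gens l V ==>
  wedge k l V (ext_elem k V vs) (ext_elem l V ws) = ext_elem (k + l) V (vs @ ws)"
 by (simp add: wedge_elem_left left_factor_elem ext_elem_closed)

text \<open>Linearity in the left factor comes from the outer lift. Linearity in the right factor is
  an identity of maps linear in \<beta>, hence checked for decomposable \<beta>, where
  \<open>left_factor\<close> is linear.\<close>

lemma bilin_wedge: "bilin (ext_power k V) (ext_power l V) (ext_power (k + l) V) (wedge k l V)"
proof (rule bilinI)
 show left: "lin (ext_power k V) (ext_power (k + l) V) (%\<beta>. wedge k l V \<beta> \<eta>)"
  if "\<eta> \<in> carrier (ext_power l V)" for \<eta>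
  unfolding wedge_eq using lin_ext_lift[OF V cvs_ext alternating_left_factor[OF that]] .
 interpret L: cvs "ext_power l V" by (simp add: cvs_iff cvs_ext)
 fix \<beta> assume \<beta>: "\<beta> \<in> carrier (ext_power k V)"
 show "lin (ext_power l V) (ext_power (k + l) V) (wedge k l V \<beta>)"
 proof (rule linI)
  fix \<eta> a assume \<eta>: "\<eta> \<in> carrier (ext_power l V)"
  show "wedge k l V \<beta> \<eta> \<in> carrier (ext_power (k + l) V)" by (rule lin_closed[OF left[OF \<eta>] \<beta>])
  show "wedge k l V \<beta> (a \<odot>\<^bsub>ext_power l V\<^esub> \<eta>) = a \<odot>\<^bsub>ext_power (k + l) V\<^esub> wedge k l V \<beta> \<eta>"
  by (rule lin_eq_ext[OF left lin_scale_map[OF left] cvs_ext _ \<beta>])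
  (use \<eta> in \<open>simp_all add: cvs_ext wedge_elem_left lin_scale[OF lin_left_factor]\<close>)
  fix \<eta>' assume \<eta>': "\<eta>' \<in> carrier (ext_power l V)"
  show "wedge k l V \<beta> (\<eta> \<oplus>\<^bsub>ext_power l V\<^esub> \<eta>') = wedge k l V \<beta> \<eta> \<oplus>\<^bsub>ext_power (k + l) V\<^esub> wedge k l V \<beta> \<eta>'"
  by (rule lin_eq_ext[OF left lin_sum_map[OF left left] cvs_ext _ \<beta>])
  (use \<eta> \<eta>' in \<open>simp_all add: cvs_ext wedge_elem_left lin_add[OF lin_left_factor]\<close>)
 qed
qed

end

lemma ext_gens_1: "ext_gens 1 V = {[v] | v. v \<in> carrier V}"
 by (auto simp: ext_gens_def length_Suc_conv)

lemma ext_gens_0: "ext_gens 0 V = {[]}"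
 by (auto simp: ext_gens_def)

lemma lin_ext_elem_1: "lin V (ext_power 1 V) (%v. ext_elem 1 V [v])"
 using alternating_add[OF alternating_ext_elem, of "[]" _ "[]" 1 V]
  alternating_scale[OF alternating_ext_elem, of "[]" _ "[]" 1 V]
 by (intro linI ext_elem_closed) (auto simp: ext_gens_1 simp del: One_nat_def)

text \<open>The map sending \<open>v\<close> to \<open>ext_elem 1 V [v]\<close> is linear and meets
  every generator, hence is onto.\<close>

lemma ext_power_1E:
 assumes "x \<in> carrier (ext_power 1 V)" "complex_vs V"
 obtains v where "v \<in> carrier V" "x = ext_elem 1 V [v]"
proof -
 interpret V: cvs V using assms by (simp add: cvs_iff)
 have "\<exists>v\<in>carrier V. x = ext_elem 1 V [v]"
  using assms(1) unfolding ext_power_def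
 proof (induction rule: presented_induct)
  case zero
  show ?case using lin_zero[OF lin_ext_elem_1 assms(2) cvs_ext]
  by (intro bexI[of _ "\<zero>\<^bsub>V\<^esub>"]) (simp_all add: ext_power_def)
 next
  case (add x a g)
  then obtain v u where "v \<in> carrier V" "x = ext_elem 1 V [v]" "u \<in> carrier V" "g = [u]"
  by (auto simp: ext_gens_1 simp del: One_nat_def)
  then show ?case
  by (intro bexI[of _ "v \<oplus>\<^bsub>V\<^esub> a \<odot>\<^bsub>V\<^esub> u"])
  (simp_all add: lin_add[OF lin_ext_elem_1] lin_scale[OF lin_ext_elem_1] flip: ext_power_def ext_elem_def del: One_nat_def)
 qed
 then show thesis using that by blast
qed

declare One_nat_def [simp del]

subsection \<open>Splitting off one factor\<close>

text \<open>The alternating sum over all ways to split one entry off a list: the entry with index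
  \<open>k\<close>, counted from 0, contributes \<open>F\<close> of the remaining list and that
  entry, with sign \<open>(-1)^k\<close>. Up to a sign depending on the length, this is the
  component of the coproduct of the exterior algebra whose second factor has degree one, followed by
  \<open>F\<close>.\<close>

fun shuffle :: "'z cvs => ('e list => 'e => 'z) => 'e list => 'z" where
 "shuffle Z F [] = \<zero>\<^bsub>Z\<^esub>"
| "shuffle Z F (e # es) = F es e \<ominus>\<^bsub>Z\<^esub> shuffle Z (%us. F (e # us)) es"

lemma alternating_cong:
 assumes f: "alternating k V W f" and eq: "!!vs. vs \<in> ext_gens k V ==> g vs = f vs" and V: "complex_vs V"
 shows "alternating k V W g"
proof (rule alternatingI)
 interpret V: cvs V using V by (simp add: cvs_iff)
 have gen: "us @ v' # ws \<in> ext_gens k V" if "us @ v # ws \<in> ext_gens k V" "v' \<in> carrier V" for us v v' ws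
  using that by (auto simp: ext_gens_def)
 show "g vs \<in> carrier W" if "vs \<in> ext_gens k V" for vs
  using that by (simp add: eq alternating_closed[OF f])
 show "g vs = \<zero>\<^bsub>W\<^esub>" if "vs \<in> ext_gens k V" "\<not> distinct vs" for vs
  using that by (simp add: eq alternating_repeat[OF f])
 fix us v ws assume g: "us @ v # ws \<in> ext_gens k V"
 then have v: "v \<in> carrier V" by (auto simp: ext_gens_def)
 show "g (us @ (a \<odot>\<^bsub>V\<^esub> v) # ws) = a \<odot>\<^bsub>W\<^esub> g (us @ v # ws)" for a
  using alternating_scale[OF f g] by (simp add: eq gen[OF g] v)
 fix v' assume v': "v' \<in> carrier V"
 show "g (us @ (v \<oplus>\<^bsub>V\<^esub> v') # ws) = g (us @ v # ws) \<oplus>\<^bsub>W\<^esub> g (us @ v' # ws)"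
  using alternating_add[OF f g v'] by (simp add: eq gen[OF g] v v')
qed

lemma alternating_lin_comp:
 assumes f: "alternating k V W f" and g: "lin W Z g" and "complex_vs W" "complex_vs Z" "complex_vs V"
 shows "alternating k V Z (%vs. g (f vs))"
proof (rule alternatingI)
 interpret V: cvs V using assms by (simp add: cvs_iff)
 show "g (f vs) \<in> carrier Z" if "vs \<in> ext_gens k V" for vs
  by (rule lin_closed[OF g alternating_closed[OF f that]])
 show "g (f vs) = \<zero>\<^bsub>Z\<^esub>" if "vs \<in> ext_gens k V" "\<not> distinct vs" for vs
  by (simp add: alternating_repeat[OF f that] lin_zero[OF g assms(3,4)])
 fix us v ws assume gen: "us @ v # ws \<in> ext_gens k V"
 show "g (f (us @ (a \<odot>\<^bsub>V\<^esub> v) # ws)) = a \<odot>\<^bsub>Z\<^esub> g (f (us @ v # ws))" for a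
  by (simp add: alternating_scale[OF f gen] lin_scale[OF g alternating_closed[OF f gen]])
 fix v' assume v': "v' \<in> carrier V"
 then have "us @ v' # ws \<in> ext_gens k V" using gen by (auto simp: ext_gens_def)
 then show "g (f (us @ (v \<oplus>\<^bsub>V\<^esub> v') # ws)) = g (f (us @ v # ws)) \<oplus>\<^bsub>Z\<^esub> g (f (us @ v' # ws))"
  by (simp add: alternating_add[OF f gen v'] lin_add[OF g alternating_closed[OF f gen] alternating_closed[OF f]])
qed

text \<open>Alternation is demanded at every length \<open>k\<close>, which makes the condition
  stable under prefixing a fixed vector, the operation on which the recursion of
  \<open>shuffle\<close> runs.\<close>

definition shufflable :: "'e cvs => 'z cvs => ('e list => 'e => 'z) => bool" where
 "shufflable E Z F \<longleftrightarrow> (\<forall>e\<in>carrier E. \<forall>k. alternating k E Z (%us. F us e)) \<and>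
  (\<forall>us. set us <= carrier E --> lin E Z (F us))"

lemma (in abelian_group) add_minus_add:
 "a \<in> carrier G ==> b \<in> carrier G ==> c \<in> carrier G ==> d \<in> carrier G ==>
  (a \<oplus> b) \<ominus> (c \<oplus> d) = (a \<ominus> c) \<oplus> (b \<ominus> d)"
 by (simp add: minus_eq minus_add a_ac)

context
 fixes E :: "'e cvs" and Z :: "'z cvs"
 assumes E: "complex_vs E" and Z: "complex_vs Z"
begin

interpretation E: cvs E using E by (simp add: cvs_iff)
interpretation Z: cvs Z using Z by (simp add: cvs_iff)

lemma shuffle_closed:
 assumes "!!us e. set us <= carrier E ==> e \<in> carrier E ==> F us e \<in> carrier Z" "set es <= carrier E"
 shows "shuffle Z F es \<in> carrier Z"
 using assms by (induction es arbitrary: F) auto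

lemma shuffle_add:
 assumes "!!us e. set us <= carrier E ==> e \<in> carrier E ==> G us e \<in> carrier Z"
  and "!!us e. set us <= carrier E ==> e \<in> carrier E ==> H us e \<in> carrier Z"
  and "!!us e. set us <= carrier E ==> e \<in> carrier E ==> F us e = G us e \<oplus>\<^bsub>Z\<^esub> H us e"
  and "set es <= carrier E"
 shows "shuffle Z F es = shuffle Z G es \<oplus>\<^bsub>Z\<^esub> shuffle Z H es"
 using assms
proof (induction es arbitrary: F G H)
 case (Cons e es)
 have "shuffle Z (%us. F (e # us)) es =
  shuffle Z (%us. G (e # us)) es \<oplus>\<^bsub>Z\<^esub> shuffle Z (%us. H (e # us)) es"
  by (rule Cons.IH) (use Cons.prems in auto)
 moreover have "shuffle Z (%us. G (e # us)) es \<in> carrier Z" "shuffle Z (%us. H (e # us)) es \<in> carrier Z"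
  using Cons.prems by (auto intro!: shuffle_closed)
 ultimately show ?case using Cons.prems by (simp add: Z.add_minus_add)
qed simp

lemma shuffle_scale:
 assumes "!!us e. set us <= carrier E ==> e \<in> carrier E ==> G us e \<in> carrier Z"
  and "!!us e. set us <= carrier E ==> e \<in> carrier E ==> F us e = a \<odot>\<^bsub>Z\<^esub> G us e"
  and "set es <= carrier E"
 shows "shuffle Z F es = a \<odot>\<^bsub>Z\<^esub> shuffle Z G es"
 using assms
proof (induction es arbitrary: F G)
 case (Cons e es)
 have "shuffle Z (%us. F (e # us)) es = a \<odot>\<^bsub>Z\<^esub> shuffle Z (%us. G (e # us)) es"
  by (rule Cons.IH) (use Cons.prems in auto)
 moreover have "shuffle Z (%us. G (e # us)) es \<in> carrier Z"
  using Cons.prems by (auto intro!: shuffle_closed)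
 ultimately show ?case using Cons.prems by (simp add: Z.scale_minus)
qed simp

lemma shuffle_zero:
 assumes "!!us e. set us <= carrier E ==> e \<in> carrier E ==> F us e = \<zero>\<^bsub>Z\<^esub>" "set es <= carrier E"
 shows "shuffle Z F es = \<zero>\<^bsub>Z\<^esub>"
 using shuffle_scale[of F F 0 es] shuffle_closed[of F es] assms by auto

text \<open>Every term that splits off another entry keeps \<open>x\<close> in its list and
  vanishes; what is left is the term splitting off the displayed \<open>x\<close>, with one sign for
  each entry of \<open>vs\<close> before it.\<close>

lemma shuffle_repeat:
 assumes "!!us e. set us <= carrier E ==> e \<in> carrier E ==> F us e \<in> carrier Z"
  and "!!us e. set us <= carrier E ==> e \<in> carrier E ==> x \<in> set us ==> F us e = \<zero>\<^bsub>Z\<^esub>"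
  and "set vs <= carrier E" "set ws <= carrier E" "x \<in> carrier E"
 shows "shuffle Z F (vs @ x # ws) = (-1) ^ length vs \<odot>\<^bsub>Z\<^esub> F (vs @ ws) x"
 using assms
proof (induction vs arbitrary: F)
 case Nil
 have "shuffle Z (%us. F (x # us)) ws = \<zero>\<^bsub>Z\<^esub>"
  by (rule shuffle_zero) (use Nil in auto)
 then show ?case using Nil by (simp add: Z.minus_eq)
next
 case (Cons v vs)
 have "shuffle Z (%us. F (v # us)) (vs @ x # ws) = (-1) ^ length vs \<odot>\<^bsub>Z\<^esub> F (v # vs @ ws) x"
  by (rule Cons.IH) (use Cons.prems in auto)
 moreover have "F (v # vs @ ws) x \<in> carrier Z" "F (vs @ x # ws) v = \<zero>\<^bsub>Z\<^esub>" using Cons.prems by auto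
 ultimately show ?case by (simp add: Z.minus_eq Z.scale_neg)
qed

text \<open>Only the term that splits off the last entry survives. In the application the entries of
  \<open>vs\<close> come from the base and are killed by the projection.\<close>

lemma shuffle_snoc:
 assumes "!!us e. set us <= carrier E ==> e \<in> carrier E ==> F us e \<in> carrier Z"
  and "!!us v. set us <= carrier E ==> v \<in> set vs ==> F us v = \<zero>\<^bsub>Z\<^esub>"
  and "set vs <= carrier E" "x \<in> carrier E"
 shows "shuffle Z F (vs @ [x]) = (-1) ^ length vs \<odot>\<^bsub>Z\<^esub> F vs x"
 using assms
proof (induction vs arbitrary: F)
 case (Cons v vs)
 have "shuffle Z (%us. F (v # us)) (vs @ [x]) = (-1) ^ length vs \<odot>\<^bsub>Z\<^esub> F (v # vs) x"
  by (rule Cons.IH) (use Cons.prems in auto)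
 moreover have "F (v # vs) x \<in> carrier Z" "F (vs @ [x]) v = \<zero>\<^bsub>Z\<^esub>" using Cons.prems by auto
 ultimately show ?case by (simp add: Z.minus_eq Z.scale_neg)
qed (simp add: Z.minus_eq)

lemma shufflable_closed:
 "shufflable E Z F ==> set us <= carrier E ==> e \<in> carrier E ==> F us e \<in> carrier Z"
 by (auto simp: shufflable_def lin_def)

lemma shufflable_Cons:
 assumes "shufflable E Z F" "u \<in> carrier E"
 shows "shufflable E Z (%us. F (u # us))"
proof -
 have "alternating k E Z (%us. F (u # us) e)" if "e \<in> carrier E" for k e
  using alternating_append_right[of 1 k E Z "%us. F us e" "[u]"] assms that
  by (simp add: shufflable_def ext_gens_def)
 then show ?thesis using assms by (simp add: shufflable_def)
qed

text \<open>Induction on the length. The only delicate case is a head \<open>e\<close> that recurs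
  in the tail: the term splitting off the head and the one splitting off the second occurrence
  survive, and the sign from moving \<open>e\<close> back to its position makes them cancel.\<close>

lemma alternating_shuffle:
 "shufflable E Z F ==> alternating k E Z (shuffle Z F)"
proof (induction k arbitrary: F)
 case 0
 show ?case by (rule alternatingI) (auto simp: ext_gens_0)
next
 case (Suc k)
 note F = Suc.prems
 have alt: "alternating l E Z (%us. F us e)" if "e \<in> carrier E" for l e
  using F that by (auto simp: shufflable_def)
 have linF: "lin E Z (F us)" if "set us <= carrier E" for us
  using F that by (auto simp: shufflable_def)
 have IH: "alternating k E Z (shuffle Z (%us. F (e # us)))" if "e \<in> carrier E" for e
  by (rule Suc.IH[OF shufflable_Cons[OF F that]])
 have cl: "shuffle Z (%us. F (e # us)) es \<in> carrier Z" if "e \<in> carrier E" "set es <= carrier E" for e es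
  by (rule shuffle_closed[OF shufflable_closed[OF shufflable_Cons[OF F that(1)]] that(2)])
 have cl': "F us e \<in> carrier Z" if "e \<in> carrier E" "set us <= carrier E" for e us
  using shufflable_closed[OF F] that by auto
 have F_add: "F (us @ (v \<oplus>\<^bsub>E\<^esub> v') # ws) e = F (us @ v # ws) e \<oplus>\<^bsub>Z\<^esub> F (us @ v' # ws) e"
  and F_scale: "F (us @ (a \<odot>\<^bsub>E\<^esub> v) # ws) e = a \<odot>\<^bsub>Z\<^esub> F (us @ v # ws) e"
  if "set us <= carrier E" "set ws <= carrier E" "v \<in> carrier E" "v' \<in> carrier E" "e \<in> carrier E"
  for us ws v v' e a
  using alternating_add[OF alt[of e "length us + Suc (length ws)"], of us v ws v']
  alternating_scale[OF alt[of e "length us + Suc (length ws)"], of us v ws a] that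
  by (auto simp: ext_gens_def)
 show ?case
 proof (rule alternatingI)
  show "shuffle Z F vs \<in> carrier Z" if "vs \<in> ext_gens (Suc k) E" for vs
  using that shuffle_closed[OF shufflable_closed[OF F]] by (auto simp: ext_gens_def)
 next
  fix us v v' ws assume g: "us @ v # ws \<in> ext_gens (Suc k) E" and v': "v' \<in> carrier E"
  show "shuffle Z F (us @ (v \<oplus>\<^bsub>E\<^esub> v') # ws) =
  shuffle Z F (us @ v # ws) \<oplus>\<^bsub>Z\<^esub> shuffle Z F (us @ v' # ws)"
  \<comment> \<open>A changed head entry is the vector split off in the first term and a list entry
    in all others. A changed later entry is a list entry in the first term and is covered by the
    induction hypothesis in the rest.\<close>
  proof (cases us)
  case Nil
  then have v: "v \<in> carrier E" "set ws <= carrier E" using g by (auto simp: ext_gens_def)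
  have "shuffle Z (%us. F ((v \<oplus>\<^bsub>E\<^esub> v') # us)) ws =
  shuffle Z (%us. F (v # us)) ws \<oplus>\<^bsub>Z\<^esub> shuffle Z (%us. F (v' # us)) ws"
  by (rule shuffle_add) (use F_add[of "[]"] v v' cl' in auto)
  then show ?thesis using Nil v v' cl cl' lin_add[OF linF] by (simp add: Z.add_minus_add)
  next
  case (Cons u us')
  then have *: "u \<in> carrier E" "v \<in> carrier E" "set ws <= carrier E" "set us' <= carrier E"
  "us' @ v # ws \<in> ext_gens k E"
  using g by (auto simp: ext_gens_def)
  show ?thesis
  using alternating_add[OF IH *(5) v'] F_add[of us' ws v v' u] * v' cl cl' Cons
  by (simp add: Z.add_minus_add)
  qed
 next
  fix us a v ws assume g: "us @ v # ws \<in> ext_gens (Suc k) E"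
  show "shuffle Z F (us @ (a \<odot>\<^bsub>E\<^esub> v) # ws) = a \<odot>\<^bsub>Z\<^esub> shuffle Z F (us @ v # ws)"
  proof (cases us)
  case Nil
  then have v: "v \<in> carrier E" "set ws <= carrier E" using g by (auto simp: ext_gens_def)
  have "shuffle Z (%us. F ((a \<odot>\<^bsub>E\<^esub> v) # us)) ws = a \<odot>\<^bsub>Z\<^esub> shuffle Z (%us. F (v # us)) ws"
  by (rule shuffle_scale) (use F_scale[of "[]"] v cl' in auto)
  then show ?thesis using Nil v cl cl' lin_scale[OF linF] by (simp add: Z.scale_minus)
  next
  case (Cons u us')
  then have *: "u \<in> carrier E" "v \<in> carrier E" "set ws <= carrier E" "set us' <= carrier E"
  "us' @ v # ws \<in> ext_gens k E"
  using g by (auto simp: ext_gens_def)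
  show ?thesis
  using alternating_scale[OF IH *(5)] F_scale[of us' ws v v u] * cl cl' Cons
  by (simp add: Z.scale_minus)
  qed
 next
  fix vs assume g: "vs \<in> ext_gens (Suc k) E" and nd: "\<not> distinct vs"
  obtain e es where vs: "vs = e # es" using g by (cases vs) (auto simp: ext_gens_def)
  then have e: "e \<in> carrier E" "set es <= carrier E" "es \<in> ext_gens k E" using g by (auto simp: ext_gens_def)
  show "shuffle Z F vs = \<zero>\<^bsub>Z\<^esub>"
  proof (cases "distinct es")
  case False
  then show ?thesis
  using alternating_repeat[OF alt[OF e(1)] e(3) False] alternating_repeat[OF IH[OF e(1)] e(3) False]
  by (simp add: vs Z.minus_eq)
  next
  case True
  then have "e \<in> set es" using nd vs by simp
  then obtain xs ys where es: "es = xs @ e # ys" by (meson split_list)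
  then have xs: "set xs <= carrier E" "set ys <= carrier E" using e by auto
  have "F us f = \<zero>\<^bsub>Z\<^esub>" if "set us <= carrier E" "f \<in> carrier E" "\<not> distinct us" for us f
  using alternating_repeat[OF alt[OF that(2)], of us] that by (auto simp: ext_gens_def)
  then have "shuffle Z (%us. F (e # us)) es = (-1) ^ length xs \<odot>\<^bsub>Z\<^esub> F (e # xs @ ys) e"
  unfolding es by (intro shuffle_repeat) (use e xs cl' in auto)
  \<comment> \<open>Moving \<open>e\<close> behind \<open>xs\<close> yields the sign of the previous
    step once more; the signs square to 1, so both surviving terms equal
    \<open>F es e\<close>.\<close>
  moreover have "F (e # xs @ ys) e = (-1) ^ length xs \<odot>\<^bsub>Z\<^esub> F es e"
  using alternating_move[OF alt[OF e(1)] Z E, of "[]" e xs ys "Suc (length xs + length ys)"] e xs es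
  by (auto simp: ext_gens_def)
  ultimately show ?thesis using cl'[OF e(1,2)]
  by (simp add: vs Z.scale_scale Z.minus_eq_zero_iff flip: power_mult_distrib)
  qed
 qed
qed

end

subsection \<open>Wedge and projection maps of an extension of vector spaces\<close>

text \<open>\<open>filt_wedge\<close> for single vector spaces, with the complementary degree
  \<open>l\<close> as a parameter, so that no truncated subtraction \<open>j - k\<close>
  remains.\<close>

definition fwedge :: "nat => nat => 'v cvs => 'e cvs => ('v => 'e) =>
  (('v list \<Rightarrow>\<^sub>0 complex) set \<times> ('e list \<Rightarrow>\<^sub>0 complex) set \<Rightarrow>\<^sub>0 complex) set => ('e list \<Rightarrow>\<^sub>0 complex) set" where
 "fwedge k l V E i = tensor_lift (ext_power k V) (ext_power l E) (ext_power (k + l) E)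
  (%(\<beta>, \<eta>). wedge k l E (ext_map k V E i \<beta>) \<eta>)"

text \<open>The identity tensored with the \<open>l\<close>-th exterior power of \<open>q\<close>.
  With the projection for \<open>q\<close> it is the formula inside \<open>filt_quot\<close>; it is
  also applied to sections, in the opposite direction.\<close>

definition rext_map :: "nat => nat => 'v cvs => 'e cvs => 'w cvs => ('e => 'w) =>
  (('v list \<Rightarrow>\<^sub>0 complex) set \<times> ('e list \<Rightarrow>\<^sub>0 complex) set \<Rightarrow>\<^sub>0 complex) set =>
  (('v list \<Rightarrow>\<^sub>0 complex) set \<times> ('w list \<Rightarrow>\<^sub>0 complex) set \<Rightarrow>\<^sub>0 complex) set" where
 "rext_map k l V E W q = tensor_lift (ext_power k V) (ext_power l E)
  (ext_tensor k V l W)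
  (%(\<beta>, \<eta>). ext_tensor_elem k V l W \<beta> (ext_map l E W q \<eta>))"

definition contr :: "nat => 'v cvs => 'w cvs => ('w => 'v) =>
  (('v list \<Rightarrow>\<^sub>0 complex) set \<times> ('w list \<Rightarrow>\<^sub>0 complex) set \<Rightarrow>\<^sub>0 complex) set =>
  (('v list \<Rightarrow>\<^sub>0 complex) set \<times> ('w list \<Rightarrow>\<^sub>0 complex) set \<Rightarrow>\<^sub>0 complex) set" where
 "contr b V W f =
  tensor_lift (ext_power b V) (ext_power 1 W) (ext_tensor (b + 1) V 0 W)
  (%(\<beta>, \<xi>). ext_tensor_elem (b + 1) V 0 W
  (wedge b 1 V \<beta> (ext_map 1 W V f \<xi>)) (ext_elem 0 W []))"

lemma lin_id: "lin V V (%x. x)"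
 by (rule linI) auto

lemma
 assumes "complex_vs V" "complex_vs E" "lin V E i"
 shows lin_fwedge: "lin (ext_tensor k V l E) (ext_power (k + l) E) (fwedge k l V E i)"
  and fwedge_tensor: "\<beta> \<in> carrier (ext_power k V) ==> \<eta> \<in> carrier (ext_power l E) ==>
  fwedge k l V E i (ext_tensor_elem k V l E \<beta> \<eta>) = wedge k l E (ext_map k V E i \<beta>) \<eta>"
  and fwedge_elem: "vs \<in> ext_gens k V ==> es \<in> ext_gens l E ==>
  fwedge k l V E i (ext_tensor_elem k V l E (ext_elem k V vs) (ext_elem l E es)) =
  ext_elem (k + l) E (map i vs @ es)"
proof -
 have b: "bilin (ext_power k V) (ext_power l E) (ext_power (k + l) E) (%\<beta> \<eta>. wedge k l E (ext_map k V E i \<beta>) \<eta>)"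
  by (rule bilin_comp[OF bilin_wedge[OF assms(2)] lin_ext_map[OF assms(3,1)] lin_id])
 note b' = cvs_ext cvs_ext cvs_ext b
 show "lin (ext_tensor k V l E) (ext_power (k + l) E) (fwedge k l V E i)"
  unfolding fwedge_def by (rule lin_tensor_lift[OF b'])
 show *: "fwedge k l V E i (ext_tensor_elem k V l E \<beta> \<eta>) = wedge k l E (ext_map k V E i \<beta>) \<eta>"
  if "\<beta> \<in> carrier (ext_power k V)" "\<eta> \<in> carrier (ext_power l E)" for \<beta> \<eta>
  unfolding fwedge_def by (rule tensor_lift_elem[OF b' that])
 show "fwedge k l V E i (ext_tensor_elem k V l E (ext_elem k V vs) (ext_elem l E es)) =
  ext_elem (k + l) E (map i vs @ es)" if "vs \<in> ext_gens k V" "es \<in> ext_gens l E"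
  using that ext_gens_map[OF assms(3)]
  by (simp add: * ext_elem_closed ext_map_elem[OF assms(3,1)] wedge_elem[OF assms(2)])
qed

lemma
 assumes "complex_vs E" "lin E W q"
 shows lin_rext_map: "lin (ext_tensor k V l E)
  (ext_tensor k V l W) (rext_map k l V E W q)"
  and rext_map_tensor: "\<beta> \<in> carrier (ext_power k V) ==> \<eta> \<in> carrier (ext_power l E) ==>
  rext_map k l V E W q (ext_tensor_elem k V l E \<beta> \<eta>) =
  ext_tensor_elem k V l W \<beta> (ext_map l E W q \<eta>)"
  and rext_map_elem: "vs \<in> ext_gens k V ==> es \<in> ext_gens l E ==>
  rext_map k l V E W q (ext_tensor_elem k V l E (ext_elem k V vs) (ext_elem l E es)) =
  ext_tensor_elem k V l W (ext_elem k V vs) (ext_elem l W (map q es))"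
proof -
 have b: "bilin (ext_power k V) (ext_power l E) (ext_tensor k V l W)
  (%\<beta> \<eta>. ext_tensor_elem k V l W \<beta> (ext_map l E W q \<eta>))"
  by (rule bilin_comp[OF bilin_tensor_elem lin_id lin_ext_map[OF assms(2,1)]])
 note b' = cvs_ext cvs_ext cvs_tensor b
 show "lin (ext_tensor k V l E)
  (ext_tensor k V l W) (rext_map k l V E W q)"
  unfolding rext_map_def by (rule lin_tensor_lift[OF b'])
 show *: "rext_map k l V E W q (ext_tensor_elem k V l E \<beta> \<eta>) =
  ext_tensor_elem k V l W \<beta> (ext_map l E W q \<eta>)"
  if "\<beta> \<in> carrier (ext_power k V)" "\<eta> \<in> carrier (ext_power l E)" for \<beta> \<eta>
  unfolding rext_map_def by (rule tensor_lift_elem[OF b' that])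
 show "rext_map k l V E W q (ext_tensor_elem k V l E (ext_elem k V vs) (ext_elem l E es)) =
  ext_tensor_elem k V l W (ext_elem k V vs) (ext_elem l W (map q es))"
  if "vs \<in> ext_gens k V" "es \<in> ext_gens l E"
  using that by (simp add: * ext_elem_closed ext_map_elem[OF assms(2,1)])
qed

lemma
 assumes "complex_vs V" "complex_vs W" "lin W V f"
 shows lin_contr: "lin (ext_tensor b V 1 W)
  (ext_tensor (b + 1) V 0 W) (contr b V W f)"
  and contr_tensor: "\<beta> \<in> carrier (ext_power b V) ==> \<xi> \<in> carrier (ext_power 1 W) ==>
  contr b V W f (ext_tensor_elem b V 1 W \<beta> \<xi>) =
  ext_tensor_elem (b + 1) V 0 W (wedge b 1 V \<beta> (ext_map 1 W V f \<xi>)) (ext_elem 0 W [])"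
  and contr_elem: "vs \<in> ext_gens b V ==> w \<in> carrier W ==>
  contr b V W f (ext_tensor_elem b V 1 W (ext_elem b V vs) (ext_elem 1 W [w])) =
  ext_tensor_elem (b + 1) V 0 W (ext_elem (b + 1) V (vs @ [f w])) (ext_elem 0 W [])"
proof -
 have e: "ext_elem 0 W [] \<in> carrier (ext_power 0 W)" by (rule ext_elem_closed) (simp add: ext_gens_0)
 have "bilin (ext_power b V) (ext_power 1 W) (ext_power (b + 1) V) (%\<beta> \<xi>. wedge b 1 V \<beta> (ext_map 1 W V f \<xi>))"
  by (rule bilin_comp[OF bilin_wedge[OF assms(1)] lin_id lin_ext_map[OF assms(3,2)]])
 then have b: "bilin (ext_power b V) (ext_power 1 W) (ext_tensor (b + 1) V 0 W)
  (%\<beta> \<xi>. ext_tensor_elem (b + 1) V 0 W (wedge b 1 V \<beta> (ext_map 1 W V f \<xi>)) (ext_elem 0 W []))"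
  by (rule bilin_lin_comp[OF _ bilin_left[OF bilin_tensor_elem e]])
 note b' = cvs_ext cvs_ext cvs_tensor b
 show "lin (ext_tensor b V 1 W)
  (ext_tensor (b + 1) V 0 W) (contr b V W f)"
  unfolding contr_def by (rule lin_tensor_lift[OF b'])
 show *: "contr b V W f (ext_tensor_elem b V 1 W \<beta> \<xi>) =
  ext_tensor_elem (b + 1) V 0 W (wedge b 1 V \<beta> (ext_map 1 W V f \<xi>)) (ext_elem 0 W [])"
  if "\<beta> \<in> carrier (ext_power b V)" "\<xi> \<in> carrier (ext_power 1 W)" for \<beta> \<xi>
  unfolding contr_def by (rule tensor_lift_elem[OF b' that])
 show "contr b V W f (ext_tensor_elem b V 1 W (ext_elem b V vs) (ext_elem 1 W [w])) =
  ext_tensor_elem (b + 1) V 0 W (ext_elem (b + 1) V (vs @ [f w])) (ext_elem 0 W [])"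
  if "vs \<in> ext_gens b V" "w \<in> carrier W"
 proof -
  have "[w] \<in> ext_gens 1 W" "[f w] \<in> ext_gens 1 V"
  using that(2) lin_closed[OF assms(3)] unfolding ext_gens_1 by auto
  then show ?thesis using that(1)
  by (simp add: * ext_elem_closed ext_map_elem[OF assms(3,2)] wedge_elem[OF assms(1)])
 qed
qed

context
 fixes V :: "'v cvs" and E :: "'e cvs" and W :: "'w cvs" and i q \<rho>
 assumes V: "complex_vs V" and E: "complex_vs E" and W: "complex_vs W"
  and i: "lin V E i" and q: "lin E W q" and \<rho>: "lin E V \<rho>"
  and qi: "!!v. v \<in> carrier V ==> q (i v) = \<zero>\<^bsub>W\<^esub>" and \<rho>i: "!!v. v \<in> carrier V ==> \<rho> (i v) = v"
begin

interpretation V: cvs V using V by (simp add: cvs_iff)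
interpretation E: cvs E using E by (simp add: cvs_iff)
interpretation W: cvs W using W by (simp add: cvs_iff)

lemma map_retract: "vs \<in> ext_gens k V ==> map \<rho> (map i vs) = vs"
 using \<rho>i by (auto simp: ext_gens_def intro!: map_idI)

text \<open>The value which \<open>filt_quot\<close> prescribes on a wedge must depend on the wedge
  alone. In place of a description of the kernel, a map \<Psi> on the whole exterior power is built:
  split off one vector, apply \<open>q\<close> to it and \<rho> to the remaining ones. \<Psi> may
  depend on \<rho>, but its values on wedges do not.\<close>

lemma fwedge_factor_1:
 obtains \<Psi> where "lin (ext_power (b + 1) E) (ext_tensor b V 1 W) \<Psi>"
  "!!t. t \<in> carrier (ext_tensor b V 1 E) ==>
  \<Psi> (fwedge b 1 V E i t) = rext_map b 1 V E W q t"
proof -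
 let ?Z = "ext_tensor b V 1 W"
 \<comment> \<open>The value zero at lengths other than \<open>b\<close> makes \<open>F\<close>
   alternating at every length, as \<open>shufflable\<close> demands.\<close>
 define F where "F = (%us e. if length us = b
  then ext_tensor_elem b V 1 W (ext_elem b V (map \<rho> us)) (ext_elem 1 W [q e]) else \<zero>\<^bsub>?Z\<^esub>)"
 interpret Z: cvs ?Z by (simp add: cvs_iff cvs_tensor)
 have q1: "ext_elem 1 W [q e] \<in> carrier (ext_power 1 W)" if "e \<in> carrier E" for e
  by (rule lin_closed[OF lin_ext_elem_1 lin_closed[OF q that]])
 have alt0: "alternating k E ?Z (%us. \<zero>\<^bsub>?Z\<^esub>)" for k
  by (rule alternatingI) simp_all
 have "alternating k E ?Z (%us. F us e)" if e: "e \<in> carrier E" for k e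
 proof (cases "k = b")
  case True
  have "alternating b V ?Z (%vs. ext_tensor_elem b V 1 W (ext_elem b V vs) (ext_elem 1 W [q e]))"
  by (rule alternating_lin_comp[OF alternating_ext_elem bilin_left[OF bilin_tensor_elem q1[OF e]]
  cvs_ext cvs_tensor V])
  from alternating_map[OF \<rho> this] have A: "alternating b E ?Z (%us. ext_tensor_elem b V 1 W
  (ext_elem b V (map \<rho> us)) (ext_elem 1 W [q e]))" .
  show ?thesis
  unfolding True
  by (intro alternating_cong[OF A]) (simp_all add: F_def ext_gens_def E)
 next
  case False
  then show ?thesis
  by (intro alternating_cong[OF alt0]) (simp_all add: F_def ext_gens_def E)
 qed
 moreover have "lin E ?Z (F us)" if "set us <= carrier E" for us
 proof (cases "length us = b")
  case True
  then have "ext_elem b V (map \<rho> us) \<in> carrier (ext_power b V)"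
  using that by (intro ext_elem_closed ext_gens_map[OF \<rho>]) (simp add: ext_gens_def)
  from lin_comp[OF lin_comp[OF q lin_ext_elem_1] bilin_right[OF bilin_tensor_elem this]]
  show ?thesis using True by (simp add: F_def)
 next
  case False
  then show ?thesis using lin_zero_map[OF cvs_tensor] by (simp add: F_def)
 qed
 ultimately have F: "shufflable E ?Z F" by (simp add: shufflable_def)
 note alt = alternating_shuffle[OF E cvs_tensor F, of "b + 1"]
 \<comment> \<open>\<open>shuffle\<close> counts signs from the left, so splitting off the last of
   \<open>b + 1\<close> entries costs \<open>(-1)^b\<close>; the prefactor undoes this.\<close>
 define \<Psi> where "\<Psi> = (%x. (-1) ^ b \<odot>\<^bsub>?Z\<^esub> ext_lift (b + 1) E ?Z (shuffle ?Z F) x)"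
 have \<Psi>: "lin (ext_power (b + 1) E) ?Z \<Psi>"
  unfolding \<Psi>_def by (rule lin_scale_map[OF lin_ext_lift[OF E cvs_tensor alt] cvs_tensor])
 moreover have "\<Psi> (fwedge b 1 V E i t) = rext_map b 1 V E W q t"
  if "t \<in> carrier (ext_tensor b V 1 E)" for t
 proof (rule lin_eq_tensor_ext[OF lin_comp[OF lin_fwedge[OF V E i] \<Psi>] lin_rext_map[OF E q] cvs_tensor _ that])
  fix vs es assume vs: "vs \<in> ext_gens b V" and "es \<in> ext_gens 1 E"
  then obtain e where es: "es = [e]" and e: "e \<in> carrier E" unfolding ext_gens_1 by auto
  have g: "map i vs @ [e] \<in> ext_gens (b + 1) E" "map i vs \<in> ext_gens b E"
  using ext_gens_map[OF i vs] e by (auto simp: ext_gens_def)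
  \<comment> \<open>Entries coming from the base are annihilated by \<open>q\<close>, so only the
    final vector \<open>e\<close> can be split off with a nonzero contribution.\<close>
  have q0: "F us e' = \<zero>\<^bsub>?Z\<^esub>" if us: "set us <= carrier E" and "e' \<in> set (map i vs)" for us e'
  proof (cases "length us = b")
  case True
  then have "ext_elem b V (map \<rho> us) \<in> carrier (ext_power b V)"
  using us by (intro ext_elem_closed ext_gens_map[OF \<rho>]) (simp add: ext_gens_def)
  note l = lin_comp[OF lin_ext_elem_1 bilin_right[OF bilin_tensor_elem this]]
  have "q e' = \<zero>\<^bsub>W\<^esub>" using that vs qi by (auto simp: ext_gens_def)
  then show ?thesis using True lin_zero[OF l W cvs_tensor] by (simp add: F_def)
  qed (simp add: F_def)
  have sh: "shuffle ?Z F (map i vs @ [e]) = (-1) ^ length (map i vs) \<odot>\<^bsub>?Z\<^esub> F (map i vs) e"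
  by (rule shuffle_snoc[OF E cvs_tensor shufflable_closed[OF E cvs_tensor F] q0])
  (use e g(2) in \<open>auto simp: ext_gens_def\<close>)
  have cl: "F (map i vs) e \<in> carrier ?Z"
  using shufflable_closed[OF E cvs_tensor F] g e by (auto simp: ext_gens_def)
  have "\<Psi> (ext_elem (b + 1) E (map i vs @ [e])) = F (map i vs) e"
  using vs cl unfolding \<Psi>_def ext_lift_elem[OF E cvs_tensor alt g(1)] sh
  by (simp add: Z.scale_scale ext_gens_def flip: power_mult_distrib)
  also have "... = ext_tensor_elem b V 1 W (ext_elem b V vs) (ext_elem 1 W [q e])"
  using map_retract[OF vs] vs by (simp add: F_def ext_gens_def)
  finally show "\<Psi> (fwedge b 1 V E i (ext_tensor_elem b V 1 E (ext_elem b V vs) (ext_elem 1 E es)))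
  = rext_map b 1 V E W q (ext_tensor_elem b V 1 E (ext_elem b V vs) (ext_elem 1 E es))"
  using vs e fwedge_elem[OF V E i vs, of "[e]" 1] rext_map_elem[OF E q vs, of "[e]" 1]
  unfolding es ext_gens_1 by (simp)
 qed
 ultimately show thesis by (rule that)
qed

text \<open>With complementary degree zero the wedge is the exterior power of \<open>i\<close> up to
  the unit, and the exterior power of \<rho> is a left inverse of it.\<close>

lemma fwedge_factor_0:
 obtains \<Psi> where "lin (ext_power k E) (ext_tensor k V 0 W) \<Psi>"
  "!!t. t \<in> carrier (ext_tensor k V 0 E) ==>
  \<Psi> (fwedge k 0 V E i t) = rext_map k 0 V E W q t"
proof -
 have e: "ext_elem 0 W [] \<in> carrier (ext_power 0 W)" by (rule ext_elem_closed) (simp add: ext_gens_0)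
 define \<Psi> where "\<Psi> = (%x. ext_tensor_elem k V 0 W (ext_map k E V \<rho> x) (ext_elem 0 W []))"
 have \<Psi>: "lin (ext_power k E) (ext_tensor k V 0 W) \<Psi>"
  unfolding \<Psi>_def by (rule lin_comp[OF lin_ext_map[OF \<rho> E] bilin_left[OF bilin_tensor_elem e]])
 moreover have "\<Psi> (fwedge k 0 V E i t) = rext_map k 0 V E W q t"
  if "t \<in> carrier (ext_tensor k V 0 E)" for t
 proof (rule lin_eq_tensor_ext[OF lin_comp[OF lin_fwedge[OF V E i, of k 0, unfolded add_0_right] \<Psi>] lin_rext_map[OF E q] cvs_tensor _ that])
  fix vs es assume vs: "vs \<in> ext_gens k V" and "es \<in> ext_gens 0 E"
  then show "\<Psi> (fwedge k 0 V E i (ext_tensor_elem k V 0 E (ext_elem k V vs) (ext_elem 0 E es)))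
  = rext_map k 0 V E W q (ext_tensor_elem k V 0 E (ext_elem k V vs) (ext_elem 0 E es))"
  using map_retract[OF vs] ext_gens_map[OF i vs]
  by (simp add: ext_gens_0 fwedge_elem[OF V E i vs] rext_map_elem[OF E q vs] \<Psi>_def ext_map_elem[OF \<rho> E] del: map_map)
 qed
 ultimately show thesis by (rule that)
qed

end

lemma rext_map_cancel:
 assumes "complex_vs E" "complex_vs W" "lin E W q" "lin W E s"
  and "!!w. w \<in> carrier W ==> q (s w) = w"
  and "x \<in> carrier (ext_tensor k V l W)"
 shows "rext_map k l V E W q (rext_map k l V W E s x) = x"
proof (rule lin_eq_tensor_ext[OF lin_comp[OF lin_rext_map[OF assms(2,4)] lin_rext_map[OF assms(1,3)]]
  lin_id cvs_tensor _ assms(6)])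
 fix vs ws assume vs: "vs \<in> ext_gens k V" and ws: "ws \<in> ext_gens l W"
 have "map q (map s ws) = ws" using ws assms(5) by (auto simp: ext_gens_def intro!: map_idI)
 then show "rext_map k l V E W q (rext_map k l V W E s
  (ext_tensor_elem k V l W (ext_elem k V vs) (ext_elem l W ws))) =
  ext_tensor_elem k V l W (ext_elem k V vs) (ext_elem l W ws)"
  using ext_gens_map[OF assms(4) ws]
  by (simp add: rext_map_elem[OF assms(2,4) vs ws] rext_map_elem[OF assms(1,3) vs] del: map_map)
qed

text \<open>On a base list \<open>vs\<close> and one vector \<open>e\<close>, write \<open>e\<close>
  as \<open>i (\<rho> e) + s (q e)\<close> in the last slot. The first summand is again a base
  vector and joins the base factor, which is the contraction by \<rho>; the second is the lift of
  the image in the quotient.\<close>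

lemma fwedge_split:
 assumes V: "complex_vs V" and E: "complex_vs E" and W: "complex_vs W"
  and i: "lin V E i" and q: "lin E W q" and \<rho>: "lin E V \<rho>" and s: "lin W E s"
  and split: "!!e. e \<in> carrier E ==> i (\<rho> e) \<oplus>\<^bsub>E\<^esub> s (q e) = e"
  and t: "t \<in> carrier (ext_tensor b V 1 E)"
 shows "fwedge b 1 V E i t = fwedge (b + 1) 0 V E i (contr b V E \<rho> t) \<oplus>\<^bsub>ext_power (b + 1) E\<^esub>
  fwedge b 1 V E i (rext_map b 1 V W E s (rext_map b 1 V E W q t))"
proof (rule lin_eq_tensor_ext[OF lin_fwedge[OF V E i] lin_sum_map[OF
  lin_comp[OF lin_contr[OF V E \<rho>] lin_fwedge[OF V E i, of "b + 1" 0, unfolded add_0_right]]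
  lin_comp[OF lin_rext_map[OF E q] lin_comp[OF lin_rext_map[OF W s] lin_fwedge[OF V E i]]]
  cvs_ext] cvs_ext _ t])
 fix vs es assume vs: "vs \<in> ext_gens b V" and "es \<in> ext_gens 1 E"
 then obtain e where es: "es = [e]" and e: "e \<in> carrier E" unfolding ext_gens_1 by auto
 note [simp] = lin_closed[OF q] lin_closed[OF s] lin_closed[OF \<rho>] lin_closed[OF i]
 have g1: "[e] \<in> ext_gens 1 E" "[q e] \<in> ext_gens 1 W" "[s (q e)] \<in> ext_gens 1 E"
  using e unfolding ext_gens_1 by auto
 have g2: "vs @ [\<rho> e] \<in> ext_gens (b + 1) V" "map i vs @ [i (\<rho> e)] \<in> ext_gens (b + 1) E"
  using e vs by (auto simp: ext_gens_def)
 have "ext_elem (b + 1) E (map i vs @ [e]) = ext_elem (b + 1) E (map i vs @ [i (\<rho> e)]) \<oplus>\<^bsub>ext_power (b + 1) E\<^esub>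
  ext_elem (b + 1) E (map i vs @ [s (q e)])"
  using alternating_add[OF alternating_ext_elem g2(2), of "s (q e)"] split[OF e] e by simp
 then show "fwedge b 1 V E i (ext_tensor_elem b V 1 E (ext_elem b V vs) (ext_elem 1 E es)) =
  fwedge (b + 1) 0 V E i (contr b V E \<rho> (ext_tensor_elem b V 1 E (ext_elem b V vs) (ext_elem 1 E es)))
  \<oplus>\<^bsub>ext_power (b + 1) E\<^esub>
  fwedge b 1 V E i (rext_map b 1 V W E s (rext_map b 1 V E W q
  (ext_tensor_elem b V 1 E (ext_elem b V vs) (ext_elem 1 E es))))"
  using fwedge_elem[OF V E i g2(1), of "[]" 0]
  by (simp add: es rext_map_elem[OF E q vs g1(1)] rext_map_elem[OF W s vs g1(2)]
  fwedge_elem[OF V E i vs g1(1)] fwedge_elem[OF V E i vs g1(3)] contr_elem[OF V E \<rho> vs e]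
  ext_gens_0)
qed

text \<open>After contraction the right factor has degree zero, where the map induced by
  \<open>q\<close> sends the unit to the unit. What remains is the contraction of the lifted vector,
  that is by the composite of \<rho> and \<open>s\<close>.\<close>

lemma rext_map_contr:
 assumes V: "complex_vs V" and E: "complex_vs E" and W: "complex_vs W"
  and q: "lin E W q" and \<rho>: "lin E V \<rho>" and s: "lin W E s"
  and x: "x \<in> carrier (ext_tensor b V 1 W)"
 shows "rext_map (b + 1) 0 V E W q (contr b V E \<rho> (rext_map b 1 V W E s x)) =
  contr b V W (%w. \<rho> (s w)) x"
proof (rule lin_eq_tensor_ext[OF lin_comp[OF lin_comp[OF lin_rext_map[OF W s] lin_contr[OF V E \<rho>]]
  lin_rext_map[OF E q]] lin_contr[OF V W lin_comp[OF s \<rho>]] cvs_tensor _ x])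
 fix vs ws assume vs: "vs \<in> ext_gens b V" and "ws \<in> ext_gens 1 W"
 then obtain w where ws: "ws = [w]" and w: "w \<in> carrier W" unfolding ext_gens_1 by auto
 note [simp] = lin_closed[OF q] lin_closed[OF s] lin_closed[OF \<rho>]
 have g: "[w] \<in> ext_gens 1 W" "vs @ [\<rho> (s w)] \<in> ext_gens (b + 1) V" "[] \<in> ext_gens 0 E"
  using w vs by (auto simp: ext_gens_def)
 show "rext_map (b + 1) 0 V E W q (contr b V E \<rho> (rext_map b 1 V W E s
  (ext_tensor_elem b V 1 W (ext_elem b V vs) (ext_elem 1 W ws)))) =
  contr b V W (%w. \<rho> (s w)) (ext_tensor_elem b V 1 W (ext_elem b V vs) (ext_elem 1 W ws))"
  using w rext_map_elem[OF E q g(2,3)]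
  by (simp add: ws rext_map_elem[OF W s vs g(1)] contr_elem[OF V E \<rho> vs]
  contr_elem[OF V W lin_comp[OF s \<rho>] vs])
qed

lemma restrI: "restrict f U \<in> S ==> (!!y. y \<in> U ==> g y = f y) ==> restrict g U \<in> S"
 by (metis restrict_ext)

section \<open>Holomorphic functions\<close>

lemma holomorphic_in_subset: "holomorphic_in n W f ==> W' <= W ==> holomorphic_in n W' f"
 unfolding holomorphic_in_def by (meson subsetD)

lemma holomorphic_in_cong:
 "(!!w. w \<in> W ==> f w = g w) ==> holomorphic_in n W f \<longleftrightarrow> holomorphic_in n W g"
 unfolding holomorphic_in_def by (simp cong: ball_cong)

lemma holomorphic_in_const: "holomorphic_in n W (%_. c)"
 unfolding holomorphic_in_def
 by (intro ballI exI[of _ "%_. 0"] allI impI exI[of _ 1]) (auto intro!: mult_nonneg_nonneg sum_nonneg)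

lemma holomorphic_in_add:
 assumes "holomorphic_in n W f" "holomorphic_in n W g"
 shows "holomorphic_in n W (%w. f w + g w)"
 unfolding holomorphic_in_def
proof
 fix z assume z: "z \<in> W"
 let ?S = "%w. \<Sum>i<n. cmod (w i - z i)"
 obtain a where a: "\<forall>e>0. \<exists>d>0. \<forall>w\<in>W. (\<forall>i<n. cmod (w i - z i) < d) -->
  cmod (f w - f z - (\<Sum>i<n. a i * (w i - z i))) \<le> e * ?S w"
  using assms(1) z unfolding holomorphic_in_def by blast
 obtain b where b: "\<forall>e>0. \<exists>d>0. \<forall>w\<in>W. (\<forall>i<n. cmod (w i - z i) < d) -->
  cmod (g w - g z - (\<Sum>i<n. b i * (w i - z i))) \<le> e * ?S w"
  using assms(2) z unfolding holomorphic_in_def by blast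
 show "\<exists>a. \<forall>e>0. \<exists>d>0. \<forall>w\<in>W. (\<forall>i<n. cmod (w i - z i) < d) -->
  cmod (f w + g w - (f z + g z) - (\<Sum>i<n. a i * (w i - z i))) \<le> e * ?S w"
 proof (intro exI[of _ "%i. a i + b i"] allI impI)
  fix e :: real assume "e > 0"
  then have e: "e / 2 > 0" by simp
  obtain d1 where d1: "d1 > 0" "\<forall>w\<in>W. (\<forall>i<n. cmod (w i - z i) < d1) -->
  cmod (f w - f z - (\<Sum>i<n. a i * (w i - z i))) \<le> e / 2 * ?S w" using a e by blast
  obtain d2 where d2: "d2 > 0" "\<forall>w\<in>W. (\<forall>i<n. cmod (w i - z i) < d2) -->
  cmod (g w - g z - (\<Sum>i<n. b i * (w i - z i))) \<le> e / 2 * ?S w" using b e by blast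
  show "\<exists>d>0. \<forall>w\<in>W. (\<forall>i<n. cmod (w i - z i) < d) -->
  cmod (f w + g w - (f z + g z) - (\<Sum>i<n. (a i + b i) * (w i - z i))) \<le> e * ?S w"
  proof (intro exI[of _ "min d1 d2"] conjI ballI impI)
  fix w assume w: "w \<in> W" "\<forall>i<n. cmod (w i - z i) < min d1 d2"
  have "f w + g w - (f z + g z) - (\<Sum>i<n. (a i + b i) * (w i - z i)) =
  (f w - f z - (\<Sum>i<n. a i * (w i - z i))) + (g w - g z - (\<Sum>i<n. b i * (w i - z i)))"
  by (simp add: algebra_simps sum.distrib sum_subtractf)
  also have "cmod ... \<le> e / 2 * ?S w + e / 2 * ?S w"
  using w d1(2) d2(2) by (intro norm_triangle_mono) auto
  finally show "cmod (f w + g w - (f z + g z) - (\<Sum>i<n. (a i + b i) * (w i - z i))) \<le> e * ?S w"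
  by (simp add: field_simps)
  qed (use d1 d2 in auto)
 qed
qed

lemma product_remainder_bound:
 fixes a b x y r S :: real
 assumes "r \<ge> 0" "S \<ge> 0"
 shows "x * (r * S) + y * (r * S) + (a * S) * (b * S) \<le> ((x + y + 1) * r) * S + (a * b * S) * S"
proof -
 have "((x + y + 1) * r) * S + (a * b * S) * S = x * (r * S) + y * (r * S) + (a * S) * (b * S) + r * S"
  by (simp add: algebra_simps)
 then show ?thesis using assms by simp
qed

text \<open>With \<open>?P\<close> and \<open>?Q\<close> the remainders of \<open>f\<close> and
  \<open>g\<close>, the remainder of the product is
  \<open>f z * ?Q + g z * ?P + (f w - f z) * (g w - g z)\<close>. The first two terms are small by
  hypothesis, the third is quadratic in the distance.\<close>

lemma holomorphic_in_mult:
 assumes "holomorphic_in n W f" "holomorphic_in n W g"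
 shows "holomorphic_in n W (%w. f w * g w)"
 unfolding holomorphic_in_def
proof
 fix z assume z: "z \<in> W"
 let ?S = "%w. \<Sum>i<n. cmod (w i - z i)"
 obtain a where a: "\<forall>e>0. \<exists>d>0. \<forall>w\<in>W. (\<forall>i<n. cmod (w i - z i) < d) -->
  cmod (f w - f z - (\<Sum>i<n. a i * (w i - z i))) \<le> e * ?S w"
  using assms(1) z unfolding holomorphic_in_def by blast
 obtain b where b: "\<forall>e>0. \<exists>d>0. \<forall>w\<in>W. (\<forall>i<n. cmod (w i - z i) < d) -->
  cmod (g w - g z - (\<Sum>i<n. b i * (w i - z i))) \<le> e * ?S w"
  using assms(2) z unfolding holomorphic_in_def by blast
 define A where "A = (\<Sum>i<n. cmod (a i))"
 define B where "B = (\<Sum>i<n. cmod (b i))"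
 have AB: "A \<ge> 0" "B \<ge> 0" by (simp_all add: A_def B_def sum_nonneg)
 have lin_le: "cmod (\<Sum>i<n. c i * (w i - z i)) \<le> (\<Sum>i<n. cmod (c i)) * ?S w" for c w
 proof -
  have "cmod (\<Sum>i<n. c i * (w i - z i)) \<le> (\<Sum>i<n. cmod (c i) * cmod (w i - z i))"
  by (rule order_trans[OF norm_sum]) (simp add: norm_mult)
  also have "... \<le> (\<Sum>i<n. cmod (c i) * ?S w)"
  by (intro sum_mono mult_left_mono member_le_sum) auto
  finally show ?thesis by (simp add: sum_distrib_right)
 qed
 show "\<exists>a. \<forall>e>0. \<exists>d>0. \<forall>w\<in>W. (\<forall>i<n. cmod (w i - z i) < d) -->
  cmod (f w * g w - f z * g z - (\<Sum>i<n. a i * (w i - z i))) \<le> e * ?S w"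
 proof (intro exI[of _ "%i. f z * b i + g z * a i"] allI impI)
  fix e :: real assume e: "e > 0"
  define K where "K = cmod (f z) + cmod (g z) + 1"
  have K: "K > 0" unfolding K_def by (simp add: add_nonneg_pos)
  \<comment> \<open>The bound 1 gives increments of at most \<open>A + 1\<close> and
    \<open>B + 1\<close> times the distance; the other bound makes the two linear error terms at
    most \<open>e / 2\<close> together.\<close>
  define e1 where "e1 = min 1 (e / (2 * K))"
  have e1: "e1 > 0" "e1 \<le> 1" "K * e1 \<le> e / 2" using e K by (auto simp: e1_def min_def field_simps)
  obtain d1 where d1: "d1 > 0" "\<forall>w\<in>W. (\<forall>i<n. cmod (w i - z i) < d1) -->
  cmod (f w - f z - (\<Sum>i<n. a i * (w i - z i))) \<le> e1 * ?S w" using a e1(1) by blast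
  obtain d2 where d2: "d2 > 0" "\<forall>w\<in>W. (\<forall>i<n. cmod (w i - z i) < d2) -->
  cmod (g w - g z - (\<Sum>i<n. b i * (w i - z i))) \<le> e1 * ?S w" using b e1(1) by blast
  \<comment> \<open>Chosen so that the quadratic term is at most \<open>L * d\<close> times the
    distance. The factor \<open>n + 1\<close> instead of \<open>n\<close> keeps \<open>L\<close>
    positive in dimension zero.\<close>
  define L where "L = (A + 1) * (B + 1) * (real n + 1)"
  have L: "L > 0" using AB unfolding L_def by (intro mult_pos_pos) auto
  define d where "d = Min {d1, d2, e / (2 * L)}"
  have d: "d > 0" "d \<le> d1" "d \<le> d2" "d \<le> e / (2 * L)" using d1 d2 e L by (auto simp: d_def)
  show "\<exists>d>0. \<forall>w\<in>W. (\<forall>i<n. cmod (w i - z i) < d) -->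
  cmod (f w * g w - f z * g z - (\<Sum>i<n. (f z * b i + g z * a i) * (w i - z i))) \<le> e * ?S w"
  proof (intro exI[of _ d] conjI ballI impI d(1))
  fix w assume w: "w \<in> W" "\<forall>i<n. cmod (w i - z i) < d"
  let ?P = "f w - f z - (\<Sum>i<n. a i * (w i - z i))" and ?Q = "g w - g z - (\<Sum>i<n. b i * (w i - z i))"
  have P: "cmod ?P \<le> e1 * ?S w" and Q: "cmod ?Q \<le> e1 * ?S w" using w d d1(2) d2(2) by force+
  have S: "?S w \<ge> 0" by (simp add: sum_nonneg)
  have "?S w \<le> real n * d" using w sum_bounded_above[of "{..<n}" "%i. cmod (w i - z i)" d] by force
  also have "... \<le> (real n + 1) * d" using d by (simp add: field_simps)
  finally have Sd: "?S w \<le> (real n + 1) * d" .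
  have "cmod (f w - f z) = cmod (?P + (\<Sum>i<n. a i * (w i - z i)))" by simp
  also have "... \<le> e1 * ?S w + A * ?S w" unfolding A_def by (intro norm_triangle_mono P lin_le)
  also have "... \<le> 1 * ?S w + A * ?S w" by (intro add_right_mono mult_right_mono e1 S)
  finally have F: "cmod (f w - f z) \<le> (A + 1) * ?S w" by (simp add: algebra_simps)
  have "cmod (g w - g z) = cmod (?Q + (\<Sum>i<n. b i * (w i - z i)))" by simp
  also have "... \<le> e1 * ?S w + B * ?S w" unfolding B_def by (intro norm_triangle_mono Q lin_le)
  also have "... \<le> 1 * ?S w + B * ?S w" by (intro add_right_mono mult_right_mono e1 S)
  finally have G: "cmod (g w - g z) \<le> (B + 1) * ?S w" by (simp add: algebra_simps)
  have eq: "f w * g w - f z * g z - (\<Sum>i<n. (f z * b i + g z * a i) * (w i - z i)) =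
  f z * ?Q + g z * ?P + (f w - f z) * (g w - g z)"
  by (simp add: algebra_simps sum.distrib sum_distrib_left sum_subtractf)
  have "cmod (f w * g w - f z * g z - (\<Sum>i<n. (f z * b i + g z * a i) * (w i - z i))) \<le>
  cmod (f z) * (e1 * ?S w) + cmod (g z) * (e1 * ?S w) + ((A + 1) * ?S w) * ((B + 1) * ?S w)"
  unfolding eq
  using S AB by (intro norm_triangle_mono) (auto simp: norm_mult intro!: mult_left_mono P Q mult_mono F G)
  also have "... \<le> (K * e1) * ?S w + ((A + 1) * (B + 1) * ?S w) * ?S w"
  unfolding K_def by (rule product_remainder_bound[OF less_imp_le[OF e1(1)] S])
  also have "... \<le> e / 2 * ?S w + e / 2 * ?S w"
  proof (rule add_mono[OF mult_right_mono[OF e1(3) S] mult_right_mono[OF _ S]])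
  have "(A + 1) * (B + 1) * ?S w \<le> (A + 1) * (B + 1) * ((real n + 1) * d)"
  using AB by (intro mult_left_mono Sd) auto
  also have "... = L * d" by (simp add: L_def)
  also have "... \<le> L * (e / (2 * L))" using L d by (intro mult_left_mono) auto
  finally show "(A + 1) * (B + 1) * ?S w \<le> e / 2" using L by simp
  qed
  finally show "cmod (f w * g w - f z * g z - (\<Sum>i<n. (f z * b i + g z * a i) * (w i - z i))) \<le> e * ?S w"
  by (simp add: field_simps)
  qed
 qed
qed

text \<open>Injectivity makes \<open>inv_into\<close> a true inverse of a chart, which is what the
  closure properties of \<open>hol\<close> rest on; it passes to product charts directly.\<close>

locale chart_space =
 fixes M :: "'y manifold"
 assumes atlas_inj: "(V, \<phi>) \<in> atlas M ==> inj_on \<phi> V"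
begin

lemma inv_chart: "(V, \<phi>) \<in> atlas M ==> w \<in> \<phi> ` (U \<inter> V) ==> inv_into V \<phi> w \<in> U"
 using atlas_inj[of V \<phi>] by auto

text \<open>An extensional \<open>f\<close> is \<open>undefined\<close> off \<open>U\<close>. The
  witness \<open>g\<close> is a total expression with the same values on \<open>U\<close>, to which
  the closure lemmas for \<open>holomorphic_in\<close> apply.\<close>

lemma holI:
 assumes "f \<in> extensional U"
  and "!!V \<phi>. (V, \<phi>) \<in> atlas M ==> \<exists>g. holomorphic_in (mdim M) (\<phi> ` (U \<inter> V)) (%w. g (inv_into V \<phi> w)) \<and>
  (\<forall>y\<in>U. f y = g y)"
 shows "f \<in> hol M U"
 unfolding hol_def
proof (intro CollectI conjI assms(1) ballI, clarify)
 fix V \<phi> assume at: "(V, \<phi>) \<in> atlas M"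
 then obtain g where g: "holomorphic_in (mdim M) (\<phi> ` (U \<inter> V)) (%w. g (inv_into V \<phi> w))" "\<forall>y\<in>U. f y = g y"
  using assms(2) by blast
 show "holomorphic_in (mdim M) (\<phi> ` (U \<inter> V)) (%w. f (inv_into V \<phi> w))"
  by (rule holomorphic_in_cong[THEN iffD1, OF _ g(1)]) (simp add: g(2) inv_chart[OF at])
qed

lemma holD: "f \<in> hol M U ==> (V, \<phi>) \<in> atlas M ==> holomorphic_in (mdim M) (\<phi> ` (U \<inter> V)) (%w. f (inv_into V \<phi> w))"
 unfolding hol_def by blast

lemma hol_restrict:
 assumes f: "f \<in> hol M U" and VU: "V <= U"
 shows "restrict f V \<in> hol M V"
proof (rule holI)
 fix V' \<phi> assume at: "(V', \<phi>) \<in> atlas M"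
 have "holomorphic_in (mdim M) (\<phi> ` (V \<inter> V')) (%w. f (inv_into V' \<phi> w))"
  by (rule holomorphic_in_subset[OF holD[OF f at]]) (use VU in blast)
 then show "\<exists>g. holomorphic_in (mdim M) (\<phi> ` (V \<inter> V')) (%w. g (inv_into V' \<phi> w)) \<and> (\<forall>y\<in>V. restrict f V y = g y)"
  by (intro exI[of _ f]) simp
qed simp

lemma hol_const: "(\<lambda>y\<in>U. c) \<in> hol M U"
 by (rule holI) (auto intro!: exI[of _ "%_. c"] holomorphic_in_const)

lemma hol_add:
 assumes f: "f \<in> hol M U" and g: "g \<in> hol M U"
 shows "(\<lambda>y\<in>U. f y + g y) \<in> hol M U"
 by (rule holI) (use holomorphic_in_add[OF holD[OF f] holD[OF g]] in \<open>auto intro!: exI[of _ "%y. f y + g y"]\<close>)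

lemma hol_mult:
 assumes f: "f \<in> hol M U" and g: "g \<in> hol M U"
 shows "(\<lambda>y\<in>U. f y * g y) \<in> hol M U"
 by (rule holI) (use holomorphic_in_mult[OF holD[OF f] holD[OF g]] in \<open>auto intro!: exI[of _ "%y. f y * g y"]\<close>)

end

section \<open>Sheaves of modules\<close>

text \<open>The sections of a bundle are only used through the following closure properties, which,
 unlike local freeness, are inherited by homomorphisms and by images.\<close>

definition presheaf :: "'y manifold => ('y, 'e) vbundle => bool" where
 "presheaf M E \<longleftrightarrow> (\<forall>y\<in>points M. complex_vs (fib E y)) \<and>
  (\<forall>U. mopen M U --> sect E U <= (\<Pi>\<^sub>E y\<in>U. carrier (fib E y))) \<and>
  (\<forall>U V s. mopen M U \<and> mopen M V \<and> V <= U \<and> s \<in> sect E U --> restrict s V \<in> sect E V) \<and>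
  (\<forall>U. mopen M U --> (\<lambda>y\<in>U. \<zero>\<^bsub>fib E y\<^esub>) \<in> sect E U) \<and>
  (\<forall>U s t. mopen M U \<and> s \<in> sect E U \<and> t \<in> sect E U --> (\<lambda>y\<in>U. s y \<oplus>\<^bsub>fib E y\<^esub> t y) \<in> sect E U) \<and>
  (\<forall>U f s. mopen M U \<and> f \<in> hol M U \<and> s \<in> sect E U --> (\<lambda>y\<in>U. f y \<odot>\<^bsub>fib E y\<^esub> s y) \<in> sect E U)"

definition sheaf :: "'y manifold => ('y, 'e) vbundle => bool" where
 "sheaf M E \<longleftrightarrow> presheaf M E \<and>
  (\<forall>U s. mopen M U \<and> s \<in> extensional U \<and>
  (\<forall>y\<in>U. \<exists>V. mopen M V \<and> y \<in> V \<and> V <= U \<and> restrict s V \<in> sect E V) --> s \<in> sect E U)"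

text \<open>The domain \<open>U\<close> is a parameter because sections and retractions exist only
  over small open sets. The family \<phi> is not cut off outside \<open>U\<close>, so a morphism
  restricts to smaller sets without being changed.\<close>

definition morph_on :: "'y manifold => 'y set => ('y, 'e) vbundle => ('y, 'f) vbundle =>
  ('y => 'e => 'f) => bool" where
 "morph_on M U E G \<phi> \<longleftrightarrow> (\<forall>y\<in>U. lin (fib E y) (fib G y) (\<phi> y)) \<and>
  (\<forall>V s. mopen M V \<and> V <= U \<and> s \<in> sect E V --> (\<lambda>y\<in>V. \<phi> y (s y)) \<in> sect G V)"

lemma morph_on_lin: "morph_on M U E G \<phi> ==> y \<in> U ==> lin (fib E y) (fib G y) (\<phi> y)"
 by (simp add: morph_on_def)

lemma morph_on_sect:
 "morph_on M U E G \<phi> ==> mopen M V ==> V <= U ==> s \<in> sect E V ==> (\<lambda>y\<in>V. \<phi> y (s y)) \<in> sect G V"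
 by (simp add: morph_on_def)

lemma morph_on_subset: "morph_on M U E G \<phi> ==> V <= U ==> morph_on M V E G \<phi>"
 by (auto simp: morph_on_def)

lemma morph_on_comp:
 assumes f: "morph_on M U E F f" and g: "morph_on M U F G g"
 shows "morph_on M U E G (%y x. g y (f y x))"
 unfolding morph_on_def
proof safe
 fix V s assume V: "mopen M V" "V <= U" "s \<in> sect E V"
 have "(\<lambda>y\<in>V. g y ((\<lambda>y\<in>V. f y (s y)) y)) \<in> sect G V"
  by (rule morph_on_sect[OF g V(1,2) morph_on_sect[OF f V]])
 then show "(\<lambda>y\<in>V. g y (f y (s y))) \<in> sect G V" by (rule restrI) simp
qed (auto intro: lin_comp morph_on_lin[OF f] morph_on_lin[OF g])

lemma presheaf_cvs: "presheaf M E ==> y \<in> points M ==> complex_vs (fib E y)"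
 by (simp add: presheaf_def)

lemma sect_PiE: "presheaf M E ==> mopen M U ==> s \<in> sect E U ==> s \<in> (\<Pi>\<^sub>E y\<in>U. carrier (fib E y))"
 by (rule subsetD[of "sect E U"]) (simp_all add: presheaf_def)

lemma sect_closed: "presheaf M E ==> mopen M U ==> s \<in> sect E U ==> y \<in> U ==> s y \<in> carrier (fib E y)"
 by (rule PiE_mem[OF sect_PiE])

lemma sect_extensional: "presheaf M E ==> mopen M U ==> s \<in> sect E U ==> s \<in> extensional U"
 using sect_PiE[of M E U s] by (simp add: PiE_def)

lemma sect_restrict:
 "presheaf M E ==> mopen M U ==> mopen M V ==> V <= U ==> s \<in> sect E U ==> restrict s V \<in> sect E V"
 by (simp add: presheaf_def)

lemma sect_zero: "presheaf M E ==> mopen M U ==> (\<lambda>y\<in>U. \<zero>\<^bsub>fib E y\<^esub>) \<in> sect E U"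
 by (simp add: presheaf_def)

lemma sect_add: "presheaf M E ==> mopen M U ==> s \<in> sect E U ==> t \<in> sect E U ==>
  (\<lambda>y\<in>U. s y \<oplus>\<^bsub>fib E y\<^esub> t y) \<in> sect E U"
 by (simp add: presheaf_def)

lemma sect_hol: "presheaf M E ==> mopen M U ==> f \<in> hol M U ==> s \<in> sect E U ==>
  (\<lambda>y\<in>U. f y \<odot>\<^bsub>fib E y\<^esub> s y) \<in> sect E U"
 by (simp add: presheaf_def)

lemma mopenD: "mopen M U ==> y \<in> U ==> y \<in> points M"
 using openin_subset by blast

lemma sheaf_presheaf: "sheaf M E ==> presheaf M E"
 by (simp add: sheaf_def)

lemma sect_local:
 assumes E: "sheaf M E" and U: "mopen M U" and s: "s \<in> extensional U"
  and loc: "!!y. y \<in> U ==> \<exists>V t. mopen M V \<and> y \<in> V \<and> V <= U \<and> t \<in> sect E V \<and> (\<forall>z\<in>V. s z = t z)"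
 shows "s \<in> sect E U"
proof -
 have "\<exists>V. mopen M V \<and> y \<in> V \<and> V <= U \<and> restrict s V \<in> sect E V" if y: "y \<in> U" for y
 proof -
  obtain V t where V: "mopen M V" "y \<in> V" "V <= U" "t \<in> sect E V" "\<forall>z\<in>V. s z = t z"
  using loc[OF y] by blast
  then have "restrict s V = t"
  using sect_extensional[OF sheaf_presheaf[OF E] V(1,4)] by (auto intro: extensionalityI)
  then show ?thesis using V by blast
 qed
 then show ?thesis using E U s by (simp add: sheaf_def)
qed

context chart_space
begin

lemma sect_scale:
 assumes "presheaf M E" "mopen M U" "s \<in> sect E U"
 shows "(\<lambda>y\<in>U. c \<odot>\<^bsub>fib E y\<^esub> s y) \<in> sect E U"
proof -
 have "(\<lambda>y\<in>U. (\<lambda>y\<in>U. c) y \<odot>\<^bsub>fib E y\<^esub> s y) \<in> sect E U" by (rule sect_hol[OF assms(1,2) hol_const assms(3)])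
 then show ?thesis by (rule restrI) simp
qed

lemma sect_minus:
 assumes E: "presheaf M E" and U: "mopen M U" and s: "s \<in> sect E U" "t \<in> sect E U"
 shows "(\<lambda>y\<in>U. s y \<ominus>\<^bsub>fib E y\<^esub> t y) \<in> sect E U"
proof -
 have "s y \<ominus>\<^bsub>fib E y\<^esub> t y = s y \<oplus>\<^bsub>fib E y\<^esub> (\<lambda>y\<in>U. (-1) \<odot>\<^bsub>fib E y\<^esub> t y) y" if "y \<in> U" for y
 proof -
  interpret cvs "fib E y"
  using presheaf_cvs[OF E mopenD[OF U that]] by (simp add: cvs_iff)
  show ?thesis using that sect_closed[OF E U s(1) that] sect_closed[OF E U s(2) that]
  by (simp add: minus_eq_scale)
 qed
 then show ?thesis by (intro restrI[OF sect_add[OF E U s(1) sect_scale[OF E U s(2), of "-1"]]]) simp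
qed

lemma sect_finsum:
 assumes E: "presheaf M E" and U: "mopen M U" and s: "!!i. i < (n::nat) ==> s i \<in> sect E U"
 shows "(\<lambda>y\<in>U. \<Oplus>\<^bsub>fib E y\<^esub> i\<in>{..<n}. s i y) \<in> sect E U"
 using s
proof (induction n)
 case 0
 have "(\<Oplus>\<^bsub>fib E y\<^esub> i\<in>{..<0::nat}. s i y) = \<zero>\<^bsub>fib E y\<^esub>" if "y \<in> U" for y
 proof -
  interpret cvs "fib E y"
  using presheaf_cvs[OF E mopenD[OF U that]] by (simp add: cvs_iff)
  show ?thesis by simp
 qed
 then show ?case by (intro restrI[OF sect_zero[OF E U]]) simp
next
 case (Suc n)
 have eq: "(\<Oplus>\<^bsub>fib E y\<^esub> i\<in>{..<Suc n}. s i y) = (\<lambda>y\<in>U. \<Oplus>\<^bsub>fib E y\<^esub> i\<in>{..<n}. s i y) y \<oplus>\<^bsub>fib E y\<^esub> s n y" if "y \<in> U" for y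
 proof -
  interpret cvs "fib E y"
  using presheaf_cvs[OF E mopenD[OF U that]] by (simp add: cvs_iff)
  show ?thesis using that sect_closed[OF E U Suc.prems that] by (simp add: finsum_lessThan_Suc)
 qed
 have "(\<lambda>y\<in>U. (\<lambda>y\<in>U. \<Oplus>\<^bsub>fib E y\<^esub> i\<in>{..<n}. s i y) y \<oplus>\<^bsub>fib E y\<^esub> s n y) \<in> sect E U"
  by (rule sect_add[OF E U]) (use Suc in auto)
 then show ?case by (rule restrI) (rule eq)
qed

lemma sect_combination:
 assumes E: "presheaf M E" and U: "mopen M U"
  and s: "!!i. i < (n::nat) ==> f i \<in> hol M U" "!!i. i < n ==> s i \<in> sect E U"
 shows "(\<lambda>y\<in>U. \<Oplus>\<^bsub>fib E y\<^esub> i\<in>{..<n}. f i y \<odot>\<^bsub>fib E y\<^esub> s i y) \<in> sect E U"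
proof -
 have "(\<lambda>y\<in>U. \<Oplus>\<^bsub>fib E y\<^esub> i\<in>{..<n}. (\<lambda>y\<in>U. f i y \<odot>\<^bsub>fib E y\<^esub> s i y) y) \<in> sect E U"
  by (rule sect_finsum[OF E U]) (rule sect_hol[OF E U s])
 then show ?thesis by (rule restrI) simp
qed

end

subsection \<open>Generated sheaves\<close>

lemma (in cvs) finsum_lessThan_add:
 "(!!i. i < n + (m::nat) ==> f i \<in> carrier V) ==> (\<Oplus>i\<in>{..<n + m}. f i) = (\<Oplus>i\<in>{..<n}. f i) \<oplus> (\<Oplus>i\<in>{..<m}. f (n + i))"
proof (induction m)
 case (Suc m)
 have "(\<Oplus>i\<in>{..<n}. f i) \<in> carrier V" "(\<Oplus>i\<in>{..<m}. f (n + i)) \<in> carrier V"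
  using Suc.prems by (auto intro!: finsum_closed)
 then show ?case using Suc by (simp add: finsum_lessThan_Suc a_assoc)
qed (auto intro!: finsum_closed)

text \<open>The conditions on generators under which \<open>generated_sect\<close> is a sheaf of
  modules; stability under restriction allows two local expressions to be added over the
  intersection of their domains.\<close>

definition generator_family :: "'y manifold => ('y => 'e cvs) => ('y set => ('y => 'e) set) => bool" where
 "generator_family M F G \<longleftrightarrow> (\<forall>y\<in>points M. complex_vs (F y)) \<and>
  (\<forall>U. mopen M U --> G U <= (\<Pi>\<^sub>E y\<in>U. carrier (F y))) \<and>
  (\<forall>U V g. mopen M U \<and> mopen M V \<and> V <= U \<and> g \<in> G U --> restrict g V \<in> G V)"

lemma generated_sectE:
 assumes "s \<in> generated_sect M F G U" "y \<in> U"
 obtains V n f g where "mopen M V" "y \<in> V" "V <= U" "\<forall>i<(n::nat). f i \<in> hol M V" "\<forall>i<n. g i \<in> G V"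
  "\<forall>z\<in>V. s z = (\<Oplus>\<^bsub>F z\<^esub> i\<in>{..<n}. f i z \<odot>\<^bsub>F z\<^esub> g i z)"
proof -
 obtain V where V: "mopen M V" "y \<in> V" "V <= U" and ex: "\<exists>(n::nat) f g. (\<forall>i<n. f i \<in> hol M V \<and> g i \<in> G V) \<and>
  (\<forall>z\<in>V. s z = (\<Oplus>\<^bsub>F z\<^esub> i\<in>{..<n}. f i z \<odot>\<^bsub>F z\<^esub> g i z))"
  using assms unfolding generated_sect_def by blast
 from ex obtain n :: nat and f g where "\<forall>i<n. f i \<in> hol M V \<and> g i \<in> G V"
  "\<forall>z\<in>V. s z = (\<Oplus>\<^bsub>F z\<^esub> i\<in>{..<n}. f i z \<odot>\<^bsub>F z\<^esub> g i z)" by blast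
 then show thesis using that[OF V] by blast
qed

context chart_space
begin

context
 fixes F :: "'y => 'e cvs" and G
 assumes FG: "generator_family M F G"
begin

lemma generator_cvs: "mopen M U ==> y \<in> U ==> cvs (F y)"
 using FG mopenD[of M U y] by (auto simp: generator_family_def cvs_iff)

lemma generator_closed: "mopen M U ==> g \<in> G U ==> y \<in> U ==> g y \<in> carrier (F y)"
 using FG PiE_mem[of g U "%y. carrier (F y)"] by (auto simp: generator_family_def subset_iff)

lemma generator_restrict: "mopen M U ==> mopen M V ==> V <= U ==> g \<in> G U ==> restrict g V \<in> G V"
 using FG by (simp add: generator_family_def)

lemma generated_sectI:
 assumes U: "mopen M U" and s: "s \<in> extensional U"
  and loc: "!!y. y \<in> U ==> \<exists>V (n::nat) f g. mopen M V \<and> y \<in> V \<and> V <= U \<and> (\<forall>i<n. f i \<in> hol M V \<and> g i \<in> G V) \<and>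
  (\<forall>z\<in>V. s z = (\<Oplus>\<^bsub>F z\<^esub> i\<in>{..<n}. f i z \<odot>\<^bsub>F z\<^esub> g i z))"
 shows "s \<in> generated_sect M F G U"
proof -
 have "s y \<in> carrier (F y)" if y: "y \<in> U" for y
 proof -
  obtain V n f g where V: "mopen M V" "y \<in> V" "\<forall>i<(n::nat). f i \<in> hol M V \<and> g i \<in> G V"
  "s y = (\<Oplus>\<^bsub>F y\<^esub> i\<in>{..<n}. f i y \<odot>\<^bsub>F y\<^esub> g i y)" using loc[OF y] by blast
  interpret cvs "F y" by (rule generator_cvs[OF V(1,2)])
  show ?thesis unfolding V(4) using V generator_closed[OF V(1) _ V(2)] by (intro finsum_closed) auto
 qed
 then show ?thesis using s loc unfolding generated_sect_def by (auto simp: PiE_iff)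
qed

lemma generated_sect_local:
 assumes U: "mopen M U" and s: "s \<in> extensional U"
  and loc: "!!y. y \<in> U ==> \<exists>V t. mopen M V \<and> y \<in> V \<and> V <= U \<and> t \<in> generated_sect M F G V \<and> (\<forall>z\<in>V. s z = t z)"
 shows "s \<in> generated_sect M F G U"
proof (rule generated_sectI[OF U s])
 fix y assume "y \<in> U"
 then obtain V t where V: "mopen M V" "y \<in> V" "V <= U" "t \<in> generated_sect M F G V" "\<forall>z\<in>V. s z = t z"
  using loc by blast
 obtain W n f g where "mopen M W" "y \<in> W" "W <= V" "\<forall>i<(n::nat). f i \<in> hol M W" "\<forall>i<n. g i \<in> G W"
  "\<forall>z\<in>W. t z = (\<Oplus>\<^bsub>F z\<^esub> i\<in>{..<n}. f i z \<odot>\<^bsub>F z\<^esub> g i z)"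
  by (rule generated_sectE[OF V(4,2)])
 then show "\<exists>V (n::nat) f g. mopen M V \<and> y \<in> V \<and> V <= U \<and> (\<forall>i<n. f i \<in> hol M V \<and> g i \<in> G V) \<and>
  (\<forall>z\<in>V. s z = (\<Oplus>\<^bsub>F z\<^esub> i\<in>{..<n}. f i z \<odot>\<^bsub>F z\<^esub> g i z))"
  using V by (intro exI[of _ W] exI[of _ n] exI[of _ f] exI[of _ g]) auto
qed

lemma generated_sect_base:
 assumes U: "mopen M U" and g: "g \<in> G U"
 shows "g \<in> generated_sect M F G U"
proof (rule generated_sectI[OF U])
 have "g \<in> (\<Pi>\<^sub>E y\<in>U. carrier (F y))" using FG U g by (auto simp: generator_family_def)
 then show "g \<in> extensional U" by (simp add: PiE_def)
 fix y assume y: "y \<in> U"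
 have "g z = (\<Oplus>\<^bsub>F z\<^esub> i\<in>{..<1::nat}. (\<lambda>y\<in>U. 1) z \<odot>\<^bsub>F z\<^esub> g z)" if z: "z \<in> U" for z
 proof -
  interpret cvs "F z" by (rule generator_cvs[OF U z])
  show ?thesis using z generator_closed[OF U g z] by (simp add: One_nat_def finsum_lessThan_Suc)
 qed
 then show "\<exists>V (n::nat) f g'. mopen M V \<and> y \<in> V \<and> V <= U \<and> (\<forall>i<n. f i \<in> hol M V \<and> g' i \<in> G V) \<and>
  (\<forall>z\<in>V. g z = (\<Oplus>\<^bsub>F z\<^esub> i\<in>{..<n}. f i z \<odot>\<^bsub>F z\<^esub> g' i z))"
  using U g y hol_const[of 1 U]
  by (intro exI[of _ U] exI[of _ 1] exI[of _ "%_. \<lambda>y\<in>U. 1"] exI[of _ "%_. g"]) auto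
qed

lemma sheaf_generated: "sheaf M \<lparr>fib = F, sect = generated_sect M F G\<rparr>"
 unfolding sheaf_def presheaf_def vbundle.simps
proof (intro conjI allI impI ballI; (elim conjE)?)
 show "complex_vs (F y)" if "y \<in> points M" for y
  using FG that by (auto simp: generator_family_def)
 show "generated_sect M F G U <= (\<Pi>\<^sub>E y\<in>U. carrier (F y))" for U
  by (auto simp: generated_sect_def)
 show restr: "restrict s V \<in> generated_sect M F G V"
  if A: "mopen M U" "mopen M V" "V <= U" "s \<in> generated_sect M F G U" for U V s
 proof (rule generated_sectI[OF A(2)])
  fix y assume y: "y \<in> V"
  obtain W n f g where W: "mopen M W" "y \<in> W" "W <= U" "\<forall>i<(n::nat). f i \<in> hol M W" "\<forall>i<n. g i \<in> G W"
  "\<forall>z\<in>W. s z = (\<Oplus>\<^bsub>F z\<^esub> i\<in>{..<n}. f i z \<odot>\<^bsub>F z\<^esub> g i z)"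
  by (rule generated_sectE[OF A(4) subsetD[OF A(3) y]])
  have VW: "mopen M (V \<inter> W)" using A W by (simp add: openin_Int)
  have "(\<Oplus>\<^bsub>F z\<^esub> i\<in>{..<n}. f i z \<odot>\<^bsub>F z\<^esub> g i z) =
  (\<Oplus>\<^bsub>F z\<^esub> i\<in>{..<n}. restrict (f i) (V \<inter> W) z \<odot>\<^bsub>F z\<^esub> restrict (g i) (V \<inter> W) z)" if "z \<in> V \<inter> W" for z
  using that by simp
  then show "\<exists>V' (n::nat) f g. mopen M V' \<and> y \<in> V' \<and> V' <= V \<and> (\<forall>i<n. f i \<in> hol M V' \<and> g i \<in> G V') \<and>
  (\<forall>z\<in>V'. restrict s V z = (\<Oplus>\<^bsub>F z\<^esub> i\<in>{..<n}. f i z \<odot>\<^bsub>F z\<^esub> g i z))"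
  using VW y W by (intro exI[of _ "V \<inter> W"] exI[of _ n] exI[of _ "%i. restrict (f i) (V \<inter> W)"]
  exI[of _ "%i. restrict (g i) (V \<inter> W)"]) (auto intro: hol_restrict generator_restrict[OF W(1) VW])
 qed auto
 show "(\<lambda>y\<in>U. \<zero>\<^bsub>F y\<^esub>) \<in> generated_sect M F G U" if U: "mopen M U" for U
 proof (rule generated_sectI[OF U])
  fix y assume y: "y \<in> U"
  \<comment> \<open>The zero section is the combination with no terms, so coefficients and
    generators are arbitrary here.\<close>
  have "\<zero>\<^bsub>F z\<^esub> = (\<Oplus>\<^bsub>F z\<^esub> i\<in>{..<0::nat}. undefined i z \<odot>\<^bsub>F z\<^esub> undefined i z)" if "z \<in> U" for z
  proof -
  interpret cvs "F z" by (rule generator_cvs[OF U that])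
  show ?thesis by simp
  qed
  then show "\<exists>V (n::nat) f g. mopen M V \<and> y \<in> V \<and> V <= U \<and> (\<forall>i<n. f i \<in> hol M V \<and> g i \<in> G V) \<and>
  (\<forall>z\<in>V. (\<lambda>y\<in>U. \<zero>\<^bsub>F y\<^esub>) z = (\<Oplus>\<^bsub>F z\<^esub> i\<in>{..<n}. f i z \<odot>\<^bsub>F z\<^esub> g i z))"
  using U y by (intro exI[of _ U] exI[of _ 0]) auto
 qed auto
 show "(\<lambda>y\<in>U. s y \<oplus>\<^bsub>F y\<^esub> t y) \<in> generated_sect M F G U"
  if U: "mopen M U" and s: "s \<in> generated_sect M F G U" and t: "t \<in> generated_sect M F G U" for U s t
 proof (rule generated_sectI[OF U])
  fix y assume y: "y \<in> U"
  obtain V n f g where V: "mopen M V" "y \<in> V" "V <= U" "\<forall>i<(n::nat). f i \<in> hol M V" "\<forall>i<n. g i \<in> G V"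
  "\<forall>z\<in>V. s z = (\<Oplus>\<^bsub>F z\<^esub> i\<in>{..<n}. f i z \<odot>\<^bsub>F z\<^esub> g i z)"
  by (rule generated_sectE[OF s y])
  obtain V' n' f' g' where V': "mopen M V'" "y \<in> V'" "V' <= U" "\<forall>i<(n'::nat). f' i \<in> hol M V'" "\<forall>i<n'. g' i \<in> G V'"
  "\<forall>z\<in>V'. t z = (\<Oplus>\<^bsub>F z\<^esub> i\<in>{..<n'}. f' i z \<odot>\<^bsub>F z\<^esub> g' i z)"
  by (rule generated_sectE[OF t y])
  let ?W = "V \<inter> V'"
  \<comment> \<open>The two expressions are concatenated: indices from \<open>n\<close> on refer to
    the second one.\<close>
  define f'' where "f'' = (%i. restrict (if i < n then f i else f' (i - n)) ?W)"
  define g'' where "g'' = (%i. restrict (if i < n then g i else g' (i - n)) ?W)"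
  have W: "mopen M ?W" using V V' by (simp add: openin_Int)
  have "s z \<oplus>\<^bsub>F z\<^esub> t z = (\<Oplus>\<^bsub>F z\<^esub> i\<in>{..<n + n'}. f'' i z \<odot>\<^bsub>F z\<^esub> g'' i z)" if z: "z \<in> ?W" for z
  proof -
  interpret cvs "F z" by (rule generator_cvs[OF W z])
  have c: "g i z \<in> carrier (F z)" if "i < n" for i using generator_closed[OF V(1) V(5)[rule_format, OF that]] z by auto
  have c': "g' i z \<in> carrier (F z)" if "i < n'" for i using generator_closed[OF V'(1) V'(5)[rule_format, OF that]] z by auto
  have "(\<Oplus>\<^bsub>F z\<^esub> i\<in>{..<n + n'}. f'' i z \<odot>\<^bsub>F z\<^esub> g'' i z) =
  (\<Oplus>\<^bsub>F z\<^esub> i\<in>{..<n}. f'' i z \<odot>\<^bsub>F z\<^esub> g'' i z) \<oplus>\<^bsub>F z\<^esub> (\<Oplus>\<^bsub>F z\<^esub> i\<in>{..<n'}. f'' (n + i) z \<odot>\<^bsub>F z\<^esub> g'' (n + i) z)"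
  using c c' z by (intro finsum_lessThan_add) (auto simp: g''_def)
  also have "(\<Oplus>\<^bsub>F z\<^esub> i\<in>{..<n}. f'' i z \<odot>\<^bsub>F z\<^esub> g'' i z) = (\<Oplus>\<^bsub>F z\<^esub> i\<in>{..<n}. f i z \<odot>\<^bsub>F z\<^esub> g i z)"
  using c z by (intro finsum_cong') (simp_all add: f''_def g''_def)
  also have "(\<Oplus>\<^bsub>F z\<^esub> i\<in>{..<n'}. f'' (n + i) z \<odot>\<^bsub>F z\<^esub> g'' (n + i) z) = (\<Oplus>\<^bsub>F z\<^esub> i\<in>{..<n'}. f' i z \<odot>\<^bsub>F z\<^esub> g' i z)"
  using c' z by (intro finsum_cong') (simp_all add: f''_def g''_def)
  finally show ?thesis using V(6) V'(6) z by simp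
  qed
  moreover have "f'' i \<in> hol M ?W" "g'' i \<in> G ?W" if "i < n + n'" for i
  proof -
  have "i < n \<or> i - n < n'" using that by auto
  then show "f'' i \<in> hol M ?W" "g'' i \<in> G ?W"
  using V(4,5) V'(4,5) that unfolding f''_def g''_def
  by (cases "i < n"; auto intro: hol_restrict generator_restrict[OF V(1) W] generator_restrict[OF V'(1) W])+
  qed
  ultimately show "\<exists>V (n::nat) f g. mopen M V \<and> y \<in> V \<and> V <= U \<and> (\<forall>i<n. f i \<in> hol M V \<and> g i \<in> G V) \<and>
  (\<forall>z\<in>V. (\<lambda>y\<in>U. s y \<oplus>\<^bsub>F y\<^esub> t y) z = (\<Oplus>\<^bsub>F z\<^esub> i\<in>{..<n}. f i z \<odot>\<^bsub>F z\<^esub> g i z))"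
  using V V' W by (intro exI[of _ ?W] exI[of _ "n + n'"] exI[of _ f''] exI[of _ g'']) auto
 qed auto
 show "(\<lambda>y\<in>U. h y \<odot>\<^bsub>F y\<^esub> s y) \<in> generated_sect M F G U"
  if U: "mopen M U" and h: "h \<in> hol M U" and s: "s \<in> generated_sect M F G U" for U h s
 proof (rule generated_sectI[OF U])
  fix y assume y: "y \<in> U"
  obtain V n f g where V: "mopen M V" "y \<in> V" "V <= U" "\<forall>i<(n::nat). f i \<in> hol M V" "\<forall>i<n. g i \<in> G V"
  "\<forall>z\<in>V. s z = (\<Oplus>\<^bsub>F z\<^esub> i\<in>{..<n}. f i z \<odot>\<^bsub>F z\<^esub> g i z)"
  by (rule generated_sectE[OF s y])
  have "h z \<odot>\<^bsub>F z\<^esub> s z = (\<Oplus>\<^bsub>F z\<^esub> i\<in>{..<n}. (\<lambda>z\<in>V. restrict h V z * f i z) z \<odot>\<^bsub>F z\<^esub> g i z)" if z: "z \<in> V" for z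
  proof -
  interpret cvs "F z" by (rule generator_cvs[OF V(1) z])
  have c: "g i z \<in> carrier (F z)" if "i < n" for i using generator_closed[OF V(1) V(5)[rule_format, OF that]] z by auto
  have "h z \<odot>\<^bsub>F z\<^esub> s z = (\<Oplus>\<^bsub>F z\<^esub> i\<in>{..<n}. h z \<odot>\<^bsub>F z\<^esub> (f i z \<odot>\<^bsub>F z\<^esub> g i z))"
  unfolding V(6)[rule_format, OF z] by (rule finsum_scale) (use c in auto)
  also have "... = (\<Oplus>\<^bsub>F z\<^esub> i\<in>{..<n}. (\<lambda>z\<in>V. restrict h V z * f i z) z \<odot>\<^bsub>F z\<^esub> g i z)"
  using c z by (intro finsum_cong') (simp_all add: scale_scale)
  finally show ?thesis .
  qed
  moreover have "(\<lambda>z\<in>V. restrict h V z * f i z) \<in> hol M V" if "i < n" for i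
  by (rule hol_mult[OF hol_restrict[OF h V(3)] V(4)[rule_format, OF that]])
  ultimately show "\<exists>V (n::nat) f g. mopen M V \<and> y \<in> V \<and> V <= U \<and> (\<forall>i<n. f i \<in> hol M V \<and> g i \<in> G V) \<and>
  (\<forall>z\<in>V. (\<lambda>y\<in>U. h y \<odot>\<^bsub>F y\<^esub> s y) z = (\<Oplus>\<^bsub>F z\<^esub> i\<in>{..<n}. f i z \<odot>\<^bsub>F z\<^esub> g i z))"
  using V(1-3,5) subsetD[OF V(3)]
  by (intro exI[of _ V] exI[of _ n] exI[of _ "%i. \<lambda>z\<in>V. restrict h V z * f i z"] exI[of _ g] conjI)
  (simp_all del: restrict_apply, simp)
 qed auto
 show "s \<in> generated_sect M F G U" if A: "mopen M U" "s \<in> extensional U"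
  "\<forall>y\<in>U. \<exists>V. mopen M V \<and> y \<in> V \<and> V <= U \<and> restrict s V \<in> generated_sect M F G V" for U s
 proof (rule generated_sect_local[OF A(1,2)])
  fix y assume "y \<in> U"
  then obtain V where "mopen M V" "y \<in> V" "V <= U" "restrict s V \<in> generated_sect M F G V" using A(3) by blast
  then show "\<exists>V t. mopen M V \<and> y \<in> V \<and> V <= U \<and> t \<in> generated_sect M F G V \<and> (\<forall>z\<in>V. s z = t z)"
  by (intro exI[of _ V] exI[of _ "restrict s V"]) auto
 qed
qed

text \<open>A fibrewise linear family commutes with the local combinations, and the target glues.
  Hence morphisms out of tensor products, exterior powers and pullbacks are checked on their
  generating sections.\<close>

lemma generated_sect_map:
 assumes E: "sheaf M E" and U: "mopen M U"
  and \<phi>: "!!y. y \<in> U ==> lin (F y) (fib E y) (\<phi> y)"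
  and gen: "!!V g. mopen M V ==> V <= U ==> g \<in> G V ==> (\<lambda>y\<in>V. \<phi> y (g y)) \<in> sect E V"
  and s: "s \<in> generated_sect M F G U"
 shows "(\<lambda>y\<in>U. \<phi> y (s y)) \<in> sect E U"
proof (rule sect_local[OF E U])
 note E' = sheaf_presheaf[OF E]
 fix y assume y: "y \<in> U"
 obtain V n f g where V: "mopen M V" "y \<in> V" "V <= U" "\<forall>i<(n::nat). f i \<in> hol M V" "\<forall>i<n. g i \<in> G V"
  "\<forall>z\<in>V. s z = (\<Oplus>\<^bsub>F z\<^esub> i\<in>{..<n}. f i z \<odot>\<^bsub>F z\<^esub> g i z)"
  by (rule generated_sectE[OF s y])
 let ?t = "\<lambda>z\<in>V. \<Oplus>\<^bsub>fib E z\<^esub> i\<in>{..<n}. f i z \<odot>\<^bsub>fib E z\<^esub> (\<lambda>y\<in>V. \<phi> y (g i y)) z"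
 have "?t \<in> sect E V"
  by (rule sect_combination[OF E' V(1) V(4)[rule_format] gen[OF V(1,3) V(5)[rule_format]]])
 moreover have "\<phi> z (s z) = ?t z" if z: "z \<in> V" for z
 proof -
  interpret F: cvs "F z" by (rule generator_cvs[OF V(1) z])
  have Ez: "complex_vs (fib E z)" by (rule presheaf_cvs[OF E' mopenD[OF V(1) z]])
  interpret Ez: cvs "fib E z" using Ez by (simp add: cvs_iff)
  have zU: "z \<in> U" using V z by auto
  have c: "g i z \<in> carrier (F z)" if "i < n" for i using generator_closed[OF V(1) V(5)[rule_format, OF that]] z by auto
  have "\<phi> z (s z) = (\<Oplus>\<^bsub>fib E z\<^esub> i\<in>{..<n}. \<phi> z (f i z \<odot>\<^bsub>F z\<^esub> g i z))"
  unfolding V(6)[rule_format, OF z] by (rule lin_finsum[OF \<phi>[OF zU] F.complex_vs Ez]) (use c in auto)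
  also have "... = ?t z"
  using z c lin_closed[OF \<phi>[OF zU]] by (auto simp: lin_scale[OF \<phi>[OF zU]] intro!: Ez.finsum_cong')
  finally show ?thesis .
 qed
 ultimately show "\<exists>V t. mopen M V \<and> y \<in> V \<and> V <= U \<and> t \<in> sect E V \<and> (\<forall>z\<in>V. (\<lambda>y\<in>U. \<phi> y (s y)) z = t z)"
  using V by (intro exI[of _ V] exI[of _ ?t]) auto
qed auto

end

end

subsection \<open>Images and homomorphisms\<close>

text \<open>Sections of the image are those with local lifts: lifts can be combined over
  intersections, and having a lift near each point is itself a local condition, which gives
  glueing.\<close>

lemma (in chart_space) sheaf_image:
 assumes E: "sheaf M E" and G: "!!y. y \<in> points M ==> complex_vs (fib G y)"
  and \<phi>: "!!y. y \<in> points M ==> lin (fib E y) (fib G y) (\<phi> y)"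
 shows "sheaf M (image_bundle M E G \<phi>)"
proof -
 note E' = sheaf_presheaf[OF E]
 let ?I = "%U. {s \<in> extensional U. \<forall>y\<in>U. \<exists>V t. mopen M V \<and> y \<in> V \<and> V <= U \<and>
  t \<in> sect E V \<and> (\<forall>z\<in>V. s z = \<phi> z (t z))}"
 have I: "s \<in> ?I U" if "s \<in> extensional U" "!!y. y \<in> U ==> \<exists>V t. mopen M V \<and> y \<in> V \<and> V <= U \<and>
  t \<in> sect E V \<and> (\<forall>z\<in>V. s z = \<phi> z (t z))" for s U
  using that by blast
 show ?thesis
  unfolding sheaf_def presheaf_def image_bundle_def vbundle.simps
 proof (intro conjI allI impI ballI; (elim conjE)?)
  show "complex_vs ((fib G y)\<lparr>carrier := \<phi> y ` carrier (fib E y)\<rparr>)" if y: "y \<in> points M" for y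
  proof -
  have Ey: "complex_vs (fib E y)" by (rule presheaf_cvs[OF E' y])
  interpret Ey: cvs "fib E y" using Ey by (simp add: cvs_iff)
  show ?thesis
  proof (rule complex_vs_restrict_carrier[OF G[OF y]])
  show "\<phi> y ` carrier (fib E y) <= carrier (fib G y)" using lin_closed[OF \<phi>[OF y]] by blast
  show "\<zero>\<^bsub>fib G y\<^esub> \<in> \<phi> y ` carrier (fib E y)"
  using lin_zero[OF \<phi>[OF y] Ey G[OF y]] by (metis Ey.zero_closed image_eqI)
  qed (auto simp flip: lin_add[OF \<phi>[OF y]] lin_scale[OF \<phi>[OF y]])
  qed
  show "?I U <= (\<Pi>\<^sub>E y\<in>U. carrier ((fib G y)\<lparr>carrier := \<phi> y ` carrier (fib E y)\<rparr>))" for U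
  proof
  fix s assume s: "s \<in> ?I U"
  have "s y \<in> \<phi> y ` carrier (fib E y)" if "y \<in> U" for y
  using s that sect_closed[OF E'] by blast
  then show "s \<in> (\<Pi>\<^sub>E y\<in>U. carrier ((fib G y)\<lparr>carrier := \<phi> y ` carrier (fib E y)\<rparr>))"
  using s by (simp add: PiE_iff)
  qed
  show "restrict s V \<in> ?I V" if A: "mopen M U" "mopen M V" "V <= U" "s \<in> ?I U" for U V s
  proof (rule I)
  fix y assume y: "y \<in> V"
  obtain W t where W: "mopen M W" "y \<in> W" "W <= U" "t \<in> sect E W" "\<forall>z\<in>W. s z = \<phi> z (t z)"
  using A y by blast
  have VW: "mopen M (V \<inter> W)" using A W by (simp add: openin_Int)
  then show "\<exists>V' t. mopen M V' \<and> y \<in> V' \<and> V' <= V \<and> t \<in> sect E V' \<and> (\<forall>z\<in>V'. restrict s V z = \<phi> z (t z))"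
  using y W sect_restrict[OF E' W(1) VW _ W(4)]
  by (intro exI[of _ "V \<inter> W"] exI[of _ "restrict t (V \<inter> W)"]) simp
  qed simp
  show "(\<lambda>y\<in>U. \<zero>\<^bsub>(fib G y)\<lparr>carrier := \<phi> y ` carrier (fib E y)\<rparr>\<^esub>) \<in> ?I U" if U: "mopen M U" for U
  proof (rule I)
  fix y assume y: "y \<in> U"
  have "\<zero>\<^bsub>fib G z\<^esub> = \<phi> z \<zero>\<^bsub>fib E z\<^esub>" if "z \<in> U" for z
  using mopenD[OF U that] lin_zero[OF \<phi> presheaf_cvs[OF E'] G] by simp
  then show "\<exists>V t. mopen M V \<and> y \<in> V \<and> V <= U \<and> t \<in> sect E V \<and>
  (\<forall>z\<in>V. (\<lambda>y\<in>U. \<zero>\<^bsub>(fib G y)\<lparr>carrier := \<phi> y ` carrier (fib E y)\<rparr>\<^esub>) z = \<phi> z (t z))"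
  using U y sect_zero[OF E' U] by (intro exI[of _ U] exI[of _ "\<lambda>y\<in>U. \<zero>\<^bsub>fib E y\<^esub>"]) simp
  qed simp
  show "(\<lambda>y\<in>U. s y \<oplus>\<^bsub>(fib G y)\<lparr>carrier := \<phi> y ` carrier (fib E y)\<rparr>\<^esub> t y) \<in> ?I U"
  if A: "mopen M U" "s \<in> ?I U" "t \<in> ?I U" for U s t
  proof (rule I)
  fix y assume y: "y \<in> U"
  obtain V s' where V: "mopen M V" "y \<in> V" "V <= U" "s' \<in> sect E V" "\<forall>z\<in>V. s z = \<phi> z (s' z)"
  using A y by blast
  obtain V' t' where V': "mopen M V'" "y \<in> V'" "V' <= U" "t' \<in> sect E V'" "\<forall>z\<in>V'. t z = \<phi> z (t' z)"
  using A y by blast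
  let ?W = "V \<inter> V'"
  have W: "mopen M ?W" using V V' by (simp add: openin_Int)
  let ?r = "\<lambda>z\<in>?W. restrict s' ?W z \<oplus>\<^bsub>fib E z\<^esub> restrict t' ?W z"
  have "?r \<in> sect E ?W"
  by (rule sect_add[OF E' W sect_restrict[OF E' V(1) W _ V(4)] sect_restrict[OF E' V'(1) W _ V'(4)]]) auto
  moreover have "s z \<oplus>\<^bsub>fib G z\<^esub> t z = \<phi> z (?r z)" if z: "z \<in> ?W" for z
  using z V V' lin_add[OF \<phi>[OF mopenD[OF W z]]] sect_closed[OF E' V(1,4)] sect_closed[OF E' V'(1,4)]
  by simp
  ultimately show "\<exists>V s'. mopen M V \<and> y \<in> V \<and> V <= U \<and> s' \<in> sect E V \<and>
  (\<forall>z\<in>V. (\<lambda>y\<in>U. s y \<oplus>\<^bsub>(fib G y)\<lparr>carrier := \<phi> y ` carrier (fib E y)\<rparr>\<^esub> t y) z = \<phi> z (s' z))"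
  using W V V' by (intro exI[of _ ?W] exI[of _ ?r]) auto
  qed simp
  show "(\<lambda>y\<in>U. h y \<odot>\<^bsub>(fib G y)\<lparr>carrier := \<phi> y ` carrier (fib E y)\<rparr>\<^esub> s y) \<in> ?I U"
  if A: "mopen M U" "h \<in> hol M U" "s \<in> ?I U" for U h s
  proof (rule I)
  fix y assume y: "y \<in> U"
  obtain V s' where V: "mopen M V" "y \<in> V" "V <= U" "s' \<in> sect E V" "\<forall>z\<in>V. s z = \<phi> z (s' z)"
  using A y by blast
  let ?r = "\<lambda>z\<in>V. restrict h V z \<odot>\<^bsub>fib E z\<^esub> s' z"
  have "?r \<in> sect E V" by (rule sect_hol[OF E' V(1) hol_restrict[OF A(2) V(3)] V(4)])
  moreover have "h z \<odot>\<^bsub>fib G z\<^esub> s z = \<phi> z (?r z)" if z: "z \<in> V" for z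
  using z V lin_scale[OF \<phi>[OF mopenD[OF V(1) z]]] sect_closed[OF E' V(1,4)] by simp
  ultimately show "\<exists>V s'. mopen M V \<and> y \<in> V \<and> V <= U \<and> s' \<in> sect E V \<and>
  (\<forall>z\<in>V. (\<lambda>y\<in>U. h y \<odot>\<^bsub>(fib G y)\<lparr>carrier := \<phi> y ` carrier (fib E y)\<rparr>\<^esub> s y) z = \<phi> z (s' z))"
  using V by (intro exI[of _ V] exI[of _ ?r]) auto
  qed simp
  show "s \<in> ?I U" if A: "mopen M U" "s \<in> extensional U"
  "\<forall>y\<in>U. \<exists>V. mopen M V \<and> y \<in> V \<and> V <= U \<and> restrict s V \<in> ?I V" for U s
  proof (rule I[OF A(2)])
  fix y assume y: "y \<in> U"
  from bspec[OF A(3) y] obtain V where V: "mopen M V" "y \<in> V" "V <= U" "restrict s V \<in> ?I V"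
  by (elim exE conjE)
  from V(2,4) have "\<exists>W t. mopen M W \<and> y \<in> W \<and> W <= V \<and> t \<in> sect E W \<and> (\<forall>z\<in>W. restrict s V z = \<phi> z (t z))"
  by (simp only: mem_Collect_eq)
  then obtain W t where "mopen M W" "y \<in> W" "W <= V" "t \<in> sect E W" "\<forall>z\<in>W. restrict s V z = \<phi> z (t z)"
  by (elim exE conjE)
  then show "\<exists>V t. mopen M V \<and> y \<in> V \<and> V <= U \<and> t \<in> sect E V \<and> (\<forall>z\<in>V. s z = \<phi> z (t z))"
  using V(3) by (intro exI[of _ W] exI[of _ t]) (simp add: subset_iff)
  qed
 qed
qed

text \<open>A linear map cut down to an extensional one stays linear when the carrier is closed
  under the operations. This is the condition on a source of homomorphisms, and it is direct to
  check for tangent spaces and relabelled fibres.\<close>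

definition closed_ops :: "'v cvs => bool" where
 "closed_ops V \<longleftrightarrow> (\<forall>x\<in>carrier V. \<forall>y\<in>carrier V. x \<oplus>\<^bsub>V\<^esub> y \<in> carrier V) \<and>
  (\<forall>a. \<forall>x\<in>carrier V. a \<odot>\<^bsub>V\<^esub> x \<in> carrier V)"

lemma complex_vs_closed_ops: "complex_vs V ==> closed_ops V"
proof -
 assume "complex_vs V"
 then interpret cvs V by (simp add: cvs_iff)
 show ?thesis by (simp add: closed_ops_def)
qed

lemma restrict_linear_map: "closed_ops V ==> lin V W f ==> restrict f (carrier V) \<in> linear_maps V W"
 unfolding linear_maps_iff closed_ops_def by (auto intro!: linI simp: lin_closed lin_add lin_scale)

lemma linear_map_lin: "f \<in> linear_maps V W ==> lin V W f"
 by (simp add: linear_maps_iff)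

lemma hom_space_simps [simp]:
 "carrier (hom_space V W) = linear_maps V W"
 "\<zero>\<^bsub>hom_space V W\<^esub> = (\<lambda>v\<in>carrier V. \<zero>\<^bsub>W\<^esub>)"
 "f \<oplus>\<^bsub>hom_space V W\<^esub> g = (\<lambda>v\<in>carrier V. f v \<oplus>\<^bsub>W\<^esub> g v)"
 "a \<odot>\<^bsub>hom_space V W\<^esub> f = (\<lambda>v\<in>carrier V. a \<odot>\<^bsub>W\<^esub> f v)"
 by (simp_all add: hom_space_def)

lemma complex_vs_hom_space:
 assumes V: "closed_ops V" and W: "complex_vs W"
 shows "complex_vs (hom_space V W)"
proof -
 interpret W: cvs W using W by (simp add: cvs_iff)
 have c: "f v \<in> carrier W" if "f \<in> linear_maps V W" "v \<in> carrier V" for f v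
  using that by (auto simp: linear_maps_iff lin_closed)
 have e: "f \<in> extensional (carrier V)" if "f \<in> linear_maps V W" for f
  using that by (simp add: linear_maps_iff)
 have add: "(\<lambda>v\<in>carrier V. f v \<oplus>\<^bsub>W\<^esub> g v) \<in> linear_maps V W" if "f \<in> linear_maps V W" "g \<in> linear_maps V W" for f g
  by (rule restrict_linear_map[OF V lin_sum_map[OF linear_map_lin linear_map_lin W]]) (use that in auto)
 have scale: "(\<lambda>v\<in>carrier V. a \<odot>\<^bsub>W\<^esub> f v) \<in> linear_maps V W" if "f \<in> linear_maps V W" for a f
  by (rule restrict_linear_map[OF V lin_scale_map[OF linear_map_lin W]]) (use that in auto)
 have zero: "(\<lambda>v\<in>carrier V. \<zero>\<^bsub>W\<^esub>) \<in> linear_maps V W"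
  by (rule restrict_linear_map[OF V lin_zero_map[OF W]])
 show ?thesis
 proof (intro complex_vsI abelian_groupI; (unfold hom_space_simps)?)
  fix f assume f: "f \<in> linear_maps V W"
  show "\<exists>g\<in>linear_maps V W. (\<lambda>v\<in>carrier V. g v \<oplus>\<^bsub>W\<^esub> f v) = (\<lambda>v\<in>carrier V. \<zero>\<^bsub>W\<^esub>)"
  by (intro bexI[OF _ scale[OF f, of "-1"]] restrict_ext) (simp add: c[OF f] W.scale_minus_one W.l_neg)
  show "(\<lambda>v\<in>carrier V. (\<lambda>v\<in>carrier V. \<zero>\<^bsub>W\<^esub>) v \<oplus>\<^bsub>W\<^esub> f v) = f"
  by (rule extensionalityI[OF _ e[OF f]]) (simp_all add: c[OF f])
  show "(\<lambda>v\<in>carrier V. 1 \<odot>\<^bsub>W\<^esub> f v) = f"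
  by (rule extensionalityI[OF _ e[OF f]]) (simp_all add: c[OF f])
 qed (simp_all add: add scale zero c W.a_ac W.scale_add_left W.scale_add_right W.scale_scale cong: restrict_cong)
qed

definition hom_source :: "'y manifold => ('y, 't) vbundle => bool" where
 "hom_source M T \<longleftrightarrow> (\<forall>y\<in>points M. closed_ops (fib T y)) \<and>
  (\<forall>U. mopen M U --> sect T U <= (\<Pi>\<^sub>E y\<in>U. carrier (fib T y)))"

lemma presheaf_hom_source: "presheaf M T ==> hom_source M T"
 by (simp add: presheaf_def hom_source_def complex_vs_closed_ops)

lemma hom_source_sect: "hom_source M T ==> mopen M U ==> t \<in> sect T U ==> y \<in> U ==> t y \<in> carrier (fib T y)"
 by (rule PiE_mem[of t U], rule subsetD[of "sect T U"]) (simp_all add: hom_source_def)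

lemma hom_source_ops: "hom_source M T ==> y \<in> points M ==> closed_ops (fib T y)"
 by (simp add: hom_source_def)

lemma fib_hom_bundle [simp]: "fib (hom_bundle M T E) y = hom_space (fib T y) (fib E y)"
 by (simp add: hom_bundle_def)

text \<open>Together with \<open>hom_sect_morphism\<close> and \<open>hom_sect_eq\<close> it
  identifies sections of \<open>hom_bundle\<close> with morphisms over \<open>U\<close>, so that
  their algebra is that of \<open>morph_on\<close>.\<close>

lemma hom_sectI:
 assumes T: "hom_source M T" and U: "mopen M U" and \<phi>: "morph_on M U T E \<phi>"
 shows "(\<lambda>y\<in>U. \<lambda>v\<in>carrier (fib T y). \<phi> y v) \<in> sect (hom_bundle M T E) U"
proof -
 have "(\<lambda>v\<in>carrier (fib T y). \<phi> y v) \<in> linear_maps (fib T y) (fib E y)" if y: "y \<in> U" for y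
  by (rule restrict_linear_map[OF hom_source_ops[OF T mopenD[OF U y]] morph_on_lin[OF \<phi> y]])
 moreover have "(\<lambda>y\<in>V. (\<lambda>y\<in>U. \<lambda>v\<in>carrier (fib T y). \<phi> y v) y (t y)) \<in> sect E V"
  if V: "mopen M V" "V <= U" "t \<in> sect T V" for V t
  using V by (intro restrI[OF morph_on_sect[OF \<phi> V]]) (simp add: subsetD hom_source_sect[OF T V(1,3)])
 ultimately show ?thesis unfolding hom_bundle_def by (simp add: PiE_iff)
qed

lemma hom_sect_morphism: "\<phi> \<in> sect (hom_bundle M T E) U ==> morph_on M U T E \<phi>"
 unfolding hom_bundle_def morph_on_def by (auto simp: PiE_iff linear_maps_iff)

lemma hom_sect_eq:
 assumes "\<phi> \<in> sect (hom_bundle M T E) U"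
 shows "\<phi> = (\<lambda>y\<in>U. \<lambda>v\<in>carrier (fib T y). \<phi> y v)"
proof -
 have "\<phi> \<in> extensional U" "!!y. y \<in> U ==> \<phi> y \<in> extensional (carrier (fib T y))"
  using assms by (auto simp: hom_bundle_def PiE_iff linear_maps_iff)
 then show ?thesis by (intro extensionalityI[of _ U]) (auto simp: extensional_restrict)
qed

lemma morph_on_add:
 assumes E: "presheaf M E" and U: "mopen M U" and \<phi>: "morph_on M U T E \<phi>" and \<psi>: "morph_on M U T E \<psi>"
 shows "morph_on M U T E (%y v. \<phi> y v \<oplus>\<^bsub>fib E y\<^esub> \<psi> y v)"
 unfolding morph_on_def
proof (intro conjI ballI allI impI; (elim conjE)?)
 show "lin (fib T y) (fib E y) (%v. \<phi> y v \<oplus>\<^bsub>fib E y\<^esub> \<psi> y v)" if "y \<in> U" for y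
  using lin_sum_map[OF morph_on_lin[OF \<phi> that] morph_on_lin[OF \<psi> that] presheaf_cvs[OF E mopenD[OF U that]]] .
 fix V s assume V: "mopen M V" "V <= U" "s \<in> sect T V"
 show "(\<lambda>y\<in>V. \<phi> y (s y) \<oplus>\<^bsub>fib E y\<^esub> \<psi> y (s y)) \<in> sect E V"
  by (rule restrI[OF sect_add[OF E V(1) morph_on_sect[OF \<phi> V] morph_on_sect[OF \<psi> V]]]) simp
qed

context chart_space
begin

lemma morph_on_hol:
 assumes E: "presheaf M E" and U: "mopen M U" and \<phi>: "morph_on M U T E \<phi>" and h: "h \<in> hol M U"
 shows "morph_on M U T E (%y v. h y \<odot>\<^bsub>fib E y\<^esub> \<phi> y v)"
 unfolding morph_on_def
proof (intro conjI ballI allI impI; (elim conjE)?)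
 show "lin (fib T y) (fib E y) (%v. h y \<odot>\<^bsub>fib E y\<^esub> \<phi> y v)" if "y \<in> U" for y
  using lin_scale_map[OF morph_on_lin[OF \<phi> that] presheaf_cvs[OF E mopenD[OF U that]]] .
 fix V s assume V: "mopen M V" "V <= U" "s \<in> sect T V"
 show "(\<lambda>y\<in>V. h y \<odot>\<^bsub>fib E y\<^esub> \<phi> y (s y)) \<in> sect E V"
  by (rule restrI[OF sect_hol[OF E V(1) hol_restrict[OF h V(2)] morph_on_sect[OF \<phi> V]]]) simp
qed

lemma morph_on_minus:
 assumes E: "presheaf M E" and U: "mopen M U" and \<phi>: "morph_on M U T E \<phi>" and \<psi>: "morph_on M U T E \<psi>"
 shows "morph_on M U T E (%y v. \<phi> y v \<ominus>\<^bsub>fib E y\<^esub> \<psi> y v)"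
 unfolding morph_on_def
proof (intro conjI ballI allI impI; (elim conjE)?)
 show "lin (fib T y) (fib E y) (%v. \<phi> y v \<ominus>\<^bsub>fib E y\<^esub> \<psi> y v)" if "y \<in> U" for y
  using lin_diff[OF morph_on_lin[OF \<phi> that] morph_on_lin[OF \<psi> that] presheaf_cvs[OF E mopenD[OF U that]]] .
 fix V s assume V: "mopen M V" "V <= U" "s \<in> sect T V"
 show "(\<lambda>y\<in>V. \<phi> y (s y) \<ominus>\<^bsub>fib E y\<^esub> \<psi> y (s y)) \<in> sect E V"
  by (rule restrI[OF sect_minus[OF E V(1) morph_on_sect[OF \<phi> V] morph_on_sect[OF \<psi> V]]]) simp
qed

lemma presheaf_hom:
 assumes T: "hom_source M T" and E: "presheaf M E"
 shows "presheaf M (hom_bundle M T E)"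
 unfolding presheaf_def fib_hom_bundle hom_space_simps
proof (intro conjI allI impI ballI; (elim conjE)?)
 show "complex_vs (hom_space (fib T y) (fib E y))" if "y \<in> points M" for y
  by (rule complex_vs_hom_space[OF hom_source_ops[OF T that] presheaf_cvs[OF E that]])
 show "sect (hom_bundle M T E) U <= (\<Pi>\<^sub>E y\<in>U. linear_maps (fib T y) (fib E y))" for U
  by (auto simp: hom_bundle_def)
 show "restrict s V \<in> sect (hom_bundle M T E) V"
  if A: "mopen M U" "mopen M V" "V <= U" "s \<in> sect (hom_bundle M T E) U" for U V s
  by (rule restrI[OF hom_sectI[OF T A(2) morph_on_subset[OF hom_sect_morphism[OF A(4)] A(3)]]])
  (subst hom_sect_eq[OF A(4)], use A in auto)
 show "(\<lambda>y\<in>U. \<lambda>v\<in>carrier (fib T y). \<zero>\<^bsub>fib E y\<^esub>) \<in> sect (hom_bundle M T E) U" if U: "mopen M U" for U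
 proof (rule hom_sectI[OF T U])
  show "morph_on M U T E (%y v. \<zero>\<^bsub>fib E y\<^esub>)"
  unfolding morph_on_def
  using U by (auto intro!: lin_zero_map presheaf_cvs[OF E mopenD] sect_zero[OF E])
 qed
 show "(\<lambda>y\<in>U. \<lambda>v\<in>carrier (fib T y). s y v \<oplus>\<^bsub>fib E y\<^esub> t y v) \<in> sect (hom_bundle M T E) U"
  if A: "mopen M U" "s \<in> sect (hom_bundle M T E) U" "t \<in> sect (hom_bundle M T E) U" for U s t
  by (rule hom_sectI[OF T A(1) morph_on_add[OF E A(1) hom_sect_morphism[OF A(2)] hom_sect_morphism[OF A(3)]]])
 show "(\<lambda>y\<in>U. \<lambda>v\<in>carrier (fib T y). h y \<odot>\<^bsub>fib E y\<^esub> s y v) \<in> sect (hom_bundle M T E) U"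
  if A: "mopen M U" "h \<in> hol M U" "s \<in> sect (hom_bundle M T E) U" for U h s
  by (rule hom_sectI[OF T A(1) morph_on_hol[OF E A(1) hom_sect_morphism[OF A(3)] A(2)]])
qed

end

lemma hom_post_eq: "g \<in> linear_maps (fib T y) (fib E y) ==> hom_post T E \<phi> y g = (\<lambda>v\<in>carrier (fib T y). \<phi> y (g v))"
 by (simp add: hom_post_def compose_def)

lemma hom_post_linear_map:
 "closed_ops (fib T y) ==> lin (fib E y) (fib G y) (\<phi> y) ==> g \<in> linear_maps (fib T y) (fib E y) ==>
  hom_post T E \<phi> y g \<in> linear_maps (fib T y) (fib G y)"
 by (subst hom_post_eq, assumption, rule restrict_linear_map, assumption, rule lin_comp[OF linear_map_lin])

lemma morph_on_hom_post:
 assumes T: "hom_source M T" and E: "presheaf M E" and U: "mopen M U" and \<phi>: "morph_on M U E G \<phi>"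
 shows "morph_on M U (hom_bundle M T E) (hom_bundle M T G) (hom_post T E \<phi>)"
 unfolding morph_on_def
proof (intro conjI ballI allI impI; (elim conjE)?)
 fix y assume y: "y \<in> U"
 note c = hom_source_ops[OF T mopenD[OF U y]] and l = morph_on_lin[OF \<phi> y]
 interpret H: cvs "hom_space (fib T y) (fib E y)"
  using complex_vs_hom_space[OF c presheaf_cvs[OF E mopenD[OF U y]]] by (simp add: cvs_iff)
 show "lin (fib (hom_bundle M T E) y) (fib (hom_bundle M T G) y) (hom_post T E \<phi> y)"
 proof (rule linI; (unfold fib_hom_bundle hom_space_simps)?)
  fix f g a assume f: "f \<in> linear_maps (fib T y) (fib E y)"
  note fc = lin_closed[OF linear_map_lin[OF f]]
  show "hom_post T E \<phi> y f \<in> linear_maps (fib T y) (fib G y)" by (intro hom_post_linear_map c l f)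
  show "hom_post T E \<phi> y (\<lambda>v\<in>carrier (fib T y). a \<odot>\<^bsub>fib E y\<^esub> f v) =
  (\<lambda>v\<in>carrier (fib T y). a \<odot>\<^bsub>fib G y\<^esub> hom_post T E \<phi> y f v)"
  using H.scale_closed[of f a] f
  by (simp add: hom_post_eq lin_scale[OF l] fc cong: restrict_cong)
  assume g: "g \<in> linear_maps (fib T y) (fib E y)"
  note gc = lin_closed[OF linear_map_lin[OF g]]
  show "hom_post T E \<phi> y (\<lambda>v\<in>carrier (fib T y). f v \<oplus>\<^bsub>fib E y\<^esub> g v) =
  (\<lambda>v\<in>carrier (fib T y). hom_post T E \<phi> y f v \<oplus>\<^bsub>fib G y\<^esub> hom_post T E \<phi> y g v)"
  using H.a_closed[of f g] f g
  by (simp add: hom_post_eq lin_add[OF l] fc gc cong: restrict_cong)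
 qed
next
 fix V s assume V: "mopen M V" "V <= U" "s \<in> sect (hom_bundle M T E) V"
 have "s y \<in> linear_maps (fib T y) (fib E y)" if "y \<in> V" for y
  using V(3) that by (auto simp: hom_bundle_def)
 then show "(\<lambda>y\<in>V. hom_post T E \<phi> y (s y)) \<in> sect (hom_bundle M T G) V"
  by (intro restrI[OF hom_sectI[OF T V(1) morph_on_comp[OF hom_sect_morphism[OF V(3)] morph_on_subset[OF \<phi> V(2)]]]])
  (simp add: hom_post_eq)
qed

context cvs
begin

lemma minus_self: "x \<in> carrier V ==> x \<ominus> x = \<zero>"
 by (simp add: minus_eq r_neg)

lemma neg_zero: "\<ominus> \<zero> = \<zero>"
 by (rule minus_equality) simp_all

lemma minus_zero_right: "x \<in> carrier V ==> x \<ominus> \<zero> = x"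
 by (simp add: minus_eq neg_zero)

end

subsection \<open>Alternating sums over faces\<close>

text \<open>This recursion computes the value of the Cech coboundary at a simplex; it turns the
 cancellation of double faces and the Leibniz rule into list inductions.\<close>

fun face_sum :: "'z cvs => ('y list => 'z) => 'y list => 'z" where
 "face_sum Z c [] = \<zero>\<^bsub>Z\<^esub>"
| "face_sum Z c (y # ys) = c ys \<ominus>\<^bsub>Z\<^esub> face_sum Z (%zs. c (y # zs)) ys"

text \<open>A crude superset of the codimension one faces, without the order of the entries. It is
  stable under prefixing a vertex and suffices to state where cochain values are required to
  lie.\<close>

definition faces :: "'y list => 'y list set" where
 "faces ys = {zs. Suc (length zs) = length ys \<and> set zs <= set ys}"

lemma faces_tail: "ys \<in> faces (y # ys)"
 by (auto simp: faces_def)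

lemma faces_Cons: "zs \<in> faces ys ==> y # zs \<in> faces (y # ys)"
 by (auto simp: faces_def)

lemma face_sum_cong:
 "(!!zs. zs \<in> faces ys ==> c zs = d zs) ==> face_sum Z c ys = face_sum Z d ys"
proof (induction ys arbitrary: c d)
 case (Cons y ys)
 have "face_sum Z (%zs. c (y # zs)) ys = face_sum Z (%zs. d (y # zs)) ys"
  by (rule Cons.IH) (rule Cons.prems, erule faces_Cons)
 then show ?case using Cons.prems[OF faces_tail] by simp
qed simp

context cvs
begin

lemma face_sum_closed:
 "(!!zs. zs \<in> faces ys ==> c zs \<in> carrier V) ==> face_sum V c ys \<in> carrier V"
proof (induction ys arbitrary: c)
 case (Cons y ys)
 have "face_sum V (%zs. c (y # zs)) ys \<in> carrier V"
  by (rule Cons.IH) (rule Cons.prems, erule faces_Cons)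
 then show ?case using Cons.prems[OF faces_tail] by simp
qed simp

lemma face_sum_minus:
 assumes "!!zs. zs \<in> faces ys ==> c zs \<in> carrier V" "!!zs. zs \<in> faces ys ==> d zs \<in> carrier V"
 shows "face_sum V (%zs. c zs \<ominus> d zs) ys = face_sum V c ys \<ominus> face_sum V d ys"
 using assms
proof (induction ys arbitrary: c d)
 case (Cons y ys)
 have "face_sum V (%zs. c (y # zs) \<ominus> d (y # zs)) ys =
  face_sum V (%zs. c (y # zs)) ys \<ominus> face_sum V (%zs. d (y # zs)) ys"
  by (rule Cons.IH) (rule Cons.prems, erule faces_Cons)+
 moreover have "face_sum V (%zs. c (y # zs)) ys \<in> carrier V" "face_sum V (%zs. d (y # zs)) ys \<in> carrier V"
  by (rule face_sum_closed, rule Cons.prems, erule faces_Cons)+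
 moreover have "c ys \<in> carrier V" "d ys \<in> carrier V" by (rule Cons.prems[OF faces_tail])+
 ultimately show ?case by (simp add: minus_eq minus_add a_ac)
qed (simp add: minus_self)

text \<open>Unfolding at the head vertex produces the face sum \<open>S\<close> over the tail, minus
  \<open>S\<close> minus a double face sum over the tail for which the induction hypothesis
  applies.\<close>

lemma face_sum_face_sum:
 assumes "!!zs. Suc (Suc (length zs)) = length ys ==> set zs <= set ys ==> c zs \<in> carrier V"
 shows "face_sum V (face_sum V c) ys = \<zero>"
 using assms
proof (induction ys arbitrary: c)
 case (Cons y ys)
 have c1: "c zs \<in> carrier V" if "zs \<in> faces ys" for zs
  using Cons.prems that by (auto simp: faces_def)
 have c2: "face_sum V (%zs. c (y # zs)) zs \<in> carrier V" if "zs \<in> faces ys" for zs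
  using that by (intro face_sum_closed Cons.prems) (auto simp: faces_def)
 have "face_sum V (face_sum V c) (y # ys) =
  face_sum V c ys \<ominus> face_sum V (%zs. c zs \<ominus> face_sum V (%us. c (y # us)) zs) ys"
  by simp
 also have "face_sum V (%zs. c zs \<ominus> face_sum V (%us. c (y # us)) zs) ys =
  face_sum V c ys \<ominus> face_sum V (face_sum V (%us. c (y # us))) ys"
  by (rule face_sum_minus[OF c1 c2])
 also have "face_sum V (face_sum V (%us. c (y # us))) ys = \<zero>"
  by (rule Cons.IH) (rule Cons.prems; auto)
 also have "face_sum V c ys \<ominus> (face_sum V c ys \<ominus> \<zero>) = \<zero>"
  using face_sum_closed[of ys c, OF c1] by (simp add: minus_zero_right minus_self)
 finally show ?case .
qed simp

text \<open>The summand \<open>k = 0\<close> omits the head; in all others the head stays and one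
  sign can be pulled out, which is the recursion of \<open>face_sum\<close>.\<close>

lemma finsum_faces_eq:
 assumes "!!zs. zs \<in> faces ys ==> c zs \<in> carrier V"
 shows "(\<Oplus>k\<in>{..<length ys}. ((-1) ^ k) \<odot> c (take k ys @ drop (Suc k) ys)) = face_sum V c ys"
 using assms
proof (induction ys arbitrary: c)
 case (Cons y ys)
 have f: "take k ys @ drop (Suc k) ys \<in> faces ys" if "k < length ys" for k
  using that set_take_subset[of k ys] set_drop_subset[of "Suc k" ys] by (auto simp: faces_def)
 have c: "c ys \<in> carrier V" "!!k. k < length ys ==> c (y # take k ys @ drop (Suc k) ys) \<in> carrier V"
  by (rule Cons.prems[OF faces_tail]) (simp add: Cons.prems[OF faces_Cons[OF f]])
 let ?t = "%k. ((-1) ^ k) \<odot> c (take k (y # ys) @ drop (Suc k) (y # ys))"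
 have "length (y # ys) = 1 + length ys" by simp
 then have "(\<Oplus>k\<in>{..<length (y # ys)}. ?t k) = (\<Oplus>k\<in>{..<1 + length ys}. ?t k)" by (simp only:)
 also have "... = (\<Oplus>k\<in>{..<1::nat}. ?t k) \<oplus> (\<Oplus>k\<in>{..<length ys}. ?t (1 + k))"
 proof (rule finsum_lessThan_add)
  show "?t k \<in> carrier V" if "k < 1 + length ys" for k
  using that c by (cases k) auto
 qed
 also have "(\<Oplus>k\<in>{..<1::nat}. ?t k) = c ys"
  using c(1) by (simp add: One_nat_def lessThan_Suc)
 also have "(\<Oplus>k\<in>{..<length ys}. ?t (1 + k)) =
  (\<Oplus>k\<in>{..<length ys}. (-1) \<odot> ((-1) ^ k \<odot> c (y # take k ys @ drop (Suc k) ys)))"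
  using c by (intro finsum_cong') (auto simp: scale_scale plus_1_eq_Suc)
 also have "... = (-1) \<odot> (\<Oplus>k\<in>{..<length ys}. (-1) ^ k \<odot> c (y # take k ys @ drop (Suc k) ys))"
  by (rule finsum_scale[symmetric]) (use c in auto)
 also have "(\<Oplus>k\<in>{..<length ys}. (-1) ^ k \<odot> c (y # take k ys @ drop (Suc k) ys)) =
  face_sum V (%zs. c (y # zs)) ys"
  by (rule Cons.IH) (rule Cons.prems, erule faces_Cons)+
 also have "c ys \<oplus> (-1) \<odot> face_sum V (%zs. c (y # zs)) ys = face_sum V c (y # ys)"
  using c(1) face_sum_closed[of ys "%zs. c (y # zs)", OF Cons.prems[OF faces_Cons]] by (simp add: minus_eq_scale)
 finally show ?case .
qed simp

end

lemma face_sum_lin: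
 assumes "lin V W f" "complex_vs V" "complex_vs W" "!!zs. zs \<in> faces ys ==> c zs \<in> carrier V"
 shows "f (face_sum V c ys) = face_sum W (%zs. f (c zs)) ys"
 using assms(4)
proof (induction ys arbitrary: c)
 case Nil
 then show ?case by (simp add: lin_zero[OF assms(1-3)])
next
 case (Cons y ys)
 interpret V: cvs V using assms by (simp add: cvs_iff)
 have "f (face_sum V (%zs. c (y # zs)) ys) = face_sum W (%zs. f (c (y # zs))) ys"
  by (rule Cons.IH) (rule Cons.prems, erule faces_Cons)+
 then show ?case
  using Cons.prems[OF faces_tail] V.face_sum_closed[of ys "%zs. c (y # zs)", OF Cons.prems[OF faces_Cons]]
  by (simp add: lin_minus[OF assms(1-3)])
qed

text \<open>The Leibniz rule by induction on \<open>m\<close>. Each step strips a vertex that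
  belongs to the \<open>c\<close> factor alone, until for \<open>m = 0\<close> the head is the
  vertex shared by both factors.\<close>

lemma face_sum_bilin:
 assumes f: "bilin V W Z f" and V: "complex_vs V" and W: "complex_vs W" and Z: "complex_vs Z"
  and c: "!!zs. length zs = Suc m ==> set zs <= set ys ==> c zs \<in> carrier V"
  and d: "!!zs. length zs = Suc n ==> set zs <= set ys ==> d zs \<in> carrier W"
  and len: "length ys = m + n + 2"
 shows "face_sum Z (%zs. f (c (take (Suc m) zs)) (d (drop m zs))) ys =
  f (face_sum V c (take (Suc (Suc m)) ys)) (d (drop (Suc m) ys)) \<oplus>\<^bsub>Z\<^esub>
  (-1) ^ m \<odot>\<^bsub>Z\<^esub> f (c (take (Suc m) ys)) (face_sum W d (drop m ys))"
 using c d len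
proof (induction m arbitrary: c ys)
 interpret V: cvs V using V by (simp add: cvs_iff)
 interpret W: cvs W using W by (simp add: cvs_iff)
 interpret Z: cvs Z using Z by (simp add: cvs_iff)
 {
  case 0
  then obtain y x xs where ys: "ys = y # x # xs" and xs: "length xs = n"
  by (auto simp: length_Suc_conv numeral_2_eq_2)
  have cy: "c [y] \<in> carrier V" "c [x] \<in> carrier V" by (rule 0(1); use ys in simp)+
  have d0: "d (x # xs) \<in> carrier W" by (rule 0(2)) (use ys xs in auto)
  have d1: "d (y # zs) \<in> carrier W" if "zs \<in> faces (x # xs)" for zs
  using 0(2)[of "y # zs"] that ys xs by (auto simp: faces_def)
  let ?D = "face_sum W (%zs. d (y # zs)) (x # xs)"
  have D: "?D \<in> carrier W" by (rule W.face_sum_closed[OF d1])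
  have "face_sum Z (%zs. f (c (take (Suc 0) zs)) (d (drop 0 zs))) ys =
  f (c [x]) (d (x # xs)) \<ominus>\<^bsub>Z\<^esub> face_sum Z (%zs. f (c [y]) (d (y # zs))) (x # xs)"
  by (simp add: ys)
  also have "face_sum Z (%zs. f (c [y]) (d (y # zs))) (x # xs) = f (c [y]) ?D"
  by (rule face_sum_lin[OF bilin_right[OF f cy(1)] W Z d1, symmetric])
  \<comment> \<open>The term \<open>f (c [y]) (d (x # xs))\<close> is subtracted and added: it is
    the face term that both coboundaries contain and the face sum of the product omits.\<close>
  also have "f (c [x]) (d (x # xs)) \<ominus>\<^bsub>Z\<^esub> f (c [y]) ?D =
  f (c [x] \<ominus>\<^bsub>V\<^esub> c [y]) (d (x # xs)) \<oplus>\<^bsub>Z\<^esub> f (c [y]) (d (x # xs) \<ominus>\<^bsub>W\<^esub> ?D)"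
  proof -
  have *: "f (c [x]) (d (x # xs)) \<in> carrier Z" "f (c [y]) (d (x # xs)) \<in> carrier Z" "f (c [y]) ?D \<in> carrier Z"
  using cy d0 D bilin_closed[OF f] by auto
  have A: "f (c [x] \<ominus>\<^bsub>V\<^esub> c [y]) (d (x # xs)) = f (c [x]) (d (x # xs)) \<ominus>\<^bsub>Z\<^esub> f (c [y]) (d (x # xs))"
  by (rule lin_minus[OF bilin_left[OF f d0] V Z cy(2,1)])
  have B: "f (c [y]) (d (x # xs) \<ominus>\<^bsub>W\<^esub> ?D) = f (c [y]) (d (x # xs)) \<ominus>\<^bsub>Z\<^esub> f (c [y]) ?D"
  by (rule lin_minus[OF bilin_right[OF f cy(1)] W Z d0 D])
  have "a \<ominus>\<^bsub>Z\<^esub> e = (a \<ominus>\<^bsub>Z\<^esub> b) \<oplus>\<^bsub>Z\<^esub> (b \<ominus>\<^bsub>Z\<^esub> e)"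
  if "a \<in> carrier Z" "b \<in> carrier Z" "e \<in> carrier Z" for a b e
  using that by (simp add: Z.minus_eq Z.a_assoc Z.r_neg1)
  then show ?thesis unfolding A B using * by blast
  qed
  also have "c [x] \<ominus>\<^bsub>V\<^esub> c [y] = face_sum V c (take (Suc (Suc 0)) ys)"
  using cy by (simp add: ys V.minus_zero_right)
  also have "d (x # xs) \<ominus>\<^bsub>W\<^esub> ?D = face_sum W d (drop 0 ys)" by (simp add: ys)
  finally have eq: "face_sum Z (%zs. f (c (take (Suc 0) zs)) (d (drop 0 zs))) ys =
  f (face_sum V c (take (Suc (Suc 0)) ys)) (d (x # xs)) \<oplus>\<^bsub>Z\<^esub> f (c [y]) (face_sum W d (drop 0 ys))" .
  have "face_sum W d (drop 0 ys) \<in> carrier W"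
  by (rule W.face_sum_closed, rule 0(2)) (use ys xs in \<open>auto simp: faces_def\<close>)
  then have "(-1) ^ 0 \<odot>\<^bsub>Z\<^esub> f (c [y]) (face_sum W d (drop 0 ys)) = f (c [y]) (face_sum W d (drop 0 ys))"
  using bilin_closed[OF f cy(1)] by (simp del: face_sum.simps)
  moreover have "drop (Suc 0) ys = x # xs" "take (Suc 0) ys = [y]" using ys by auto
  ultimately show ?case unfolding eq by (simp only:)
 next
  case (Suc m)
  then obtain y ys' where ys: "ys = y # ys'" and len: "length ys' = m + n + 2"
  by (cases ys) auto
  let ?c = "%zs. c (y # zs)"
  have IH: "face_sum Z (%zs. f (?c (take (Suc m) zs)) (d (drop m zs))) ys' =
  f (face_sum V ?c (take (Suc (Suc m)) ys')) (d (drop (Suc m) ys')) \<oplus>\<^bsub>Z\<^esub>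
  (-1) ^ m \<odot>\<^bsub>Z\<^esub> f (?c (take (Suc m) ys')) (face_sum W d (drop m ys'))"
  proof (rule Suc.IH)
  show "?c zs \<in> carrier V" if "length zs = Suc m" "set zs <= set ys'" for zs
  by (rule Suc.prems(1)) (use that ys in auto)
  show "d zs \<in> carrier W" if "length zs = Suc n" "set zs <= set ys'" for zs
  by (rule Suc.prems(2)) (use that ys in auto)
  qed (rule len)
  have sub: "set (take k ys') <= set ys" "set (drop k ys') <= set ys" for k
  using set_take_subset[of k ys'] set_drop_subset[of k ys'] ys by auto
  have C1: "c (take (Suc (Suc m)) ys') \<in> carrier V" by (rule Suc.prems(1)) (use sub len in auto)
  have C2: "?c (take (Suc m) ys') \<in> carrier V" by (rule Suc.prems(1)) (use sub len ys in auto)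
  have C3: "face_sum V ?c (take (Suc (Suc m)) ys') \<in> carrier V"
  by (rule V.face_sum_closed, rule Suc.prems(1)) (use sub[of "Suc (Suc m)"] len ys in \<open>auto simp: faces_def\<close>)
  have D1: "d (drop (Suc m) ys') \<in> carrier W" by (rule Suc.prems(2)) (use sub len in auto)
  have D2: "face_sum W d (drop m ys') \<in> carrier W"
  by (rule W.face_sum_closed, rule Suc.prems(2)) (use sub(2)[of m] len ys in \<open>auto simp: faces_def\<close>)
  note cl = bilin_closed[OF f C1 D1] bilin_closed[OF f C3 D1] bilin_closed[OF f C2 D2]
  have "face_sum Z (%zs. f (c (take (Suc (Suc m)) zs)) (d (drop (Suc m) zs))) ys =
  f (c (take (Suc (Suc m)) ys')) (d (drop (Suc m) ys')) \<ominus>\<^bsub>Z\<^esub>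
  face_sum Z (%zs. f (?c (take (Suc m) zs)) (d (drop m zs))) ys'"
  by (simp add: ys)
  also have "... = (f (c (take (Suc (Suc m)) ys')) (d (drop (Suc m) ys')) \<ominus>\<^bsub>Z\<^esub>
  f (face_sum V ?c (take (Suc (Suc m)) ys')) (d (drop (Suc m) ys'))) \<oplus>\<^bsub>Z\<^esub>
  (-1) ^ Suc m \<odot>\<^bsub>Z\<^esub> f (?c (take (Suc m) ys')) (face_sum W d (drop m ys'))"
  unfolding IH using cl by (simp add: Z.minus_eq Z.minus_add Z.a_assoc Z.scale_neg)
  also have "f (c (take (Suc (Suc m)) ys')) (d (drop (Suc m) ys')) \<ominus>\<^bsub>Z\<^esub>
  f (face_sum V ?c (take (Suc (Suc m)) ys')) (d (drop (Suc m) ys')) =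
  f (face_sum V c (take (Suc (Suc (Suc m))) ys)) (d (drop (Suc m) ys'))"
  using lin_minus[OF bilin_left[OF f D1] V Z C1 C3] by (simp add: ys)
  finally show ?case by (simp add: ys)
 }
qed

section \<open>Cech cohomology\<close>

lemma simplices_face: "ys \<in> simplices M (Suc n) ==> zs \<in> faces ys ==> zs \<in> simplices M n"
 by (auto simp: simplices_def faces_def)

lemma overlap_mono: "set zs <= set ys ==> overlap \<U> ys <= overlap \<U> zs"
 by (auto simp: overlap_def)

lemma overlap_face: "zs \<in> faces ys ==> overlap \<U> ys <= overlap \<U> zs"
 by (rule overlap_mono) (simp add: faces_def)

lemma overlap_open:
 assumes "is_cover M \<U>" "ys \<in> simplices M n"
 shows "mopen M (overlap \<U> ys)"
proof -
 have "ys \<noteq> []" "set ys <= points M" using assms(2) by (auto simp: simplices_def)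
 then show ?thesis
  using assms(1) unfolding overlap_def is_cover_def by (intro openin_INT2) auto
qed

lemma overlap_refine:
 assumes "refines M \<W> \<U>" "ys \<in> simplices M n"
 shows "overlap \<W> ys <= overlap \<U> ys"
 using assms unfolding overlap_def simplices_def by blast

lemma is_cover_points: "is_cover M \<U> ==> ys \<in> simplices M n ==> z \<in> overlap \<U> ys ==> z \<in> points M"
 using overlap_open mopenD by metis

text \<open>The cochains may live on different covers; evaluation on the overlaps of a common
  refinement \<W> makes the difference meaningful, exactly as in
  \<open>cohomologous\<close>.\<close>

definition cochain_diff :: "'y manifold => ('y, 'e) vbundle => nat => ('y => 'y set) =>
  ('y, 'e) cochain => ('y, 'e) cochain => ('y, 'e) cochain" where
 "cochain_diff M E n \<W> c d = (\<lambda>ys\<in>simplices M n. \<lambda>z\<in>overlap \<W> ys. c ys z \<ominus>\<^bsub>fib E z\<^esub> d ys z)"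

definition cochain_restrict :: "'y manifold => nat => ('y => 'y set) => ('y, 'e) cochain => ('y, 'e) cochain" where
 "cochain_restrict M n \<W> c = (\<lambda>ys\<in>simplices M n. \<lambda>z\<in>overlap \<W> ys. c ys z)"

lemma cochain_eqI:
 assumes "c \<in> cochains M E n \<U>" "d \<in> cochains M E n \<U>" "presheaf M E" "is_cover M \<U>"
  and "!!ys z. ys \<in> simplices M n ==> z \<in> overlap \<U> ys ==> c ys z = d ys z"
 shows "c = d"
proof (rule extensionalityI[of _ "simplices M n"])
 show "c \<in> extensional (simplices M n)" "d \<in> extensional (simplices M n)"
  using assms(1,2) by (auto simp: cochains_def PiE_iff)
 fix ys assume ys: "ys \<in> simplices M n"
 then have "c ys \<in> sect E (overlap \<U> ys)" "d ys \<in> sect E (overlap \<U> ys)"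
  using assms(1,2) by (auto simp: cochains_def PiE_iff)
 then have "c ys \<in> extensional (overlap \<U> ys)" "d ys \<in> extensional (overlap \<U> ys)"
  using sect_extensional[OF assms(3) overlap_open[OF assms(4) ys]] by blast+
 then show "c ys = d ys" using assms(5)[OF ys] by (rule extensionalityI)
qed

lemma cochain_sect: "c \<in> cochains M E n \<U> ==> ys \<in> simplices M n ==> c ys \<in> sect E (overlap \<U> ys)"
 by (auto simp: cochains_def PiE_iff)

lemma cochainI:
 "(!!ys. ys \<in> simplices M n ==> (\<lambda>z\<in>overlap \<U> ys. f ys z) \<in> sect E (overlap \<U> ys)) ==>
  (\<lambda>ys\<in>simplices M n. \<lambda>z\<in>overlap \<U> ys. f ys z) \<in> cochains M E n \<U>"
 by (simp add: cochains_def)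

section \<open>Restriction, difference and coboundary of cochains\<close>

context chart_space
begin

context
 fixes E :: "('y, 'e) vbundle"
 assumes E: "presheaf M E"
begin

lemma fib_cvs: "is_cover M \<U> ==> ys \<in> simplices M n ==> z \<in> overlap \<U> ys ==> cvs (fib E z)"
 using presheaf_cvs[OF E is_cover_points] by (simp add: cvs_iff)

lemma cochain_closed:
 "is_cover M \<U> ==> c \<in> cochains M E n \<U> ==> ys \<in> simplices M n ==> z \<in> overlap \<U> ys ==> c ys z \<in> carrier (fib E z)"
 using sect_closed[OF E overlap_open cochain_sect] by metis

lemma cochain_face_closed:
 assumes "is_cover M \<U>" "c \<in> cochains M E n \<U>" "ys \<in> simplices M (Suc n)" "z \<in> overlap \<U> ys" "zs \<in> faces ys"
 shows "c zs z \<in> carrier (fib E z)"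
 using cochain_closed[OF assms(1,2) simplices_face[OF assms(3,5)]] overlap_face[OF assms(5)] assms(4) by blast

lemma cochain_sect_restrict:
 assumes "is_cover M \<U>" "is_cover M \<W>" "refines M \<W> \<U>" "c \<in> cochains M E n \<U>" "ys \<in> simplices M n"
 shows "(\<lambda>z\<in>overlap \<W> ys. c ys z) \<in> sect E (overlap \<W> ys)"
 by (rule sect_restrict[OF E overlap_open[OF assms(1,5)] overlap_open[OF assms(2,5)]
  overlap_refine[OF assms(3,5)] cochain_sect[OF assms(4,5)]])

lemma cochain_restrict_cochain:
 assumes "is_cover M \<U>" "is_cover M \<W>" "refines M \<W> \<U>" "c \<in> cochains M E n \<U>"
 shows "cochain_restrict M n \<W> c \<in> cochains M E n \<W>"
 unfolding cochain_restrict_def by (rule cochainI) (rule cochain_sect_restrict[OF assms])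

lemma cochain_diff_cochain:
 assumes W: "is_cover M \<W>" and U: "is_cover M \<U>" "refines M \<W> \<U>" "c \<in> cochains M E n \<U>"
  and V: "is_cover M \<V>" "refines M \<W> \<V>" "d \<in> cochains M E n \<V>"
 shows "cochain_diff M E n \<W> c d \<in> cochains M E n \<W>"
 unfolding cochain_diff_def
proof (rule cochainI)
 fix ys assume ys: "ys \<in> simplices M n"
 show "(\<lambda>z\<in>overlap \<W> ys. c ys z \<ominus>\<^bsub>fib E z\<^esub> d ys z) \<in> sect E (overlap \<W> ys)"
  by (rule restrI[OF sect_minus[OF E overlap_open[OF W ys] cochain_sect_restrict[OF U(1) W U(2,3) ys]
  cochain_sect_restrict[OF V(1) W V(2,3) ys]]]) simp
qed

lemma coboundary_eq:
 assumes "is_cover M \<U>" "c \<in> cochains M E n \<U>" "ys \<in> simplices M (Suc n)" "z \<in> overlap \<U> ys"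
 shows "coboundary M E n \<U> c ys z = face_sum (fib E z) (%zs. c zs z) ys"
proof -
 interpret cvs "fib E z" by (rule fib_cvs[OF assms(1,3,4)])
 have "{..Suc n} = {..<length ys}" using assms(3) by (auto simp: simplices_def)
 then have "coboundary M E n \<U> c ys z =
  (\<Oplus>\<^bsub>fib E z\<^esub> k\<in>{..<length ys}. ((-1) ^ k) \<odot>\<^bsub>fib E z\<^esub> c (take k ys @ drop (Suc k) ys) z)"
  using assms(3,4) by (simp add: coboundary_def)
 also have "... = face_sum (fib E z) (%zs. c zs z) ys"
  by (rule finsum_faces_eq[where c = "%zs. c zs z", OF cochain_face_closed[OF assms]])
 finally show ?thesis .
qed

lemma coboundary_cochain:
 assumes U: "is_cover M \<U>" and c: "c \<in> cochains M E n \<U>"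
 shows "coboundary M E n \<U> c \<in> cochains M E (Suc n) \<U>"
 unfolding coboundary_def
proof (rule cochainI)
 fix ys assume ys: "ys \<in> simplices M (Suc n)"
 let ?O = "overlap \<U> ys"
 note O = overlap_open[OF U ys]
 have f: "take k ys @ drop (Suc k) ys \<in> faces ys" if "k < Suc (Suc n)" for k
  using that ys set_take_subset[of k ys] set_drop_subset[of "Suc k" ys]
  by (auto simp: faces_def simplices_def)
 have s: "(\<lambda>z\<in>?O. c (take k ys @ drop (Suc k) ys) z) \<in> sect E ?O" if "k < Suc (Suc n)" for k
  using sect_restrict[OF E overlap_open[OF U simplices_face[OF ys f[OF that]]] O overlap_face[OF f[OF that]]
  cochain_sect[OF c simplices_face[OF ys f[OF that]]]] .
 show "(\<lambda>z\<in>?O. \<Oplus>\<^bsub>fib E z\<^esub> k\<in>{..Suc n}. ((-1) ^ k) \<odot>\<^bsub>fib E z\<^esub> c (take k ys @ drop (Suc k) ys) z) \<in> sect E ?O"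
  unfolding lessThan_Suc_atMost[symmetric]
 proof (rule restrI[OF sect_combination[OF E O hol_const s, where n = "Suc (Suc n)"]])
  fix z assume z: "z \<in> ?O"
  interpret cvs "fib E z" by (rule fib_cvs[OF U ys z])
  show "(\<Oplus>\<^bsub>fib E z\<^esub> k\<in>{..<Suc (Suc n)}. ((-1) ^ k) \<odot>\<^bsub>fib E z\<^esub> c (take k ys @ drop (Suc k) ys) z) =
  (\<Oplus>\<^bsub>fib E z\<^esub> k\<in>{..<Suc (Suc n)}. (\<lambda>z\<in>?O. (-1) ^ k) z \<odot>\<^bsub>fib E z\<^esub>
  (\<lambda>z\<in>?O. c (take k ys @ drop (Suc k) ys) z) z)"
  using z by simp
 qed simp
qed

lemma zero_cochain_cochain: "is_cover M \<U> ==> zero_cochain M E n \<U> \<in> cochains M E n \<U>"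
 unfolding zero_cochain_def by (rule cochainI) (rule sect_zero[OF E overlap_open])

lemma zero_cochain_eq: "ys \<in> simplices M n ==> z \<in> overlap \<U> ys ==> zero_cochain M E n \<U> ys z = \<zero>\<^bsub>fib E z\<^esub>"
 by (simp add: zero_cochain_def)

lemma coboundary_coboundary:
 assumes U: "is_cover M \<U>" and c: "c \<in> cochains M E n \<U>"
 shows "coboundary M E (Suc n) \<U> (coboundary M E n \<U> c) = zero_cochain M E (Suc (Suc n)) \<U>"
proof (rule cochain_eqI[OF coboundary_cochain[OF U coboundary_cochain[OF U c]] zero_cochain_cochain[OF U] E U])
 fix ys z assume ys: "ys \<in> simplices M (Suc (Suc n))" and z: "z \<in> overlap \<U> ys"
 interpret cvs "fib E z" by (rule fib_cvs[OF U ys z])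
 have "coboundary M E (Suc n) \<U> (coboundary M E n \<U> c) ys z =
  face_sum (fib E z) (%zs. coboundary M E n \<U> c zs z) ys"
  by (rule coboundary_eq[OF U coboundary_cochain[OF U c] ys z])
 also have "... = face_sum (fib E z) (face_sum (fib E z) (%zs. c zs z)) ys"
 proof (rule face_sum_cong)
  fix zs assume zs: "zs \<in> faces ys"
  show "coboundary M E n \<U> c zs z = face_sum (fib E z) (%zs. c zs z) zs"
  using coboundary_eq[OF U c simplices_face[OF ys zs]] overlap_face[OF zs] z by blast
 qed
 also have "... = \<zero>\<^bsub>fib E z\<^esub>"
 proof (rule face_sum_face_sum)
  fix zs assume zs: "Suc (Suc (length zs)) = length ys" "set zs <= set ys"
  then have "zs \<in> simplices M n" using ys by (auto simp: simplices_def)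
  moreover have "z \<in> overlap \<U> zs" using overlap_mono[OF zs(2)] z by blast
  ultimately show "c zs z \<in> carrier (fib E z)" by (rule cochain_closed[OF U c])
 qed
 finally show "coboundary M E (Suc n) \<U> (coboundary M E n \<U> c) ys z = zero_cochain M E (Suc (Suc n)) \<U> ys z"
  by (simp add: zero_cochain_eq[OF ys z])
qed

lemma coboundary_diff:
 assumes W: "is_cover M \<W>" and U: "is_cover M \<U>" "refines M \<W> \<U>" "c \<in> cochains M E n \<U>"
  and V: "is_cover M \<V>" "refines M \<W> \<V>" "d \<in> cochains M E n \<V>"
 shows "coboundary M E n \<W> (cochain_diff M E n \<W> c d) =
  cochain_diff M E (Suc n) \<W> (coboundary M E n \<U> c) (coboundary M E n \<V> d)"
proof (rule cochain_eqI[OF coboundary_cochain[OF W cochain_diff_cochain[OF W U V]]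
  cochain_diff_cochain[OF W U(1,2) coboundary_cochain[OF U(1,3)] V(1,2) coboundary_cochain[OF V(1,3)]] E W])
 fix ys z assume ys: "ys \<in> simplices M (Suc n)" and z: "z \<in> overlap \<W> ys"
 interpret cvs "fib E z" by (rule fib_cvs[OF W ys z])
 have zU: "z \<in> overlap \<U> ys" and zV: "z \<in> overlap \<V> ys"
  using z overlap_refine[OF U(2) ys] overlap_refine[OF V(2) ys] by auto
 have "coboundary M E n \<W> (cochain_diff M E n \<W> c d) ys z =
  face_sum (fib E z) (%zs. cochain_diff M E n \<W> c d zs z) ys"
  by (rule coboundary_eq[OF W cochain_diff_cochain[OF W U V] ys z])
 also have "... = face_sum (fib E z) (%zs. c zs z \<ominus>\<^bsub>fib E z\<^esub> d zs z) ys"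
  using z overlap_face[of _ ys \<W>] simplices_face[OF ys]
  by (intro face_sum_cong) (simp add: cochain_diff_def subset_iff)
 also have "... = coboundary M E n \<U> c ys z \<ominus>\<^bsub>fib E z\<^esub> coboundary M E n \<V> d ys z"
  unfolding coboundary_eq[OF U(1,3) ys zU] coboundary_eq[OF V(1,3) ys zV]
  by (rule face_sum_minus[OF cochain_face_closed[OF U(1,3) ys zU] cochain_face_closed[OF V(1,3) ys zV]])
 finally show "coboundary M E n \<W> (cochain_diff M E n \<W> c d) ys z =
  cochain_diff M E (Suc n) \<W> (coboundary M E n \<U> c) (coboundary M E n \<V> d) ys z"
  using ys z by (simp add: cochain_diff_def)
qed

lemma coboundary_restrict:
 assumes W: "is_cover M \<W>" and U: "is_cover M \<U>" "refines M \<W> \<U>" "c \<in> cochains M E n \<U>"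
 shows "coboundary M E n \<W> (cochain_restrict M n \<W> c) = cochain_restrict M (Suc n) \<W> (coboundary M E n \<U> c)"
proof (rule cochain_eqI[OF coboundary_cochain[OF W cochain_restrict_cochain[OF U(1) W U(2,3)]]
  cochain_restrict_cochain[OF U(1) W U(2) coboundary_cochain[OF U(1,3)]] E W])
 fix ys z assume ys: "ys \<in> simplices M (Suc n)" and z: "z \<in> overlap \<W> ys"
 have zU: "z \<in> overlap \<U> ys" using z overlap_refine[OF U(2) ys] by auto
 have "coboundary M E n \<W> (cochain_restrict M n \<W> c) ys z =
  face_sum (fib E z) (%zs. cochain_restrict M n \<W> c zs z) ys"
  by (rule coboundary_eq[OF W cochain_restrict_cochain[OF U(1) W U(2,3)] ys z])
 also have "... = face_sum (fib E z) (%zs. c zs z) ys"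
  using z overlap_face[of _ ys \<W>] simplices_face[OF ys]
  by (intro face_sum_cong) (simp add: cochain_restrict_def subset_iff)
 also have "... = coboundary M E n \<U> c ys z" by (rule coboundary_eq[OF U(1,3) ys zU, symmetric])
 finally show "coboundary M E n \<W> (cochain_restrict M n \<W> c) ys z =
  cochain_restrict M (Suc n) \<W> (coboundary M E n \<U> c) ys z"
  using ys z by (simp add: cochain_restrict_def)
qed

lemma zero_cochain_diff: "is_cover M \<W> ==> refines M \<W> \<U> ==> refines M \<W> \<V> ==>
  cochain_diff M E n \<W> (zero_cochain M E n \<U>) (zero_cochain M E n \<V>) = zero_cochain M E n \<W>"
proof -
 assume W: "is_cover M \<W>" and s: "refines M \<W> \<U>" "refines M \<W> \<V>"
 show ?thesis
  unfolding cochain_diff_def zero_cochain_def[of M E n \<W>]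
 proof (intro restrict_ext)
  fix ys z assume ys: "ys \<in> simplices M n" and z: "z \<in> overlap \<W> ys"
  interpret cvs "fib E z" by (rule fib_cvs[OF W ys z])
  show "zero_cochain M E n \<U> ys z \<ominus>\<^bsub>fib E z\<^esub> zero_cochain M E n \<V> ys z = \<zero>\<^bsub>fib E z\<^esub>"
  using ys z overlap_refine[OF s(1) ys] overlap_refine[OF s(2) ys]
  by (simp add: zero_cochain_eq subset_iff minus_self)
 qed
qed

lemma coboundary_cochain':
 "is_cover M \<U> ==> b \<in> coboundaries M E n \<U> ==> b \<in> cochains M E n \<U>"
 by (cases n) (auto intro: zero_cochain_cochain coboundary_cochain)

lemma coboundaries_diff:
 assumes W: "is_cover M \<W>" and U: "is_cover M \<U>" "refines M \<W> \<U>" "c \<in> coboundaries M E n \<U>"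
  and V: "is_cover M \<V>" "refines M \<W> \<V>" "d \<in> coboundaries M E n \<V>"
 shows "cochain_diff M E n \<W> c d \<in> coboundaries M E n \<W>"
proof (cases n)
 case 0
 then show ?thesis using U V W by (simp add: zero_cochain_diff)
next
 case (Suc m)
 then obtain a b where "a \<in> cochains M E m \<U>" "c = coboundary M E m \<U> a"
  "b \<in> cochains M E m \<V>" "d = coboundary M E m \<V> b" using U(3) V(3) by auto
 then show ?thesis
  using cochain_diff_cochain[OF W U(1,2) _ V(1,2), of a m b] coboundary_diff[OF W U(1,2) _ V(1,2), of a m b] Suc
  by (metis coboundaries.simps(2) image_eqI)
qed

lemma cochain_diff_self:
 assumes W: "is_cover M \<W>" and c: "c \<in> cochains M E n \<W>"
 shows "cochain_diff M E n \<W> c c = zero_cochain M E n \<W>"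
 unfolding cochain_diff_def zero_cochain_def
proof (intro restrict_ext)
 fix ys z assume ys: "ys \<in> simplices M n" and z: "z \<in> overlap \<W> ys"
 interpret cvs "fib E z" by (rule fib_cvs[OF W ys z])
 show "c ys z \<ominus>\<^bsub>fib E z\<^esub> c ys z = \<zero>\<^bsub>fib E z\<^esub>"
  using cochain_closed[OF W c ys z] by (rule minus_self)
qed

lemma coboundary_zero:
 assumes W: "is_cover M \<W>"
 shows "coboundary M E n \<W> (zero_cochain M E n \<W>) = zero_cochain M E (Suc n) \<W>"
proof -
 note z = zero_cochain_cochain[OF W, of n]
 have r: "refines M \<W> \<W>" by simp
 show ?thesis
  using coboundary_diff[OF W W r z W r z] zero_cochain_diff[OF W r r, of n]
  cochain_diff_self[OF W coboundary_cochain[OF W z]] by simp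
qed

lemma zero_coboundary: "is_cover M \<W> ==> zero_cochain M E n \<W> \<in> coboundaries M E n \<W>"
 using coboundary_zero zero_cochain_cochain by (cases n) (auto intro!: image_eqI[where f = "coboundary M E _ \<W>", OF sym])

lemma cohomologous_iff:
 "cohomologous M E n \<U> c \<V> d \<longleftrightarrow> (\<exists>\<W>. is_cover M \<W> \<and> (\<forall>y\<in>points M. \<W> y <= \<U> y \<inter> \<V> y) \<and>
  cochain_diff M E n \<W> c d \<in> coboundaries M E n \<W>)"
 by (simp add: cohomologous_def cochain_diff_def)

end

end

lemma (in cvs) minus_minus_cancel:
 "a \<in> carrier V ==> b \<in> carrier V ==> e \<in> carrier V ==> (a \<ominus> b) \<ominus> (e \<ominus> b) = a \<ominus> e"
 by (simp add: minus_eq minus_add a_ac r_neg1 r_neg2)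

lemma cocycleD: "c \<in> cocycles M E n \<U> ==> c \<in> cochains M E n \<U>"
 by (simp add: cocycles_def)

lemma cocycle_coboundary: "c \<in> cocycles M E n \<U> ==> coboundary M E n \<U> c = zero_cochain M E (Suc n) \<U>"
 by (simp add: cocycles_def)

lemma is_cover_Int: "is_cover M \<U> ==> is_cover M \<V> ==> is_cover M (%y. \<U> y \<inter> \<V> y)"
 by (auto simp: is_cover_def)

text \<open>A section \<tau> of \<open>q\<close> and a retraction \<rho> of \<open>i\<close> over
  \<open>U\<close>. The last condition makes them complementary: \<open>i (\<rho> e)\<close> is what
  remains of \<open>e\<close> after \<open>\<tau> (q e)\<close> is removed.\<close>

definition split_on :: "'y manifold => 'y set => ('y, 'e) vbundle => ('y, 'f) vbundle => ('y, 'g) vbundle =>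
  ('y => 'e => 'f) => ('y => 'f => 'g) => ('y => 'g => 'f) => ('y => 'f => 'e) => bool" where
 "split_on M U E' E E'' i q \<tau> \<rho> \<longleftrightarrow>
  morph_on M U E'' E \<tau> \<and> morph_on M U E E' \<rho> \<and>
  (\<forall>y\<in>U. (\<forall>w\<in>carrier (fib E'' y). q y (\<tau> y w) = w) \<and> (\<forall>v\<in>carrier (fib E' y). \<rho> y (i y v) = v) \<and>
  (\<forall>v\<in>carrier (fib E' y). q y (i y v) = \<zero>\<^bsub>fib E'' y\<^esub>) \<and>
  (\<forall>e\<in>carrier (fib E y). i y (\<rho> y e) \<oplus>\<^bsub>fib E y\<^esub> \<tau> y (q y e) = e))"

lemma split_on_subset: "split_on M U E' E E'' i q \<tau> \<rho> ==> V <= U ==> split_on M V E' E E'' i q \<tau> \<rho>"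
 unfolding split_on_def by (auto intro: morph_on_subset)

section \<open>Cohomology classes and their representatives\<close>

context chart_space
begin

context
 fixes E :: "('y, 'e) vbundle"
 assumes E: "presheaf M E"
begin

lemma cocycle_restrict:
 assumes "is_cover M \<U>" "is_cover M \<W>" "refines M \<W> \<U>" "c \<in> cocycles M E n \<U>"
 shows "cochain_restrict M n \<W> c \<in> cocycles M E n \<W>"
proof -
 note c = cocycleD[OF assms(4)]
 have "cochain_restrict M (Suc n) \<W> (zero_cochain M E (Suc n) \<U>) = zero_cochain M E (Suc n) \<W>"
  unfolding cochain_restrict_def zero_cochain_def[of M E "Suc n" \<W>]
  using overlap_refine[OF assms(3)] by (intro restrict_ext) (simp add: zero_cochain_eq[OF E] subset_iff)
 then show ?thesis
  unfolding cocycles_def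
  using cochain_restrict_cochain[OF E assms(1-3) c] coboundary_restrict[OF E assms(2,1,3) c]
  by (simp add: cocycle_coboundary[OF assms(4)])
qed

lemma cohomologous_refl:
 assumes "is_cover M \<U>" "c \<in> cochains M E n \<U>"
 shows "cohomologous M E n \<U> c \<U> c"
 unfolding cohomologous_iff[OF E]
 using cochain_diff_self[OF E assms] zero_coboundary[OF E assms(1)] assms(1)
 by (intro exI[of _ \<U>]) simp

text \<open>On the intersection of the two refinements \<open>(c - d) - (e - d) = c - e\<close>.
  Combined with reflexivity this one rule yields symmetry and transitivity.\<close>

lemma cohomologous_common:
 assumes U: "is_cover M \<U>" "c \<in> cochains M E n \<U>" and V: "is_cover M \<V>" "d \<in> cochains M E n \<V>"
  and X: "is_cover M \<X>" "e \<in> cochains M E n \<X>"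
  and cd: "cohomologous M E n \<U> c \<V> d" and ed: "cohomologous M E n \<X> e \<V> d"
 shows "cohomologous M E n \<U> c \<X> e"
proof -
 obtain \<W>1 where W1: "is_cover M \<W>1" "\<forall>y\<in>points M. \<W>1 y <= \<U> y \<inter> \<V> y"
  "cochain_diff M E n \<W>1 c d \<in> coboundaries M E n \<W>1" using cd unfolding cohomologous_iff[OF E] by blast
 obtain \<W>2 where W2: "is_cover M \<W>2" "\<forall>y\<in>points M. \<W>2 y <= \<X> y \<inter> \<V> y"
  "cochain_diff M E n \<W>2 e d \<in> coboundaries M E n \<W>2" using ed unfolding cohomologous_iff[OF E] by blast
 define \<W> where "\<W> = (%y. \<W>1 y \<inter> \<W>2 y)"
 have W: "is_cover M \<W>" unfolding \<W>_def by (rule is_cover_Int[OF W1(1) W2(1)])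
 have s: "\<forall>y\<in>points M. \<W> y <= \<W>1 y" "\<forall>y\<in>points M. \<W> y <= \<W>2 y"
  "refines M \<W> \<U>" "refines M \<W> \<V>" "refines M \<W> \<X>"
  using W1(2) W2(2) unfolding \<W>_def by blast+
 have "cochain_diff M E n \<W> (cochain_diff M E n \<W>1 c d) (cochain_diff M E n \<W>2 e d) =
  cochain_diff M E n \<W> c e"
  unfolding cochain_diff_def[of M E n \<W>]
 proof (intro restrict_ext)
  fix ys z assume ys: "ys \<in> simplices M n" and z: "z \<in> overlap \<W> ys"
  note r = subsetD[OF overlap_refine[OF s(1) ys] z] subsetD[OF overlap_refine[OF s(2) ys] z]
  subsetD[OF overlap_refine[OF s(3) ys] z] subsetD[OF overlap_refine[OF s(4) ys] z]
  subsetD[OF overlap_refine[OF s(5) ys] z]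
  interpret cvs "fib E z" by (rule fib_cvs[OF E W ys z])
  show "cochain_diff M E n \<W>1 c d ys z \<ominus>\<^bsub>fib E z\<^esub> cochain_diff M E n \<W>2 e d ys z = c ys z \<ominus>\<^bsub>fib E z\<^esub> e ys z"
  using minus_minus_cancel[OF cochain_closed[OF E U ys r(3)] cochain_closed[OF E V ys r(4)]
  cochain_closed[OF E X ys r(5)]] ys r by (simp add: cochain_diff_def)
 qed
 moreover have "cochain_diff M E n \<W> (cochain_diff M E n \<W>1 c d) (cochain_diff M E n \<W>2 e d)
  \<in> coboundaries M E n \<W>"
  by (rule coboundaries_diff[OF E W W1(1) s(1) W1(3) W2(1) s(2) W2(3)])
 ultimately show ?thesis
  unfolding cohomologous_iff[OF E] using W s(3,5) by (intro exI[of _ \<W>]) auto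
qed

lemma cohomologous_sym:
 assumes "is_cover M \<U>" "c \<in> cochains M E n \<U>" "is_cover M \<V>" "d \<in> cochains M E n \<V>"
  and "cohomologous M E n \<U> c \<V> d"
 shows "cohomologous M E n \<V> d \<U> c"
 by (rule cohomologous_common[OF assms(3,4,3,4,1,2) cohomologous_refl[OF assms(3,4)] assms(5)])

lemma coclass_eqI:
 assumes U: "is_cover M \<U>" "c \<in> cochains M E n \<U>" and V: "is_cover M \<V>" "d \<in> cochains M E n \<V>"
  and cd: "cohomologous M E n \<U> c \<V> d"
 shows "coclass M E n \<U> c = coclass M E n \<V> d"
proof -
 note dc = cohomologous_sym[OF U V cd]
 have "cohomologous M E n \<U> c \<X> e \<longleftrightarrow> cohomologous M E n \<V> d \<X> e" if X: "is_cover M \<X>" "e \<in> cocycles M E n \<X>" for \<X> e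
 proof -
  note X' = X(1) cocycleD[OF X(2)]
  show ?thesis
  using cohomologous_common[OF V U X' dc cohomologous_sym[OF U X']]
  cohomologous_common[OF U V X' cd cohomologous_sym[OF V X']] by blast
 qed
 then show ?thesis unfolding coclass_def by auto
qed

lemma coclass_mem: "is_cover M \<U> ==> c \<in> cocycles M E n \<U> ==> (\<U>, c) \<in> coclass M E n \<U> c"
 unfolding coclass_def using cohomologous_refl cocycleD by blast

lemma coclass_memD:
 assumes "(\<V>, d) \<in> coclass M E n \<U> c"
 shows "is_cover M \<V>" "d \<in> cocycles M E n \<V>" "cohomologous M E n \<U> c \<V> d"
 using assms unfolding coclass_def by auto

lemma cohomologous_restrict:
 assumes "is_cover M \<U>" "is_cover M \<W>" "refines M \<W> \<U>" "c \<in> cochains M E n \<U>"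
 shows "cohomologous M E n \<W> (cochain_restrict M n \<W> c) \<U> c"
proof -
 have "cochain_diff M E n \<W> (cochain_restrict M n \<W> c) c = zero_cochain M E n \<W>"
  unfolding cochain_diff_def zero_cochain_def
 proof (intro restrict_ext)
  fix ys z assume ys: "ys \<in> simplices M n" and z: "z \<in> overlap \<W> ys"
  interpret cvs "fib E z" by (rule fib_cvs[OF E assms(2) ys z])
  show "cochain_restrict M n \<W> c ys z \<ominus>\<^bsub>fib E z\<^esub> c ys z = \<zero>\<^bsub>fib E z\<^esub>"
  using minus_self[OF cochain_closed[OF E assms(1,4) ys subsetD[OF overlap_refine[OF assms(3) ys] z]]] ys z
  by (simp add: cochain_restrict_def)
 qed
 then show ?thesis
  unfolding cohomologous_iff[OF E] using assms zero_coboundary[OF E assms(2)]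
  by (intro exI[of _ \<W>]) auto
qed

text \<open>Allows the cover of a representative to be shrunk until a given sequence splits over
  each of its members.\<close>

lemma coclass_restrict:
 assumes "is_cover M \<U>" "is_cover M \<W>" "refines M \<W> \<U>" "c \<in> cochains M E n \<U>"
 shows "coclass M E n \<W> (cochain_restrict M n \<W> c) = coclass M E n \<U> c"
 by (rule coclass_eqI[OF assms(2) cochain_restrict_cochain[OF E assms] assms(1,4) cohomologous_restrict[OF assms]])

end

subsection \<open>Functoriality\<close>

context
 fixes E :: "('y, 'e) vbundle" and G :: "('y, 'f) vbundle" and \<phi>
 assumes E: "presheaf M E" and G: "presheaf M G"
  and \<phi>: "morph_on M (points M) E G \<phi>"
begin

lemma cochain_map_eq: "ys \<in> simplices M n ==> z \<in> overlap \<U> ys ==> cochain_map M n \<phi> \<U> c ys z = \<phi> z (c ys z)"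
 by (simp add: cochain_map_def)

lemma cochain_map_cochain:
 assumes U: "is_cover M \<U>" and c: "c \<in> cochains M E n \<U>"
 shows "cochain_map M n \<phi> \<U> c \<in> cochains M G n \<U>"
 unfolding cochain_map_def
proof (rule cochainI)
 fix ys assume ys: "ys \<in> simplices M n"
 show "(\<lambda>z\<in>overlap \<U> ys. \<phi> z (c ys z)) \<in> sect G (overlap \<U> ys)"
  by (rule morph_on_sect[OF \<phi> overlap_open[OF U ys] _ cochain_sect[OF c ys]])
  (use is_cover_points[OF U ys] in blast)
qed

lemma coboundary_map:
 assumes U: "is_cover M \<U>" and c: "c \<in> cochains M E n \<U>"
 shows "coboundary M G n \<U> (cochain_map M n \<phi> \<U> c) = cochain_map M (Suc n) \<phi> \<U> (coboundary M E n \<U> c)"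
proof (rule cochain_eqI[OF coboundary_cochain[OF G U cochain_map_cochain[OF U c]]
  cochain_map_cochain[OF U coboundary_cochain[OF E U c]] G U])
 fix ys z assume ys: "ys \<in> simplices M (Suc n)" and z: "z \<in> overlap \<U> ys"
 note zp = is_cover_points[OF U ys z]
 have "coboundary M G n \<U> (cochain_map M n \<phi> \<U> c) ys z =
  face_sum (fib G z) (%zs. cochain_map M n \<phi> \<U> c zs z) ys"
  by (rule coboundary_eq[OF G U cochain_map_cochain[OF U c] ys z])
 also have "... = face_sum (fib G z) (%zs. \<phi> z (c zs z)) ys"
  using z overlap_face[of _ ys \<U>] simplices_face[OF ys]
  by (intro face_sum_cong) (simp add: cochain_map_eq subset_iff)
 also have "... = \<phi> z (face_sum (fib E z) (%zs. c zs z) ys)"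
  by (rule face_sum_lin[OF morph_on_lin[OF \<phi> zp] presheaf_cvs[OF E zp] presheaf_cvs[OF G zp]
  cochain_face_closed[OF E U c ys z], symmetric])
 finally show "coboundary M G n \<U> (cochain_map M n \<phi> \<U> c) ys z =
  cochain_map M (Suc n) \<phi> \<U> (coboundary M E n \<U> c) ys z"
  using ys z by (simp add: cochain_map_eq coboundary_eq[OF E U c ys z])
qed

lemma cochain_map_zero:
 assumes U: "is_cover M \<U>"
 shows "cochain_map M n \<phi> \<U> (zero_cochain M E n \<U>) = zero_cochain M G n \<U>"
 unfolding cochain_map_def zero_cochain_def[of M G]
proof (intro restrict_ext)
 fix ys z assume ys: "ys \<in> simplices M n" and z: "z \<in> overlap \<U> ys"
 note zp = is_cover_points[OF U ys z]
 show "\<phi> z (zero_cochain M E n \<U> ys z) = \<zero>\<^bsub>fib G z\<^esub>"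
  using lin_zero[OF morph_on_lin[OF \<phi> zp] presheaf_cvs[OF E zp] presheaf_cvs[OF G zp]]
  by (simp add: zero_cochain_eq[OF E ys z])
qed

lemma coboundaries_map:
 assumes U: "is_cover M \<U>" and b: "b \<in> coboundaries M E n \<U>"
 shows "cochain_map M n \<phi> \<U> b \<in> coboundaries M G n \<U>"
proof (cases n)
 case 0
 then show ?thesis using b cochain_map_zero[OF U] by simp
next
 case (Suc m)
 then obtain a where a: "a \<in> cochains M E m \<U>" "b = coboundary M E m \<U> a" using b by auto
 then show ?thesis
  using coboundary_map[OF U a(1)] cochain_map_cochain[OF U a(1)] Suc
  by (metis coboundaries.simps(2) image_eqI)
qed

lemma cochain_map_diff:
 assumes W: "is_cover M \<W>" and U: "is_cover M \<U>" "refines M \<W> \<U>" "c \<in> cochains M E n \<U>"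
  and V: "is_cover M \<V>" "refines M \<W> \<V>" "d \<in> cochains M E n \<V>"
 shows "cochain_diff M G n \<W> (cochain_map M n \<phi> \<U> c) (cochain_map M n \<phi> \<V> d) =
  cochain_map M n \<phi> \<W> (cochain_diff M E n \<W> c d)"
 unfolding cochain_diff_def[of M G] cochain_map_def[of M n \<phi> \<W>]
proof (intro restrict_ext)
 fix ys z assume ys: "ys \<in> simplices M n" and z: "z \<in> overlap \<W> ys"
 note zp = is_cover_points[OF W ys z]
 note r = subsetD[OF overlap_refine[OF U(2) ys] z] subsetD[OF overlap_refine[OF V(2) ys] z]
 show "cochain_map M n \<phi> \<U> c ys z \<ominus>\<^bsub>fib G z\<^esub> cochain_map M n \<phi> \<V> d ys z = \<phi> z (cochain_diff M E n \<W> c d ys z)"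
  using lin_minus[OF morph_on_lin[OF \<phi> zp] presheaf_cvs[OF E zp] presheaf_cvs[OF G zp]
  cochain_closed[OF E U(1,3) ys r(1)] cochain_closed[OF E V(1,3) ys r(2)]] ys z r
  by (simp add: cochain_map_eq cochain_diff_def)
qed

text \<open>Another representative differs from \<open>c\<close> by a coboundary on a refinement,
  and \<phi> carries it to a coboundary; so the description in \<open>cohomology_map\<close> has a
  single value.\<close>

lemma cohomology_map_coclass:
 assumes U: "is_cover M \<U>" and c: "c \<in> cocycles M E n \<U>"
 shows "cohomology_map M G \<phi> n (coclass M E n \<U> c) = coclass M G n \<U> (cochain_map M n \<phi> \<U> c)"
 unfolding cohomology_map_def
proof (rule the_equality)
 show "\<exists>\<V> d. (\<V>, d) \<in> coclass M E n \<U> c \<and>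
  coclass M G n \<U> (cochain_map M n \<phi> \<U> c) = coclass M G n \<V> (cochain_map M n \<phi> \<V> d)"
  using coclass_mem[OF E U c] by blast
 fix \<eta> assume "\<exists>\<V> d. (\<V>, d) \<in> coclass M E n \<U> c \<and> \<eta> = coclass M G n \<V> (cochain_map M n \<phi> \<V> d)"
 then obtain \<V> d where Vd: "(\<V>, d) \<in> coclass M E n \<U> c" and \<eta>: "\<eta> = coclass M G n \<V> (cochain_map M n \<phi> \<V> d)"
  by blast
 note V = coclass_memD[OF E Vd]
 obtain \<W> where W: "is_cover M \<W>" "\<forall>y\<in>points M. \<W> y <= \<U> y \<inter> \<V> y"
  "cochain_diff M E n \<W> c d \<in> coboundaries M E n \<W>" using V(3) unfolding cohomologous_iff[OF E] by blast
 have s: "refines M \<W> \<U>" "refines M \<W> \<V>" using W(2) by auto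
 have "cohomologous M G n \<U> (cochain_map M n \<phi> \<U> c) \<V> (cochain_map M n \<phi> \<V> d)"
  unfolding cohomologous_iff[OF G]
  using W(1,2) coboundaries_map[OF W(1,3)]
  cochain_map_diff[OF W(1) U s(1) cocycleD[OF c] V(1) s(2) cocycleD[OF V(2)]]
  by (intro exI[of _ \<W>]) simp
 then show "\<eta> = coclass M G n \<U> (cochain_map M n \<phi> \<U> c)"
  unfolding \<eta> using coclass_eqI[OF G U cochain_map_cochain[OF U cocycleD[OF c]]
  V(1) cochain_map_cochain[OF V(1) cocycleD[OF V(2)]]] by simp
qed

end

subsection \<open>The connecting homomorphism of a locally split sequence\<close>

text \<open>An overlap lies in the cover member of its first vertex, so the local map chosen at that
  vertex is defined there. The choice of the first vertex fixes all signs later on.\<close>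

lemma vertex_map_cochain:
 assumes E: "presheaf M E" and U: "is_cover M \<U>" and c: "c \<in> cochains M E n \<U>"
  and \<tau>: "!!y. y \<in> points M ==> morph_on M (\<U> y) E G (\<tau> y)"
 shows "(\<lambda>ys\<in>simplices M n. \<lambda>z\<in>overlap \<U> ys. \<tau> (hd ys) z (c ys z)) \<in> cochains M G n \<U>"
proof (rule cochainI)
 fix ys assume ys: "ys \<in> simplices M n"
 then have h: "hd ys \<in> set ys" "hd ys \<in> points M" by (cases ys; auto simp: simplices_def)+
 show "(\<lambda>z\<in>overlap \<U> ys. \<tau> (hd ys) z (c ys z)) \<in> sect G (overlap \<U> ys)"
  by (rule morph_on_sect[OF \<tau>[OF h(2)] overlap_open[OF U ys] _ cochain_sect[OF c ys]])
  (use h in \<open>auto simp: overlap_def\<close>)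
qed

context
 fixes E' :: "('y, 'e) vbundle" and E :: "('y, 'f) vbundle" and E'' :: "('y, 'g) vbundle"
  and i q \<U> \<tau> \<rho>
 assumes E': "presheaf M E'" and E: "presheaf M E" and E'': "presheaf M E''"
  and i: "morph_on M (points M) E' E i" and q: "morph_on M (points M) E E'' q"
  and U: "is_cover M \<U>"
  and split: "\<forall>y\<in>points M. split_on M (\<U> y) E' E E'' i q (\<tau> y) (\<rho> y)"
begin

lemma split_vertex:
 assumes "ys \<in> simplices M n" "z \<in> overlap \<U> ys" "y \<in> set ys"
 shows "lin (fib E'' z) (fib E z) (\<tau> y z)" "lin (fib E z) (fib E' z) (\<rho> y z)"
  "w \<in> carrier (fib E'' z) ==> q z (\<tau> y z w) = w" "v \<in> carrier (fib E' z) ==> \<rho> y z (i z v) = v"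
  "v \<in> carrier (fib E' z) ==> q z (i z v) = \<zero>\<^bsub>fib E'' z\<^esub>"
  "e \<in> carrier (fib E z) ==> i z (\<rho> y z e) \<oplus>\<^bsub>fib E z\<^esub> \<tau> y z (q z e) = e"
proof -
 have y: "y \<in> points M" "z \<in> \<U> y" using assms by (auto simp: simplices_def overlap_def)
 from bspec[OF split y(1)] y(2) show "lin (fib E'' z) (fib E z) (\<tau> y z)" "lin (fib E z) (fib E' z) (\<rho> y z)"
  "w \<in> carrier (fib E'' z) ==> q z (\<tau> y z w) = w" "v \<in> carrier (fib E' z) ==> \<rho> y z (i z v) = v"
  "v \<in> carrier (fib E' z) ==> q z (i z v) = \<zero>\<^bsub>fib E'' z\<^esub>"
  "e \<in> carrier (fib E z) ==> i z (\<rho> y z e) \<oplus>\<^bsub>fib E z\<^esub> \<tau> y z (q z e) = e"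
  unfolding split_on_def by (auto dest: morph_on_lin)
qed

lemma hd_in_simplex: "ys \<in> simplices M n ==> hd ys \<in> set ys"
 by (cases ys) (auto simp: simplices_def)

lemma points_lin:
 assumes "is_cover M \<W>" "ys \<in> simplices M n" "z \<in> overlap \<W> ys"
 shows "lin (fib E' z) (fib E z) (i z)" "lin (fib E z) (fib E'' z) (q z)"
 using is_cover_points[OF assms] morph_on_lin[OF i] morph_on_lin[OF q] by blast+

text \<open>The retraction at any vertex of the simplex gives injectivity of \<open>i\<close> on the
  fibre.\<close>

lemma incl_eq_iff:
 assumes "ys \<in> simplices M n" "z \<in> overlap \<U> ys" "v \<in> carrier (fib E' z)" "v' \<in> carrier (fib E' z)"
  "i z v = i z v'"
 shows "v = v'"
 using split_vertex(4)[OF assms(1,2) hd_in_simplex[OF assms(1)]] assms(3-5) by metis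

text \<open>Where \<open>q\<close> kills \<open>c\<close>, the splitting identity reduces to
  \<open>i (\<rho> c) = c\<close>, so applying \<rho> at the first vertex gives the
  preimage.\<close>

lemma kernel_lift:
 assumes c: "c \<in> cochains M E n \<U>" and qc: "cochain_map M n q \<U> c = zero_cochain M E'' n \<U>"
 obtains a where "a \<in> cochains M E' n \<U>" "cochain_map M n i \<U> a = c"
proof -
 define a where "a = (\<lambda>ys\<in>simplices M n. \<lambda>z\<in>overlap \<U> ys. \<rho> (hd ys) z (c ys z))"
 have a: "a \<in> cochains M E' n \<U>"
  unfolding a_def by (rule vertex_map_cochain[OF E U c]) (use split in \<open>simp add: split_on_def\<close>)
 moreover have "cochain_map M n i \<U> a = c"
 proof (rule cochain_eqI[OF cochain_map_cochain[OF E' E i U a] c E U])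
  fix ys z assume ys: "ys \<in> simplices M n" and z: "z \<in> overlap \<U> ys"
  note s = split_vertex[OF ys z hd_in_simplex[OF ys]]
  interpret cvs "fib E z" by (rule fib_cvs[OF E U ys z])
  have cz: "c ys z \<in> carrier (fib E z)" by (rule cochain_closed[OF E U c ys z])
  have "q z (c ys z) = \<zero>\<^bsub>fib E'' z\<^esub>"
  using fun_cong[OF fun_cong[OF qc, of ys], of z] ys z by (simp add: cochain_map_def zero_cochain_eq[OF E''])
  moreover have "\<tau> (hd ys) z \<zero>\<^bsub>fib E'' z\<^esub> = \<zero>\<^bsub>fib E z\<^esub>"
  by (rule lin_zero[OF s(1)]) (use is_cover_points[OF U ys z] presheaf_cvs[OF E] presheaf_cvs[OF E''] in auto)
  moreover have "i z (\<rho> (hd ys) z (c ys z)) \<in> carrier (fib E z)"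
  by (rule lin_closed[OF points_lin(1)[OF U ys z] lin_closed[OF s(2) cz]])
  ultimately have "i z (\<rho> (hd ys) z (c ys z)) = c ys z" using s(6)[OF cz] by simp
  then show "cochain_map M n i \<U> a ys z = c ys z" using ys z by (simp add: cochain_map_def a_def)
 qed
 ultimately show thesis by (rule that)
qed

text \<open>The formula for the lift is kept in the conclusion, since the explicit form of its
  coboundary is required in \<open>connecting_coclass\<close>.\<close>

lemma lift_cochain:
 assumes c: "c \<in> cochains M E'' n \<U>"
 obtains e where "e \<in> cochains M E n \<U>" "cochain_map M n q \<U> e = c"
  "\<forall>ys\<in>simplices M n. \<forall>z\<in>overlap \<U> ys. e ys z = \<tau> (hd ys) z (c ys z)"
proof -
 define e where "e = (\<lambda>ys\<in>simplices M n. \<lambda>z\<in>overlap \<U> ys. \<tau> (hd ys) z (c ys z))"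
 have e: "e \<in> cochains M E n \<U>"
  unfolding e_def by (rule vertex_map_cochain[OF E'' U c]) (use split in \<open>simp add: split_on_def\<close>)
 moreover have "cochain_map M n q \<U> e = c"
 proof (rule cochain_eqI[OF cochain_map_cochain[OF E E'' q U e] c E'' U])
  fix ys z assume ys: "ys \<in> simplices M n" and z: "z \<in> overlap \<U> ys"
  show "cochain_map M n q \<U> e ys z = c ys z"
  using split_vertex(3)[OF ys z hd_in_simplex[OF ys] cochain_closed[OF E'' U c ys z]] ys z
  by (simp add: cochain_map_def e_def)
 qed
 ultimately show thesis using that by (simp add: e_def)
qed

text \<open>A coboundary lifts to a cocycle, namely to the coboundary of a lift of its primitive. In
  degree zero the only coboundary is zero.\<close>

lemma lift_coboundary:
 assumes b: "b \<in> coboundaries M E'' n \<U>"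
 obtains h where "h \<in> cocycles M E n \<U>" "cochain_map M n q \<U> h = b"
proof (cases n)
 case 0
 have "zero_cochain M E 0 \<U> \<in> cocycles M E 0 \<U>"
  unfolding cocycles_def using zero_cochain_cochain[OF E U] coboundary_zero[OF E U] by blast
 then show thesis
  using that[of "zero_cochain M E 0 \<U>"] cochain_map_zero[OF E E'' q U, of 0] b 0 by simp
next
 case (Suc m)
 then obtain a where a: "a \<in> cochains M E'' m \<U>" "b = coboundary M E'' m \<U> a" using b by auto
 obtain e where e: "e \<in> cochains M E m \<U>" "cochain_map M m q \<U> e = a" by (rule lift_cochain[OF a(1)])
 have "coboundary M E m \<U> e \<in> cocycles M E n \<U>"
  unfolding cocycles_def Suc using coboundary_cochain[OF E U e(1)] coboundary_coboundary[OF E U e(1)] by blast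
 moreover have "cochain_map M n q \<U> (coboundary M E m \<U> e) = b"
  using coboundary_map[OF E E'' q U e(1)] a e Suc by simp
 ultimately show thesis by (rule that)
qed

end

end

context chart_space
begin

lemma cochain_diff_zero:
 assumes E: "presheaf M E" and W: "is_cover M \<W>" and c: "c \<in> cochains M E n \<W>"
 shows "cochain_diff M E n \<W> c (zero_cochain M E n \<W>) = c"
proof (rule cochain_eqI[OF cochain_diff_cochain[OF E W W _ c W _ zero_cochain_cochain[OF E W]] c E W])
 fix ys z assume ys: "ys \<in> simplices M n" and z: "z \<in> overlap \<W> ys"
 interpret cvs "fib E z" by (rule fib_cvs[OF E W ys z])
 show "cochain_diff M E n \<W> c (zero_cochain M E n \<W>) ys z = c ys z"
  using minus_zero_right[OF cochain_closed[OF E W c ys z]] ys z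
  by (simp add: cochain_diff_def zero_cochain_eq[OF E])
qed simp_all

text \<open>The definition of \<open>connecting\<close> ranges over representatives on arbitrary
  covers. The splittings over \<U> restrict to a common refinement \<W>, where the usual comparison
  is made: the \<open>q\<close>-images of \<open>c\<close> and \<open>d\<close> differ by a
  coboundary, and correcting by a cocycle above it leaves a cochain coming from \<open>E'\<close>
  whose coboundary is \<open>c' - d'\<close>.\<close>

lemma connecting_unique:
 fixes E' :: "('y, 'e) vbundle" and E :: "('y, 'f) vbundle" and E'' :: "('y, 'g) vbundle"
 assumes E': "presheaf M E'" and E: "presheaf M E" and E'': "presheaf M E''"
  and i: "morph_on M (points M) E' E i" and q: "morph_on M (points M) E E'' q"
  and U: "is_cover M \<U>"
  and split: "\<forall>y\<in>points M. split_on M (\<U> y) E' E E'' i q (\<tau> y) (\<rho> y)"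
  and V: "is_cover M \<V>" and cd: "cohomologous M E'' n \<U> (cochain_map M n q \<U> c) \<V> (cochain_map M n q \<V> d)"
  and c: "c \<in> cochains M E n \<U>" and c': "c' \<in> cochains M E' (Suc n) \<U>"
  "cochain_map M (Suc n) i \<U> c' = coboundary M E n \<U> c"
  and d: "d \<in> cochains M E n \<V>" and d': "d' \<in> cochains M E' (Suc n) \<V>"
  "cochain_map M (Suc n) i \<V> d' = coboundary M E n \<V> d"
 shows "coclass M E' (Suc n) \<V> d' = coclass M E' (Suc n) \<U> c'"
proof -
 obtain \<W> where W: "is_cover M \<W>" "\<forall>y\<in>points M. \<W> y <= \<U> y \<inter> \<V> y" and
  b: "cochain_diff M E'' n \<W> (cochain_map M n q \<U> c) (cochain_map M n q \<V> d) \<in> coboundaries M E'' n \<W>"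
  using cd unfolding cohomologous_iff[OF E''] by blast
 have s: "refines M \<W> \<U>" "refines M \<W> \<V>" "refines M \<W> \<W>" using W(2) by auto
 have splitW: "\<forall>y\<in>points M. split_on M (\<W> y) E' E E'' i q (\<tau> y) (\<rho> y)"
  using split_on_subset[OF bspec[OF split]] s(1) by blast
 define f0 where "f0 = cochain_diff M E n \<W> c d"
 have f0: "f0 \<in> cochains M E n \<W>" unfolding f0_def by (rule cochain_diff_cochain[OF E W(1) U s(1) c V s(2) d])
 \<comment> \<open>A cocycle \<open>h\<close> above the coboundary by which the two
   \<open>q\<close>-images differ: subtracting it changes no coboundary.\<close>
 obtain h where h: "h \<in> cocycles M E n \<W>"
  "cochain_map M n q \<W> h = cochain_diff M E'' n \<W> (cochain_map M n q \<U> c) (cochain_map M n q \<V> d)"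
  by (rule lift_coboundary[OF E' E E'' i q W(1) splitW b])
 note h' = cocycleD[OF h(1)]
 have qf0: "cochain_map M n q \<W> f0 = cochain_map M n q \<W> h"
  unfolding f0_def h(2) by (rule cochain_map_diff[OF E E'' q W(1) U s(1) c V s(2) d, symmetric])
 \<comment> \<open>Killed by \<open>q\<close>, hence the image of a cochain \<open>a\<close> of
   \<open>E'\<close>, and with the same coboundary as \<open>c - d\<close>.\<close>
 define f where "f = cochain_diff M E n \<W> f0 h"
 have f: "f \<in> cochains M E n \<W>" unfolding f_def by (rule cochain_diff_cochain[OF E W(1) W(1) s(3) f0 W(1) s(3) h'])
 have "cochain_map M n q \<W> f = zero_cochain M E'' n \<W>"
  unfolding f_def using cochain_map_diff[OF E E'' q W(1) W(1) s(3) f0 W(1) s(3) h']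
  cochain_diff_self[OF E'' W(1) cochain_map_cochain[OF E E'' q W(1) h']] by (simp add: qf0)
 then obtain a where a: "a \<in> cochains M E' n \<W>" "cochain_map M n i \<W> a = f"
  using kernel_lift[OF E' E E'' i q W(1) splitW f] by blast
 have "coboundary M E n \<W> f = coboundary M E n \<W> f0"
  unfolding f_def using coboundary_diff[OF E W(1) W(1) s(3) f0 W(1) s(3) h']
  cochain_diff_zero[OF E W(1) coboundary_cochain[OF E W(1) f0]] by (simp add: cocycle_coboundary[OF h(1)])
 also have "... = cochain_diff M E (Suc n) \<W> (coboundary M E n \<U> c) (coboundary M E n \<V> d)"
  unfolding f0_def by (rule coboundary_diff[OF E W(1) U s(1) c V s(2) d])
 also have "... = cochain_map M (Suc n) i \<W> (cochain_diff M E' (Suc n) \<W> c' d')"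
  unfolding c'(2)[symmetric] d'(2)[symmetric]
  by (rule cochain_map_diff[OF E' E i W(1) U s(1) c'(1) V s(2) d'(1)])
 finally have eq: "cochain_map M (Suc n) i \<W> (coboundary M E' n \<W> a) =
  cochain_map M (Suc n) i \<W> (cochain_diff M E' (Suc n) \<W> c' d')"
  using coboundary_map[OF E' E i W(1) a(1)] a(2) by simp
 note cdiff = cochain_diff_cochain[OF E' W(1) U s(1) c'(1) V s(2) d'(1)]
 have "coboundary M E' n \<W> a = cochain_diff M E' (Suc n) \<W> c' d'"
 proof (rule cochain_eqI[OF coboundary_cochain[OF E' W(1) a(1)] cdiff E' W(1)])
  fix ys z assume ys: "ys \<in> simplices M (Suc n)" and z: "z \<in> overlap \<W> ys"
  show "coboundary M E' n \<W> a ys z = cochain_diff M E' (Suc n) \<W> c' d' ys z"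
  proof (rule incl_eq_iff[OF E' E E'' i q W(1) splitW ys z])
  show "i z (coboundary M E' n \<W> a ys z) = i z (cochain_diff M E' (Suc n) \<W> c' d' ys z)"
  using fun_cong[OF fun_cong[OF eq, of ys], of z] ys z by (simp add: cochain_map_def)
  qed (rule cochain_closed[OF E' W(1) coboundary_cochain[OF E' W(1) a(1)] ys z]
  cochain_closed[OF E' W(1) cdiff ys z])+
 qed
 then have "cochain_diff M E' (Suc n) \<W> c' d' \<in> coboundaries M E' (Suc n) \<W>"
  using a(1) by (metis coboundaries.simps(2) image_eqI)
 then have "cohomologous M E' (Suc n) \<U> c' \<V> d'"
  unfolding cohomologous_iff[OF E'] using W by blast
 then show ?thesis using coclass_eqI[OF E' U c'(1) V d'(1)] by simp
qed

text \<open>For the lift by \<tau> at the first vertex, the cocycle condition collapses all faces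
  through the first vertex \<open>y\<close> to a single term, so the coboundary at
  \<open>y # us\<close> is \<tau> at the next vertex minus \<tau> at \<open>y\<close>, both applied
  to \<open>c'' us\<close>. The splitting identity at \<open>y\<close> shows that this is
  \<open>i\<close> of the stated \<open>c'\<close>.\<close>

theorem connecting_coclass:
 fixes E' :: "('y, 'e) vbundle" and E :: "('y, 'f) vbundle" and E'' :: "('y, 'g) vbundle"
 assumes E': "presheaf M E'" and E: "presheaf M E" and E'': "presheaf M E''"
  and i: "morph_on M (points M) E' E i" and q: "morph_on M (points M) E E'' q"
  and U: "is_cover M \<U>"
  and split: "\<forall>y\<in>points M. split_on M (\<U> y) E' E E'' i q (\<tau> y) (\<rho> y)"
  and c'': "c'' \<in> cocycles M E'' n \<U>"
 defines "c' \<equiv> \<lambda>ys\<in>simplices M (Suc n). \<lambda>z\<in>overlap \<U> ys. \<rho> (hd ys) z (\<tau> (hd (tl ys)) z (c'' (tl ys) z))"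
 shows "c' \<in> cocycles M E' (Suc n) \<U>"
  and "connecting M E' E i q n (coclass M E'' n \<U> c'') = coclass M E' (Suc n) \<U> c'"
proof -
 note c''c = cocycleD[OF c'']
 obtain c where c: "c \<in> cochains M E n \<U>" "cochain_map M n q \<U> c = c''"
  "\<forall>ys\<in>simplices M n. \<forall>z\<in>overlap \<U> ys. c ys z = \<tau> (hd ys) z (c'' ys z)"
  by (rule lift_cochain[OF E' E E'' i q U split c''c])
 have c'_cochain: "c' \<in> cochains M E' (Suc n) \<U>"
  unfolding c'_def
 proof (rule cochainI)
  fix ys assume ys: "ys \<in> simplices M (Suc n)"
  note O = overlap_open[OF U ys]
  have tl: "tl ys \<in> faces ys" using ys by (cases ys) (auto simp: simplices_def faces_def)
  have h: "hd ys \<in> set ys" "hd (tl ys) \<in> set ys"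
  using ys by (cases ys; cases "tl ys"; auto simp: simplices_def)+
  then have hp: "hd ys \<in> points M" "hd (tl ys) \<in> points M"
  and sub: "overlap \<U> ys <= \<U> (hd ys)" "overlap \<U> ys <= \<U> (hd (tl ys))"
  using ys by (auto simp: simplices_def overlap_def)
  have "morph_on M (\<U> (hd (tl ys))) E'' E (\<tau> (hd (tl ys)))" "morph_on M (\<U> (hd ys)) E E' (\<rho> (hd ys))"
  using bspec[OF split hp(1)] bspec[OF split hp(2)] by (auto simp: split_on_def)
  from morph_on_comp[OF morph_on_subset[OF this(1) sub(2)] morph_on_subset[OF this(2) sub(1)]]
  have m: "morph_on M (overlap \<U> ys) E'' E' (%z v. \<rho> (hd ys) z (\<tau> (hd (tl ys)) z v))" .
  have r: "restrict (c'' (tl ys)) (overlap \<U> ys) \<in> sect E'' (overlap \<U> ys)"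
  by (rule sect_restrict[OF E'' overlap_open[OF U simplices_face[OF ys tl]] O overlap_face[OF tl]
  cochain_sect[OF c''c simplices_face[OF ys tl]]])
  show "(\<lambda>z\<in>overlap \<U> ys. \<rho> (hd ys) z (\<tau> (hd (tl ys)) z (c'' (tl ys) z))) \<in> sect E' (overlap \<U> ys)"
  by (rule restrI[OF morph_on_sect[OF m O subset_refl r]]) simp
 qed
 have ic': "cochain_map M (Suc n) i \<U> c' = coboundary M E n \<U> c"
 proof (rule cochain_eqI[OF cochain_map_cochain[OF E' E i U c'_cochain] coboundary_cochain[OF E U c(1)] E U])
  fix ys z assume ys: "ys \<in> simplices M (Suc n)" and z: "z \<in> overlap \<U> ys"
  obtain y us where yus: "ys = y # us" using ys by (cases ys) (auto simp: simplices_def)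
  have us: "us \<in> faces ys" by (simp add: yus faces_tail)
  note usn = simplices_face[OF ys us] and zu = subsetD[OF overlap_face[OF us] z]
  have hus: "hd us \<in> set ys" using usn yus by (cases us) (auto simp: simplices_def)
  note sy = split_vertex[OF E' E E'' i q U split ys z, of y] and sx = split_vertex[OF E' E E'' i q U split ys z hus]
  have yy: "y \<in> set ys" using yus by simp
  note zp = is_cover_points[OF U ys z]
  interpret E: cvs "fib E z" by (rule fib_cvs[OF E U ys z])
  interpret E'': cvs "fib E'' z" by (rule fib_cvs[OF E'' U ys z])
  note E''z = presheaf_cvs[OF E'' zp] and Ez = presheaf_cvs[OF E zp]
  let ?v = "c'' us z"
  have v: "?v \<in> carrier (fib E'' z)" by (rule cochain_closed[OF E'' U c''c usn zu])
  have cl: "c'' (y # zs) z \<in> carrier (fib E'' z)" if "zs \<in> faces us" for zs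
  using cochain_face_closed[OF E'' U c''c ys z, of "y # zs"] faces_Cons[OF that] yus by simp
  have S: "face_sum (fib E'' z) (%zs. c'' (y # zs) z) us \<in> carrier (fib E'' z)"
  by (rule E''.face_sum_closed[OF cl])
  have "coboundary M E'' n \<U> c'' ys z = \<zero>\<^bsub>fib E'' z\<^esub>"
  using zero_cochain_eq[OF E'' ys z] by (simp add: cocycle_coboundary[OF c''])
  \<comment> \<open>The cocycle condition at \<open>y # us\<close>: the signed sum over the faces
    containing \<open>y\<close> equals the value at the face omitting it.\<close>
  then have "?v \<ominus>\<^bsub>fib E'' z\<^esub> face_sum (fib E'' z) (%zs. c'' (y # zs) z) us = \<zero>\<^bsub>fib E'' z\<^esub>"
  unfolding coboundary_eq[OF E'' U c''c ys z] by (simp add: yus)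
  then have Sv: "face_sum (fib E'' z) (%zs. c'' (y # zs) z) us = ?v"
  using E''.minus_eq_zero_iff[OF v S] by simp
  have "coboundary M E n \<U> c ys z = c us z \<ominus>\<^bsub>fib E z\<^esub> face_sum (fib E z) (%zs. c (y # zs) z) us"
  unfolding coboundary_eq[OF E U c(1) ys z] by (simp add: yus)
  also have "face_sum (fib E z) (%zs. c (y # zs) z) us = face_sum (fib E z) (%zs. \<tau> y z (c'' (y # zs) z)) us"
  proof (rule face_sum_cong)
  fix zs assume "zs \<in> faces us"
  then have "y # zs \<in> faces ys" using yus faces_Cons by simp
  then show "c (y # zs) z = \<tau> y z (c'' (y # zs) z)"
  using c(3) simplices_face[OF ys] subsetD[OF overlap_face z] by simp
  qed
  also have "... = \<tau> y z ?v"
  using face_sum_lin[where c = "%zs. c'' (y # zs) z" and ys = us, OF sy(1)[OF yy] E''z Ez] cl Sv by simp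
  also have "c us z = \<tau> (hd us) z ?v" by (rule c(3)[rule_format, OF usn zu])
  finally have dc: "coboundary M E n \<U> c ys z = \<tau> (hd us) z ?v \<ominus>\<^bsub>fib E z\<^esub> \<tau> y z ?v" .
  let ?e = "\<tau> (hd us) z ?v"
  have e: "?e \<in> carrier (fib E z)" "\<tau> y z ?v \<in> carrier (fib E z)"
  using lin_closed[OF sx(1) v] lin_closed[OF sy(1)[OF yy] v] .
  have ie: "i z (\<rho> y z ?e) \<in> carrier (fib E z)"
  by (rule lin_closed[OF points_lin(1)[OF E' E E'' i q U split U ys z] lin_closed[OF sy(2)[OF yy] e(1)]])
  \<comment> \<open>The splitting at \<open>y\<close> applied to the lift made at the other vertex;
    \<open>q\<close> of that lift is \<open>?v\<close>, whichever vertex was used.\<close>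
  have "i z (\<rho> y z ?e) \<oplus>\<^bsub>fib E z\<^esub> \<tau> y z ?v = ?e"
  using sy(6)[OF yy e(1)] sx(3)[OF v] by simp
  then have "i z (\<rho> y z ?e) = ?e \<ominus>\<^bsub>fib E z\<^esub> \<tau> y z ?v"
  using e ie by (metis E.minus_eq E.a_assoc E.a_inv_closed E.r_neg E.r_zero)
  then show "cochain_map M (Suc n) i \<U> c' ys z = coboundary M E n \<U> c ys z"
  unfolding dc using ys z by (simp add: cochain_map_def c'_def) (simp add: yus)
 qed
 \<comment> \<open>The coboundary of \<open>c'\<close> has image zero under \<open>i\<close>, being
   a double coboundary of the lift, and \<open>i\<close> is injective on the fibres over the
   cover.\<close>
 show c'Z: "c' \<in> cocycles M E' (Suc n) \<U>"
 proof -
  have eq: "cochain_map M (Suc (Suc n)) i \<U> (coboundary M E' (Suc n) \<U> c') =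
  cochain_map M (Suc (Suc n)) i \<U> (zero_cochain M E' (Suc (Suc n)) \<U>)"
  using coboundary_map[OF E' E i U c'_cochain] coboundary_coboundary[OF E U c(1)] cochain_map_zero[OF E' E i U]
  by (simp add: ic')
  have "coboundary M E' (Suc n) \<U> c' = zero_cochain M E' (Suc (Suc n)) \<U>"
  proof (rule cochain_eqI[OF coboundary_cochain[OF E' U c'_cochain] zero_cochain_cochain[OF E' U] E' U])
  fix ys z assume ys: "ys \<in> simplices M (Suc (Suc n))" and z: "z \<in> overlap \<U> ys"
  show "coboundary M E' (Suc n) \<U> c' ys z = zero_cochain M E' (Suc (Suc n)) \<U> ys z"
  proof (rule incl_eq_iff[OF E' E E'' i q U split ys z])
  show "i z (coboundary M E' (Suc n) \<U> c' ys z) = i z (zero_cochain M E' (Suc (Suc n)) \<U> ys z)"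
  using fun_cong[OF fun_cong[OF eq, of ys], of z] ys z by (simp add: cochain_map_def)
  qed (rule cochain_closed[OF E' U coboundary_cochain[OF E' U c'_cochain] ys z]
  cochain_closed[OF E' U zero_cochain_cochain[OF E' U] ys z])+
  qed
  then show ?thesis using c'_cochain by (simp add: cocycles_def)
 qed
 show "connecting M E' E i q n (coclass M E'' n \<U> c'') = coclass M E' (Suc n) \<U> c'"
  unfolding connecting_def
 proof (rule the_equality)
  show "\<exists>\<V> d'' d d'. (\<V>, d'') \<in> coclass M E'' n \<U> c'' \<and> d \<in> cochains M E n \<V> \<and> cochain_map M n q \<V> d = d'' \<and>
  d' \<in> cocycles M E' (Suc n) \<V> \<and> cochain_map M (Suc n) i \<V> d' = coboundary M E n \<V> d \<and>
  coclass M E' (Suc n) \<U> c' = coclass M E' (Suc n) \<V> d'"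
  using coclass_mem[OF E'' U c''] c(1,2) c'Z ic' by blast
  fix \<eta> assume "\<exists>\<V> d'' d d'. (\<V>, d'') \<in> coclass M E'' n \<U> c'' \<and> d \<in> cochains M E n \<V> \<and> cochain_map M n q \<V> d = d'' \<and>
  d' \<in> cocycles M E' (Suc n) \<V> \<and> cochain_map M (Suc n) i \<V> d' = coboundary M E n \<V> d \<and>
  \<eta> = coclass M E' (Suc n) \<V> d'"
  then obtain \<V> d'' d d' where Vd: "(\<V>, d'') \<in> coclass M E'' n \<U> c''" and d: "d \<in> cochains M E n \<V>"
  "cochain_map M n q \<V> d = d''" and d': "d' \<in> cocycles M E' (Suc n) \<V>"
  "cochain_map M (Suc n) i \<V> d' = coboundary M E n \<V> d" and \<eta>: "\<eta> = coclass M E' (Suc n) \<V> d'"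
  by blast
  note V = coclass_memD[OF E'' Vd]
  show "\<eta> = coclass M E' (Suc n) \<U> c'"
  unfolding \<eta>
  by (rule connecting_unique[OF E' E E'' i q U split V(1) _ c(1) c'_cochain ic' d(1) cocycleD[OF d'(1)] d'(2)])
  (use V(3) c(2) d(2) in simp_all)
 qed
qed

subsection \<open>Tensor products and exterior powers of sheaves\<close>

lemma generator_family_tensor:
 assumes E: "presheaf M E" and G: "presheaf M G"
 shows "generator_family M (%y. tensor_space (fib E y) (fib G y))
  (%V. {\<lambda>y\<in>V. tensor_elem (fib E y) (fib G y) (s y) (t y) | s t. s \<in> sect E V \<and> t \<in> sect G V})"
 unfolding generator_family_def
proof (intro conjI ballI allI impI subsetI; (elim conjE)?)
 show "complex_vs (tensor_space (fib E y) (fib G y))" for y by (rule cvs_tensor)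
 fix U g assume U: "mopen M U"
  and "g \<in> {\<lambda>y\<in>U. tensor_elem (fib E y) (fib G y) (s y) (t y) | s t. s \<in> sect E U \<and> t \<in> sect G U}"
 then obtain s t where st: "s \<in> sect E U" "t \<in> sect G U"
  and g: "g = (\<lambda>y\<in>U. tensor_elem (fib E y) (fib G y) (s y) (t y))" by blast
 show "g \<in> (\<Pi>\<^sub>E y\<in>U. carrier (tensor_space (fib E y) (fib G y)))"
  unfolding g by (auto intro!: tensor_elem_closed sect_closed[OF E U st(1)] sect_closed[OF G U st(2)])
 fix V assume V: "mopen M V" "V <= U"
 have "restrict g V = (\<lambda>y\<in>V. tensor_elem (fib E y) (fib G y) (restrict s V y) (restrict t V y))"
  unfolding g by (rule ext) (use V(2) in auto)
 then show "restrict g V \<in> {\<lambda>y\<in>V. tensor_elem (fib E y) (fib G y) (s y) (t y) | s t. s \<in> sect E V \<and> t \<in> sect G V}"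
  using sect_restrict[OF E U V(1,2) st(1)] sect_restrict[OF G U V(1,2) st(2)] by blast
qed

lemma tensor_bundle_simps:
 "fib (tensor_bundle M E G) y = tensor_space (fib E y) (fib G y)"
 "sect (tensor_bundle M E G) = generated_sect M (%y. tensor_space (fib E y) (fib G y))
  (%V. {\<lambda>y\<in>V. tensor_elem (fib E y) (fib G y) (s y) (t y) | s t. s \<in> sect E V \<and> t \<in> sect G V})"
 by (simp_all add: tensor_bundle_def)

lemma sheaf_tensor:
 assumes E: "presheaf M E" and G: "presheaf M G"
 shows "sheaf M (tensor_bundle M E G)"
 unfolding tensor_bundle_def by (rule sheaf_generated[OF generator_family_tensor[OF assms]])

lemma tensor_elem_sect:
 assumes "presheaf M E" "presheaf M G" "mopen M U" "s \<in> sect E U" "t \<in> sect G U"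
 shows "(\<lambda>y\<in>U. tensor_elem (fib E y) (fib G y) (s y) (t y)) \<in> sect (tensor_bundle M E G) U"
 unfolding tensor_bundle_simps
 by (rule generated_sect_base[OF generator_family_tensor[OF assms(1,2)] assms(3)]) (use assms(4,5) in blast)

lemma tensor_sect_map:
 assumes "presheaf M E" "presheaf M G" "sheaf M H" "mopen M U"
  and "!!y. y \<in> U ==> lin (tensor_space (fib E y) (fib G y)) (fib H y) (\<phi> y)"
  and gen: "!!V s t. mopen M V ==> V <= U ==> s \<in> sect E V ==> t \<in> sect G V ==>
  (\<lambda>y\<in>V. \<phi> y (tensor_elem (fib E y) (fib G y) (s y) (t y))) \<in> sect H V"
  and "s \<in> sect (tensor_bundle M E G) U"
 shows "(\<lambda>y\<in>U. \<phi> y (s y)) \<in> sect H U"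
proof (rule generated_sect_map[OF generator_family_tensor[OF assms(1,2)] assms(3-5) _ assms(7)[unfolded tensor_bundle_simps]])
 fix V g assume V: "mopen M V" "V <= U"
  and "g \<in> {\<lambda>y\<in>V. tensor_elem (fib E y) (fib G y) (s y) (t y) | s t. s \<in> sect E V \<and> t \<in> sect G V}"
 then obtain s t where "s \<in> sect E V" "t \<in> sect G V" "g = (\<lambda>y\<in>V. tensor_elem (fib E y) (fib G y) (s y) (t y))" by blast
 then show "(\<lambda>y\<in>V. \<phi> y (g y)) \<in> sect H V" by (intro restrI[OF gen[OF V]]) simp_all
qed

subsection \<open>Cup products\<close>

definition cup_cochain :: "('y, 'e) vbundle => ('y, 'f) vbundle => nat => nat => ('y => 'y set) =>
  ('y, 'e) cochain => ('y, 'f) cochain => ('y, ('e \<times> 'f \<Rightarrow>\<^sub>0 complex) set) cochain" where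
 "cup_cochain E G m n \<U> c d = (\<lambda>ys\<in>simplices M (m + n). \<lambda>z\<in>overlap \<U> ys.
  tensor_elem (fib E z) (fib G z) (c (take (Suc m) ys) z) (d (drop m ys) z))"

lemma simplex_take_drop:
 assumes "ys \<in> simplices M (m + n)"
 shows "take (Suc m) ys \<in> simplices M m" "drop m ys \<in> simplices M n"
  "overlap \<U> ys <= overlap \<U> (take (Suc m) ys)" "overlap \<U> ys <= overlap \<U> (drop m ys)"
 using assms set_take_subset[of "Suc m" ys] set_drop_subset[of m ys]
 by (auto simp: simplices_def intro!: overlap_mono)

context
 fixes E :: "('y, 'e) vbundle" and G :: "('y, 'f) vbundle"
 assumes E: "presheaf M E" and G: "presheaf M G"
begin

lemma T_presheaf: "presheaf M (tensor_bundle M E G)"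
 by (rule sheaf_presheaf[OF sheaf_tensor[OF E G]])

lemma cup_cochain_eq: "ys \<in> simplices M (m + n) ==> z \<in> overlap \<U> ys ==>
  cup_cochain E G m n \<U> c d ys z = tensor_elem (fib E z) (fib G z) (c (take (Suc m) ys) z) (d (drop m ys) z)"
 by (simp add: cup_cochain_def)

lemma cup_cochain_cochain:
 assumes U: "is_cover M \<U>" and c: "c \<in> cochains M E m \<U>" and d: "d \<in> cochains M G n \<U>"
 shows "cup_cochain E G m n \<U> c d \<in> cochains M (tensor_bundle M E G) (m + n) \<U>"
 unfolding cup_cochain_def
proof (rule cochainI)
 fix ys assume ys: "ys \<in> simplices M (m + n)"
 note td = simplex_take_drop[OF ys] and O = overlap_open[OF U ys]
 show "(\<lambda>z\<in>overlap \<U> ys. tensor_elem (fib E z) (fib G z) (c (take (Suc m) ys) z) (d (drop m ys) z))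
  \<in> sect (tensor_bundle M E G) (overlap \<U> ys)"
  by (rule restrI[OF tensor_elem_sect[OF E G O
  sect_restrict[OF E overlap_open[OF U td(1)] O td(3) cochain_sect[OF c td(1)]]
  sect_restrict[OF G overlap_open[OF U td(2)] O td(4) cochain_sect[OF d td(2)]]]]) simp
qed

lemma coboundary_cup:
 assumes U: "is_cover M \<U>" and c: "c \<in> cochains M E m \<U>" and d: "d \<in> cochains M G n \<U>"
  and ys: "ys \<in> simplices M (Suc (m + n))" and z: "z \<in> overlap \<U> ys"
 shows "coboundary M (tensor_bundle M E G) (m + n) \<U> (cup_cochain E G m n \<U> c d) ys z =
  tensor_elem (fib E z) (fib G z) (coboundary M E m \<U> c (take (Suc (Suc m)) ys) z) (d (drop (Suc m) ys) z)
  \<oplus>\<^bsub>tensor_space (fib E z) (fib G z)\<^esub> (-1) ^ m \<odot>\<^bsub>tensor_space (fib E z) (fib G z)\<^esub>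
  tensor_elem (fib E z) (fib G z) (c (take (Suc m) ys) z) (coboundary M G n \<U> d (drop m ys) z)"
proof -
 note zp = is_cover_points[OF U ys z]
 have sub: "zs \<in> simplices M k" "z \<in> overlap \<U> zs" if "length zs = Suc k" "set zs <= set ys" for zs k
  using that ys subsetD[OF overlap_mono[OF that(2)] z] by (auto simp: simplices_def)
 have t: "take (Suc (Suc m)) ys \<in> simplices M (Suc m)" "z \<in> overlap \<U> (take (Suc (Suc m)) ys)"
  "drop m ys \<in> simplices M (Suc n)" "z \<in> overlap \<U> (drop m ys)"
  by (rule sub; use ys set_take_subset[of _ ys] set_drop_subset[of _ ys] in \<open>auto simp: simplices_def\<close>)+
 have "coboundary M (tensor_bundle M E G) (m + n) \<U> (cup_cochain E G m n \<U> c d) ys z =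
  face_sum (tensor_space (fib E z) (fib G z)) (%zs. cup_cochain E G m n \<U> c d zs z) ys"
  using coboundary_eq[OF T_presheaf U cup_cochain_cochain[OF U c d] ys z] by (simp add: tensor_bundle_simps)
 also have "... = face_sum (tensor_space (fib E z) (fib G z))
  (%zs. tensor_elem (fib E z) (fib G z) (c (take (Suc m) zs) z) (d (drop m zs) z)) ys"
  using z overlap_face[of _ ys \<U>] simplices_face[OF ys]
  by (intro face_sum_cong) (simp add: cup_cochain_eq subset_iff)
 also have "... = tensor_elem (fib E z) (fib G z) (face_sum (fib E z) (%zs. c zs z) (take (Suc (Suc m)) ys)) (d (drop (Suc m) ys) z)
  \<oplus>\<^bsub>tensor_space (fib E z) (fib G z)\<^esub> (-1) ^ m \<odot>\<^bsub>tensor_space (fib E z) (fib G z)\<^esub>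
  tensor_elem (fib E z) (fib G z) (c (take (Suc m) ys) z) (face_sum (fib G z) (%zs. d zs z) (drop m ys))"
 proof (rule face_sum_bilin[where c = "%zs. c zs z" and d = "%zs. d zs z" and n = n, OF bilin_tensor_elem
  presheaf_cvs[OF E zp] presheaf_cvs[OF G zp] cvs_tensor])
  show "c zs z \<in> carrier (fib E z)" if "length zs = Suc m" "set zs <= set ys" for zs
  by (rule cochain_closed[OF E U c sub[OF that]])
  show "d zs z \<in> carrier (fib G z)" if "length zs = Suc n" "set zs <= set ys" for zs
  by (rule cochain_closed[OF G U d sub[OF that]])
  show "length ys = m + n + 2" using ys by (simp add: simplices_def)
 qed
 finally show ?thesis
  by (simp add: coboundary_eq[OF E U c t(1,2)] coboundary_eq[OF G U d t(3,4)])
qed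

lemma tensor_elem_zero:
 assumes "complex_vs V" "complex_vs W"
 shows "w \<in> carrier W ==> tensor_elem V W \<zero>\<^bsub>V\<^esub> w = \<zero>\<^bsub>tensor_space V W\<^esub>"
  and "v \<in> carrier V ==> tensor_elem V W v \<zero>\<^bsub>W\<^esub> = \<zero>\<^bsub>tensor_space V W\<^esub>"
 by (rule lin_zero[OF bilin_left[OF bilin_tensor_elem] assms(1) cvs_tensor], assumption)
  (rule lin_zero[OF bilin_right[OF bilin_tensor_elem] assms(2) cvs_tensor])

lemma coboundary_cup_left:
 assumes U: "is_cover M \<U>" and c: "c \<in> cochains M E m \<U>" and d: "d \<in> cocycles M G n \<U>"
 shows "coboundary M (tensor_bundle M E G) (m + n) \<U> (cup_cochain E G m n \<U> c d) =
  cup_cochain E G (Suc m) n \<U> (coboundary M E m \<U> c) d"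
proof (rule cochain_eqI[OF coboundary_cochain[OF T_presheaf U cup_cochain_cochain[OF U c cocycleD[OF d]]]
  cup_cochain_cochain[OF U coboundary_cochain[OF E U c] cocycleD[OF d], simplified] T_presheaf U])
 fix ys z assume ys: "ys \<in> simplices M (Suc (m + n))" and z: "z \<in> overlap \<U> ys"
 note zp = is_cover_points[OF U ys z]
 interpret T: cvs "tensor_space (fib E z) (fib G z)" by (simp add: cvs_iff cvs_tensor)
 have ys': "ys \<in> simplices M (m + Suc n)" "ys \<in> simplices M (Suc m + n)" using ys by simp_all
 note td = simplex_take_drop[OF ys'(1)] and td' = simplex_take_drop[OF ys'(2)]
 have "coboundary M G n \<U> d (drop m ys) z = \<zero>\<^bsub>fib G z\<^esub>"
  using zero_cochain_eq[OF G td(2) subsetD[OF td(4) z]] by (simp add: cocycle_coboundary[OF d])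
 moreover have "c (take (Suc m) ys) z \<in> carrier (fib E z)"
  by (rule cochain_closed[OF E U c td(1) subsetD[OF td(3) z]])
 moreover have "coboundary M E m \<U> c (take (Suc (Suc m)) ys) z \<in> carrier (fib E z)"
  by (rule cochain_closed[OF E U coboundary_cochain[OF E U c] td'(1) subsetD[OF td'(3) z]])
 moreover have "d (drop (Suc m) ys) z \<in> carrier (fib G z)"
  by (rule cochain_closed[OF G U cocycleD[OF d] td'(2) subsetD[OF td'(4) z]])
 ultimately show "coboundary M (tensor_bundle M E G) (m + n) \<U> (cup_cochain E G m n \<U> c d) ys z =
  cup_cochain E G (Suc m) n \<U> (coboundary M E m \<U> c) d ys z"
  unfolding coboundary_cup[OF U c cocycleD[OF d] ys z] cup_cochain_eq[OF ys'(2) z]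
  by (simp add: tensor_elem_zero[OF presheaf_cvs[OF E zp] presheaf_cvs[OF G zp]] tensor_elem_closed)
qed

text \<open>Stated pointwise, because the Leibniz sign \<open>(-1)^m\<close> acts through the
  scalars of each fibre. The term with the coboundary of \<open>c\<close> drops out.\<close>

lemma coboundary_cup_right:
 assumes U: "is_cover M \<U>" and c: "c \<in> cocycles M E m \<U>" and d: "d \<in> cochains M G n \<U>"
  and ys: "ys \<in> simplices M (Suc (m + n))" and z: "z \<in> overlap \<U> ys"
 shows "coboundary M (tensor_bundle M E G) (m + n) \<U> (cup_cochain E G m n \<U> c d) ys z =
  (-1) ^ m \<odot>\<^bsub>tensor_space (fib E z) (fib G z)\<^esub> cup_cochain E G m (Suc n) \<U> c (coboundary M G n \<U> d) ys z"
proof -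
 note zp = is_cover_points[OF U ys z]
 interpret T: cvs "tensor_space (fib E z) (fib G z)" by (simp add: cvs_iff cvs_tensor)
 have ys': "ys \<in> simplices M (m + Suc n)" "ys \<in> simplices M (Suc m + n)" using ys by simp_all
 note td = simplex_take_drop[OF ys'(1)] and td' = simplex_take_drop[OF ys'(2)]
 have "coboundary M E m \<U> c (take (Suc (Suc m)) ys) z = \<zero>\<^bsub>fib E z\<^esub>"
  using zero_cochain_eq[OF E td'(1) subsetD[OF td'(3) z]] by (simp add: cocycle_coboundary[OF c])
 moreover have "d (drop (Suc m) ys) z \<in> carrier (fib G z)"
  by (rule cochain_closed[OF G U d td'(2) subsetD[OF td'(4) z]])
 moreover have "c (take (Suc m) ys) z \<in> carrier (fib E z)"
  by (rule cochain_closed[OF E U cocycleD[OF c] td(1) subsetD[OF td(3) z]])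
 moreover have "coboundary M G n \<U> d (drop m ys) z \<in> carrier (fib G z)"
  by (rule cochain_closed[OF G U coboundary_cochain[OF G U d] td(2) subsetD[OF td(4) z]])
 ultimately show ?thesis
  unfolding coboundary_cup[OF U cocycleD[OF c] d ys z] cup_cochain_eq[OF ys'(1) z]
  by (simp add: tensor_elem_zero[OF presheaf_cvs[OF E zp] presheaf_cvs[OF G zp]] tensor_elem_closed)
qed

end

end

context chart_space
begin

lemma coboundaries_restrict:
 assumes E: "presheaf M E"
  and U: "is_cover M \<U>" and W: "is_cover M \<W>" and WU: "refines M \<W> \<U>" and b: "b \<in> coboundaries M E n \<U>"
 shows "cochain_restrict M n \<W> b \<in> coboundaries M E n \<W>"
proof (cases n)
 case 0
 have "cochain_restrict M 0 \<W> (zero_cochain M E 0 \<U>) = zero_cochain M E 0 \<W>"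
  unfolding cochain_restrict_def zero_cochain_def[of M E 0 \<W>]
  using overlap_refine[OF WU] by (intro restrict_ext) (simp add: zero_cochain_eq[OF E] subset_iff)
 then show ?thesis using b 0 zero_coboundary[OF E W, of 0] by simp
next
 case (Suc m)
 then obtain a where "a \<in> cochains M E m \<U>" "b = coboundary M E m \<U> a" using b Suc by auto
 then show ?thesis
  using coboundary_restrict[OF E W U WU, of a m] cochain_restrict_cochain[OF E U W WU, of a m] Suc
  by (metis coboundaries.simps(2) image_eqI)
qed

lemma cochain_diff_restrict:
 assumes "refines M \<W> \<W>'"
 shows "cochain_restrict M n \<W> (cochain_diff M E n \<W>' c d) = cochain_diff M E n \<W> c d"
 unfolding cochain_restrict_def cochain_diff_def
 using overlap_refine[OF assms] by (intro restrict_ext) (simp add: subset_iff)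


context
 fixes E :: "('y, 'e) vbundle" and G :: "('y, 'f) vbundle"
 assumes E: "presheaf M E" and G: "presheaf M G"
begin

lemma cup_cocycle:
 assumes U: "is_cover M \<U>" and c: "c \<in> cocycles M E m \<U>" and d: "d \<in> cocycles M G n \<U>"
 shows "cup_cochain E G m n \<U> c d \<in> cocycles M (tensor_bundle M E G) (m + n) \<U>"
proof -
 note T = T_presheaf[OF E G]
 note cc = cocycleD[OF c] and dc = cocycleD[OF d]
 have "cup_cochain E G (Suc m) n \<U> (zero_cochain M E (Suc m) \<U>) d = zero_cochain M (tensor_bundle M E G) (Suc m + n) \<U>"
 proof (rule cochain_eqI[OF cup_cochain_cochain[OF E G U zero_cochain_cochain[OF E U] dc] zero_cochain_cochain[OF T U] T U])
  fix ys z assume ys: "ys \<in> simplices M (Suc m + n)" and z: "z \<in> overlap \<U> ys"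
  note zp = is_cover_points[OF U ys z] and td = simplex_take_drop[OF ys]
  have "d (drop (Suc m) ys) z \<in> carrier (fib G z)"
  by (rule cochain_closed[OF G U dc td(2) subsetD[OF td(4) z]])
  then show "cup_cochain E G (Suc m) n \<U> (zero_cochain M E (Suc m) \<U>) d ys z =
  zero_cochain M (tensor_bundle M E G) (Suc m + n) \<U> ys z"
  unfolding cup_cochain_eq[OF E G ys z] zero_cochain_eq[OF T ys z] zero_cochain_eq[OF E td(1) subsetD[OF td(3) z]]
  tensor_bundle_simps
  by (rule tensor_elem_zero[OF E G presheaf_cvs[OF E zp] presheaf_cvs[OF G zp]])
 qed
 then show ?thesis
  unfolding cocycles_def
  using coboundary_cup_left[OF E G U cc d] cup_cochain_cochain[OF E G U cc dc]
  by (simp add: cocycle_coboundary[OF c])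
qed

lemma cup_coboundary_left:
 assumes U: "is_cover M \<U>" and b: "b \<in> coboundaries M E m \<U>" and d: "d \<in> cocycles M G n \<U>"
 shows "cup_cochain E G m n \<U> b d \<in> coboundaries M (tensor_bundle M E G) (m + n) \<U>"
proof (cases m)
 case 0
 note T = T_presheaf[OF E G] and dc = cocycleD[OF d]
 have "cup_cochain E G 0 n \<U> (zero_cochain M E 0 \<U>) d = zero_cochain M (tensor_bundle M E G) (0 + n) \<U>"
 proof (rule cochain_eqI[OF cup_cochain_cochain[OF E G U zero_cochain_cochain[OF E U] dc] zero_cochain_cochain[OF T U] T U])
  fix ys z assume ys: "ys \<in> simplices M (0 + n)" and z: "z \<in> overlap \<U> ys"
  note zp = is_cover_points[OF U ys z] and td = simplex_take_drop[OF ys]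
  have "d (drop 0 ys) z \<in> carrier (fib G z)"
  by (rule cochain_closed[OF G U dc td(2) subsetD[OF td(4) z]])
  then show "cup_cochain E G 0 n \<U> (zero_cochain M E 0 \<U>) d ys z =
  zero_cochain M (tensor_bundle M E G) (0 + n) \<U> ys z"
  unfolding cup_cochain_eq[OF E G ys z] zero_cochain_eq[OF T ys z] zero_cochain_eq[OF E td(1) subsetD[OF td(3) z]]
  tensor_bundle_simps
  by (rule tensor_elem_zero[OF E G presheaf_cvs[OF E zp] presheaf_cvs[OF G zp]])
 qed
 then show ?thesis using b 0 zero_coboundary[OF T U] by simp
next
 case (Suc k)
 then obtain a where a: "a \<in> cochains M E k \<U>" "b = coboundary M E k \<U> a" using b by auto
 then show ?thesis
  using coboundary_cup_left[OF E G U a(1) d] cup_cochain_cochain[OF E G U a(1) cocycleD[OF d]] Suc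
  by (metis add_Suc coboundaries.simps(2) image_eqI)
qed

lemma cup_coboundary_right:
 assumes U: "is_cover M \<U>" and c: "c \<in> cocycles M E m \<U>" and b: "b \<in> coboundaries M G n \<U>"
 shows "cup_cochain E G m n \<U> c b \<in> coboundaries M (tensor_bundle M E G) (m + n) \<U>"
proof (cases n)
 case 0
 note T = T_presheaf[OF E G] and cc = cocycleD[OF c]
 have "cup_cochain E G m 0 \<U> c (zero_cochain M G 0 \<U>) = zero_cochain M (tensor_bundle M E G) (m + 0) \<U>"
 proof (rule cochain_eqI[OF cup_cochain_cochain[OF E G U cc zero_cochain_cochain[OF G U]] zero_cochain_cochain[OF T U] T U])
  fix ys z assume ys: "ys \<in> simplices M (m + 0)" and z: "z \<in> overlap \<U> ys"
  note zp = is_cover_points[OF U ys z] and td = simplex_take_drop[OF ys]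
  have "c (take (Suc m) ys) z \<in> carrier (fib E z)"
  by (rule cochain_closed[OF E U cc td(1) subsetD[OF td(3) z]])
  then show "cup_cochain E G m 0 \<U> c (zero_cochain M G 0 \<U>) ys z =
  zero_cochain M (tensor_bundle M E G) (m + 0) \<U> ys z"
  unfolding cup_cochain_eq[OF E G ys z] zero_cochain_eq[OF T ys z] zero_cochain_eq[OF G td(2) subsetD[OF td(4) z]]
  tensor_bundle_simps
  by (rule tensor_elem_zero[OF E G presheaf_cvs[OF E zp] presheaf_cvs[OF G zp]])
 qed
 then show ?thesis using b 0 zero_coboundary[OF T U] by simp
next
 case (Suc k)
 note T = T_presheaf[OF E G] and cc = cocycleD[OF c]
 obtain e where e: "e \<in> cochains M G k \<U>" "b = coboundary M G k \<U> e" using b Suc by auto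
 let ?u = "coboundary M (tensor_bundle M E G) (m + k) \<U> (cup_cochain E G m k \<U> c e)"
 let ?x = "cup_cochain E G m (Suc k) \<U> c b" and ?o = "zero_cochain M (tensor_bundle M E G) (Suc (m + k)) \<U>"
 note cup = cup_cochain_cochain[OF E G U cc e(1)]
 have u: "?u \<in> coboundaries M (tensor_bundle M E G) (Suc (m + k)) \<U>" using cup by simp
 have s: "refines M \<U> \<U>" by simp
 have x: "?x \<in> cochains M (tensor_bundle M E G) (Suc (m + k)) \<U>"
  using cup_cochain_cochain[OF E G U cc coboundary_cochain[OF G U e(1)]] e(2) by simp
 have ou: "cochain_diff M (tensor_bundle M E G) (Suc (m + k)) \<U> ?o ?u \<in> coboundaries M (tensor_bundle M E G) (Suc (m + k)) \<U>"
  by (rule coboundaries_diff[OF T U U s zero_coboundary[OF T U] U s u])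
 \<comment> \<open>The Leibniz sign is absorbed by the parity of \<open>m\<close>: for odd
   \<open>m\<close> the negative of \<open>?u\<close> is written as zero minus \<open>?u\<close>, a
   difference of coboundaries.\<close>
 have "?x = (if even m then ?u else cochain_diff M (tensor_bundle M E G) (Suc (m + k)) \<U> ?o ?u)"
 proof (rule cochain_eqI[OF x _ T U])
  show "(if even m then ?u else cochain_diff M (tensor_bundle M E G) (Suc (m + k)) \<U> ?o ?u)
  \<in> cochains M (tensor_bundle M E G) (Suc (m + k)) \<U>"
  using coboundary_cochain'[OF T U u] coboundary_cochain'[OF T U ou] by simp
  fix ys z assume ys: "ys \<in> simplices M (Suc (m + k))" and z: "z \<in> overlap \<U> ys"
  interpret V: cvs "tensor_space (fib E z) (fib G z)" by (simp add: cvs_iff cvs_tensor)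
  have xz: "?x ys z \<in> carrier (tensor_space (fib E z) (fib G z))"
  using cochain_closed[OF T U x ys z] by (simp add: tensor_bundle_simps)
  have "?u ys z = (-1) ^ m \<odot>\<^bsub>tensor_space (fib E z) (fib G z)\<^esub> ?x ys z"
  unfolding coboundary_cup_right[OF E G U c e(1) ys z] e(2) ..
  then show "?x ys z = (if even m then ?u else cochain_diff M (tensor_bundle M E G) (Suc (m + k)) \<U> ?o ?u) ys z"
  using xz ys z by (simp add: cochain_diff_def zero_cochain_eq[OF T] tensor_bundle_simps V.scale_minus_one V.minus_eq)
 qed
 then show ?thesis using u ou Suc by (simp del: coboundaries.simps)
qed

text \<open>Rests on \<open>c d - c' d' = (c - c') d - c' (d' - d)\<close>, a difference of two
  products with one coboundary factor each. The order \<open>d' - d\<close> is chosen so that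
  \<open>cochain_diff\<close> alone expresses it.\<close>

lemma cup_cohomologous:
 assumes U: "is_cover M \<U>" and c: "c \<in> cocycles M E m \<U>" and d: "d \<in> cocycles M G n \<U>"
  and V: "is_cover M \<V>" and c': "c' \<in> cocycles M E m \<V>" and d': "d' \<in> cocycles M G n \<V>"
  and cc': "cohomologous M E m \<U> c \<V> c'" and dd': "cohomologous M G n \<U> d \<V> d'"
 shows "cohomologous M (tensor_bundle M E G) (m + n) \<U> (cup_cochain E G m n \<U> c d) \<V> (cup_cochain E G m n \<V> c' d')"
proof -
 let ?T = "tensor_bundle M E G"
 note T = T_presheaf[OF E G]
 obtain \<W>1 where W1: "is_cover M \<W>1" "\<forall>y\<in>points M. \<W>1 y <= \<U> y \<inter> \<V> y"
  "cochain_diff M E m \<W>1 c c' \<in> coboundaries M E m \<W>1" using cc' unfolding cohomologous_iff[OF E] by blast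
 obtain \<W>2 where W2: "is_cover M \<W>2" "\<forall>y\<in>points M. \<W>2 y <= \<V> y \<inter> \<U> y"
  "cochain_diff M G n \<W>2 d' d \<in> coboundaries M G n \<W>2"
  using cohomologous_sym[OF G U cocycleD[OF d] V cocycleD[OF d'] dd']
  unfolding cohomologous_iff[OF G] by blast
 define \<W> where "\<W> = (%y. \<W>1 y \<inter> \<W>2 y)"
 have W: "is_cover M \<W>" unfolding \<W>_def by (rule is_cover_Int[OF W1(1) W2(1)])
 have s: "\<forall>y\<in>points M. \<W> y <= \<W>1 y" "\<forall>y\<in>points M. \<W> y <= \<W>2 y"
  "refines M \<W> \<U>" "refines M \<W> \<V>" "refines M \<W> \<W>"
  using W1(2) W2(2) unfolding \<W>_def by blast+
 let ?b = "cochain_diff M E m \<W> c c'" and ?b' = "cochain_diff M G n \<W> d' d"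
 let ?d = "cochain_restrict M n \<W> d" and ?c' = "cochain_restrict M m \<W> c'"
 have b: "?b \<in> coboundaries M E m \<W>" "?b' \<in> coboundaries M G n \<W>"
  using coboundaries_restrict[OF E W1(1) W s(1) W1(3)] coboundaries_restrict[OF G W2(1) W s(2) W2(3)]
  cochain_diff_restrict[OF s(1), of m E c c'] cochain_diff_restrict[OF s(2), of n G d' d] by simp_all
 have x: "cup_cochain E G m n \<W> ?b ?d \<in> coboundaries M ?T (m + n) \<W>"
  by (rule cup_coboundary_left[OF W b(1) cocycle_restrict[OF G U W s(3) d]])
 have y: "cup_cochain E G m n \<W> ?c' ?b' \<in> coboundaries M ?T (m + n) \<W>"
  by (rule cup_coboundary_right[OF W cocycle_restrict[OF E V W s(4) c'] b(2)])
 have "cochain_diff M ?T (m + n) \<W> (cup_cochain E G m n \<W> ?b ?d) (cup_cochain E G m n \<W> ?c' ?b') =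
  cochain_diff M ?T (m + n) \<W> (cup_cochain E G m n \<U> c d) (cup_cochain E G m n \<V> c' d')"
  unfolding cochain_diff_def[of M ?T]
 proof (intro restrict_ext)
  fix ys z assume ys: "ys \<in> simplices M (m + n)" and z: "z \<in> overlap \<W> ys"
  note td = simplex_take_drop[OF ys]
  note zU = subsetD[OF overlap_refine[OF s(3) ys] z] and zV = subsetD[OF overlap_refine[OF s(4) ys] z]
  note zp = is_cover_points[OF W ys z]
  note Ez = presheaf_cvs[OF E zp] and Gz = presheaf_cvs[OF G zp]
  interpret T: cvs "tensor_space (fib E z) (fib G z)" by (simp add: cvs_iff cvs_tensor)
  let ?t = "take (Suc m) ys" and ?u = "drop m ys"
  have zt: "z \<in> overlap \<W> ?t" "z \<in> overlap \<W> ?u" using td(3,4)[of \<W>] z by auto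
  have cl: "c ?t z \<in> carrier (fib E z)" "c' ?t z \<in> carrier (fib E z)"
  "d ?u z \<in> carrier (fib G z)" "d' ?u z \<in> carrier (fib G z)"
  by (rule cochain_closed[OF E U cocycleD[OF c] td(1) subsetD[OF td(3) zU]]
  cochain_closed[OF E V cocycleD[OF c'] td(1) subsetD[OF td(3) zV]]
  cochain_closed[OF G U cocycleD[OF d] td(2) subsetD[OF td(4) zU]]
  cochain_closed[OF G V cocycleD[OF d'] td(2) subsetD[OF td(4) zV]])+
  let ?e = "tensor_elem (fib E z) (fib G z)"
  have "?e (c ?t z \<ominus>\<^bsub>fib E z\<^esub> c' ?t z) (d ?u z) = ?e (c ?t z) (d ?u z) \<ominus>\<^bsub>tensor_space (fib E z) (fib G z)\<^esub> ?e (c' ?t z) (d ?u z)"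
  by (rule lin_minus[OF bilin_left[OF bilin_tensor_elem cl(3)] Ez cvs_tensor cl(1,2)])
  moreover have "?e (c' ?t z) (d' ?u z \<ominus>\<^bsub>fib G z\<^esub> d ?u z) = ?e (c' ?t z) (d' ?u z) \<ominus>\<^bsub>tensor_space (fib E z) (fib G z)\<^esub> ?e (c' ?t z) (d ?u z)"
  by (rule lin_minus[OF bilin_right[OF bilin_tensor_elem cl(2)] Gz cvs_tensor cl(4,3)])
  ultimately show "cup_cochain E G m n \<W> ?b ?d ys z \<ominus>\<^bsub>fib ?T z\<^esub> cup_cochain E G m n \<W> ?c' ?b' ys z =
  cup_cochain E G m n \<U> c d ys z \<ominus>\<^bsub>fib ?T z\<^esub> cup_cochain E G m n \<V> c' d' ys z"
  unfolding cup_cochain_eq[OF E G ys z] cup_cochain_eq[OF E G ys zU] cup_cochain_eq[OF E G ys zV] tensor_bundle_simps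
  using td(1,2) zt T.minus_minus_cancel[OF tensor_elem_closed[OF cl(1,3)] tensor_elem_closed[OF cl(2,3)] tensor_elem_closed[OF cl(2,4)]]
  by (simp add: cochain_diff_def cochain_restrict_def)
 qed
 then have "cochain_diff M ?T (m + n) \<W> (cup_cochain E G m n \<U> c d) (cup_cochain E G m n \<V> c' d') \<in> coboundaries M ?T (m + n) \<W>"
  using coboundaries_diff[OF T W W s(5) x W s(5) y] by simp
 then show ?thesis
  unfolding cohomologous_iff[OF T] using W s(3,4) by (intro exI[of _ \<W>]) auto
qed

text \<open>The definition of \<open>cup\<close> asks for both representatives on one cover; the
  pair \<open>c\<close>, \<open>d\<close> provides such a choice, and any other gives the same class
  by \<open>cup_cohomologous\<close>.\<close>

theorem cup_coclass:
 assumes U: "is_cover M \<U>" and c: "c \<in> cocycles M E m \<U>" and d: "d \<in> cocycles M G n \<U>"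
 shows "cup M E G m n (coclass M E m \<U> c) (coclass M G n \<U> d) =
  coclass M (tensor_bundle M E G) (m + n) \<U> (cup_cochain E G m n \<U> c d)"
 unfolding cup_def cup_cochain_def[symmetric]
proof (rule the_equality)
 let ?T = "tensor_bundle M E G"
 note T = T_presheaf[OF E G]
 show "\<exists>\<V> c' d'. (\<V>, c') \<in> coclass M E m \<U> c \<and> (\<V>, d') \<in> coclass M G n \<U> d \<and>
  coclass M ?T (m + n) \<U> (cup_cochain E G m n \<U> c d) = coclass M ?T (m + n) \<V> (cup_cochain E G m n \<V> c' d')"
  using coclass_mem[OF E U c] coclass_mem[OF G U d] by blast
 fix \<eta> assume "\<exists>\<V> c' d'. (\<V>, c') \<in> coclass M E m \<U> c \<and> (\<V>, d') \<in> coclass M G n \<U> d \<and>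
  \<eta> = coclass M ?T (m + n) \<V> (cup_cochain E G m n \<V> c' d')"
 then obtain \<V> c' d' where c': "(\<V>, c') \<in> coclass M E m \<U> c" and d': "(\<V>, d') \<in> coclass M G n \<U> d"
  and \<eta>: "\<eta> = coclass M ?T (m + n) \<V> (cup_cochain E G m n \<V> c' d')" by blast
 note V = coclass_memD[OF E c'] and V' = coclass_memD[OF G d']
 have "coclass M ?T (m + n) \<U> (cup_cochain E G m n \<U> c d) = coclass M ?T (m + n) \<V> (cup_cochain E G m n \<V> c' d')"
  by (rule coclass_eqI[OF T U cocycleD[OF cup_cocycle[OF U c d]] V(1)
  cocycleD[OF cup_cocycle[OF V(1,2) V'(2)]] cup_cohomologous[OF U c d V(1,2) V'(2) V(3) V'(3)]])
 then show "\<eta> = coclass M ?T (m + n) \<U> (cup_cochain E G m n \<U> c d)" using \<eta> by simp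
qed

end

subsection \<open>Exterior powers and pullbacks\<close>

lemma ext_bundle_simps:
 "fib (ext_bundle M k E) y = ext_power k (fib E y)"
 "sect (ext_bundle M k E) = generated_sect M (%y. ext_power k (fib E y))
  (%V. {\<lambda>y\<in>V. ext_elem k (fib E y) (map (%s. s y) ss) | ss. length ss = k \<and> set ss <= sect E V})"
 by (simp_all add: ext_bundle_def)

lemma sect_list_ext_gens:
 assumes "presheaf M E" "mopen M U" "length ss = k" "set ss <= sect E U" "y \<in> U"
 shows "map (%s. s y) ss \<in> ext_gens k (fib E y)"
 using assms(3,4) sect_closed[OF assms(1,2) _ assms(5)] by (auto simp: ext_gens_def)

lemma generator_family_ext:
 assumes E: "presheaf M E"
 shows "generator_family M (%y. ext_power k (fib E y))
  (%V. {\<lambda>y\<in>V. ext_elem k (fib E y) (map (%s. s y) ss) | ss. length ss = k \<and> set ss <= sect E V})"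
 unfolding generator_family_def
proof (intro conjI ballI allI impI subsetI; (elim conjE)?)
 show "complex_vs (ext_power k (fib E y))" for y by (rule cvs_ext)
 fix U g assume U: "mopen M U"
  and "g \<in> {\<lambda>y\<in>U. ext_elem k (fib E y) (map (%s. s y) ss) | ss. length ss = k \<and> set ss <= sect E U}"
 then obtain ss where ss: "length ss = k" "set ss <= sect E U"
  and g: "g = (\<lambda>y\<in>U. ext_elem k (fib E y) (map (%s. s y) ss))" by blast
 show "g \<in> (\<Pi>\<^sub>E y\<in>U. carrier (ext_power k (fib E y)))"
  unfolding g by (auto intro!: ext_elem_closed sect_list_ext_gens[OF E U ss])
 fix V assume V: "mopen M V" "V <= U"
 have eq: "restrict g V = (\<lambda>y\<in>V. ext_elem k (fib E y) (map (%s. s y) (map (%s. restrict s V) ss)))"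
  unfolding g using V(2) by (intro ext) (auto simp: comp_def)
 have "set (map (%s. restrict s V) ss) <= sect E V" "length (map (%s. restrict s V) ss) = k"
  using sect_restrict[OF E U V(1,2)] ss by auto
 then show "restrict g V \<in> {\<lambda>y\<in>V. ext_elem k (fib E y) (map (%s. s y) ss) | ss. length ss = k \<and> set ss <= sect E V}"
  unfolding eq by blast
qed

lemma sheaf_ext: "presheaf M E ==> sheaf M (ext_bundle M k E)"
 unfolding ext_bundle_def by (rule sheaf_generated[OF generator_family_ext])

lemma ext_elem_sect:
 assumes "presheaf M E" "mopen M U" "length ss = k" "set ss <= sect E U"
 shows "(\<lambda>y\<in>U. ext_elem k (fib E y) (map (%s. s y) ss)) \<in> sect (ext_bundle M k E) U"
 unfolding ext_bundle_simps
 by (rule generated_sect_base[OF generator_family_ext[OF assms(1)] assms(2)]) (use assms(3,4) in blast)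

lemma ext_sect_map:
 assumes "presheaf M E" "sheaf M H" "mopen M U"
  and "!!y. y \<in> U ==> lin (ext_power k (fib E y)) (fib H y) (\<phi> y)"
  and gen: "!!V ss. mopen M V ==> V <= U ==> length ss = k ==> set ss <= sect E V ==>
  (\<lambda>y\<in>V. \<phi> y (ext_elem k (fib E y) (map (%s. s y) ss))) \<in> sect H V"
  and "s \<in> sect (ext_bundle M k E) U"
 shows "(\<lambda>y\<in>U. \<phi> y (s y)) \<in> sect H U"
proof (rule generated_sect_map[OF generator_family_ext[OF assms(1)] assms(2-4) _ assms(6)[unfolded ext_bundle_simps]])
 fix V g assume V: "mopen M V" "V <= U"
  and "g \<in> {\<lambda>y\<in>V. ext_elem k (fib E y) (map (%s. s y) ss) | ss. length ss = k \<and> set ss <= sect E V}"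
 then obtain ss where "length ss = k" "set ss <= sect E V" "g = (\<lambda>y\<in>V. ext_elem k (fib E y) (map (%s. s y) ss))" by blast
 then show "(\<lambda>y\<in>V. \<phi> y (g y)) \<in> sect H V" by (intro restrI[OF gen[OF V]]) simp_all
qed

end

text \<open>The properties of a holomorphic map on which \<open>pullback\<close> depends, isolated
  so that both projections of a product share the lemmas.\<close>

locale chart_map = Y: chart_space M + X: chart_space N
 for M :: "'y manifold" and N :: "'x manifold" +
 fixes p :: "'y => 'x"
 assumes cont: "mopen N W ==> mopen M {y \<in> points M. p y \<in> W}"
  and p_points: "y \<in> points M ==> p y \<in> points N"
  and hol_pullback: "mopen N W ==> mopen M V ==> p ` V <= W ==> f \<in> hol N W ==> (\<lambda>y\<in>V. f (p y)) \<in> hol M V"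
begin

lemma pullback_simps:
 "fib (pullback M N p E) y = fib E (p y)"
 "sect (pullback M N p E) = generated_sect M (%y. fib E (p y))
  (%V. {\<lambda>y\<in>V. t (p y) | t W. mopen N W \<and> p ` V <= W \<and> t \<in> sect E W})"
 by (simp_all add: pullback_def)

lemma generator_family_pullback:
 assumes E: "presheaf N E"
 shows "generator_family M (%y. fib E (p y)) (%V. {\<lambda>y\<in>V. t (p y) | t W. mopen N W \<and> p ` V <= W \<and> t \<in> sect E W})"
 unfolding generator_family_def
proof (intro conjI ballI allI impI subsetI; (elim conjE)?)
 show "complex_vs (fib E (p y))" if "y \<in> points M" for y by (rule presheaf_cvs[OF E p_points[OF that]])
 fix U g assume U: "mopen M U" and "g \<in> {\<lambda>y\<in>U. t (p y) | t W. mopen N W \<and> p ` U <= W \<and> t \<in> sect E W}"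
 then obtain t W where W: "mopen N W" "p ` U <= W" "t \<in> sect E W" and g: "g = (\<lambda>y\<in>U. t (p y))" by blast
 show "g \<in> (\<Pi>\<^sub>E y\<in>U. carrier (fib E (p y)))"
  unfolding g using W(2) by (auto intro!: sect_closed[OF E W(1,3)])
 fix V assume V: "mopen M V" "V <= U"
 have "restrict g V = (\<lambda>y\<in>V. t (p y))" unfolding g by (rule ext) (use V(2) in auto)
 then show "restrict g V \<in> {\<lambda>y\<in>V. t (p y) | t W. mopen N W \<and> p ` V <= W \<and> t \<in> sect E W}"
  using W V(2) by blast
qed

lemma sheaf_pullback: "presheaf N E ==> sheaf M (pullback M N p E)"
 unfolding pullback_def by (rule Y.sheaf_generated[OF generator_family_pullback])

lemma pullback_sect:
 assumes "presheaf N E" "mopen M V" "mopen N W" "p ` V <= W" "t \<in> sect E W"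
 shows "(\<lambda>y\<in>V. t (p y)) \<in> sect (pullback M N p E) V"
 unfolding pullback_simps
 by (rule Y.generated_sect_base[OF generator_family_pullback[OF assms(1)] assms(2)]) (use assms(3-5) in blast)

lemma pullback_sect_map:
 assumes "presheaf N E" "sheaf M H" "mopen M U"
  and "!!y. y \<in> U ==> lin (fib E (p y)) (fib H y) (\<phi> y)"
  and gen: "!!V W t. mopen M V ==> V <= U ==> mopen N W ==> p ` V <= W ==> t \<in> sect E W ==>
  (\<lambda>y\<in>V. \<phi> y (t (p y))) \<in> sect H V"
  and "s \<in> sect (pullback M N p E) U"
 shows "(\<lambda>y\<in>U. \<phi> y (s y)) \<in> sect H U"
proof (rule Y.generated_sect_map[OF generator_family_pullback[OF assms(1)] assms(2-4) _ assms(6)[unfolded pullback_simps]])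
 fix V g assume V: "mopen M V" "V <= U" and "g \<in> {\<lambda>y\<in>V. t (p y) | t W. mopen N W \<and> p ` V <= W \<and> t \<in> sect E W}"
 then obtain t W where "mopen N W" "p ` V <= W" "t \<in> sect E W" "g = (\<lambda>y\<in>V. t (p y))" by blast
 then show "(\<lambda>y\<in>V. \<phi> y (g y)) \<in> sect H V" by (intro restrI[OF gen[OF V]]) simp_all
qed

text \<open>A map out of the pullback of an exterior power preserves sections once it does so on
 pullbacks of decomposable sections.\<close>

lemma pullback_ext_sect_map:
 assumes E: "presheaf N E" and H: "sheaf M H" and U: "mopen M U"
  and \<phi>: "!!y. y \<in> U ==> lin (ext_power k (fib E (p y))) (fib H y) (\<phi> y)"
  and gen: "!!V W ss. mopen M V ==> V <= U ==> mopen N W ==> p ` V <= W ==> length ss = k ==> set ss <= sect E W ==>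
  (\<lambda>y\<in>V. \<phi> y (ext_elem k (fib E (p y)) (map (%s. s (p y)) ss))) \<in> sect H V"
  and s: "s \<in> sect (pullback M N p (ext_bundle N k E)) U"
 shows "(\<lambda>y\<in>U. \<phi> y (s y)) \<in> sect H U"
proof (rule pullback_sect_map[OF sheaf_presheaf[OF X.sheaf_ext[OF E]] H U _ _ s])
 show "lin (fib (ext_bundle N k E) (p y)) (fib H y) (\<phi> y)" if "y \<in> U" for y
  using \<phi>[OF that] by (simp add: X.ext_bundle_simps)
 fix V W t assume V: "mopen M V" "V <= U" and W: "mopen N W" "p ` V <= W" "t \<in> sect (ext_bundle N k E) W"
 note H' = sheaf_presheaf[OF H]
 show "(\<lambda>y\<in>V. \<phi> y (t (p y))) \<in> sect H V"
 proof (rule sect_local[OF H V(1)])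
  fix y assume y: "y \<in> V"
  then have "p y \<in> W" using W(2) by blast
  then obtain W' n f g where W': "mopen N W'" "p y \<in> W'" "W' <= W" "\<forall>i<(n::nat). f i \<in> hol N W'"
  "\<forall>i<n. g i \<in> {\<lambda>y\<in>W'. ext_elem k (fib E y) (map (%s. s y) ss) | ss. length ss = k \<and> set ss <= sect E W'}"
  "\<forall>z\<in>W'. t z = (\<Oplus>\<^bsub>ext_power k (fib E z)\<^esub> i\<in>{..<n}. f i z \<odot>\<^bsub>ext_power k (fib E z)\<^esub> g i z)"
  by (rule generated_sectE[OF W(3)[unfolded X.ext_bundle_simps]])
  \<comment> \<open>\<open>t\<close> is a combination of decomposable sections only near
    \<open>p y\<close>; the preimage of that neighbourhood is where its pullback is one.\<close>
  define V' where "V' = V \<inter> {y \<in> points M. p y \<in> W'}"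
  have V': "mopen M V'" unfolding V'_def by (rule openin_Int[OF V(1) cont[OF W'(1)]])
  have yV': "y \<in> V'" using y W'(2) mopenD[OF V(1)] by (simp add: V'_def)
  have sub: "V' <= V" "p ` V' <= W'" by (auto simp: V'_def)
  have "\<forall>i\<in>{..<n}. \<exists>l. length l = k \<and> set l <= sect E W' \<and> g i = (\<lambda>y\<in>W'. ext_elem k (fib E y) (map (%s. s y) l))"
  proof
  fix i assume "i \<in> {..<n}"
  then have "g i \<in> {\<lambda>y\<in>W'. ext_elem k (fib E y) (map (%s. s y) ss) | ss. length ss = k \<and> set ss <= sect E W'}"
  using W'(5) by blast
  then show "\<exists>l. length l = k \<and> set l <= sect E W' \<and> g i = (\<lambda>y\<in>W'. ext_elem k (fib E y) (map (%s. s y) l))"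
  by blast
  qed
  from bchoice[OF this] obtain ss where ss: "\<forall>i\<in>{..<n}. length (ss i) = k \<and> set (ss i) <= sect E W' \<and>
  g i = (\<lambda>y\<in>W'. ext_elem k (fib E y) (map (%s. s y) (ss i)))" ..
  let ?g = "%i. \<lambda>y\<in>V'. \<phi> y (ext_elem k (fib E (p y)) (map (%s. s (p y)) (ss i)))"
  let ?f = "%i. \<lambda>y\<in>V'. f i (p y)"
  let ?r = "\<lambda>z\<in>V'. \<Oplus>\<^bsub>fib H z\<^esub> i\<in>{..<n}. ?f i z \<odot>\<^bsub>fib H z\<^esub> ?g i z"
  have r: "?r \<in> sect H V'"
  proof (rule Y.sect_combination[OF H' V'])
  show "?f i \<in> hol M V'" if "i < n" for i
  by (rule hol_pullback[OF W'(1) V' sub(2)]) (use W'(4) that in blast)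
  show "?g i \<in> sect H V'" if "i < n" for i
  by (rule gen[OF V' order_trans[OF sub(1) V(2)] W'(1) sub(2)]) (use ss that in auto)
  qed
  have eq: "\<phi> z (t (p z)) = ?r z" if z: "z \<in> V'" for z
  proof -
  have zU: "z \<in> U" "p z \<in> W'" using z sub V(2) by auto
  note zp = mopenD[OF V' z]
  note Hz = presheaf_cvs[OF H' zp]
  interpret Hz: cvs "fib H z" using Hz by (simp add: cvs_iff)
  interpret X: cvs "ext_power k (fib E (p z))" by (simp add: cvs_iff cvs_ext)
  have gi: "g i (p z) = ext_elem k (fib E (p z)) (map (%s. s (p z)) (ss i))" if "i < n" for i
  using ss that zU by simp
  have cl: "g i (p z) \<in> carrier (ext_power k (fib E (p z)))" if "i < n" for i
  unfolding gi[OF that]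
  by (rule ext_elem_closed, rule X.sect_list_ext_gens[OF E W'(1) _ _ zU(2)]) (use ss that in auto)
  have "\<phi> z (t (p z)) = \<phi> z (\<Oplus>\<^bsub>ext_power k (fib E (p z))\<^esub> i\<in>{..<n}. f i (p z) \<odot>\<^bsub>ext_power k (fib E (p z))\<^esub> g i (p z))"
  using W'(6) zU by simp
  also have "... = (\<Oplus>\<^bsub>fib H z\<^esub> i\<in>{..<n}. \<phi> z (f i (p z) \<odot>\<^bsub>ext_power k (fib E (p z))\<^esub> g i (p z)))"
  by (rule lin_finsum[OF \<phi>[OF zU(1)] cvs_ext Hz]) (use cl in auto)
  also have "... = ?r z"
  using z cl lin_closed[OF \<phi>[OF zU(1)]] by (auto simp: lin_scale[OF \<phi>[OF zU(1)]] gi intro!: Hz.finsum_cong')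
  finally show ?thesis .
  qed
  show "\<exists>V' t'. mopen M V' \<and> y \<in> V' \<and> V' <= V \<and> t' \<in> sect H V' \<and> (\<forall>z\<in>V'. (\<lambda>y\<in>V. \<phi> y (t (p y))) z = t' z)"
  by (intro exI[of _ V'] exI[of _ ?r] conjI ballI V' yV' sub(1) r) (use eq sub(1) in \<open>simp add: subset_iff\<close>)
 qed simp
qed

end

section \<open>Product manifolds\<close>

text \<open>\<pi> selects the coordinates \<open>h 0, ..., h (m - 1)\<close>. Its distances are
  bounded by those in the larger space, so the estimate for \<open>f\<close> carries over.\<close>

lemma holomorphic_in_coordinates:
 assumes f: "holomorphic_in m W f" and h: "inj_on h {..<m}" "h ` {..<m} <= {..<n}"
  and \<pi>: "!!w. w \<in> W' ==> \<pi> w \<in> W" "!!w i. w \<in> W' ==> i < m ==> \<pi> w i = w (h i)"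
 shows "holomorphic_in n W' (%w. f (\<pi> w))"
 unfolding holomorphic_in_def
proof
 fix z assume z: "z \<in> W'"
 obtain a where a: "\<forall>e>0. \<exists>d>0. \<forall>w\<in>W. (\<forall>i<m. cmod (w i - \<pi> z i) < d) -->
  cmod (f w - f (\<pi> z) - (\<Sum>i<m. a i * (w i - \<pi> z i))) \<le> e * (\<Sum>i<m. cmod (w i - \<pi> z i))"
  using f \<pi>(1)[OF z] unfolding holomorphic_in_def by blast
 \<comment> \<open>The linear part of \<open>f\<close> in the selected coordinates, extended by zero
   in the remaining directions.\<close>
 define a' where "a' = (%j. if j \<in> h ` {..<m} then a (inv_into {..<m} h j) else 0)"
 have sum1: "(\<Sum>j<n. a' j * (w j - z j)) = (\<Sum>i<m. a i * (\<pi> w i - \<pi> z i))" if w: "w \<in> W'" for w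
 proof -
  have "(\<Sum>j<n. a' j * (w j - z j)) = (\<Sum>j\<in>h ` {..<m}. a' j * (w j - z j))"
  by (rule sum.mono_neutral_right) (use h(2) in \<open>auto simp: a'_def\<close>)
  also have "... = (\<Sum>i<m. a' (h i) * (w (h i) - z (h i)))" by (simp add: sum.reindex[OF h(1)])
  also have "... = (\<Sum>i<m. a i * (\<pi> w i - \<pi> z i))"
  by (rule sum.cong) (use \<pi>(2) w z h(1) in \<open>auto simp: a'_def inv_into_f_f\<close>)
  finally show ?thesis .
 qed
 have sum2: "(\<Sum>i<m. cmod (\<pi> w i - \<pi> z i)) \<le> (\<Sum>j<n. cmod (w j - z j))" if w: "w \<in> W'" for w
 proof -
  have "(\<Sum>i<m. cmod (\<pi> w i - \<pi> z i)) = (\<Sum>i<m. cmod (w (h i) - z (h i)))"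
  by (rule sum.cong) (use \<pi>(2) w z in auto)
  also have "... = (\<Sum>j\<in>h ` {..<m}. cmod (w j - z j))" by (simp add: sum.reindex[OF h(1)])
  also have "... \<le> (\<Sum>j<n. cmod (w j - z j))" by (rule sum_mono2) (use h(2) in auto)
  finally show ?thesis .
 qed
 show "\<exists>a. \<forall>e>0. \<exists>d>0. \<forall>w\<in>W'. (\<forall>i<n. cmod (w i - z i) < d) -->
  cmod (f (\<pi> w) - f (\<pi> z) - (\<Sum>i<n. a i * (w i - z i))) \<le> e * (\<Sum>i<n. cmod (w i - z i))"
 proof (intro exI[of _ a'] allI impI)
  fix e :: real assume e: "e > 0"
  obtain d where d: "d > 0" "\<forall>w\<in>W. (\<forall>i<m. cmod (w i - \<pi> z i) < d) -->
  cmod (f w - f (\<pi> z) - (\<Sum>i<m. a i * (w i - \<pi> z i))) \<le> e * (\<Sum>i<m. cmod (w i - \<pi> z i))"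
  using a e by blast
  show "\<exists>d>0. \<forall>w\<in>W'. (\<forall>i<n. cmod (w i - z i) < d) -->
  cmod (f (\<pi> w) - f (\<pi> z) - (\<Sum>i<n. a' i * (w i - z i))) \<le> e * (\<Sum>i<n. cmod (w i - z i))"
  proof (intro exI[of _ d] conjI d(1) ballI impI)
  fix w assume w: "w \<in> W'" "\<forall>i<n. cmod (w i - z i) < d"
  have "\<forall>i<m. cmod (\<pi> w i - \<pi> z i) < d" using w \<pi>(2)[OF w(1)] \<pi>(2)[OF z] h(2) by force
  then have "cmod (f (\<pi> w) - f (\<pi> z) - (\<Sum>i<m. a i * (\<pi> w i - \<pi> z i))) \<le> e * (\<Sum>i<m. cmod (\<pi> w i - \<pi> z i))"
  using d(2) \<pi>(1)[OF w(1)] by blast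
  also have "... \<le> e * (\<Sum>i<n. cmod (w i - z i))" using sum2[OF w(1)] e by simp
  finally show "cmod (f (\<pi> w) - f (\<pi> z) - (\<Sum>i<n. a' i * (w i - z i))) \<le> e * (\<Sum>i<n. cmod (w i - z i))"
  by (simp add: sum1[OF w(1)])
  qed
 qed
qed

lemma complex_manifold_chart:
 assumes "complex_manifold M" "(U, \<phi>) \<in> atlas M"
 shows "mopen M U" "inj_on \<phi> U" "\<phi> ` U <= extensional {..<mdim M}"
proof -
 have *: "mopen M U" "openin (complex_space (mdim M)) (\<phi> ` U)"
  "homeomorphic_map (subtopology (mtop M) U) (subtopology (complex_space (mdim M)) (\<phi> ` U)) \<phi>"
  using assms unfolding complex_manifold_def by blast+
 show "mopen M U" by (rule *(1))
 have "topspace (subtopology (mtop M) U) = U" using openin_subset[OF *(1)] by auto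
 then show "inj_on \<phi> U" using homeomorphic_imp_injective_map[OF *(3)] by simp
 have "\<phi> ` U <= topspace (complex_space (mdim M))" by (rule openin_subset[OF *(2)])
 then show "\<phi> ` U <= extensional {..<mdim M}" by (auto simp: complex_space_def PiE_def)
qed

lemma chart_space_complex_manifold: "complex_manifold M ==> chart_space M"
 by unfold_locales (rule complex_manifold_chart)

context
 fixes M :: "'x manifold" and N :: "'b manifold"
 assumes M: "complex_manifold M" and N: "complex_manifold N"
begin

definition product_chart where
 "product_chart \<phi> \<psi> = (%(x, b). \<lambda>i\<in>{..<mdim M + mdim N}. if i < mdim M then \<phi> x i else \<psi> b (i - mdim M))"

lemma prod_atlasE:
 assumes "(O', \<Phi>) \<in> atlas (prod_manifold M N)"
 obtains U \<phi> V \<psi> where "(U, \<phi>) \<in> atlas M" "(V, \<psi>) \<in> atlas N" "O' = U \<times> V" "\<Phi> = product_chart \<phi> \<psi>"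
 using assms unfolding prod_manifold_def product_chart_def by auto

lemma product_chart_eq:
 "i < mdim M ==> product_chart \<phi> \<psi> (x, b) i = \<phi> x i"
 "i < mdim N ==> product_chart \<phi> \<psi> (x, b) (mdim M + i) = \<psi> b i"
 by (auto simp: product_chart_def)

text \<open>A product chart records only coordinates below the two dimensions; these determine the
  points because the values of the factor charts are extensional.\<close>

lemma inj_product_chart:
 assumes "(U, \<phi>) \<in> atlas M" "(V, \<psi>) \<in> atlas N"
 shows "inj_on (product_chart \<phi> \<psi>) (U \<times> V)"
proof (rule inj_onI, clarify)
 fix x b x' b' assume xb: "x \<in> U" "b \<in> V" "x' \<in> U" "b' \<in> V"
  and eq: "product_chart \<phi> \<psi> (x, b) = product_chart \<phi> \<psi> (x', b')"
 have "\<phi> x = \<phi> x'"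
 proof (rule extensionalityI)
  show "\<phi> x \<in> extensional {..<mdim M}" "\<phi> x' \<in> extensional {..<mdim M}"
  using complex_manifold_chart(3)[OF M assms(1)] xb by auto
  show "\<phi> x i = \<phi> x' i" if "i \<in> {..<mdim M}" for i
  using fun_cong[OF eq, of i] that by (simp add: product_chart_eq)
 qed
 moreover have "\<psi> b = \<psi> b'"
 proof (rule extensionalityI)
  show "\<psi> b \<in> extensional {..<mdim N}" "\<psi> b' \<in> extensional {..<mdim N}"
  using complex_manifold_chart(3)[OF N assms(2)] xb by auto
  show "\<psi> b i = \<psi> b' i" if "i \<in> {..<mdim N}" for i
  using fun_cong[OF eq, of "mdim M + i"] that by (simp add: product_chart_eq)
 qed
 ultimately show "x = x' \<and> b = b'"
  using inj_onD[OF complex_manifold_chart(2)[OF M assms(1)]] inj_onD[OF complex_manifold_chart(2)[OF N assms(2)]] xb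
  by blast
qed

lemma chart_space_prod: "chart_space (prod_manifold M N)"
 by unfold_locales (auto elim!: prod_atlasE intro: inj_product_chart)

lemma prod_manifold_simps: "mtop (prod_manifold M N) = prod_topology (mtop M) (mtop N)"
 "mdim (prod_manifold M N) = mdim M + mdim N"
 by (simp_all add: prod_manifold_def)

lemma chart_map_fst: "chart_map (prod_manifold M N) M fst"
proof -
 interpret P: chart_space "prod_manifold M N" by (rule chart_space_prod)
 interpret X: chart_space M by (rule chart_space_complex_manifold[OF M])
 show ?thesis
 proof unfold_locales
  show "mopen (prod_manifold M N) {y \<in> points (prod_manifold M N). fst y \<in> W}" if "mopen M W" for W
  proof -
  have "{y \<in> points (prod_manifold M N). fst y \<in> W} = W \<times> points N"
  using openin_subset[OF that] by (auto simp: prod_manifold_simps)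
  then show ?thesis using that by (simp add: prod_manifold_simps openin_prod_Times_iff)
  qed
  show "fst y \<in> points M" if "y \<in> points (prod_manifold M N)" for y
  using that by (auto simp: prod_manifold_simps)
  fix W and O' :: "('x \<times> 'b) set" and f assume W: "mopen M W" and O': "fst ` O' <= W" and f: "f \<in> hol M W"
  show "(\<lambda>y\<in>O'. f (fst y)) \<in> hol (prod_manifold M N) O'"
  proof (rule P.holI)
  fix C \<Phi> assume "(C, \<Phi>) \<in> atlas (prod_manifold M N)"
  then obtain U \<phi> V \<psi> where c: "(U, \<phi>) \<in> atlas M" "(V, \<psi>) \<in> atlas N" "C = U \<times> V" "\<Phi> = product_chart \<phi> \<psi>"
  by (rule prod_atlasE)
  note inj = inj_product_chart[OF c(1,2)] and inj\<phi> = complex_manifold_chart(2)[OF M c(1)]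
  \<comment> \<open>The identity of \<open>U\<close> is inserted as the inverse of \<phi> after
    \<phi>: the function becomes \<open>f\<close> in the chart \<phi>, preceded by the selection of
    the first \<open>mdim M\<close> coordinates.\<close>
  have "holomorphic_in (mdim M + mdim N) (\<Phi> ` (O' \<inter> C)) (%w. f (inv_into U \<phi> (\<phi> (fst (inv_into C \<Phi> w)))))"
  proof (rule holomorphic_in_coordinates[OF X.holD[OF f c(1)], where h = "%i. i"])
  fix w assume "w \<in> \<Phi> ` (O' \<inter> C)"
  then obtain x b where xb: "(x, b) \<in> O'" "x \<in> U" "b \<in> V" "w = \<Phi> (x, b)" using c(3) by auto
  then have inv: "inv_into C \<Phi> w = (x, b)" using inj by (simp add: c inv_into_f_f)
  have "x \<in> W" using O' xb(1) by (metis fst_conv image_subset_iff)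
  then show "\<phi> (fst (inv_into C \<Phi> w)) \<in> \<phi> ` (W \<inter> U)" unfolding inv fst_conv using xb(2) by blast
  show "\<phi> (fst (inv_into C \<Phi> w)) i = w i" if "i < mdim M" for i
  using that unfolding inv by (simp add: xb(4) c(4) product_chart_eq)
  qed auto
  moreover have "inv_into U \<phi> (\<phi> (fst (inv_into C \<Phi> w))) = fst (inv_into C \<Phi> w)" if "w \<in> \<Phi> ` (O' \<inter> C)" for w
  using that inv_into_into[of w \<Phi> C] inj\<phi> by (intro inv_into_f_f) (auto simp: c(3))
  ultimately have "holomorphic_in (mdim M + mdim N) (\<Phi> ` (O' \<inter> C)) (%w. f (fst (inv_into C \<Phi> w)))"
  by (subst holomorphic_in_cong[where g = "%w. f (inv_into U \<phi> (\<phi> (fst (inv_into C \<Phi> w))))"]) simp_all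
  then show "\<exists>g. holomorphic_in (mdim (prod_manifold M N)) (\<Phi> ` (O' \<inter> C)) (%w. g (inv_into C \<Phi> w)) \<and>
  (\<forall>y\<in>O'. (\<lambda>y\<in>O'. f (fst y)) y = g y)"
  by (intro exI[of _ "%y. f (fst y)"]) (simp add: prod_manifold_simps)
  qed simp
 qed
qed

lemma chart_map_snd: "chart_map (prod_manifold M N) N snd"
proof -
 interpret P: chart_space "prod_manifold M N" by (rule chart_space_prod)
 interpret X: chart_space N by (rule chart_space_complex_manifold[OF N])
 show ?thesis
 proof unfold_locales
  show "mopen (prod_manifold M N) {y \<in> points (prod_manifold M N). snd y \<in> W}" if "mopen N W" for W
  proof -
  have "{y \<in> points (prod_manifold M N). snd y \<in> W} = points M \<times> W"
  using openin_subset[OF that] by (auto simp: prod_manifold_simps)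
  then show ?thesis using that by (simp add: prod_manifold_simps openin_prod_Times_iff)
  qed
  show "snd y \<in> points N" if "y \<in> points (prod_manifold M N)" for y
  using that by (auto simp: prod_manifold_simps)
  fix W and O' :: "('x \<times> 'b) set" and f assume W: "mopen N W" and O': "snd ` O' <= W" and f: "f \<in> hol N W"
  show "(\<lambda>y\<in>O'. f (snd y)) \<in> hol (prod_manifold M N) O'"
  proof (rule P.holI)
  fix C \<Phi> assume "(C, \<Phi>) \<in> atlas (prod_manifold M N)"
  then obtain U \<phi> V \<psi> where c: "(U, \<phi>) \<in> atlas M" "(V, \<psi>) \<in> atlas N" "C = U \<times> V" "\<Phi> = product_chart \<phi> \<psi>"
  by (rule prod_atlasE)
  note inj = inj_product_chart[OF c(1,2)] and inj\<psi> = complex_manifold_chart(2)[OF N c(2)]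
  have "holomorphic_in (mdim M + mdim N) (\<Phi> ` (O' \<inter> C)) (%w. f (inv_into V \<psi> (\<psi> (snd (inv_into C \<Phi> w)))))"
  proof (rule holomorphic_in_coordinates[OF X.holD[OF f c(2)], where h = "%i. mdim M + i"])
  fix w assume "w \<in> \<Phi> ` (O' \<inter> C)"
  then obtain x b where xb: "(x, b) \<in> O'" "x \<in> U" "b \<in> V" "w = \<Phi> (x, b)" using c(3) by auto
  then have inv: "inv_into C \<Phi> w = (x, b)" using inj by (simp add: c inv_into_f_f)
  have "b \<in> W" using O' xb(1) by (metis snd_conv image_subset_iff)
  then show "\<psi> (snd (inv_into C \<Phi> w)) \<in> \<psi> ` (W \<inter> V)" unfolding inv snd_conv using xb(3) by blast
  show "\<psi> (snd (inv_into C \<Phi> w)) i = w (mdim M + i)" if "i < mdim N" for i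
  using that unfolding inv by (simp add: xb(4) c(4) product_chart_eq)
  qed auto
  moreover have "inv_into V \<psi> (\<psi> (snd (inv_into C \<Phi> w))) = snd (inv_into C \<Phi> w)" if "w \<in> \<Phi> ` (O' \<inter> C)" for w
  using that inv_into_into[of w \<Phi> C] inj\<psi> by (intro inv_into_f_f) (auto simp: c(3))
  ultimately have "holomorphic_in (mdim M + mdim N) (\<Phi> ` (O' \<inter> C)) (%w. f (snd (inv_into C \<Phi> w)))"
  by (subst holomorphic_in_cong[where g = "%w. f (inv_into V \<psi> (\<psi> (snd (inv_into C \<Phi> w))))"]) simp_all
  then show "\<exists>g. holomorphic_in (mdim (prod_manifold M N)) (\<Phi> ` (O' \<inter> C)) (%w. g (inv_into C \<Phi> w)) \<and>
  (\<forall>y\<in>O'. (\<lambda>y\<in>O'. f (snd y)) y = g y)"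
  by (intro exI[of _ "%y. f (snd y)"]) (simp add: prod_manifold_simps)
  qed simp
 qed
qed

end

section \<open>Local frames\<close>

text \<open>The local triviality clause of \<open>holomorphic_vector_bundle\<close>, named so that
  the neighbourhood, the rank and the frame can be passed around.\<close>

definition frame :: "'y manifold => ('y, 'e) vbundle => 'y set => nat => (nat => 'y => 'e) => bool" where
 "frame M E U r e \<longleftrightarrow> mopen M U \<and>
  (\<forall>z\<in>U. (\<forall>i<r. e i z \<in> carrier (fib E z)) \<and>
  (\<forall>v\<in>carrier (fib E z). \<exists>!c. c \<in> extensional {..<r} \<and>
  v = (\<Oplus>\<^bsub>fib E z\<^esub> i\<in>{..<r}. c i \<odot>\<^bsub>fib E z\<^esub> e i z))) \<and>
  (\<forall>V. mopen M V \<and> V <= U -->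
  sect E V = {\<lambda>z\<in>V. \<Oplus>\<^bsub>fib E z\<^esub> i\<in>{..<r}. f i z \<odot>\<^bsub>fib E z\<^esub> e i z | f. \<forall>i<r. f i \<in> hol M V})"

lemma frame_exists:
 assumes "holomorphic_vector_bundle M E" "y \<in> points M"
 obtains U r e where "frame M E U r e" "y \<in> U"
proof -
 have "\<exists>U r e. frame M E U r e \<and> y \<in> U"
 proof -
  have "\<forall>y\<in>points M. \<exists>U (r::nat) e. mopen M U \<and> y \<in> U \<and>
  (\<forall>z\<in>U. (\<forall>i<r. e i z \<in> carrier (fib E z)) \<and>
  (\<forall>v\<in>carrier (fib E z). \<exists>!c. c \<in> extensional {..<r} \<and>
  v = (\<Oplus>\<^bsub>fib E z\<^esub> i\<in>{..<r}. c i \<odot>\<^bsub>fib E z\<^esub> e i z))) \<and>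
  (\<forall>V. mopen M V \<and> V <= U -->
  sect E V = {\<lambda>z\<in>V. \<Oplus>\<^bsub>fib E z\<^esub> i\<in>{..<r}. f i z \<odot>\<^bsub>fib E z\<^esub> e i z | f. \<forall>i<r. f i \<in> hol M V})"
  using assms(1) unfolding holomorphic_vector_bundle_def by (elim conjE)
  from bspec[OF this assms(2)] show ?thesis
  by (elim exE conjE) (intro exI conjI, unfold frame_def, intro conjI)
 qed
 then show thesis using that by blast
qed

lemma frame_open: "frame M E U r e ==> mopen M U"
 by (simp add: frame_def)

lemma frame_closed: "frame M E U r e ==> z \<in> U ==> i < r ==> e i z \<in> carrier (fib E z)"
 by (simp add: frame_def)

lemma frame_coordinates:
 assumes "frame M E U r e" "z \<in> U" "v \<in> carrier (fib E z)"
 obtains c where "v = (\<Oplus>\<^bsub>fib E z\<^esub> i\<in>{..<r}. c i \<odot>\<^bsub>fib E z\<^esub> e i z)"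
proof -
 have "\<exists>!c. c \<in> extensional {..<r} \<and> v = (\<Oplus>\<^bsub>fib E z\<^esub> i\<in>{..<r}. c i \<odot>\<^bsub>fib E z\<^esub> e i z)"
  using assms by (simp add: frame_def)
 then show thesis using that by blast
qed

lemma ex1_implies_unique: "\<exists>!x. P x ==> P a ==> P b ==> a = b"
 by blast

text \<open>Uniqueness holds in the definition for extensional coefficient functions; restricting
  arbitrary ones to the indices below \<open>r\<close> changes no sum.\<close>

lemma frame_unique:
 assumes F: "frame M E U r e" and z: "z \<in> U" and E: "complex_vs (fib E z)"
  and eq: "(\<Oplus>\<^bsub>fib E z\<^esub> i\<in>{..<r}. c i \<odot>\<^bsub>fib E z\<^esub> e i z) = (\<Oplus>\<^bsub>fib E z\<^esub> i\<in>{..<r}. d i \<odot>\<^bsub>fib E z\<^esub> e i z)"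
  and "i < r"
 shows "c i = d i"
proof -
 interpret cvs "fib E z" using E by (simp add: cvs_iff)
 have cl: "e i z \<in> carrier (fib E z)" if "i < r" for i by (rule frame_closed[OF F z that])
 let ?s = "%c. \<Oplus>\<^bsub>fib E z\<^esub> i\<in>{..<r}. c i \<odot>\<^bsub>fib E z\<^esub> e i z"
 have r: "?s (restrict c {..<r}) = ?s c" for c
  using cl by (intro finsum_cong') auto
 have "?s c \<in> carrier (fib E z)" using cl by (intro finsum_closed) auto
 then have ex1: "\<exists>!c'. c' \<in> extensional {..<r} \<and> ?s c = ?s c'" using F z by (simp add: frame_def)
 have "?s c = ?s (restrict c {..<r})" "?s c = ?s (restrict d {..<r})"
  by (rule r[symmetric], rule trans[OF eq r[symmetric]])
 then have "restrict c {..<r} = restrict d {..<r}"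
  by (intro ex1_implies_unique[OF ex1]) (simp_all only: restrict_extensional simp_thms)
 from fun_cong[OF this, of i] show ?thesis using \<open>i < r\<close> by simp
qed

lemma frame_sect:
 "frame M E U r e ==> mopen M V ==> V <= U ==>
  sect E V = {\<lambda>z\<in>V. \<Oplus>\<^bsub>fib E z\<^esub> i\<in>{..<r}. f i z \<odot>\<^bsub>fib E z\<^esub> e i z | f. \<forall>i<r. f i \<in> hol M V}"
 by (simp add: frame_def)

lemma frame_sectE:
 assumes "frame M E U r e" "mopen M V" "V <= U" "s \<in> sect E V"
 obtains f where "\<forall>i<r. f i \<in> hol M V" "\<forall>z\<in>V. s z = (\<Oplus>\<^bsub>fib E z\<^esub> i\<in>{..<r}. f i z \<odot>\<^bsub>fib E z\<^esub> e i z)"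
proof -
 have "s \<in> {\<lambda>z\<in>V. \<Oplus>\<^bsub>fib E z\<^esub> i\<in>{..<r}. f i z \<odot>\<^bsub>fib E z\<^esub> e i z | f. \<forall>i<r. f i \<in> hol M V}"
  using assms(4) by (simp only: frame_sect[OF assms(1-3)])
 then obtain f where f: "\<forall>i<r. f i \<in> hol M V" and s: "s = (\<lambda>z\<in>V. \<Oplus>\<^bsub>fib E z\<^esub> i\<in>{..<r}. f i z \<odot>\<^bsub>fib E z\<^esub> e i z)"
  by blast
 show thesis by (rule that[OF f]) (simp add: s)
qed

lemma frame_sectI:
 assumes "frame M E U r e" "mopen M V" "V <= U" "\<forall>i<r. f i \<in> hol M V"
 shows "(\<lambda>z\<in>V. \<Oplus>\<^bsub>fib E z\<^esub> i\<in>{..<r}. f i z \<odot>\<^bsub>fib E z\<^esub> e i z) \<in> sect E V"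
 unfolding frame_sect[OF assms(1-3)] using assms(4) by blast

text \<open>The definition of a vector bundle postulates restriction and glueing; closure under the
  module operations has to be read off from frames.\<close>

lemma (in chart_space) sheaf_vector_bundle:
 assumes E: "holomorphic_vector_bundle M E"
 shows "sheaf M E"
proof -
 note D = E[unfolded holomorphic_vector_bundle_def]
 note 1 = D[THEN conjunct1] and 2 = D[THEN conjunct2, THEN conjunct1]
  and 3 = D[THEN conjunct2, THEN conjunct2, THEN conjunct1]
  and 4 = D[THEN conjunct2, THEN conjunct2, THEN conjunct2, THEN conjunct1]
 note cv = bspec[OF 1] and PiE = 2[THEN spec, THEN mp]
 have restr: "restrict s V \<in> sect E V" if "mopen M U" "mopen M V" "V <= U" "s \<in> sect E U" for U V s
  by (rule 3[THEN spec[of _ U], THEN spec, THEN spec, THEN mp]) (intro conjI that)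
 have glue: "s \<in> sect E U" if "mopen M U" "s \<in> extensional U"
  "\<forall>y\<in>U. \<exists>V. mopen M V \<and> y \<in> V \<and> V <= U \<and> restrict s V \<in> sect E V" for U s
  by (rule 4[THEN spec, THEN spec, THEN mp]) (intro conjI that)
 \<comment> \<open>A family of fibre vectors is a section once it has holomorphic coefficients in
   every frame, after intersecting with the frame's domain.\<close>
 have comb: "(\<lambda>y\<in>U. g y) \<in> sect E U"
  if U: "mopen M U" and loc: "!!V r e. frame M E V r e ==> \<exists>f. (\<forall>i<r. f i \<in> hol M (U \<inter> V)) \<and>
  (\<forall>z\<in>U \<inter> V. g z = (\<Oplus>\<^bsub>fib E z\<^esub> i\<in>{..<r}. f i z \<odot>\<^bsub>fib E z\<^esub> e i z))" for U g
 proof (rule glue[OF U])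
  show "\<forall>y\<in>U. \<exists>V. mopen M V \<and> y \<in> V \<and> V <= U \<and> restrict (\<lambda>y\<in>U. g y) V \<in> sect E V"
  proof
  fix y assume y: "y \<in> U"
  obtain V r e where V: "frame M E V r e" "y \<in> V" by (rule frame_exists[OF E mopenD[OF U y]])
  obtain f where f: "\<forall>i<r. f i \<in> hol M (U \<inter> V)"
  "\<forall>z\<in>U \<inter> V. g z = (\<Oplus>\<^bsub>fib E z\<^esub> i\<in>{..<r}. f i z \<odot>\<^bsub>fib E z\<^esub> e i z)" using loc[OF V(1)] by blast
  have UV: "mopen M (U \<inter> V)" by (rule openin_Int[OF U frame_open[OF V(1)]])
  have "restrict (\<lambda>y\<in>U. g y) (U \<inter> V) \<in> sect E (U \<inter> V)"
  by (rule restrI[OF frame_sectI[OF V(1) UV _ f(1)]]) (use f(2) in auto)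
  then show "\<exists>V. mopen M V \<and> y \<in> V \<and> V <= U \<and> restrict (\<lambda>y\<in>U. g y) V \<in> sect E V"
  using UV y V(2) by (intro exI[of _ "U \<inter> V"]) simp
  qed
 qed simp
 show ?thesis
  unfolding sheaf_def presheaf_def
 proof (intro conjI allI impI ballI; (elim conjE)?)
  show "(\<lambda>y\<in>U. \<zero>\<^bsub>fib E y\<^esub>) \<in> sect E U" if U: "mopen M U" for U
  proof (rule comb[OF U])
  fix V r e assume V: "frame M E V r e"
  have "\<zero>\<^bsub>fib E z\<^esub> = (\<Oplus>\<^bsub>fib E z\<^esub> i\<in>{..<r}. (\<lambda>y\<in>U \<inter> V. 0) z \<odot>\<^bsub>fib E z\<^esub> e i z)" if z: "z \<in> U \<inter> V" for z
  proof -
  interpret cvs "fib E z" using cv mopenD[OF U] z by (simp add: cvs_iff)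
  have "(\<Oplus>\<^bsub>fib E z\<^esub> i\<in>{..<r}. (\<lambda>y\<in>U \<inter> V. 0) z \<odot>\<^bsub>fib E z\<^esub> e i z) = (\<Oplus>\<^bsub>fib E z\<^esub> i\<in>{..<r}. \<zero>\<^bsub>fib E z\<^esub>)"
  using z frame_closed[OF V] by (intro finsum_cong') auto
  then show ?thesis by simp
  qed
  then show "\<exists>f. (\<forall>i<r. f i \<in> hol M (U \<inter> V)) \<and>
  (\<forall>z\<in>U \<inter> V. \<zero>\<^bsub>fib E z\<^esub> = (\<Oplus>\<^bsub>fib E z\<^esub> i\<in>{..<r}. f i z \<odot>\<^bsub>fib E z\<^esub> e i z))"
  using hol_const by (intro exI[of _ "%i. \<lambda>y\<in>U \<inter> V. 0"]) blast
  qed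
  show "(\<lambda>y\<in>U. s y \<oplus>\<^bsub>fib E y\<^esub> t y) \<in> sect E U" if U: "mopen M U" and s: "s \<in> sect E U" and t: "t \<in> sect E U" for U s t
  proof (rule comb[OF U])
  fix V r e assume V: "frame M E V r e"
  have UV: "mopen M (U \<inter> V)" by (rule openin_Int[OF U frame_open[OF V(1)]])
  obtain f where f: "\<forall>i<r. f i \<in> hol M (U \<inter> V)"
  "\<forall>z\<in>U \<inter> V. restrict s (U \<inter> V) z = (\<Oplus>\<^bsub>fib E z\<^esub> i\<in>{..<r}. f i z \<odot>\<^bsub>fib E z\<^esub> e i z)"
  by (rule frame_sectE[OF V UV Int_lower2 restr[OF U UV Int_lower1 s]])
  obtain g where g: "\<forall>i<r. g i \<in> hol M (U \<inter> V)"
  "\<forall>z\<in>U \<inter> V. restrict t (U \<inter> V) z = (\<Oplus>\<^bsub>fib E z\<^esub> i\<in>{..<r}. g i z \<odot>\<^bsub>fib E z\<^esub> e i z)"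
  by (rule frame_sectE[OF V UV Int_lower2 restr[OF U UV Int_lower1 t]])
  have "s z \<oplus>\<^bsub>fib E z\<^esub> t z = (\<Oplus>\<^bsub>fib E z\<^esub> i\<in>{..<r}. (\<lambda>y\<in>U \<inter> V. f i y + g i y) z \<odot>\<^bsub>fib E z\<^esub> e i z)"
  if z: "z \<in> U \<inter> V" for z
  proof -
  interpret cvs "fib E z" using cv mopenD[OF U] z by (simp add: cvs_iff)
  have cl: "e i z \<in> carrier (fib E z)" if "i < r" for i using frame_closed[OF V _ that] z by blast
  have "s z \<oplus>\<^bsub>fib E z\<^esub> t z = (\<Oplus>\<^bsub>fib E z\<^esub> i\<in>{..<r}. f i z \<odot>\<^bsub>fib E z\<^esub> e i z \<oplus>\<^bsub>fib E z\<^esub> g i z \<odot>\<^bsub>fib E z\<^esub> e i z)"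
  using f(2) g(2) z cl by (subst finsum_addf) auto
  also have "... = (\<Oplus>\<^bsub>fib E z\<^esub> i\<in>{..<r}. (\<lambda>y\<in>U \<inter> V. f i y + g i y) z \<odot>\<^bsub>fib E z\<^esub> e i z)"
  using z cl by (intro finsum_cong') (auto simp: scale_add_left)
  finally show ?thesis .
  qed
  then show "\<exists>f. (\<forall>i<r. f i \<in> hol M (U \<inter> V)) \<and>
  (\<forall>z\<in>U \<inter> V. s z \<oplus>\<^bsub>fib E z\<^esub> t z = (\<Oplus>\<^bsub>fib E z\<^esub> i\<in>{..<r}. f i z \<odot>\<^bsub>fib E z\<^esub> e i z))"
  using hol_add f(1) g(1) by (intro exI[of _ "%i. \<lambda>y\<in>U \<inter> V. f i y + g i y"]) blast
  qed
  show "(\<lambda>y\<in>U. h y \<odot>\<^bsub>fib E y\<^esub> s y) \<in> sect E U" if U: "mopen M U" and h: "h \<in> hol M U" and s: "s \<in> sect E U" for U h s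
  proof (rule comb[OF U])
  fix V r e assume V: "frame M E V r e"
  have UV: "mopen M (U \<inter> V)" by (rule openin_Int[OF U frame_open[OF V(1)]])
  obtain f where f: "\<forall>i<r. f i \<in> hol M (U \<inter> V)"
  "\<forall>z\<in>U \<inter> V. restrict s (U \<inter> V) z = (\<Oplus>\<^bsub>fib E z\<^esub> i\<in>{..<r}. f i z \<odot>\<^bsub>fib E z\<^esub> e i z)"
  by (rule frame_sectE[OF V UV Int_lower2 restr[OF U UV Int_lower1 s]])
  have "h z \<odot>\<^bsub>fib E z\<^esub> s z = (\<Oplus>\<^bsub>fib E z\<^esub> i\<in>{..<r}. (\<lambda>y\<in>U \<inter> V. restrict h (U \<inter> V) y * f i y) z \<odot>\<^bsub>fib E z\<^esub> e i z)"
  if z: "z \<in> U \<inter> V" for z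
  proof -
  interpret cvs "fib E z" using cv mopenD[OF U] z by (simp add: cvs_iff)
  have cl: "e i z \<in> carrier (fib E z)" if "i < r" for i using frame_closed[OF V _ that] z by blast
  have "h z \<odot>\<^bsub>fib E z\<^esub> s z = (\<Oplus>\<^bsub>fib E z\<^esub> i\<in>{..<r}. h z \<odot>\<^bsub>fib E z\<^esub> (f i z \<odot>\<^bsub>fib E z\<^esub> e i z))"
  using f(2) z cl by (subst finsum_scale[symmetric]) auto
  also have "... = (\<Oplus>\<^bsub>fib E z\<^esub> i\<in>{..<r}. (\<lambda>y\<in>U \<inter> V. restrict h (U \<inter> V) y * f i y) z \<odot>\<^bsub>fib E z\<^esub> e i z)"
  using z cl by (intro finsum_cong') (auto simp: scale_scale)
  finally show ?thesis .
  qed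
  then show "\<exists>f. (\<forall>i<r. f i \<in> hol M (U \<inter> V)) \<and>
  (\<forall>z\<in>U \<inter> V. h z \<odot>\<^bsub>fib E z\<^esub> s z = (\<Oplus>\<^bsub>fib E z\<^esub> i\<in>{..<r}. f i z \<odot>\<^bsub>fib E z\<^esub> e i z))"
  using hol_mult[OF hol_restrict[OF h Int_lower1]] f(1)
  by (intro exI[of _ "%i. \<lambda>y\<in>U \<inter> V. restrict h (U \<inter> V) y * f i y"]) blast
  qed
 next
  show "s \<in> sect E U" if A: "mopen M U" "s \<in> extensional U"
  "\<forall>y\<in>U. \<exists>V. mopen M V \<and> y \<in> V \<and> V <= U \<and> restrict s V \<in> sect E V" for U s
  by (rule glue[OF A])
 qed (rule cv PiE restr; assumption)+
qed

text \<open>Every fibre vector extends to a local section. This is the bridge from identities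
  between sections to identities on fibres.\<close>

definition locally_spanned :: "'y manifold => ('y, 'e) vbundle => bool" where
 "locally_spanned M E \<longleftrightarrow> (\<forall>z\<in>points M. \<forall>v\<in>carrier (fib E z). \<exists>V s. mopen M V \<and> z \<in> V \<and> s \<in> sect E V \<and> s z = v)"

lemma (in chart_space) frame_elem_sect:
 assumes F: "frame M E U r e" and V: "mopen M V" "V <= U" and k: "k < r" and E: "presheaf M E"
 shows "(\<lambda>x\<in>V. e k x) \<in> sect E V"
proof (rule restrI[OF frame_sectI[OF F V]])
 show "\<forall>i<r. (\<lambda>x\<in>V. if k = i then 1 else 0) \<in> hol M V" using hol_const by (cases "k < r") auto
 fix x assume x: "x \<in> V"
 interpret cvs "fib E x" using presheaf_cvs[OF E mopenD[OF V(1) x]] by (simp add: cvs_iff)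
 have cl: "e i x \<in> carrier (fib E x)" if "i < r" for i using frame_closed[OF F subsetD[OF V(2) x] that] .
 have "(\<Oplus>\<^bsub>fib E x\<^esub> i\<in>{..<r}. (\<lambda>x\<in>V. if k = i then 1 else 0) x \<odot>\<^bsub>fib E x\<^esub> e i x) =
  (\<Oplus>\<^bsub>fib E x\<^esub> i\<in>{..<r}. if k = i then e i x else \<zero>\<^bsub>fib E x\<^esub>)"
  using x cl by (intro finsum_cong') auto
 also have "... = e k x" by (rule finsum_singleton) (use k cl in auto)
 finally show "e k x = (\<Oplus>\<^bsub>fib E x\<^esub> i\<in>{..<r}. (\<lambda>x\<in>V. if k = i then 1 else 0) x \<odot>\<^bsub>fib E x\<^esub> e i x)" ..
qed

lemma (in chart_space) locally_spanned_vector_bundle: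
 assumes E: "holomorphic_vector_bundle M E"
 shows "locally_spanned M E"
 unfolding locally_spanned_def
proof (intro ballI)
 fix z v assume z: "z \<in> points M" and v: "v \<in> carrier (fib E z)"
 obtain U r e where F: "frame M E U r e" "z \<in> U" by (rule frame_exists[OF E z])
 obtain c where c: "v = (\<Oplus>\<^bsub>fib E z\<^esub> i\<in>{..<r}. c i \<odot>\<^bsub>fib E z\<^esub> e i z)" by (rule frame_coordinates[OF F v])
 have "(\<lambda>x\<in>U. \<Oplus>\<^bsub>fib E x\<^esub> i\<in>{..<r}. (\<lambda>x\<in>U. c i) x \<odot>\<^bsub>fib E x\<^esub> e i x) \<in> sect E U"
  by (rule frame_sectI[OF F(1) frame_open[OF F(1)] subset_refl]) (intro allI impI hol_const)
 then show "\<exists>V s. mopen M V \<and> z \<in> V \<and> s \<in> sect E V \<and> s z = v"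
  using frame_open[OF F(1)] F(2) by (intro exI conjI) (assumption+, simp add: c)
qed

lemma (in chart_map) locally_spanned_pullback:
 assumes E: "holomorphic_vector_bundle N E"
 shows "locally_spanned M (pullback M N p E)"
 unfolding locally_spanned_def pullback_simps
proof (intro ballI)
 fix z v assume z: "z \<in> points M" and v: "v \<in> carrier (fib E (p z))"
 obtain V s where V: "mopen N V" "p z \<in> V" "s \<in> sect E V" "s (p z) = v"
  using X.locally_spanned_vector_bundle[OF E] p_points[OF z] v unfolding locally_spanned_def by blast
 let ?U = "{y \<in> points M. p y \<in> V}"
 have "(\<lambda>y\<in>?U. s (p y)) \<in> sect (pullback M N p E) ?U"
  by (rule pullback_sect[OF sheaf_presheaf[OF X.sheaf_vector_bundle[OF E]] cont[OF V(1)] V(1) _ V(3)]) auto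
 then show "\<exists>V s. mopen M V \<and> z \<in> V \<and> s \<in> generated_sect M (%y. fib E (p y))
  (%V. {\<lambda>y\<in>V. t (p y) | t W. mopen N W \<and> p ` V <= W \<and> t \<in> sect E W}) V \<and> s z = v"
  using cont[OF V(1)] z V(2,4) unfolding pullback_simps by (intro exI[of _ ?U] exI[of _ "\<lambda>y\<in>?U. s (p y)"]) simp
qed

section \<open>Local splittings\<close>

context chart_map
begin

text \<open>The members of a frame of \<open>TX\<close> are lifted one by one near \<open>y\<close>
  and extended linearly through frame coordinates. The result maps sections to sections, since the
  coordinates of a pulled back section are pulled back holomorphic functions.\<close>

lemma section_exists:
 fixes E :: "('y, 'f) vbundle" and TX :: "('x, 'g) vbundle"
 assumes TX: "holomorphic_vector_bundle N TX" and E: "sheaf M E"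
  and q: "morph_on M (points M) E (pullback M N p TX) q"
  and surj: "!!U s y. mopen M U ==> s \<in> sect (pullback M N p TX) U ==> y \<in> U ==>
  \<exists>V t. mopen M V \<and> y \<in> V \<and> V <= U \<and> t \<in> sect E V \<and> (\<forall>z\<in>V. q z (t z) = s z)"
  and y: "y \<in> points M"
 obtains U \<tau> where "mopen M U" "y \<in> U" "morph_on M U (pullback M N p TX) E \<tau>"
  "\<forall>z\<in>U. \<forall>w\<in>carrier (fib TX (p z)). q z (\<tau> z w) = w"
proof -
 note X' = sheaf_presheaf[OF X.sheaf_vector_bundle[OF TX]]
 note E' = sheaf_presheaf[OF E]
 obtain U0 r e where F: "frame N TX U0 r e" and pyU0: "p y \<in> U0" by (rule frame_exists[OF TX p_points[OF y]])
 note U0 = frame_open[OF F]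
 define V0 where "V0 = {y \<in> points M. p y \<in> U0}"
 have V0: "mopen M V0" "y \<in> V0" "p ` V0 <= U0" unfolding V0_def using cont[OF U0] y pyU0 by auto
 have "\<forall>i\<in>{..<r}. \<exists>V t. mopen M V \<and> y \<in> V \<and> V <= V0 \<and> t \<in> sect E V \<and> (\<forall>z\<in>V. q z (t z) = e i (p z))"
 proof
  fix i assume "i \<in> {..<r}"
  then have "(\<lambda>z\<in>V0. (\<lambda>x\<in>U0. e i x) (p z)) \<in> sect (pullback M N p TX) V0"
  by (intro pullback_sect[OF X' V0(1) U0 V0(3)] X.frame_elem_sect[OF F U0 _ _ X']) auto
  from surj[OF V0(1) this V0(2)] obtain V t where Vt: "mopen M V" "y \<in> V" "V <= V0" "t \<in> sect E V"
  "\<forall>z\<in>V. q z (t z) = (\<lambda>z\<in>V0. (\<lambda>x\<in>U0. e i x) (p z)) z" by blast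
  have "\<forall>z\<in>V. q z (t z) = e i (p z)" using Vt(3,5) V0(3) by (auto simp: subset_iff)
  then show "\<exists>V t. mopen M V \<and> y \<in> V \<and> V <= V0 \<and> t \<in> sect E V \<and> (\<forall>z\<in>V. q z (t z) = e i (p z))"
  using Vt by blast
 qed
 from bchoice[OF this] obtain Vf where
  "\<forall>i\<in>{..<r}. \<exists>t. mopen M (Vf i) \<and> y \<in> Vf i \<and> Vf i <= V0 \<and> t \<in> sect E (Vf i) \<and> (\<forall>z\<in>Vf i. q z (t z) = e i (p z))" ..
 from bchoice[OF this] obtain tf where
  tf: "\<forall>i\<in>{..<r}. mopen M (Vf i) \<and> y \<in> Vf i \<and> Vf i <= V0 \<and> tf i \<in> sect E (Vf i) \<and> (\<forall>z\<in>Vf i. q z (tf i z) = e i (p z))" ..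
 \<comment> \<open>The factor \<open>points M\<close> makes the finite intersection open also for
   rank zero, where the index set is empty.\<close>
 define U where "U = ((\<Inter>i\<in>{..<r}. Vf i) \<inter> points M) \<inter> V0"
 have U: "mopen M U" unfolding U_def using tf V0(1) by (intro openin_Int openin_INT) auto
 have yU: "y \<in> U" unfolding U_def using tf V0(2) y by auto
 have sub: "U <= Vf i" if "i < r" for i using that by (auto simp: U_def)
 have pU: "p z \<in> U0" if "z \<in> U" for z using that by (auto simp: U_def V0_def)
 \<comment> \<open>Frame coordinates, chosen without extensionality; \<open>co_unique\<close>
   determines them at the indices below \<open>r\<close>, the ones over which the sums run.\<close>
 define co where "co = (%x v. SOME c. v = (\<Oplus>\<^bsub>fib TX x\<^esub> i\<in>{..<r}. c i \<odot>\<^bsub>fib TX x\<^esub> e i x))"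
 have co: "v = (\<Oplus>\<^bsub>fib TX x\<^esub> i\<in>{..<r}. co x v i \<odot>\<^bsub>fib TX x\<^esub> e i x)" if xv: "x \<in> U0" "v \<in> carrier (fib TX x)" for x v
 proof -
  obtain c where "v = (\<Oplus>\<^bsub>fib TX x\<^esub> i\<in>{..<r}. c i \<odot>\<^bsub>fib TX x\<^esub> e i x)" by (rule frame_coordinates[OF F xv])
  then show ?thesis
  unfolding co_def by (rule someI[where P = "%c. v = (\<Oplus>\<^bsub>fib TX x\<^esub> i\<in>{..<r}. c i \<odot>\<^bsub>fib TX x\<^esub> e i x)"])
 qed
 have Xx: "complex_vs (fib TX x)" if "x \<in> U0" for x by (rule presheaf_cvs[OF X' mopenD[OF U0 that]])
 have co_unique: "co x v i = c i" if "x \<in> U0" "v \<in> carrier (fib TX x)" "i < r"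
  "v = (\<Oplus>\<^bsub>fib TX x\<^esub> i\<in>{..<r}. c i \<odot>\<^bsub>fib TX x\<^esub> e i x)" for x v c i
  by (rule frame_unique[OF F that(1) Xx[OF that(1)] _ that(3)]) (use co[OF that(1,2)] that(4) in simp)
 define \<tau> where "\<tau> = (%z v. \<Oplus>\<^bsub>fib E z\<^esub> i\<in>{..<r}. co (p z) v i \<odot>\<^bsub>fib E z\<^esub> tf i z)"
 have tcl: "tf i z \<in> carrier (fib E z)" if "i < r" "z \<in> U" for i z
  using tf that sub[OF that(1)] by (intro sect_closed[OF E', of "Vf i"]) auto
 have lin: "lin (fib TX (p z)) (fib E z) (\<tau> z)" if z: "z \<in> U" for z
 proof -
  note x = pU[OF z]
  interpret X: cvs "fib TX (p z)" using Xx[OF x] by (simp add: cvs_iff)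
  interpret E: cvs "fib E z" using presheaf_cvs[OF E' mopenD[OF U z]] by (simp add: cvs_iff)
  have ecl: "e i (p z) \<in> carrier (fib TX (p z))" if "i < r" for i by (rule frame_closed[OF F x that])
  show ?thesis
  proof (rule linI)
  fix v w a assume v: "v \<in> carrier (fib TX (p z))"
  show "\<tau> z v \<in> carrier (fib E z)" unfolding \<tau>_def using tcl z by (intro E.finsum_closed) auto
  have "co (p z) (a \<odot>\<^bsub>fib TX (p z)\<^esub> v) i = a * co (p z) v i" if "i < r" for i
  proof (rule co_unique[OF x _ that])
  have "a \<odot>\<^bsub>fib TX (p z)\<^esub> v = a \<odot>\<^bsub>fib TX (p z)\<^esub> (\<Oplus>\<^bsub>fib TX (p z)\<^esub> i\<in>{..<r}. co (p z) v i \<odot>\<^bsub>fib TX (p z)\<^esub> e i (p z))"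
  using co[OF x v] by simp
  also have "... = (\<Oplus>\<^bsub>fib TX (p z)\<^esub> i\<in>{..<r}. a \<odot>\<^bsub>fib TX (p z)\<^esub> (co (p z) v i \<odot>\<^bsub>fib TX (p z)\<^esub> e i (p z)))"
  by (rule X.finsum_scale) (use ecl in auto)
  also have "... = (\<Oplus>\<^bsub>fib TX (p z)\<^esub> i\<in>{..<r}. (a * co (p z) v i) \<odot>\<^bsub>fib TX (p z)\<^esub> e i (p z))"
  using ecl by (intro X.finsum_cong') (auto simp: X.scale_scale)
  finally show "a \<odot>\<^bsub>fib TX (p z)\<^esub> v = (\<Oplus>\<^bsub>fib TX (p z)\<^esub> i\<in>{..<r}. (a * co (p z) v i) \<odot>\<^bsub>fib TX (p z)\<^esub> e i (p z))" .
  qed (use v in simp)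
  then have "\<tau> z (a \<odot>\<^bsub>fib TX (p z)\<^esub> v) = (\<Oplus>\<^bsub>fib E z\<^esub> i\<in>{..<r}. a \<odot>\<^bsub>fib E z\<^esub> (co (p z) v i \<odot>\<^bsub>fib E z\<^esub> tf i z))"
  unfolding \<tau>_def using tcl[OF _ z] by (intro E.finsum_cong') (auto simp: E.scale_scale)
  also have "... = a \<odot>\<^bsub>fib E z\<^esub> \<tau> z v"
  unfolding \<tau>_def by (rule E.finsum_scale[symmetric]) (use tcl z in auto)
  finally show "\<tau> z (a \<odot>\<^bsub>fib TX (p z)\<^esub> v) = a \<odot>\<^bsub>fib E z\<^esub> \<tau> z v" .
  assume w: "w \<in> carrier (fib TX (p z))"
  have "co (p z) (v \<oplus>\<^bsub>fib TX (p z)\<^esub> w) i = co (p z) v i + co (p z) w i" if "i < r" for i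
  proof (rule co_unique[OF x _ that])
  have "v \<oplus>\<^bsub>fib TX (p z)\<^esub> w = (\<Oplus>\<^bsub>fib TX (p z)\<^esub> i\<in>{..<r}. co (p z) v i \<odot>\<^bsub>fib TX (p z)\<^esub> e i (p z)) \<oplus>\<^bsub>fib TX (p z)\<^esub>
  (\<Oplus>\<^bsub>fib TX (p z)\<^esub> i\<in>{..<r}. co (p z) w i \<odot>\<^bsub>fib TX (p z)\<^esub> e i (p z))"
  using co[OF x v] co[OF x w] by simp
  also have "... = (\<Oplus>\<^bsub>fib TX (p z)\<^esub> i\<in>{..<r}. co (p z) v i \<odot>\<^bsub>fib TX (p z)\<^esub> e i (p z) \<oplus>\<^bsub>fib TX (p z)\<^esub>
  co (p z) w i \<odot>\<^bsub>fib TX (p z)\<^esub> e i (p z))"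
  by (rule X.finsum_addf[symmetric]) (use ecl in auto)
  also have "... = (\<Oplus>\<^bsub>fib TX (p z)\<^esub> i\<in>{..<r}. (co (p z) v i + co (p z) w i) \<odot>\<^bsub>fib TX (p z)\<^esub> e i (p z))"
  using ecl by (intro X.finsum_cong') (auto simp: X.scale_add_left)
  finally show "v \<oplus>\<^bsub>fib TX (p z)\<^esub> w = (\<Oplus>\<^bsub>fib TX (p z)\<^esub> i\<in>{..<r}. (co (p z) v i + co (p z) w i) \<odot>\<^bsub>fib TX (p z)\<^esub> e i (p z))" .
  qed (use v w in simp)
  then have "\<tau> z (v \<oplus>\<^bsub>fib TX (p z)\<^esub> w) = (\<Oplus>\<^bsub>fib E z\<^esub> i\<in>{..<r}. co (p z) v i \<odot>\<^bsub>fib E z\<^esub> tf i z \<oplus>\<^bsub>fib E z\<^esub>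
  co (p z) w i \<odot>\<^bsub>fib E z\<^esub> tf i z)"
  unfolding \<tau>_def using tcl[OF _ z] by (intro E.finsum_cong') (auto simp: E.scale_add_left)
  also have "... = \<tau> z v \<oplus>\<^bsub>fib E z\<^esub> \<tau> z w"
  unfolding \<tau>_def by (rule E.finsum_addf) (use tcl z in auto)
  finally show "\<tau> z (v \<oplus>\<^bsub>fib TX (p z)\<^esub> w) = \<tau> z v \<oplus>\<^bsub>fib E z\<^esub> \<tau> z w" .
  qed
 qed
 moreover have "(\<lambda>z\<in>V. \<tau> z (s z)) \<in> sect E V"
  if V: "mopen M V" "V <= U" and s: "s \<in> sect (pullback M N p TX) V" for V s
 proof (rule pullback_sect_map[OF X' E V(1) lin _ s])
  show "z \<in> U" if "z \<in> V" for z using that V(2) by blast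
  fix V' W t assume V': "mopen M V'" "V' <= V" and W: "mopen N W" "p ` V' <= W" "t \<in> sect TX W"
  let ?W = "W \<inter> U0"
  have Wo: "mopen N ?W" by (rule openin_Int[OF W(1) U0])
  have pV': "p ` V' <= ?W" using W(2) V'(2) V(2) pU by blast
  obtain f where f: "\<forall>i<r. f i \<in> hol N ?W"
  "\<forall>x\<in>?W. restrict t ?W x = (\<Oplus>\<^bsub>fib TX x\<^esub> i\<in>{..<r}. f i x \<odot>\<^bsub>fib TX x\<^esub> e i x)"
  by (rule frame_sectE[OF F Wo Int_lower2 sect_restrict[OF X' W(1) Wo Int_lower1 W(3)]])
  have "(\<lambda>z\<in>V'. \<Oplus>\<^bsub>fib E z\<^esub> i\<in>{..<r}. (\<lambda>z\<in>V'. f i (p z)) z \<odot>\<^bsub>fib E z\<^esub> restrict (tf i) V' z) \<in> sect E V'"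
  proof (rule Y.sect_combination[OF E' V'(1)])
  fix i assume i: "i < r"
  show "(\<lambda>z\<in>V'. f i (p z)) \<in> hol M V'" by (rule hol_pullback[OF Wo V'(1) pV']) (use f i in blast)
  show "restrict (tf i) V' \<in> sect E V'"
  using tf i V'(2) V(2) sub[OF i] by (intro sect_restrict[OF E' _ V'(1), of "Vf i"]) auto
  qed
  then show "(\<lambda>z\<in>V'. \<tau> z (t (p z))) \<in> sect E V'"
  proof (rule restrI)
  fix z assume z: "z \<in> V'"
  then have zU: "z \<in> U" and pz: "p z \<in> ?W" using V'(2) V(2) pV' by auto
  have t: "t (p z) = (\<Oplus>\<^bsub>fib TX (p z)\<^esub> i\<in>{..<r}. f i (p z) \<odot>\<^bsub>fib TX (p z)\<^esub> e i (p z))"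
  using bspec[OF f(2) pz] pz by simp
  have tc: "t (p z) \<in> carrier (fib TX (p z))" by (rule sect_closed[OF X' W(1,3)]) (use pz in simp)
  interpret E: cvs "fib E z" using presheaf_cvs[OF E' mopenD[OF U zU]] by (simp add: cvs_iff)
  show "\<tau> z (t (p z)) = (\<Oplus>\<^bsub>fib E z\<^esub> i\<in>{..<r}. (\<lambda>z\<in>V'. f i (p z)) z \<odot>\<^bsub>fib E z\<^esub> restrict (tf i) V' z)"
  unfolding \<tau>_def using z tcl[OF _ zU] co_unique[OF pU[OF zU] tc _ t] by (intro E.finsum_cong') auto
  qed
 qed
 ultimately have "morph_on M U (pullback M N p TX) E \<tau>" by (simp add: morph_on_def pullback_simps)
 moreover have "q z (\<tau> z w) = w" if z: "z \<in> U" and w: "w \<in> carrier (fib TX (p z))" for z w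
 proof -
  note zp = mopenD[OF U z]
  have ql: "lin (fib E z) (fib TX (p z)) (q z)" using morph_on_lin[OF q zp] by (simp add: pullback_simps)
  note Ez = presheaf_cvs[OF E' zp] and Xz = Xx[OF pU[OF z]]
  interpret E: cvs "fib E z" using Ez by (simp add: cvs_iff)
  interpret X: cvs "fib TX (p z)" using Xz by (simp add: cvs_iff)
  have "q z (\<tau> z w) = (\<Oplus>\<^bsub>fib TX (p z)\<^esub> i\<in>{..<r}. q z (co (p z) w i \<odot>\<^bsub>fib E z\<^esub> tf i z))"
  unfolding \<tau>_def by (rule lin_finsum[OF ql Ez Xz]) (use tcl z in auto)
  also have "... = (\<Oplus>\<^bsub>fib TX (p z)\<^esub> i\<in>{..<r}. co (p z) w i \<odot>\<^bsub>fib TX (p z)\<^esub> e i (p z))"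
  proof (rule X.finsum_cong')
  fix i assume "i \<in> {..<r}"
  then have i: "i < r" by simp
  have "q z (tf i z) = e i (p z)" using tf i sub[OF i] z by blast
  then show "q z (co (p z) w i \<odot>\<^bsub>fib E z\<^esub> tf i z) = co (p z) w i \<odot>\<^bsub>fib TX (p z)\<^esub> e i (p z)"
  using lin_scale[OF ql tcl[OF i z]] by simp
  qed (use frame_closed[OF F pU[OF z]] in auto)
  also have "... = w" using co[OF pU[OF z] w] by simp
  finally show ?thesis .
 qed
 ultimately show thesis using U yU that by blast
qed

end

context chart_space
begin

text \<open>The hypotheses \<open>inj\<close> and \<open>ker\<close> concern sections over open
  sets, whereas a retraction acts on fibres. The core is that \<open>i\<close> is injective on each
  fibre over \<open>U\<close>; given this, \<rho> is the inverse of \<open>i\<close> applied to the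
  projector complementary to \<open>\<tau> q\<close>.\<close>

lemma retraction_exists:
 fixes E' :: "('y, 'e) vbundle" and E :: "('y, 'f) vbundle" and E'' :: "('y, 'g) vbundle"
 assumes hE: "holomorphic_vector_bundle M E" and E': "presheaf M E'" and span: "locally_spanned M E'"
  and E'': "presheaf M E''"
  and i: "morph_on M (points M) E' E i" and q: "morph_on M (points M) E E'' q"
  and inj: "!!U. mopen M U ==> inj_on (%s. \<lambda>y\<in>U. i y (s y)) (sect E' U)"
  and ker: "!!U. mopen M U ==> {t \<in> sect E U. \<forall>y\<in>U. q y (t y) = \<zero>\<^bsub>fib E'' y\<^esub>} = (%s. \<lambda>y\<in>U. i y (s y)) ` sect E' U"
  and U: "mopen M U" and \<tau>: "morph_on M U E'' E \<tau>" and q\<tau>: "\<forall>z\<in>U. \<forall>w\<in>carrier (fib E'' z). q z (\<tau> z w) = w"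
 obtains \<rho> where "split_on M U E' E E'' i q \<tau> \<rho>"
proof -
 note E = sheaf_presheaf[OF sheaf_vector_bundle[OF hE]]
 \<comment> \<open>The projector onto the kernel of \<open>q\<close> along \<tau>: \<open>q\<close>
   annihilates its values, and it fixes the image of \<open>i\<close>.\<close>
 let ?L = "%z e. e \<ominus>\<^bsub>fib E z\<^esub> \<tau> z (q z e)"
 have pts: "z \<in> points M" if "z \<in> U" for z by (rule mopenD[OF U that])
 have Up: "U <= points M" using pts by blast
 have L: "morph_on M U E E ?L"
 proof (rule morph_on_minus[OF E U])
  show "morph_on M U E E (%z e. e)"
  unfolding morph_on_def
  proof (intro conjI ballI allI impI; (elim conjE)?)
  fix V s assume "mopen M V" "V <= U" "s \<in> sect E V"
  then show "(\<lambda>y\<in>V. s y) \<in> sect E V" using sect_extensional[OF E] by (simp add: extensional_restrict)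
  qed (rule lin_id)
  show "morph_on M U E E (%z e. \<tau> z (q z e))" by (rule morph_on_comp[OF morph_on_subset[OF q Up] \<tau>])
 qed
 have cvE: "cvs (fib E z)" and cvE': "cvs (fib E' z)" and cvE'': "cvs (fib E'' z)" if "z \<in> points M" for z
  using presheaf_cvs[OF E that] presheaf_cvs[OF E' that] presheaf_cvs[OF E'' that]
  by (simp_all add: cvs_iff)
 have qL: "q z (?L z e) = \<zero>\<^bsub>fib E'' z\<^esub>" if z: "z \<in> U" and e: "e \<in> carrier (fib E z)" for z e
 proof -
  note zp = pts[OF z]
  have c: "q z e \<in> carrier (fib E'' z)" by (rule lin_closed[OF morph_on_lin[OF q zp] e])
  have "q z (?L z e) = q z e \<ominus>\<^bsub>fib E'' z\<^esub> q z (\<tau> z (q z e))"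
  by (rule lin_minus[OF morph_on_lin[OF q zp] presheaf_cvs[OF E zp] presheaf_cvs[OF E'' zp] e
  lin_closed[OF morph_on_lin[OF \<tau> z] c]])
  then show ?thesis using q\<tau> z c cvs.minus_self[OF cvE''[OF zp] c] by simp
 qed
 \<comment> \<open>Exactness on sections: \<open>?L\<close> applied to \<open>t\<close> lies in the
   kernel of \<open>q\<close> over all of \<open>V\<close>, hence comes from a section of
   \<open>E'\<close>.\<close>
 have B1: "\<exists>u\<in>sect E' V. \<forall>z\<in>V. i z (u z) = ?L z (t z)" if V: "mopen M V" "V <= U" and t: "t \<in> sect E V" for V t
 proof -
  have "(\<lambda>z\<in>V. ?L z (t z)) \<in> sect E V" by (rule morph_on_sect[OF L V t])
  moreover have "\<forall>z\<in>V. q z ((\<lambda>z\<in>V. ?L z (t z)) z) = \<zero>\<^bsub>fib E'' z\<^esub>"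
  using qL V(2) sect_closed[OF E V(1) t] by auto
  ultimately have "(\<lambda>z\<in>V. ?L z (t z)) \<in> (%s. \<lambda>y\<in>V. i y (s y)) ` sect E' V" unfolding ker[OF V(1), symmetric] by blast
  then obtain u where u: "u \<in> sect E' V" "(\<lambda>z\<in>V. ?L z (t z)) = (\<lambda>y\<in>V. i y (u y))" by blast
  have "i z (u z) = ?L z (t z)" if "z \<in> V" for z using fun_cong[OF u(2), of z] that by simp
  then show ?thesis using u(1) by blast
 qed
 have qi_sect: "q z (i z (s z)) = \<zero>\<^bsub>fib E'' z\<^esub>" if V: "mopen M V" and s: "s \<in> sect E' V" and z: "z \<in> V" for V s z
 proof -
  have "(\<lambda>y\<in>V. i y (s y)) \<in> {t \<in> sect E V. \<forall>y\<in>V. q y (t y) = \<zero>\<^bsub>fib E'' y\<^esub>}" unfolding ker[OF V] using s by blast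
  then show ?thesis using z by auto
 qed
 have qi: "q z (i z u) = \<zero>\<^bsub>fib E'' z\<^esub>" if z: "z \<in> points M" and u: "u \<in> carrier (fib E' z)" for z u
 proof -
  obtain V s where "mopen M V" "z \<in> V" "s \<in> sect E' V" "s z = u" using span z u unfolding locally_spanned_def by blast
  then show ?thesis using qi_sect by blast
 qed
 have Li: "?L z (i z u) = i z u" if z: "z \<in> U" and u: "u \<in> carrier (fib E' z)" for z u
 proof -
  note zp = pts[OF z]
  interpret cvs "fib E z" by (rule cvE[OF zp])
  show ?thesis
  using qi[OF zp u] lin_zero[OF morph_on_lin[OF \<tau> z] presheaf_cvs[OF E'' zp] presheaf_cvs[OF E zp]]
  minus_zero_right[OF lin_closed[OF morph_on_lin[OF i zp] u]] by simp
 qed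
 \<comment> \<open>Injectivity on sections does not by itself pass to fibres. Extend
   \<open>u\<close> to a section \<open>s'\<close> and expand \<open>i s'\<close> in a frame
   \<open>e k\<close> of \<open>E\<close> with coefficients \<open>f k\<close>, which vanish at
   \<open>z\<close>. As \<open>?L\<close> fixes \<open>i s'\<close>, the section \<open>s'\<close>
   is the combination, with the same coefficients, of the lifts \<open>R k\<close> of the projected
   frame, and so vanishes at \<open>z\<close>.\<close>
 have B2: "u = \<zero>\<^bsub>fib E' z\<^esub>" if z: "z \<in> U" and u: "u \<in> carrier (fib E' z)" and iu: "i z u = \<zero>\<^bsub>fib E z\<^esub>" for z u
 proof -
  note zp = pts[OF z]
  obtain V s where V: "mopen M V" "z \<in> V" "s \<in> sect E' V" "s z = u"
  using span zp u unfolding locally_spanned_def by blast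
  obtain W r e where F: "frame M E W r e" "z \<in> W" by (rule frame_exists[OF hE zp])
  define Q where "Q = U \<inter> V \<inter> W"
  have Q: "mopen M Q" "Q <= U" "Q <= V" "Q <= W" "z \<in> Q"
  unfolding Q_def using U V F z by (auto intro!: openin_Int frame_open[OF F(1)])
  have Qp: "Q <= points M" using Q(2) Up by blast
  define s' where "s' = restrict s Q"
  have s': "s' \<in> sect E' Q" unfolding s'_def by (rule sect_restrict[OF E' V(1) Q(1,3) V(3)])
  have T: "(\<lambda>x\<in>Q. i x (s' x)) \<in> sect E Q" by (rule morph_on_sect[OF i Q(1) Qp s'])
  obtain f where f: "\<forall>k<r. f k \<in> hol M Q"
  "\<forall>x\<in>Q. (\<lambda>x\<in>Q. i x (s' x)) x = (\<Oplus>\<^bsub>fib E x\<^esub> k\<in>{..<r}. f k x \<odot>\<^bsub>fib E x\<^esub> e k x)"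
  by (rule frame_sectE[OF F(1) Q(1,4) T])
  have ecl: "e k x \<in> carrier (fib E x)" if "k < r" "x \<in> Q" for k x
  by (rule frame_closed[OF F(1) _ that(1)]) (use that Q in blast)
  have f0: "f k z = 0" if k: "k < r" for k
  proof (rule frame_unique[OF F presheaf_cvs[OF E zp] _ k])
  interpret cvs "fib E z" by (rule cvE[OF zp])
  have "(\<Oplus>\<^bsub>fib E z\<^esub> k\<in>{..<r}. 0 \<odot>\<^bsub>fib E z\<^esub> e k z) = (\<Oplus>\<^bsub>fib E z\<^esub> k\<in>{..<r}. \<zero>\<^bsub>fib E z\<^esub>)"
  using ecl[OF _ Q(5)] by (intro finsum_cong') auto
  then show "(\<Oplus>\<^bsub>fib E z\<^esub> k\<in>{..<r}. f k z \<odot>\<^bsub>fib E z\<^esub> e k z) = (\<Oplus>\<^bsub>fib E z\<^esub> k\<in>{..<r}. 0 \<odot>\<^bsub>fib E z\<^esub> e k z)"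
  using bspec[OF f(2) Q(5)] Q(5) iu V(4) by (simp add: s'_def)
  qed
  have "\<forall>k\<in>{..<r}. \<exists>u. u \<in> sect E' Q \<and> (\<forall>x\<in>Q. i x (u x) = ?L x (e k x))"
  proof
  fix k assume "k \<in> {..<r}"
  then have "(\<lambda>x\<in>Q. e k x) \<in> sect E Q" by (intro frame_elem_sect[OF F(1) Q(1,4) _ E]) simp
  from B1[OF Q(1,2) this] show "\<exists>u. u \<in> sect E' Q \<and> (\<forall>x\<in>Q. i x (u x) = ?L x (e k x))" by auto
  qed
  from bchoice[OF this] obtain R where R: "\<forall>k\<in>{..<r}. R k \<in> sect E' Q \<and> (\<forall>x\<in>Q. i x (R k x) = ?L x (e k x))" ..
  let ?S = "\<lambda>x\<in>Q. \<Oplus>\<^bsub>fib E' x\<^esub> k\<in>{..<r}. f k x \<odot>\<^bsub>fib E' x\<^esub> R k x"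
  have S: "?S \<in> sect E' Q" by (rule sect_combination[OF E' Q(1)]) (use f R in auto)
  have Rcl: "R k x \<in> carrier (fib E' x)" if "k < r" "x \<in> Q" for k x
  using R that by (intro sect_closed[OF E' Q(1)]) auto
  \<comment> \<open>Applying \<open>i\<close> to the lifts and pulling \<open>?L\<close> out of the
    sum gives \<open>?L\<close> of \<open>i s'\<close>, which is \<open>i s'\<close> again.\<close>
  have "(\<lambda>x\<in>Q. i x (?S x)) = (\<lambda>x\<in>Q. i x (s' x))"
  proof (rule restrict_ext)
  fix x assume x: "x \<in> Q"
  have xp: "x \<in> points M" and xU: "x \<in> U" using x Qp Q(2) by auto
  note Ex = presheaf_cvs[OF E xp] and E'x = presheaf_cvs[OF E' xp]
  note il = morph_on_lin[OF i xp] and Ll = morph_on_lin[OF L xU]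
  interpret Ex: cvs "fib E x" by (rule cvE[OF xp])
  interpret E'x: cvs "fib E' x" by (rule cvE'[OF xp])
  have "i x (?S x) = (\<Oplus>\<^bsub>fib E x\<^esub> k\<in>{..<r}. i x (f k x \<odot>\<^bsub>fib E' x\<^esub> R k x))"
  using x Rcl[OF _ x] by simp (rule lin_finsum[OF il E'x Ex], simp)
  also have "... = (\<Oplus>\<^bsub>fib E x\<^esub> k\<in>{..<r}. ?L x (f k x \<odot>\<^bsub>fib E x\<^esub> e k x))"
  proof (rule Ex.finsum_cong')
  fix k assume "k \<in> {..<r}"
  then have k: "k < r" "i x (R k x) = ?L x (e k x)" using R x by auto
  show "i x (f k x \<odot>\<^bsub>fib E' x\<^esub> R k x) = ?L x (f k x \<odot>\<^bsub>fib E x\<^esub> e k x)"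
  using lin_scale[OF il Rcl[OF k(1) x], of "f k x"] lin_scale[OF Ll ecl[OF k(1) x], of "f k x"] k(2) by simp
  qed (use ecl[OF _ x] lin_closed[OF Ll] in auto)
  also have "... = ?L x (\<Oplus>\<^bsub>fib E x\<^esub> k\<in>{..<r}. f k x \<odot>\<^bsub>fib E x\<^esub> e k x)"
  by (rule lin_finsum[OF Ll Ex Ex, symmetric]) (use ecl[OF _ x] in auto)
  also have "(\<Oplus>\<^bsub>fib E x\<^esub> k\<in>{..<r}. f k x \<odot>\<^bsub>fib E x\<^esub> e k x) = i x (s' x)" using bspec[OF f(2) x] x by simp
  also have "?L x (i x (s' x)) = i x (s' x)" by (rule Li[OF xU sect_closed[OF E' Q(1) s' x]])
  finally show "i x (?S x) = i x (s' x)" .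
  qed
  then have "?S = s'" by (rule inj_onD[OF inj[OF Q(1)] _ S s'])
  then have "u = ?S z" using V(4) Q(5) by (simp add: s'_def)
  also have "... = \<zero>\<^bsub>fib E' z\<^esub>"
  proof -
  interpret cvs "fib E' z" by (rule cvE'[OF zp])
  have "(\<Oplus>\<^bsub>fib E' z\<^esub> k\<in>{..<r}. f k z \<odot>\<^bsub>fib E' z\<^esub> R k z) = (\<Oplus>\<^bsub>fib E' z\<^esub> k\<in>{..<r}. \<zero>\<^bsub>fib E' z\<^esub>)"
  using f0 Rcl[OF _ Q(5)] by (intro finsum_cong') auto
  then show ?thesis using Q(5) by simp
  qed
  finally show ?thesis .
 qed
 have inj_fib: "u = u'" if z: "z \<in> U" and u: "u \<in> carrier (fib E' z)" "u' \<in> carrier (fib E' z)" and eq: "i z u = i z u'" for z u u'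
 proof -
  note zp = pts[OF z]
  interpret E': cvs "fib E' z" by (rule cvE'[OF zp])
  interpret E: cvs "fib E z" by (rule cvE[OF zp])
  have "i z (u \<ominus>\<^bsub>fib E' z\<^esub> u') = \<zero>\<^bsub>fib E z\<^esub>"
  using lin_minus[OF morph_on_lin[OF i zp] E'.complex_vs E.complex_vs u] eq
  E.minus_self[OF lin_closed[OF morph_on_lin[OF i zp] u(2)]] by simp
  then have "u \<ominus>\<^bsub>fib E' z\<^esub> u' = \<zero>\<^bsub>fib E' z\<^esub>" using B2[OF z] u by simp
  then show ?thesis using E'.minus_eq_zero_iff[OF u] by simp
 qed
 \<comment> \<open>Chosen fibre by fibre, but unique by \<open>inj_fib\<close>; linearity and the
   section property follow by exhibiting a vector with the same image under
   \<open>i\<close>.\<close>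
 define \<rho> where "\<rho> = (%z e. SOME u. u \<in> carrier (fib E' z) \<and> i z u = ?L z e)"
 have \<rho>: "\<rho> z e \<in> carrier (fib E' z) \<and> i z (\<rho> z e) = ?L z e" if z: "z \<in> U" and e: "e \<in> carrier (fib E z)" for z e
 proof -
  obtain V s where V: "mopen M V" "z \<in> V" "s \<in> sect E V" "s z = e"
  using locally_spanned_vector_bundle[OF hE] pts[OF z] e unfolding locally_spanned_def by blast
  have UV: "mopen M (U \<inter> V)" by (rule openin_Int[OF U V(1)])
  obtain u where u: "u \<in> sect E' (U \<inter> V)" "\<forall>x\<in>U \<inter> V. i x (u x) = ?L x (restrict s (U \<inter> V) x)"
  using B1[OF UV Int_lower1 sect_restrict[OF E V(1) UV Int_lower2 V(3)]] by blast
  have "u z \<in> carrier (fib E' z) \<and> i z (u z) = ?L z e"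
  using sect_closed[OF E' UV u(1)] bspec[OF u(2)] z V(2,4) by simp
  then show ?thesis unfolding \<rho>_def by (rule someI)
 qed
 have \<rho>_eq: "\<rho> z e = u" if "z \<in> U" "e \<in> carrier (fib E z)" "u \<in> carrier (fib E' z)" "i z u = ?L z e" for z e u
  using inj_fib[OF that(1) _ that(3)] \<rho>[OF that(1,2)] that(4) by simp
 have "split_on M U E' E E'' i q \<tau> \<rho>"
  unfolding split_on_def
 proof (intro conjI ballI \<tau>)
  show "morph_on M U E E' \<rho>"
  unfolding morph_on_def
  proof (intro conjI ballI allI impI; (elim conjE)?)
  fix z assume z: "z \<in> U"
  note zp = pts[OF z]
  note il = morph_on_lin[OF i zp] and Ll = morph_on_lin[OF L z]
  interpret E': cvs "fib E' z" by (rule cvE'[OF zp])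
  interpret E: cvs "fib E z" by (rule cvE[OF zp])
  show "lin (fib E z) (fib E' z) (\<rho> z)"
  proof (rule linI)
  fix x y a assume x: "x \<in> carrier (fib E z)"
  note rx = \<rho>[OF z x]
  show "\<rho> z x \<in> carrier (fib E' z)" using rx by blast
  show "\<rho> z (a \<odot>\<^bsub>fib E z\<^esub> x) = a \<odot>\<^bsub>fib E' z\<^esub> \<rho> z x"
  using rx by (intro \<rho>_eq[OF z]) (simp_all only: x E.scale_closed E'.scale_closed lin_scale[OF il] lin_scale[OF Ll])
  assume y: "y \<in> carrier (fib E z)"
  show "\<rho> z (x \<oplus>\<^bsub>fib E z\<^esub> y) = \<rho> z x \<oplus>\<^bsub>fib E' z\<^esub> \<rho> z y"
  using rx \<rho>[OF z y] by (intro \<rho>_eq[OF z]) (simp_all only: x y E.a_closed E'.a_closed lin_add[OF il] lin_add[OF Ll])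
  qed
  next
  fix V t assume V: "mopen M V" "V <= U" "t \<in> sect E V"
  obtain u where u: "u \<in> sect E' V" "\<forall>z\<in>V. i z (u z) = ?L z (t z)" using B1[OF V] by blast
  have eq: "\<rho> z (t z) = u z" if z: "z \<in> V" for z
  by (rule \<rho>_eq[OF subsetD[OF V(2) z] sect_closed[OF E V(1,3) z] sect_closed[OF E' V(1) u(1) z] bspec[OF u(2) z]])
  have "restrict u V \<in> sect E' V" using u(1) sect_extensional[OF E' V(1) u(1)] by (simp add: extensional_restrict)
  then show "(\<lambda>z\<in>V. \<rho> z (t z)) \<in> sect E' V" by (rule restrI) (rule eq)
  qed
  fix z assume z: "z \<in> U"
  note zp = pts[OF z]
  show "q z (\<tau> z w) = w" if "w \<in> carrier (fib E'' z)" for w using q\<tau> z that by blast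
  show "q z (i z v) = \<zero>\<^bsub>fib E'' z\<^esub>" if "v \<in> carrier (fib E' z)" for v by (rule qi[OF zp that])
  show "\<rho> z (i z v) = v" if "v \<in> carrier (fib E' z)" for v
  by (rule \<rho>_eq[OF z lin_closed[OF morph_on_lin[OF i zp] that] that Li[OF z that, symmetric]])
  fix e assume e: "e \<in> carrier (fib E z)"
  interpret cvs "fib E z" by (rule cvE[OF zp])
  show "i z (\<rho> z e) \<oplus>\<^bsub>fib E z\<^esub> \<tau> z (q z e) = e"
  using \<rho>[OF z e] add_minus_cancel[OF e lin_closed[OF morph_on_lin[OF \<tau> z] lin_closed[OF morph_on_lin[OF q zp] e]]]
  by simp
 qed
 then show thesis by (rule that)
qed

end

section \<open>Hom sheaves, image sheaves and subspaces of fibres\<close>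

lemma hom_post_hom_post:
 assumes "closed_ops (fib T y)" "lin (fib E y) (fib G y) (\<phi> y)" "g \<in> linear_maps (fib T y) (fib E y)"
 shows "hom_post T G \<psi> y (hom_post T E \<phi> y g) = (\<lambda>v\<in>carrier (fib T y). \<psi> y (\<phi> y (g v)))"
proof -
 have "hom_post T E \<phi> y g \<in> linear_maps (fib T y) (fib G y)"
  by (intro hom_post_linear_map assms)
 then have "hom_post T G \<psi> y (hom_post T E \<phi> y g) = (\<lambda>v\<in>carrier (fib T y). \<psi> y (hom_post T E \<phi> y g v))"
  by (rule hom_post_eq)
 also have "... = (\<lambda>v\<in>carrier (fib T y). \<psi> y (\<phi> y (g v)))"
  by (rule restrict_ext) (simp add: hom_post_eq[OF assms(3)])
 finally show ?thesis .
qed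

lemma linear_map_ext: "g \<in> linear_maps V W ==> (!!v. v \<in> carrier V ==> f v = g v) ==> restrict f (carrier V) = g"
 by (rule extensionalityI[of _ "carrier V"]) (simp_all add: linear_maps_iff)

text \<open>Post-composition with \<open>i\<close>, \<open>q\<close>, \<tau> and \<rho> preserves
  the identities of a splitting. This makes the Hom sequences accessible to
  \<open>connecting_coclass\<close>, whatever the source \<open>T\<close>.\<close>

lemma split_on_hom_post:
 assumes T: "hom_source M T" and E': "presheaf M E'" and E: "presheaf M E" and E'': "presheaf M E''"
  and i: "morph_on M (points M) E' E i" and q: "morph_on M (points M) E E'' q"
  and U: "mopen M U" and split: "split_on M U E' E E'' i q \<tau> \<rho>"
 shows "split_on M U (hom_bundle M T E') (hom_bundle M T E) (hom_bundle M T E'')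
  (hom_post T E' i) (hom_post T E q) (hom_post T E'' \<tau>) (hom_post T E \<rho>)"
 unfolding split_on_def
proof (intro conjI ballI)
 have \<tau>: "morph_on M U E'' E \<tau>" and \<rho>: "morph_on M U E E' \<rho>" using split by (simp_all add: split_on_def)
 show "morph_on M U (hom_bundle M T E'') (hom_bundle M T E) (hom_post T E'' \<tau>)"
  by (rule morph_on_hom_post[OF T E'' U \<tau>])
 show "morph_on M U (hom_bundle M T E) (hom_bundle M T E') (hom_post T E \<rho>)"
  by (rule morph_on_hom_post[OF T E U \<rho>])
 fix y assume y: "y \<in> U"
 note yp = mopenD[OF U y]
 note c = hom_source_ops[OF T yp]
 note il = morph_on_lin[OF i yp] and ql = morph_on_lin[OF q yp]
  and \<tau>l = morph_on_lin[OF \<tau> y] and \<rho>l = morph_on_lin[OF \<rho> y]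
 have s: "\<forall>w\<in>carrier (fib E'' y). q y (\<tau> y w) = w" "\<forall>v\<in>carrier (fib E' y). \<rho> y (i y v) = v"
  "\<forall>v\<in>carrier (fib E' y). q y (i y v) = \<zero>\<^bsub>fib E'' y\<^esub>"
  "\<forall>e\<in>carrier (fib E y). i y (\<rho> y e) \<oplus>\<^bsub>fib E y\<^esub> \<tau> y (q y e) = e"
  using split y unfolding split_on_def by blast+
 {
  fix g assume "g \<in> carrier (fib (hom_bundle M T E'') y)"
  then have g: "g \<in> linear_maps (fib T y) (fib E'' y)" by simp
  show "hom_post T E q y (hom_post T E'' \<tau> y g) = g"
  unfolding hom_post_hom_post[where T = T and y = y and \<phi> = \<tau>, OF c \<tau>l g] using s(1) lin_closed[OF linear_map_lin[OF g]]
  by (intro linear_map_ext[OF g]) simp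
 next
  fix g assume "g \<in> carrier (fib (hom_bundle M T E') y)"
  then have g: "g \<in> linear_maps (fib T y) (fib E' y)" by simp
  show "hom_post T E \<rho> y (hom_post T E' i y g) = g"
  unfolding hom_post_hom_post[where T = T and y = y and \<phi> = i, OF c il g] using s(2) lin_closed[OF linear_map_lin[OF g]]
  by (intro linear_map_ext[OF g]) simp
  show "hom_post T E q y (hom_post T E' i y g) = \<zero>\<^bsub>fib (hom_bundle M T E'') y\<^esub>"
  unfolding hom_post_hom_post[where T = T and y = y and \<phi> = i, OF c il g] fib_hom_bundle hom_space_simps
  using s(3) lin_closed[OF linear_map_lin[OF g]] by (intro restrict_ext) simp
 next
  fix g assume "g \<in> carrier (fib (hom_bundle M T E) y)"
  then have g: "g \<in> linear_maps (fib T y) (fib E y)" by simp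
  show "hom_post T E' i y (hom_post T E \<rho> y g) \<oplus>\<^bsub>fib (hom_bundle M T E) y\<^esub> hom_post T E'' \<tau> y (hom_post T E q y g) = g"
  unfolding hom_post_hom_post[where T = T and y = y and \<phi> = \<rho>, OF c \<rho>l g] hom_post_hom_post[where T = T and y = y and \<phi> = q, OF c ql g] fib_hom_bundle hom_space_simps
  using s(4) lin_closed[OF linear_map_lin[OF g]] by (intro linear_map_ext[OF g]) simp
 }
qed

lemma fib_image_bundle: "fib (image_bundle M E G \<phi>) y = (fib G y)\<lparr>carrier := \<phi> y ` carrier (fib E y)\<rparr>"
 by (simp add: image_bundle_def)

lemma morphism_into_image:
 assumes E: "presheaf M E" and \<phi>: "!!y. y \<in> points M ==> lin (fib E y) (fib G y) (\<phi> y)" and U: "U <= points M"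
 shows "morph_on M U E (image_bundle M E G \<phi>) \<phi>"
 unfolding morph_on_def fib_image_bundle
proof (intro conjI ballI allI impI; (elim conjE)?)
 show "lin (fib E y) ((fib G y)\<lparr>carrier := \<phi> y ` carrier (fib E y)\<rparr>) (\<phi> y)" if "y \<in> U" for y
  using \<phi>[of y] that U unfolding lin_def by auto
 show "(\<lambda>y\<in>V. \<phi> y (s y)) \<in> sect (image_bundle M E G \<phi>) V" if "mopen M V" "V <= U" "s \<in> sect E V" for V s
  using that unfolding image_bundle_def by auto
qed

text \<open>On the image, \<open>h\<close> is determined by \<open>g\<close> on preimages, and
  sections of the image have local lifts; the properties of \<open>g\<close> thus descend. The work
  in applying it lies in verifying \<open>h\<close>, that is in well-definedness.\<close>

lemma morphism_from_image:
 assumes E: "presheaf M E" and \<phi>: "!!y. y \<in> points M ==> lin (fib E y) (fib G y) (\<phi> y)"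
  and H: "sheaf M H" and g: "morph_on M U E H g" and U: "U <= points M"
  and h: "!!y t. y \<in> U ==> t \<in> carrier (fib E y) ==> h y (\<phi> y t) = g y t"
 shows "morph_on M U (image_bundle M E G \<phi>) H h"
 unfolding morph_on_def fib_image_bundle
proof (intro conjI ballI allI impI; (elim conjE)?)
 fix y assume y: "y \<in> U"
 note l = \<phi>[OF subsetD[OF U y]] and gl = morph_on_lin[OF g y]
 interpret Ey: cvs "fib E y" using presheaf_cvs[OF E subsetD[OF U y]] by (simp add: cvs_iff)
 show "lin ((fib G y)\<lparr>carrier := \<phi> y ` carrier (fib E y)\<rparr>) (fib H y) (h y)"
 proof (rule linI)
  fix x x' a assume "x \<in> carrier ((fib G y)\<lparr>carrier := \<phi> y ` carrier (fib E y)\<rparr>)"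
  then obtain t where t: "t \<in> carrier (fib E y)" "x = \<phi> y t" by auto
  show "h y x \<in> carrier (fib H y)" using t h[OF y] lin_closed[OF gl] by simp
  show "h y (a \<odot>\<^bsub>(fib G y)\<lparr>carrier := \<phi> y ` carrier (fib E y)\<rparr>\<^esub> x) = a \<odot>\<^bsub>fib H y\<^esub> h y x"
  using h[OF y Ey.scale_closed[OF t(1), of a]] h[OF y t(1)] t
  by (simp add: lin_scale[OF l t(1)] lin_scale[OF gl t(1)])
  assume "x' \<in> carrier ((fib G y)\<lparr>carrier := \<phi> y ` carrier (fib E y)\<rparr>)"
  then obtain t' where t': "t' \<in> carrier (fib E y)" "x' = \<phi> y t'" by auto
  show "h y (x \<oplus>\<^bsub>(fib G y)\<lparr>carrier := \<phi> y ` carrier (fib E y)\<rparr>\<^esub> x') = h y x \<oplus>\<^bsub>fib H y\<^esub> h y x'"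
  using h[OF y Ey.a_closed[OF t(1) t'(1)]] h[OF y t(1)] h[OF y t'(1)] t t'
  by (simp add: lin_add[OF l t(1) t'(1)] lin_add[OF gl t(1) t'(1)])
 qed
next
 fix V s assume V: "mopen M V" "V <= U" and s: "s \<in> sect (image_bundle M E G \<phi>) V"
 show "(\<lambda>y\<in>V. h y (s y)) \<in> sect H V"
 proof (rule sect_local[OF H V(1)])
  fix y assume y: "y \<in> V"
  have "\<forall>y\<in>V. \<exists>W t. mopen M W \<and> y \<in> W \<and> W <= V \<and> t \<in> sect E W \<and> (\<forall>z\<in>W. s z = \<phi> z (t z))"
  using s by (simp add: image_bundle_def)
  from bspec[OF this y] obtain W t where W: "mopen M W" "y \<in> W" "W <= V" "t \<in> sect E W" "\<forall>z\<in>W. s z = \<phi> z (t z)"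
  by (elim exE conjE)
  have "(\<lambda>z\<in>W. g z (t z)) \<in> sect H W" by (rule morph_on_sect[OF g W(1) order_trans[OF W(3) V(2)] W(4)])
  moreover have "h z (s z) = g z (t z)" if z: "z \<in> W" for z
  using bspec[OF W(5) z] h[OF _ sect_closed[OF E W(1,4) z]] z W(3) V(2) by (metis subsetD)
  ultimately show "\<exists>W t. mopen M W \<and> y \<in> W \<and> W <= V \<and> t \<in> sect H W \<and> (\<forall>z\<in>W. (\<lambda>y\<in>V. h y (s y)) z = t z)"
  using W(1-3) by (intro exI[of _ W] exI[of _ "\<lambda>z\<in>W. g z (t z)"]) (simp add: subset_iff)
 qed simp
qed

text \<open>The identification of the first exterior power with the space itself: on lists of length
  one \<open>hd\<close> is alternating, so it lifts and inverts \<open>ext_elem\<close>.\<close>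

lemma ext_1_unlift:
 assumes V: "complex_vs V"
 shows "lin (ext_power 1 V) V (ext_lift 1 V V hd)"
  and "v \<in> carrier V ==> ext_lift 1 V V hd (ext_elem 1 V [v]) = v"
  and "x \<in> carrier (ext_power 1 V) ==> ext_elem 1 V [ext_lift 1 V V hd x] = x"
proof -
 have alt: "alternating 1 V V hd"
  by (rule alternatingI) (auto simp: ext_gens_def length_Suc_conv Cons_eq_append_conv append_eq_Cons_conv One_nat_def)
 show "lin (ext_power 1 V) V (ext_lift 1 V V hd)" by (rule lin_ext_lift[OF V V alt])
 show *: "ext_lift 1 V V hd (ext_elem 1 V [v]) = v" if "v \<in> carrier V" for v
  using ext_lift_elem[OF V V alt, of "[v]"] that unfolding ext_gens_1 by simp
 show "ext_elem 1 V [ext_lift 1 V V hd x] = x" if "x \<in> carrier (ext_power 1 V)"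
  using that by (rule ext_power_1E[OF _ V]) (simp add: *)
qed

text \<open>A subspace is given as a space with smaller carrier, as in \<open>image_bundle\<close>;
  being closed under the operations, it contains the range once it contains the images of
  generators.\<close>

lemma lin_presented_range:
 assumes f: "lin (presented S R) F f" and F: "complex_vs (F\<lparr>carrier := C\<rparr>)"
  and gen: "!!g. g \<in> S ==> f (presented_gen R g) \<in> C" and zero: "f \<zero>\<^bsub>presented S R\<^esub> \<in> C"
  and x: "x \<in> carrier (presented S R)"
 shows "f x \<in> C"
proof -
 interpret C: cvs "F\<lparr>carrier := C\<rparr>" using F by (simp add: cvs_iff)
 interpret P: cvs "presented S R" by (simp add: cvs_iff complex_vs_presented)
 show ?thesis using x
 proof (induction rule: presented_induct)
  case (add x a g)
  have "f (x \<oplus>\<^bsub>presented S R\<^esub> a \<odot>\<^bsub>presented S R\<^esub> presented_gen R g) = f x \<oplus>\<^bsub>F\<^esub> a \<odot>\<^bsub>F\<^esub> f (presented_gen R g)"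
  using add by (simp add: lin_add[OF f] lin_scale[OF f] presented_gen_closed)
  then show ?case using C.a_closed[of "f x" "a \<odot>\<^bsub>F\<^esub> f (presented_gen R g)"] C.scale_closed[of "f (presented_gen R g)" a] add gen
  by simp
 qed (rule zero)
qed

lemma lin_ext_range:
 assumes f: "lin (ext_power k V) F f" and F: "complex_vs F" and C: "complex_vs (F\<lparr>carrier := C\<rparr>)"
  and gen: "!!vs. vs \<in> ext_gens k V ==> f (ext_elem k V vs) \<in> C" and x: "x \<in> carrier (ext_power k V)"
 shows "f x \<in> C"
proof -
 interpret C: cvs "F\<lparr>carrier := C\<rparr>" using C by (simp add: cvs_iff)
 have "\<zero>\<^bsub>F\<^esub> \<in> C" using C.zero_closed by simp
 then have z: "f \<zero>\<^bsub>presented (ext_gens k V) (ext_rels k V)\<^esub> \<in> C"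
  using lin_zero[OF f cvs_ext F] by (simp add: ext_power_def)
 show ?thesis
  by (rule lin_presented_range[OF f[unfolded ext_power_def] C _ z x[unfolded ext_power_def]])
  (use gen in \<open>simp add: ext_elem_def\<close>)
qed

lemma lin_tensor_ext_range:
 assumes f: "lin (ext_tensor k V l W) F f" and F: "complex_vs F"
  and C: "complex_vs (F\<lparr>carrier := C\<rparr>)"
  and gen: "!!vs ws. vs \<in> ext_gens k V ==> ws \<in> ext_gens l W ==>
  f (ext_tensor_elem k V l W (ext_elem k V vs) (ext_elem l W ws)) \<in> C"
  and x: "x \<in> carrier (ext_tensor k V l W)"
 shows "f x \<in> C"
proof -
 interpret C: cvs "F\<lparr>carrier := C\<rparr>" using C by (simp add: cvs_iff)
 have zC: "\<zero>\<^bsub>F\<^esub> \<in> C" using C.zero_closed by simp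
 show ?thesis
 proof (rule lin_presented_range[OF f[unfolded tensor_space_def] C _ _ x[unfolded tensor_space_def]])
  show "f \<zero>\<^bsub>presented (carrier (ext_power k V) \<times> carrier (ext_power l W)) (tensor_rels (ext_power k V) (ext_power l W))\<^esub> \<in> C"
  using lin_zero[OF f cvs_tensor F] zC by (simp add: tensor_space_def)
  fix vw assume "vw \<in> carrier (ext_power k V) \<times> carrier (ext_power l W)"
  then obtain v w where vw: "vw = (v, w)" and v: "v \<in> carrier (ext_power k V)" and w: "w \<in> carrier (ext_power l W)"
  by auto
  note b = bilin_lin_comp[OF bilin_tensor_elem f]
  have "f (ext_tensor_elem k V l W v w) \<in> C"
  proof (rule lin_ext_range[OF bilin_left[OF b w] F C _ v])
  fix vs assume vs: "vs \<in> ext_gens k V"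
  show "f (ext_tensor_elem k V l W (ext_elem k V vs) w) \<in> C"
  by (rule lin_ext_range[OF bilin_right[OF b ext_elem_closed[OF vs]] F C gen[OF vs] w])
  qed
  then show "f (presented_gen (tensor_rels (ext_power k V) (ext_power l W)) vw) \<in> C"
  by (simp add: vw tensor_elem_def)
 qed
qed

section \<open>The filtration of a gt-model\<close>

locale gt =
 fixes \<Y> :: "('x, 'b, 'u, 'w, 'e) gt_data"
 assumes model: "gt_model \<Y>"
begin

abbreviation "Y \<equiv> total \<Y>"
abbreviation "TX \<equiv> from_fiber \<Y> (fiber_odd \<Y>)"
abbreviation "TB \<equiv> from_base \<Y> (base_odd \<Y>)"
abbreviation "TY \<equiv> total_odd \<Y>"
abbreviation "XX a \<equiv> from_fiber \<Y> (ext_bundle (fiber \<Y>) a (fiber_odd \<Y>))"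
abbreviation "XB b \<equiv> from_base \<Y> (ext_bundle (base \<Y>) b (base_odd \<Y>))"
abbreviation "fV y \<equiv> fib (base_odd \<Y>) (snd y)"
abbreviation "fW y \<equiv> fib (fiber_odd \<Y>) (fst y)"
abbreviation "fE y \<equiv> fib (total_odd \<Y>) y"
abbreviation "odd_split U \<equiv> split_on Y U TB TY TX (odd_incl \<Y>) (odd_proj \<Y>)"
abbreviation "wedgeY k l y \<equiv> fwedge k l (fV y) (fE y) (odd_incl \<Y> y)"
abbreviation "projY k l y \<equiv> rext_map k l (fV y) (fE y) (fW y) (odd_proj \<Y> y)"

lemma bundles: "holomorphic_vector_bundle (fiber \<Y>) (fiber_odd \<Y>)"
 "holomorphic_vector_bundle (base \<Y>) (base_odd \<Y>)"
 "holomorphic_vector_bundle Y TY" "short_exact Y TB TY TX (odd_incl \<Y>) (odd_proj \<Y>)"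
 using model by (simp_all add: gt_model_def)

sublocale px: chart_map Y "fiber \<Y>" fst
 using model unfolding gt_model_def total_def by (intro chart_map_fst) simp_all

sublocale pb: chart_map Y "base \<Y>" snd
 using model unfolding gt_model_def total_def by (intro chart_map_snd) simp_all

lemma fib_simps [simp]:
 "fib TX y = fW y" "fib TB y = fV y" "fib (XX a) y = ext_power a (fW y)" "fib (XB b) y = ext_power b (fV y)"
 by (simp_all add: from_fiber_def from_base_def px.pullback_simps pb.pullback_simps px.X.ext_bundle_simps pb.X.ext_bundle_simps)

lemma base_presheaf: "presheaf (base \<Y>) (base_odd \<Y>)"
 and fiber_presheaf: "presheaf (fiber \<Y>) (fiber_odd \<Y>)"
 by (rule sheaf_presheaf[OF pb.X.sheaf_vector_bundle[OF bundles(2)]]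
  sheaf_presheaf[OF px.X.sheaf_vector_bundle[OF bundles(1)]])+

lemma TX_sheaf: "sheaf Y TX" and TB_sheaf: "sheaf Y TB" and TY_sheaf: "sheaf Y TY"
 and XX_sheaf: "sheaf Y (XX a)" and XB_sheaf: "sheaf Y (XB b)"
 unfolding from_fiber_def from_base_def
 by (rule px.sheaf_pullback pb.sheaf_pullback px.Y.sheaf_vector_bundle bundles
  base_presheaf fiber_presheaf sheaf_presheaf px.X.sheaf_ext pb.X.sheaf_ext)+

lemmas TX_presheaf = sheaf_presheaf[OF TX_sheaf] and TB_presheaf = sheaf_presheaf[OF TB_sheaf]
 and TY_presheaf = sheaf_presheaf[OF TY_sheaf] and XX_presheaf = sheaf_presheaf[OF XX_sheaf]
 and XB_presheaf = sheaf_presheaf[OF XB_sheaf]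

lemma ext_TY_sheaf: "sheaf Y (ext_bundle Y k TY)"
 by (rule px.Y.sheaf_ext[OF TY_presheaf])

lemmas ext_TY_presheaf = sheaf_presheaf[OF ext_TY_sheaf]

lemma cvs_fibers: "y \<in> points Y ==> complex_vs (fV y)" "y \<in> points Y ==> complex_vs (fW y)"
 "y \<in> points Y ==> complex_vs (fE y)"
 using presheaf_cvs[OF TB_presheaf] presheaf_cvs[OF TX_presheaf] presheaf_cvs[OF TY_presheaf]
 by simp_all

lemma incl: "morph_on Y (points Y) TB TY (odd_incl \<Y>)" and proj: "morph_on Y (points Y) TY TX (odd_proj \<Y>)"
 using bundles(4) unfolding short_exact_def by (auto intro: hom_sect_morphism)

lemma incl_lin: "y \<in> points Y ==> lin (fV y) (fE y) (odd_incl \<Y> y)"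
 and proj_lin: "y \<in> points Y ==> lin (fE y) (fW y) (odd_proj \<Y> y)"
 using morph_on_lin[OF incl] morph_on_lin[OF proj] by simp_all

lemma splitting_exists:
 assumes y: "y \<in> points Y"
 obtains U s \<rho> where "mopen Y U" "y \<in> U" "odd_split U s \<rho>"
proof -
 note ex = bundles(4)[unfolded short_exact_def]
 note exU = ex[THEN conjunct2, THEN conjunct2, THEN spec, THEN mp]
 have surj: "\<exists>V t. mopen Y V \<and> y \<in> V \<and> V <= U \<and> t \<in> sect TY V \<and> (\<forall>z\<in>V. odd_proj \<Y> z (t z) = s z)"
  if "mopen Y U" "s \<in> sect TX U" "y \<in> U" for U s y
  using exU[OF that(1)] that(2,3) by blast
 obtain U s where U: "mopen Y U" "y \<in> U" "morph_on Y U TX TY s"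
  "\<forall>z\<in>U. \<forall>w\<in>carrier (fW z). odd_proj \<Y> z (s z w) = w"
  by (rule px.section_exists[OF bundles(1) TY_sheaf proj[unfolded from_fiber_def] surj[unfolded from_fiber_def] y])
  (auto simp: from_fiber_def)
 have q: "\<forall>z\<in>U. \<forall>w\<in>carrier (fib TX z). odd_proj \<Y> z (s z w) = w" using U(4) by simp
 have span: "locally_spanned Y TB" unfolding from_base_def by (rule pb.locally_spanned_pullback[OF bundles(2)])
 obtain \<rho> where "odd_split U s \<rho>"
  by (rule px.Y.retraction_exists[OF bundles(3) TB_presheaf span TX_presheaf incl proj _ _ U(1,3) q])
  (rule exU[THEN conjunct1] exU[THEN conjunct2, THEN conjunct1], assumption)+
 then show thesis using that U(1,2) by blast
qed

subsection \<open>Sections of first exterior powers\<close>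

text \<open>By construction such a section is only locally a combination of pulled back elements.
  Undoing \<open>ext_elem\<close> fibrewise yields one section of \<open>TX\<close> over all of
  \<open>V\<close>, to which a morphism can be applied.\<close>

lemma XX1_sectE:
 assumes V: "mopen Y V" and s: "s \<in> sect (XX 1) V"
 obtains u where "u \<in> sect TX V" "\<forall>y\<in>V. s y = ext_elem 1 (fW y) [u y]"
proof -
 let ?l = "%y. ext_lift 1 (fW y) (fW y) hd"
 have cv: "complex_vs (fW y)" if "y \<in> V" for y using cvs_fibers(2)[OF mopenD[OF V that]] .
 have "(\<lambda>y\<in>V. ?l y (s y)) \<in> sect TX V"
  unfolding from_fiber_def
 proof (rule px.pullback_ext_sect_map[OF fiber_presheaf TX_sheaf[unfolded from_fiber_def] V _ _ s[unfolded from_fiber_def]])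
  show "lin (ext_power 1 (fW y)) (fib (pullback Y (fiber \<Y>) fst (fiber_odd \<Y>)) y) (?l y)" if "y \<in> V" for y
  using ext_1_unlift(1)[OF cv[OF that]] by (simp add: px.pullback_simps)
  fix V' W ss assume V': "mopen Y V'" "V' <= V" and W: "mopen (fiber \<Y>) W" "fst ` V' <= W"
  and ss: "length ss = 1" "set ss <= sect (fiber_odd \<Y>) W"
  then obtain t where t: "ss = [t]" "t \<in> sect (fiber_odd \<Y>) W"
  by (cases ss) (auto simp: One_nat_def)
  show "(\<lambda>y\<in>V'. ?l y (ext_elem 1 (fW y) (map (%s. s (fst y)) ss))) \<in> sect (pullback Y (fiber \<Y>) fst (fiber_odd \<Y>)) V'"
  proof (rule restrI[OF px.pullback_sect[OF fiber_presheaf V'(1) W t(2)]])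
  fix y assume y: "y \<in> V'"
  then have "t (fst y) \<in> carrier (fW y)" using W(2) by (intro sect_closed[OF fiber_presheaf W(1) t(2)]) auto
  then show "?l y (ext_elem 1 (fW y) (map (%s. s (fst y)) ss)) = t (fst y)"
  using ext_1_unlift(2)[OF cv[OF subsetD[OF V'(2) y]]] by (simp add: t(1))
  qed
 qed
 moreover have "s y = ext_elem 1 (fW y) [(\<lambda>y\<in>V. ?l y (s y)) y]" if y: "y \<in> V" for y
  using ext_1_unlift(3)[OF cv[OF y]] sect_closed[OF XX_presheaf V s y] y by simp
 ultimately show thesis using that by blast
qed

lemma XX1_sectI:
 assumes V: "mopen Y V" and u: "u \<in> sect TX V"
 shows "(\<lambda>y\<in>V. ext_elem 1 (fW y) [u y]) \<in> sect (XX 1) V"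
proof (rule px.pullback_sect_map[OF fiber_presheaf XX_sheaf V _ _ u[unfolded from_fiber_def]])
 show "lin (fW y) (fib (XX 1) y) (%v. ext_elem 1 (fW y) [v])" for y
  using lin_ext_elem_1 by simp
 fix V' W t assume V': "mopen Y V'" "V' <= V" and W: "mopen (fiber \<Y>) W" "fst ` V' <= W" "t \<in> sect (fiber_odd \<Y>) W"
 have "(\<lambda>x\<in>W. ext_elem 1 (fib (fiber_odd \<Y>) x) (map (%s. s x) [t])) \<in> sect (ext_bundle (fiber \<Y>) 1 (fiber_odd \<Y>)) W"
  by (rule px.X.ext_elem_sect[OF fiber_presheaf W(1)]) (use W(3) in \<open>auto simp: One_nat_def\<close>)
 from px.pullback_sect[OF sheaf_presheaf[OF px.X.sheaf_ext[OF fiber_presheaf]] V'(1) W(1,2) this]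
 show "(\<lambda>y\<in>V'. ext_elem 1 (fW y) [t (fst y)]) \<in> sect (XX 1) V'"
  unfolding from_fiber_def by (rule restrI) (use W(2) in \<open>simp add: image_subset_iff\<close>)
qed

lemma XX0_sect:
 assumes V: "mopen Y V"
 shows "(\<lambda>y\<in>V. ext_elem 0 (fW y) []) \<in> sect (XX 0) V"
proof -
 have W: "mopen (fiber \<Y>) (points (fiber \<Y>))" "fst ` V <= points (fiber \<Y>)"
  using px.p_points mopenD[OF V] by auto
 have "(\<lambda>x\<in>points (fiber \<Y>). ext_elem 0 (fib (fiber_odd \<Y>) x) (map (%s. s x) [])) \<in> sect (ext_bundle (fiber \<Y>) 0 (fiber_odd \<Y>)) (points (fiber \<Y>))"
  by (rule px.X.ext_elem_sect[OF fiber_presheaf W(1)]) auto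
 from px.pullback_sect[OF sheaf_presheaf[OF px.X.sheaf_ext[OF fiber_presheaf]] V W this]
 show ?thesis unfolding from_fiber_def by (rule restrI) (use W(2) in \<open>simp add: image_subset_iff\<close>)
qed

lemma ext_TY_1_sectE:
 assumes V: "mopen Y V" and s: "s \<in> sect (ext_bundle Y 1 TY) V"
 obtains u where "u \<in> sect TY V" "\<forall>y\<in>V. s y = ext_elem 1 (fE y) [u y]"
proof -
 let ?l = "%y. ext_lift 1 (fE y) (fE y) hd"
 have cv: "complex_vs (fE y)" if "y \<in> V" for y using cvs_fibers(3)[OF mopenD[OF V that]] .
 have "(\<lambda>y\<in>V. ?l y (s y)) \<in> sect TY V"
 proof (rule px.Y.ext_sect_map[OF TY_presheaf TY_sheaf V ext_1_unlift(1)[OF cv] _ s])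
  fix V' ss assume V': "mopen Y V'" "V' <= V" and ss: "length ss = 1" "set ss <= sect TY V'"
  then obtain t where t: "ss = [t]" "t \<in> sect TY V'" by (cases ss) (auto simp: One_nat_def)
  have "restrict t V' \<in> sect TY V'" using sect_restrict[OF TY_presheaf V'(1) V'(1) subset_refl t(2)] .
  then show "(\<lambda>y\<in>V'. ?l y (ext_elem 1 (fE y) (map (%s. s y) ss))) \<in> sect TY V'"
  proof (rule restrI)
  fix y assume y: "y \<in> V'"
  show "?l y (ext_elem 1 (fE y) (map (%s. s y) ss)) = t y"
  using ext_1_unlift(2)[OF cv[OF subsetD[OF V'(2) y]]] sect_closed[OF TY_presheaf V'(1) t(2) y] by (simp add: t(1))
  qed
 qed
 moreover have "s y = ext_elem 1 (fE y) [(\<lambda>y\<in>V. ?l y (s y)) y]" if y: "y \<in> V" for y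
  using ext_1_unlift(3)[OF cv[OF y]] sect_closed[OF ext_TY_presheaf V s y] y by (simp add: px.Y.ext_bundle_simps)
 ultimately show thesis using that by blast
qed

lemma ext_TY_1_sectI:
 assumes V: "mopen Y V" and u: "u \<in> sect TY V"
 shows "(\<lambda>y\<in>V. ext_elem 1 (fE y) [u y]) \<in> sect (ext_bundle Y 1 TY) V"
 using px.Y.ext_elem_sect[OF TY_presheaf V, of "[u]" 1] u by (simp add: One_nat_def)

lemma ext_TY_0_sect: "mopen Y V ==> (\<lambda>y\<in>V. ext_elem 0 (fE y) []) \<in> sect (ext_bundle Y 0 TY) V"
 using px.Y.ext_elem_sect[OF TY_presheaf, of V "[]" 0] by simp

text \<open>Neither factor is globally pulled back from the base. The claim is linear in each, so
  \<beta> is reduced to pulled back decomposables and then \<open>u\<close> to a pulled back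
  section.\<close>

lemma wedge_vector_sect:
 assumes V: "mopen Y V" and \<beta>: "\<beta> \<in> sect (XB b) V" and u: "u \<in> sect TB V"
 shows "(\<lambda>y\<in>V. wedge b 1 (fV y) (\<beta> y) (ext_elem 1 (fV y) [u y])) \<in> sect (XB (b + 1)) V"
proof (rule pb.pullback_ext_sect_map[OF base_presheaf XB_sheaf V _ _ \<beta>[unfolded from_base_def]])
 have ucl: "u y \<in> carrier (fV y)" if "y \<in> V" for y using sect_closed[OF TB_presheaf V u that] by simp
 show "lin (ext_power b (fV y)) (fib (XB (b + 1)) y) (%\<beta>. wedge b 1 (fV y) \<beta> (ext_elem 1 (fV y) [u y]))" if y: "y \<in> V" for y
  using bilin_left[OF bilin_wedge[OF cvs_fibers(1)[OF mopenD[OF V y]]] lin_closed[OF lin_ext_elem_1 ucl[OF y]]] by simp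
 fix V' W ss assume V': "mopen Y V'" "V' <= V" and W: "mopen (base \<Y>) W" "snd ` V' <= W"
  and ss: "length ss = b" "set ss <= sect (base_odd \<Y>) W"
 let ?e = "%y. map (%s. s (snd y)) ss"
 have cv: "complex_vs (fV y)" if "y \<in> V'" for y using cvs_fibers(1)[OF mopenD[OF V'(1) that]] .
 have eg: "?e y \<in> ext_gens b (fV y)" if "y \<in> V'" for y
  using W(2) that by (intro pb.X.sect_list_ext_gens[OF base_presheaf W(1) ss]) auto
 have "(\<lambda>y\<in>V'. wedge b 1 (fV y) (ext_elem b (fV y) (?e y)) (ext_elem 1 (fV y) [restrict u V' y])) \<in> sect (XB (b + 1)) V'"
 proof (rule pb.pullback_sect_map[OF base_presheaf XB_sheaf V'(1) _ _
  sect_restrict[OF TB_presheaf V V'(1,2) u, unfolded from_base_def]])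
  show "lin (fV y) (fib (XB (b + 1)) y) (%v. wedge b 1 (fV y) (ext_elem b (fV y) (?e y)) (ext_elem 1 (fV y) [v]))"
  if y: "y \<in> V'" for y
  using lin_comp[OF lin_ext_elem_1 bilin_right[OF bilin_wedge[OF cv[OF y]] ext_elem_closed[OF eg[OF y]]]] by simp
  fix V'' W' t assume V'': "mopen Y V''" "V'' <= V'" and W': "mopen (base \<Y>) W'" "snd ` V'' <= W'" "t \<in> sect (base_odd \<Y>) W'"
  \<comment> \<open>The two factors come from different open sets of the base; over the intersection
    they concatenate to a list of \<open>b + 1\<close> sections.\<close>
  let ?W = "W \<inter> W'"
  have Wo: "mopen (base \<Y>) ?W" by (rule openin_Int[OF W(1) W'(1)])
  have sub: "snd ` V'' <= ?W" using W(2) W'(2) V''(2) by blast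
  let ?ss = "map (%s. restrict s ?W) (ss @ [t])"
  have tt: "restrict t ?W \<in> sect (base_odd \<Y>) ?W" by (rule sect_restrict[OF base_presheaf W'(1) Wo Int_lower2 W'(3)])
  have "set ?ss <= sect (base_odd \<Y>) ?W"
  using sect_restrict[OF base_presheaf W(1) Wo Int_lower1] ss(2) tt by auto
  then have "(\<lambda>x\<in>?W. ext_elem (b + 1) (fib (base_odd \<Y>) x) (map (%s. s x) ?ss)) \<in> sect (ext_bundle (base \<Y>) (b + 1) (base_odd \<Y>)) ?W"
  using ss(1) by (intro pb.X.ext_elem_sect[OF base_presheaf Wo]) simp_all
  from pb.pullback_sect[OF sheaf_presheaf[OF pb.X.sheaf_ext[OF base_presheaf]] V''(1) Wo sub this]
  show "(\<lambda>y\<in>V''. wedge b 1 (fV y) (ext_elem b (fV y) (?e y)) (ext_elem 1 (fV y) [t (snd y)])) \<in> sect (XB (b + 1)) V''"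
  unfolding from_base_def
  proof (rule restrI)
  fix y assume y: "y \<in> V''"
  then have yW: "snd y \<in> ?W" and y': "y \<in> V'" using sub V''(2) by auto
  have "t (snd y) \<in> carrier (fV y)" using yW by (intro sect_closed[OF base_presheaf W'(1,3)]) simp
  then have g: "[t (snd y)] \<in> ext_gens 1 (fV y)" unfolding ext_gens_1 by blast
  have m: "map (%s. s (snd y)) ?ss = ?e y @ [t (snd y)]" using yW by (simp add: comp_def)
  show "wedge b 1 (fV y) (ext_elem b (fV y) (?e y)) (ext_elem 1 (fV y) [t (snd y)]) =
  (\<lambda>x\<in>?W. ext_elem (b + 1) (fib (base_odd \<Y>) x) (map (%s. s x) ?ss)) (snd y)"
  unfolding restrict_apply'[OF yW] m by (rule wedge_elem[OF cv[OF y'] eg[OF y'] g])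
  qed
 qed
 then show "(\<lambda>y\<in>V'. wedge b 1 (fV y) (ext_elem b (fV y) (?e y)) (ext_elem 1 (fV y) [u y])) \<in> sect (XB (b + 1)) V'"
  by (rule restrI) simp
qed

text \<open>Stated for a bundle \<open>A\<close> with abstract first and zeroth exterior powers,
  because it is applied to \<open>TX\<close>, where these are pulled back from the fiber, and to
  \<open>TY\<close>, where they are formed on the total space.\<close>

lemma contr_morphism:
 assumes A: "presheaf Y A" and A1: "presheaf Y A1" and A0: "presheaf Y A0"
  and fibs: "!!y. fib A1 y = ext_power 1 (fib A y)" "!!y. fib A0 y = ext_power 0 (fib A y)"
  and A1E: "!!V s. mopen Y V ==> s \<in> sect A1 V ==> \<exists>u\<in>sect A V. \<forall>y\<in>V. s y = ext_elem 1 (fib A y) [u y]"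
  and A0I: "!!V. mopen Y V ==> (\<lambda>y\<in>V. ext_elem 0 (fib A y) []) \<in> sect A0 V"
  and U: "mopen Y U" and f: "morph_on Y U A TB f"
 shows "morph_on Y U (tensor_bundle Y (XB b) A1) (tensor_bundle Y (XB (b + 1)) A0)
  (%y. contr b (fV y) (fib A y) (f y))"
proof -
 have fl: "lin (fib A y) (fV y) (f y)" if "y \<in> U" for y using morph_on_lin[OF f that] by simp
 have cl: "lin (ext_tensor b (fV y) 1 (fib A y))
  (ext_tensor (b + 1) (fV y) 0 (fib A y)) (contr b (fV y) (fib A y) (f y))"
  if y: "y \<in> U" for y
  by (rule lin_contr[OF cvs_fibers(1) presheaf_cvs[OF A] fl]) (use mopenD[OF U y] y in auto)
 show ?thesis
  unfolding morph_on_def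
 proof (intro conjI ballI allI impI; (elim conjE)?)
  show "lin (fib (tensor_bundle Y (XB b) A1) y) (fib (tensor_bundle Y (XB (b + 1)) A0) y)
  (contr b (fV y) (fib A y) (f y))" if "y \<in> U" for y
  using cl[OF that] by (simp add: px.Y.tensor_bundle_simps fibs)
  fix V s assume V: "mopen Y V" "V <= U" and s: "s \<in> sect (tensor_bundle Y (XB b) A1) V"
  show "(\<lambda>y\<in>V. contr b (fV y) (fib A y) (f y) (s y)) \<in> sect (tensor_bundle Y (XB (b + 1)) A0) V"
  proof (rule px.Y.tensor_sect_map[OF XB_presheaf A1 px.Y.sheaf_tensor[OF XB_presheaf A0] V(1) _ _ s])
  show "lin (tensor_space (fib (XB b) y) (fib A1 y)) (fib (tensor_bundle Y (XB (b + 1)) A0) y)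
  (contr b (fV y) (fib A y) (f y))" if "y \<in> V" for y
  using cl subsetD[OF V(2) that] by (simp add: px.Y.tensor_bundle_simps fibs)
  fix V' \<beta> \<xi> assume V': "mopen Y V'" "V' <= V" and \<beta>: "\<beta> \<in> sect (XB b) V'" and \<xi>: "\<xi> \<in> sect A1 V'"
  have V'U: "V' <= U" using V' V by blast
  obtain u where u: "u \<in> sect A V'" "\<forall>y\<in>V'. \<xi> y = ext_elem 1 (fib A y) [u y]" using A1E[OF V'(1) \<xi>] by blast
  have fu: "(\<lambda>y\<in>V'. f y (u y)) \<in> sect TB V'" by (rule morph_on_sect[OF f V'(1) V'U u(1)])
  show "(\<lambda>y\<in>V'. contr b (fV y) (fib A y) (f y) (tensor_elem (fib (XB b) y) (fib A1 y) (\<beta> y) (\<xi> y)))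
  \<in> sect (tensor_bundle Y (XB (b + 1)) A0) V'"
  proof (rule restrI[OF px.Y.tensor_elem_sect[OF XB_presheaf A0 V'(1) wedge_vector_sect[OF V'(1) \<beta> fu] A0I[OF V'(1)]]])
  fix y assume y: "y \<in> V'"
  then have yU: "y \<in> U" using V'U by blast
  note yp = mopenD[OF U yU]
  note Ay = presheaf_cvs[OF A yp]
  have uy: "u y \<in> carrier (fib A y)" by (rule sect_closed[OF A V'(1) u(1) y])
  then have g: "[u y] \<in> ext_gens 1 (fib A y)" unfolding ext_gens_1 by blast
  have "\<beta> y \<in> carrier (ext_power b (fV y))" using sect_closed[OF XB_presheaf V'(1) \<beta> y] by simp
  then show "contr b (fV y) (fib A y) (f y) (tensor_elem (fib (XB b) y) (fib A1 y) (\<beta> y) (\<xi> y)) =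
  tensor_elem (fib (XB (b + 1)) y) (fib A0 y)
  ((\<lambda>y\<in>V'. wedge b 1 (fV y) (\<beta> y) (ext_elem 1 (fV y) [(\<lambda>y\<in>V'. f y (u y)) y])) y)
  ((\<lambda>y\<in>V'. ext_elem 0 (fib A y) []) y)"
  using y u(2) contr_tensor[OF cvs_fibers(1)[OF yp] Ay fl[OF yU] _ ext_elem_closed[OF g], of "\<beta> y" b]
  ext_map_elem[OF fl[OF yU] Ay g] by (simp add: fibs)
  qed
  qed
 qed
qed

text \<open>Kept general in \<open>A\<close>, \<open>C\<close> and \<open>f\<close> so as to cover
  the projection from \<open>TY\<close> to \<open>TX\<close> as well as a local section in the
  opposite direction.\<close>

lemma rext_map_morphism:
 assumes Al: "presheaf Y Al" and Cl: "presheaf Y Cl" and A: "presheaf Y A"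
  and fibs: "!!y. fib Al y = ext_power l (fib A y)" "!!y. fib Cl y = ext_power l (fib C y)"
  and U: "mopen Y U" and f: "!!y. y \<in> U ==> lin (fib A y) (fib C y) (f y)"
  and sect: "!!V s. mopen Y V ==> V <= U ==> s \<in> sect Al V ==>
  (\<lambda>y\<in>V. ext_map l (fib A y) (fib C y) (f y) (s y)) \<in> sect Cl V"
 shows "morph_on Y U (tensor_bundle Y (XB k) Al) (tensor_bundle Y (XB k) Cl)
  (%y. rext_map k l (fV y) (fib A y) (fib C y) (f y))"
proof -
 have cl: "lin (ext_tensor k (fV y) l (fib A y))
  (ext_tensor k (fV y) l (fib C y)) (rext_map k l (fV y) (fib A y) (fib C y) (f y))"
  if y: "y \<in> U" for y
  by (rule lin_rext_map[OF presheaf_cvs[OF A mopenD[OF U y]] f[OF y]])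
 show ?thesis
  unfolding morph_on_def
 proof (intro conjI ballI allI impI; (elim conjE)?)
  show "lin (fib (tensor_bundle Y (XB k) Al) y) (fib (tensor_bundle Y (XB k) Cl) y)
  (rext_map k l (fV y) (fib A y) (fib C y) (f y))" if "y \<in> U" for y
  using cl[OF that] by (simp add: px.Y.tensor_bundle_simps fibs)
  fix V s assume V: "mopen Y V" "V <= U" and s: "s \<in> sect (tensor_bundle Y (XB k) Al) V"
  show "(\<lambda>y\<in>V. rext_map k l (fV y) (fib A y) (fib C y) (f y) (s y)) \<in> sect (tensor_bundle Y (XB k) Cl) V"
  proof (rule px.Y.tensor_sect_map[OF XB_presheaf Al px.Y.sheaf_tensor[OF XB_presheaf Cl] V(1) _ _ s])
  show "lin (tensor_space (fib (XB k) y) (fib Al y)) (fib (tensor_bundle Y (XB k) Cl) y)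
  (rext_map k l (fV y) (fib A y) (fib C y) (f y))" if "y \<in> V" for y
  using cl subsetD[OF V(2) that] by (simp add: px.Y.tensor_bundle_simps fibs)
  fix V' \<beta> \<eta> assume V': "mopen Y V'" "V' <= V" and \<beta>: "\<beta> \<in> sect (XB k) V'" and \<eta>: "\<eta> \<in> sect Al V'"
  have V'U: "V' <= U" using V' V by blast
  show "(\<lambda>y\<in>V'. rext_map k l (fV y) (fib A y) (fib C y) (f y) (tensor_elem (fib (XB k) y) (fib Al y) (\<beta> y) (\<eta> y)))
  \<in> sect (tensor_bundle Y (XB k) Cl) V'"
  proof (rule restrI[OF px.Y.tensor_elem_sect[OF XB_presheaf Cl V'(1) \<beta> sect[OF V'(1) V'U \<eta>]]])
  fix y assume y: "y \<in> V'"
  then have yU: "y \<in> U" using V'U by blast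
  show "rext_map k l (fV y) (fib A y) (fib C y) (f y) (tensor_elem (fib (XB k) y) (fib Al y) (\<beta> y) (\<eta> y)) =
  tensor_elem (fib (XB k) y) (fib Cl y) (\<beta> y) ((\<lambda>y\<in>V'. ext_map l (fib A y) (fib C y) (f y) (\<eta> y)) y)"
  using rext_map_tensor[OF presheaf_cvs[OF A mopenD[OF U yU]] f[OF yU], of "\<beta> y" k "fV y" "\<eta> y" l]
  sect_closed[OF XB_presheaf V'(1) \<beta> y] sect_closed[OF Al V'(1) \<eta> y] y by (simp add: fibs)
  qed
  qed
 qed
qed

end

section \<open>Steps and quotients of the filtration as sheaves\<close>

context gt
begin

lemma split_onD:
 assumes "odd_split U s \<rho>" "y \<in> U"
 shows "lin (fW y) (fE y) (s y)" "lin (fE y) (fV y) (\<rho> y)" "w \<in> carrier (fW y) ==> odd_proj \<Y> y (s y w) = w"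
  "v \<in> carrier (fV y) ==> \<rho> y (odd_incl \<Y> y v) = v" "v \<in> carrier (fV y) ==> odd_proj \<Y> y (odd_incl \<Y> y v) = \<zero>\<^bsub>fW y\<^esub>"
  "e \<in> carrier (fE y) ==> odd_incl \<Y> y (\<rho> y e) \<oplus>\<^bsub>fE y\<^esub> s y (odd_proj \<Y> y e) = e"
proof -
 note d = assms(1)[unfolded split_on_def]
 show "lin (fW y) (fE y) (s y)" using morph_on_lin[OF d[THEN conjunct1] assms(2)] by simp
 show "lin (fE y) (fV y) (\<rho> y)" using morph_on_lin[OF d[THEN conjunct2, THEN conjunct1] assms(2)] by simp
 note p = bspec[OF d[THEN conjunct2, THEN conjunct2] assms(2), unfolded fib_simps]
 show "w \<in> carrier (fW y) ==> odd_proj \<Y> y (s y w) = w" by (rule bspec[OF p[THEN conjunct1]])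
 show "v \<in> carrier (fV y) ==> \<rho> y (odd_incl \<Y> y v) = v" by (rule bspec[OF p[THEN conjunct2, THEN conjunct1]])
 show "v \<in> carrier (fV y) ==> odd_proj \<Y> y (odd_incl \<Y> y v) = \<zero>\<^bsub>fW y\<^esub>"
  by (rule bspec[OF p[THEN conjunct2, THEN conjunct2, THEN conjunct1]])
 show "e \<in> carrier (fE y) ==> odd_incl \<Y> y (\<rho> y e) \<oplus>\<^bsub>fE y\<^esub> s y (odd_proj \<Y> y e) = e"
  by (rule bspec[OF p[THEN conjunct2, THEN conjunct2, THEN conjunct2]])
qed

lemma filt_source_eq: "filt_source \<Y> (k + l) k = tensor_bundle Y (XB k) (ext_bundle Y l TY)"
 by (simp add: filt_source_def)

lemma graded_bundle_eq: "graded_bundle \<Y> l k = tensor_bundle Y (XB k) (XX l)"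
 by (simp add: graded_bundle_def)

lemma filt_wedge_eq: "filt_wedge \<Y> (k + l) k y = wedgeY k l y"
 by (simp add: filt_wedge_def fwedge_def Let_def)

lemma filt_eq: "filt \<Y> (k + l) k = image_bundle Y (tensor_bundle Y (XB k) (ext_bundle Y l TY))
  (ext_bundle Y (k + l) TY) (%y. wedgeY k l y)"
proof -
 have "filt_wedge \<Y> (k + l) k = (%y. wedgeY k l y)" by (rule ext) (rule filt_wedge_eq)
 then show ?thesis unfolding filt_def filt_source_eq by simp
qed

lemma fib_source: "fib (tensor_bundle Y (XB k) (ext_bundle Y l TY)) y = ext_tensor k (fV y) l (fE y)"
 and fib_graded: "fib (graded_bundle \<Y> l k) y = ext_tensor k (fV y) l (fW y)"
 by (simp_all add: graded_bundle_eq px.Y.tensor_bundle_simps px.Y.ext_bundle_simps)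

lemma fib_filt: "fib (filt \<Y> (k + l) k) y = (ext_power (k + l) (fE y))\<lparr>carrier :=
  wedgeY k l y ` carrier (ext_tensor k (fV y) l (fE y))\<rparr>"
 unfolding filt_eq fib_image_bundle fib_source by (simp add: px.Y.ext_bundle_simps)

lemma source_sheaf: "sheaf Y (tensor_bundle Y (XB k) (ext_bundle Y l TY))"
 by (rule px.Y.sheaf_tensor[OF XB_presheaf ext_TY_presheaf])

lemma graded_sheaf: "sheaf Y (graded_bundle \<Y> l k)"
 unfolding graded_bundle_eq by (rule px.Y.sheaf_tensor[OF XB_presheaf XX_presheaf])

lemmas source_presheaf = sheaf_presheaf[OF source_sheaf] and graded_presheaf = sheaf_presheaf[OF graded_sheaf]

lemma lin_wedge: "y \<in> points Y ==> lin (ext_tensor k (fV y) l (fE y)) (ext_power (k + l) (fE y))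
  (wedgeY k l y)"
 by (rule lin_fwedge[OF cvs_fibers(1,3) incl_lin])

lemma lin_wedge': "y \<in> points Y ==> lin (fib (tensor_bundle Y (XB k) (ext_bundle Y l TY)) y)
  (fib (ext_bundle Y (k + l) TY) y) (wedgeY k l y)"
 using lin_wedge by (simp add: fib_source px.Y.ext_bundle_simps)

lemma filt_sheaf: "sheaf Y (filt \<Y> (k + l) k)"
 unfolding filt_eq by (rule px.Y.sheaf_image[OF source_sheaf presheaf_cvs[OF ext_TY_presheaf] lin_wedge'])

lemmas filt_presheaf = sheaf_presheaf[OF filt_sheaf]

text \<open>Evaluates the description inside \<open>filt_quot\<close>: a splitting near
  \<open>y\<close> supplies a map \<Psi> that computes the right-hand side from the wedge alone, so
  all preimages of the wedge give the same answer. The degrees 0 and 1 are those of the steps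
  \<open>b + 1\<close> and \<open>b\<close> in total degree \<open>b + 1\<close>.\<close>

lemma filt_quot_wedge:
 assumes y: "y \<in> points Y" and l: "l \<le> 1" and t: "t \<in> carrier (ext_tensor k (fV y) l (fE y))"
 shows "filt_quot \<Y> (k + l) k y (wedgeY k l y t) =
  projY k l y t"
proof -
 obtain U s \<rho> where U: "mopen Y U" "y \<in> U" "odd_split U s \<rho>"
  by (rule splitting_exists[OF y])
 note sp = split_onD[OF U(3,2)]
 note factor = cvs_fibers(1)[OF y] cvs_fibers(3)[OF y] cvs_fibers(2)[OF y] incl_lin[OF y] proj_lin[OF y] sp(2) sp(5) sp(4)
 have "\<exists>\<Psi>. \<forall>t\<in>carrier (ext_tensor k (fV y) l (fE y)).
  \<Psi> (wedgeY k l y t) = projY k l y t"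
 proof (cases "l = 0")
  case True
  show ?thesis unfolding True by (rule fwedge_factor_0[OF factor, where k = k]) blast+
 next
  case False
  then have l1: "l = 1" using l by simp
  show ?thesis unfolding l1 by (rule fwedge_factor_1[OF factor, where b = k]) blast+
 qed
 then obtain \<Psi> where \<Psi>: "!!t. t \<in> carrier (ext_tensor k (fV y) l (fE y)) ==>
  \<Psi> (wedgeY k l y t) = projY k l y t" by blast
 have q: "filt_quot \<Y> (k + l) k y = (\<lambda>v\<in>carrier (fib (filt \<Y> (k + l) k) y).
  THE w. \<exists>t\<in>carrier (ext_tensor k (fV y) l (fE y)).
  wedgeY k l y t = v \<and> w = projY k l y t)"
  unfolding filt_quot_def Let_def filt_wedge_eq filt_source_eq fib_source rext_map_def by simp
 have "wedgeY k l y t \<in> carrier (fib (filt \<Y> (k + l) k) y)" using t by (simp add: fib_filt)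
 moreover have "(THE w. \<exists>t'\<in>carrier (ext_tensor k (fV y) l (fE y)).
  wedgeY k l y t' = wedgeY k l y t \<and>
  w = projY k l y t') = projY k l y t"
 proof (rule the_equality)
  fix w assume "\<exists>t'\<in>carrier (ext_tensor k (fV y) l (fE y)).
  wedgeY k l y t' = wedgeY k l y t \<and>
  w = projY k l y t'"
  then obtain t' where t': "t' \<in> carrier (ext_tensor k (fV y) l (fE y))"
  "wedgeY k l y t' = wedgeY k l y t"
  "w = projY k l y t'" by blast
  show "w = projY k l y t"
  unfolding t'(3) \<Psi>[OF t'(1), symmetric] \<Psi>[OF t, symmetric] t'(2) ..
 qed (use t in blast)
 ultimately show ?thesis unfolding q by (simp only: restrict_apply')
qed

lemma ext_proj_sect:
 assumes V: "mopen Y V" and l: "l \<le> 1" and s: "s \<in> sect (ext_bundle Y l TY) V"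
 shows "(\<lambda>y\<in>V. ext_map l (fE y) (fW y) (odd_proj \<Y> y) (s y)) \<in> sect (XX l) V"
proof (cases "l = 0")
 case True
 show ?thesis
  unfolding True
 proof (rule px.Y.ext_sect_map[OF TY_presheaf XX_sheaf V _ _ s[unfolded True]])
  show "lin (ext_power 0 (fE y)) (fib (XX 0) y) (ext_map 0 (fE y) (fW y) (odd_proj \<Y> y))" if "y \<in> V" for y
  using lin_ext_map[OF proj_lin cvs_fibers(3)] mopenD[OF V that] by simp
  fix V' ss assume V': "mopen Y V'" "V' <= V" and "length ss = 0" "set ss <= sect TY V'"
  then have ss: "ss = []" by simp
  show "(\<lambda>y\<in>V'. ext_map 0 (fE y) (fW y) (odd_proj \<Y> y) (ext_elem 0 (fE y) (map (%s. s y) ss))) \<in> sect (XX 0) V'"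
  proof (rule restrI[OF XX0_sect[OF V'(1)]])
  fix y assume "y \<in> V'"
  then have y: "y \<in> points Y" using mopenD[OF V'(1)] by blast
  have "[] \<in> ext_gens 0 (fE y)" by (simp add: ext_gens_0)
  from ext_map_elem[OF proj_lin[OF y] cvs_fibers(3)[OF y] this]
  show "ext_map 0 (fE y) (fW y) (odd_proj \<Y> y) (ext_elem 0 (fE y) (map (%s. s y) ss)) = ext_elem 0 (fW y) []"
  by (simp add: ss)
  qed
 qed
next
 case False
 then have l1: "l = 1" using l by simp
 obtain u where u: "u \<in> sect TY V" "\<forall>y\<in>V. s y = ext_elem 1 (fE y) [u y]"
  by (rule ext_TY_1_sectE[OF V s[unfolded l1]])
 have "(\<lambda>y\<in>V. odd_proj \<Y> y (u y)) \<in> sect TX V"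
  by (rule morph_on_sect[OF proj V _ u(1)]) (use mopenD[OF V] in blast)
 then have "(\<lambda>y\<in>V. ext_elem 1 (fW y) [(\<lambda>y\<in>V. odd_proj \<Y> y (u y)) y]) \<in> sect (XX 1) V" by (rule XX1_sectI[OF V])
 then show ?thesis
  unfolding l1
 proof (rule restrI)
  fix y assume y: "y \<in> V"
  note yp = mopenD[OF V y]
  have "[u y] \<in> ext_gens 1 (fE y)" using sect_closed[OF TY_presheaf V u(1) y] unfolding ext_gens_1 by blast
  from ext_map_elem[OF proj_lin[OF yp] cvs_fibers(3)[OF yp] this]
  show "ext_map 1 (fE y) (fW y) (odd_proj \<Y> y) (s y) = ext_elem 1 (fW y) [(\<lambda>y\<in>V. odd_proj \<Y> y (u y)) y]"
  using y u(2) by simp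
 qed
qed

lemma filt_quot_morphism:
 assumes l: "l \<le> 1"
 shows "morph_on Y (points Y) (filt \<Y> (k + l) k) (graded_bundle \<Y> l k) (filt_quot \<Y> (k + l) k)"
 unfolding filt_eq
proof (rule morphism_from_image[OF source_presheaf lin_wedge' graded_sheaf _ subset_refl])
 have "morph_on Y (points Y) (tensor_bundle Y (XB k) (ext_bundle Y l TY)) (tensor_bundle Y (XB k) (XX l))
  (%y. rext_map k l (fV y) (fib TY y) (fib TX y) (odd_proj \<Y> y))"
  by (rule rext_map_morphism[OF ext_TY_presheaf XX_presheaf TY_presheaf])
  (simp_all add: px.Y.ext_bundle_simps proj_lin ext_proj_sect[OF _ l])
 then show "morph_on Y (points Y) (tensor_bundle Y (XB k) (ext_bundle Y l TY)) (graded_bundle \<Y> l k)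
  (%y. projY k l y)" unfolding graded_bundle_eq by simp
 fix y t assume "y \<in> points Y" "t \<in> carrier (fib (tensor_bundle Y (XB k) (ext_bundle Y l TY)) y)"
 then show "filt_quot \<Y> (k + l) k y (wedgeY k l y t) =
  projY k l y t"
  using filt_quot_wedge[OF _ l] by (simp add: fib_source)
qed

text \<open>The inclusion of the step \<open>b + 1\<close> into the step \<open>b\<close> on
  generators: the last base vector is reread as a vector of the total bundle.\<close>

lemma wedge_last:
 assumes y: "y \<in> points Y" and us: "us \<in> ext_gens b (fV y)" and v: "v \<in> carrier (fV y)"
 shows "wedgeY (b + 1) 0 y (ext_tensor_elem (b + 1) (fV y) 0 (fE y)
  (ext_elem (b + 1) (fV y) (us @ [v])) (ext_elem 0 (fE y) [])) =
  wedgeY b 1 y (ext_tensor_elem b (fV y) 1 (fE y)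
  (ext_elem b (fV y) us) (ext_elem 1 (fE y) [odd_incl \<Y> y v]))"
proof -
 have g: "us @ [v] \<in> ext_gens (b + 1) (fV y)" "[] \<in> ext_gens 0 (fE y)" "[odd_incl \<Y> y v] \<in> ext_gens 1 (fE y)"
  using us v lin_closed[OF incl_lin[OF y] v] by (auto simp: ext_gens_def)
 note w = fwedge_elem[OF cvs_fibers(1)[OF y] cvs_fibers(3)[OF y] incl_lin[OF y]]
 show ?thesis unfolding w[OF g(1,2)] w[OF us g(3)] by simp
qed

lemma ext_gens_snocE:
 assumes "vs \<in> ext_gens (b + 1) V"
 obtains us v where "vs = us @ [v]" "us \<in> ext_gens b V" "v \<in> carrier V"
 using assms by (cases vs rule: rev_cases) (auto simp: ext_gens_def)

text \<open>The source of the step \<open>b + 1\<close> maps into the step \<open>b\<close>, on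
  fibres by \<open>wedge_last\<close>. For sections, both factors must be localised until the base
  factor is a pulled back decomposable one, whose last vector can be transferred to
  \<open>TY\<close>.\<close>

lemma filt_step_morphism:
 "morph_on Y (points Y) (tensor_bundle Y (XB (b + 1)) (ext_bundle Y 0 TY)) (filt \<Y> (b + 1) b)
  (%y. wedgeY (b + 1) 0 y)"
proof -
 let ?S = "%y. ext_tensor (b + 1) (fV y) 0 (fE y)"
 let ?w = "%y. wedgeY (b + 1) 0 y"
 have lin: "lin (?S y) (fib (filt \<Y> (b + 1) b) y) (?w y)" if y: "y \<in> points Y" for y
 proof -
  let ?C = "wedgeY b 1 y ` carrier (ext_tensor b (fV y) 1 (fE y))"
  have l: "lin (?S y) (ext_power (b + 1) (fE y)) (?w y)" using lin_wedge[OF y, of "b + 1" 0] by simp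
  have C: "complex_vs ((ext_power (b + 1) (fE y))\<lparr>carrier := ?C\<rparr>)"
  using presheaf_cvs[OF filt_presheaf[of b 1] y] by (simp add: fib_filt)
  have "?w y x \<in> ?C" if x: "x \<in> carrier (?S y)" for x
  proof (rule lin_tensor_ext_range[OF l cvs_ext C _ x])
  fix vs ws assume vs: "vs \<in> ext_gens (b + 1) (fV y)" and ws: "ws \<in> ext_gens 0 (fE y)"
  obtain us v where us: "vs = us @ [v]" "us \<in> ext_gens b (fV y)" "v \<in> carrier (fV y)" by (rule ext_gens_snocE[OF vs])
  have g: "[odd_incl \<Y> y v] \<in> ext_gens 1 (fE y)" using lin_closed[OF incl_lin[OF y] us(3)] unfolding ext_gens_1 by blast
  have ws: "ws = []" using ws by (simp add: ext_gens_0)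
  show "?w y (ext_tensor_elem (b + 1) (fV y) 0 (fE y) (ext_elem (b + 1) (fV y) vs) (ext_elem 0 (fE y) ws)) \<in> ?C"
  unfolding us(1) ws wedge_last[OF y us(2,3)]
  by (intro imageI tensor_elem_closed ext_elem_closed us(2) g)
  qed
  then show ?thesis using l by (simp add: fib_filt lin_def)
 qed
 show ?thesis
  unfolding morph_on_def fib_source
 proof (intro conjI ballI allI impI; (elim conjE)?)
  fix V s assume V: "mopen Y V" and "V <= points Y" and s: "s \<in> sect (tensor_bundle Y (XB (b + 1)) (ext_bundle Y 0 TY)) V"
  show "(\<lambda>y\<in>V. ?w y (s y)) \<in> sect (filt \<Y> (b + 1) b) V"
  proof (rule px.Y.tensor_sect_map[OF XB_presheaf ext_TY_presheaf filt_sheaf V _ _ s])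
  show "lin (tensor_space (fib (XB (b + 1)) y) (fib (ext_bundle Y 0 TY) y)) (fib (filt \<Y> (b + 1) b) y) (?w y)"
  if "y \<in> V" for y using lin[OF mopenD[OF V that]] by (simp add: px.Y.ext_bundle_simps)
  fix V' \<beta> \<eta> assume V': "mopen Y V'" "V' <= V" and \<beta>: "\<beta> \<in> sect (XB (b + 1)) V'" and \<eta>: "\<eta> \<in> sect (ext_bundle Y 0 TY) V'"
  have blin: "bilin (ext_power (b + 1) (fV y)) (ext_power 0 (fE y)) (fib (filt \<Y> (b + 1) b) y)
  (%\<beta> \<eta>. ?w y (ext_tensor_elem (b + 1) (fV y) 0 (fE y) \<beta> \<eta>))" if "y \<in> points Y" for y
  by (rule bilin_lin_comp[OF bilin_tensor_elem lin[OF that]])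
  have \<eta>cl: "\<eta> y \<in> carrier (ext_power 0 (fE y))" if "y \<in> V'" for y
  using sect_closed[OF ext_TY_presheaf V'(1) \<eta> that] by (simp add: px.Y.ext_bundle_simps)
  have "(\<lambda>y\<in>V'. ?w y (ext_tensor_elem (b + 1) (fV y) 0 (fE y) (\<beta> y) (\<eta> y))) \<in> sect (filt \<Y> (b + 1) b) V'"
  proof (rule pb.pullback_ext_sect_map[OF base_presheaf filt_sheaf V'(1) _ _ \<beta>[unfolded from_base_def]])
  show "lin (ext_power (b + 1) (fV y)) (fib (filt \<Y> (b + 1) b) y)
  (%\<beta>. ?w y (ext_tensor_elem (b + 1) (fV y) 0 (fE y) \<beta> (\<eta> y)))" if "y \<in> V'" for y
  by (rule bilin_left[OF blin \<eta>cl[OF that]]) (rule mopenD[OF V'(1) that])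
  fix V1 W ss assume V1: "mopen Y V1" "V1 <= V'" and W: "mopen (base \<Y>) W" "snd ` V1 <= W"
  and ss: "length ss = b + 1" "set ss <= sect (base_odd \<Y>) W"
  let ?e = "%y. ext_elem (b + 1) (fV y) (map (%s. s (snd y)) ss)"
  have gens: "map (%s. s (snd y)) ts \<in> ext_gens k (fV y)" if "y \<in> V1" "length ts = k" "set ts <= sect (base_odd \<Y>) W" for y ts k
  using W(2) that by (intro pb.X.sect_list_ext_gens[OF base_presheaf W(1)]) auto
  have "(\<lambda>y\<in>V1. ?w y (ext_tensor_elem (b + 1) (fV y) 0 (fE y) (?e y) (restrict \<eta> V1 y))) \<in> sect (filt \<Y> (b + 1) b) V1"
  proof (rule px.Y.ext_sect_map[OF TY_presheaf filt_sheaf V1(1) _ _ sect_restrict[OF ext_TY_presheaf V'(1) V1 \<eta>]])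
  show "lin (ext_power 0 (fE y)) (fib (filt \<Y> (b + 1) b) y)
  (%\<eta>. ?w y (ext_tensor_elem (b + 1) (fV y) 0 (fE y) (?e y) \<eta>))" if "y \<in> V1" for y
  by (rule bilin_right[OF blin ext_elem_closed[OF gens[OF that ss]]]) (rule mopenD[OF V1(1) that])
  fix V2 and ss' :: "('x \<times> 'b => 'e) list" assume V2: "mopen Y V2" "V2 <= V1" and "length ss' = 0" "set ss' <= sect TY V2"
  then have ss': "ss' = []" by simp
  \<comment> \<open>The last of the \<open>b + 1\<close> base sections is detached; its inclusion
    becomes the factor of degree one from \<open>TY\<close>.\<close>
  obtain ts t where ts: "ss = ts @ [t]" "length ts = b" using ss(1) by (cases ss rule: rev_cases) auto
  have tsS: "set ts <= sect (base_odd \<Y>) W" "t \<in> sect (base_odd \<Y>) W" using ss(2) ts by auto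
  have W2: "snd ` V2 <= W" using W(2) V2(2) by blast
  have V2p: "V2 <= points Y" using mopenD[OF V2(1)] by blast
  have "(\<lambda>y\<in>V2. (\<lambda>x\<in>W. ext_elem b (fib (base_odd \<Y>) x) (map (%s. s x) ts)) (snd y)) \<in> sect (XB b) V2"
  unfolding from_base_def
  by (rule pb.pullback_sect[OF sheaf_presheaf[OF pb.X.sheaf_ext[OF base_presheaf]] V2(1) W(1) W2
  pb.X.ext_elem_sect[OF base_presheaf W(1) ts(2) tsS(1)]])
  then have A: "(\<lambda>y\<in>V2. ext_elem b (fV y) (map (%s. s (snd y)) ts)) \<in> sect (XB b) V2"
  by (rule restrI) (use W2 in \<open>simp add: image_subset_iff\<close>)
  have "(\<lambda>y\<in>V2. t (snd y)) \<in> sect TB V2"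
  unfolding from_base_def by (rule pb.pullback_sect[OF base_presheaf V2(1) W(1) W2 tsS(2)])
  from ext_TY_1_sectI[OF V2(1) morph_on_sect[OF incl V2(1) V2p this]]
  have B: "(\<lambda>y\<in>V2. ext_elem 1 (fE y) [odd_incl \<Y> y (t (snd y))]) \<in> sect (ext_bundle Y 1 TY) V2"
  by (rule restrI) simp
  have "(\<lambda>y\<in>V2. wedgeY b 1 y ((\<lambda>y\<in>V2. tensor_elem (fib (XB b) y) (fib (ext_bundle Y 1 TY) y)
  ((\<lambda>y\<in>V2. ext_elem b (fV y) (map (%s. s (snd y)) ts)) y) ((\<lambda>y\<in>V2. ext_elem 1 (fE y) [odd_incl \<Y> y (t (snd y))]) y)) y))
  \<in> sect (filt \<Y> (b + 1) b) V2"
  unfolding filt_eq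
  by (rule morph_on_sect[OF morphism_into_image[OF source_presheaf lin_wedge' subset_refl] V2(1) V2p
  px.Y.tensor_elem_sect[OF XB_presheaf ext_TY_presheaf V2(1) A B]])
  then show "(\<lambda>y\<in>V2. ?w y (ext_tensor_elem (b + 1) (fV y) 0 (fE y) (?e y)
  (ext_elem 0 (fE y) (map (%s. s y) ss')))) \<in> sect (filt \<Y> (b + 1) b) V2"
  proof (rule restrI)
  fix y assume y: "y \<in> V2"
  have tc: "t (snd y) \<in> carrier (fV y)" using W2 y by (intro sect_closed[OF base_presheaf W(1) tsS(2)]) auto
  show "?w y (ext_tensor_elem (b + 1) (fV y) 0 (fE y) (?e y) (ext_elem 0 (fE y) (map (%s. s y) ss'))) =
  wedgeY b 1 y ((\<lambda>y\<in>V2. tensor_elem (fib (XB b) y) (fib (ext_bundle Y 1 TY) y)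
  ((\<lambda>y\<in>V2. ext_elem b (fV y) (map (%s. s (snd y)) ts)) y) ((\<lambda>y\<in>V2. ext_elem 1 (fE y) [odd_incl \<Y> y (t (snd y))]) y)) y)"
  using y wedge_last[OF mopenD[OF V2(1) y] gens[OF subsetD[OF V2(2) y] ts(2) tsS(1)] tc]
  by (simp add: ts(1) ss' px.Y.ext_bundle_simps)
  qed
  qed
  then show "(\<lambda>y\<in>V1. ?w y (ext_tensor_elem (b + 1) (fV y) 0 (fE y) (?e y) (\<eta> y))) \<in> sect (filt \<Y> (b + 1) b) V1"
  by (rule restrI) simp
  qed
  then show "(\<lambda>y\<in>V'. ?w y (tensor_elem (fib (XB (b + 1)) y) (fib (ext_bundle Y 0 TY) y) (\<beta> y) (\<eta> y))) \<in> sect (filt \<Y> (b + 1) b) V'"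
  by (simp add: px.Y.ext_bundle_simps)
  qed
 qed (rule lin)
qed

text \<open>For the last step the complementary degree is zero; these variants have
  \<open>b + 1\<close> in place of \<open>b + 1 + 0\<close>, the form in which
  \<open>boundary_map\<close> mentions it.\<close>

lemmas filt_eq_0 = filt_eq[of "b + 1" 0, unfolded add_0_right] and fib_filt_0 = fib_filt[of "b + 1" 0, unfolded add_0_right]
 and filt_sheaf_0 = filt_sheaf[of "b + 1" 0, unfolded add_0_right] and filt_presheaf_0 = filt_presheaf[of "b + 1" 0, unfolded add_0_right]
 and lin_wedge'_0 = lin_wedge'[of _ "b + 1" 0, unfolded add_0_right]
 and filt_quot_wedge_0 = filt_quot_wedge[of _ 0 _ "b + 1", unfolded add_0_right, OF _ zero_le]
 and filt_quot_morphism_0 = filt_quot_morphism[of 0 "b + 1", unfolded add_0_right, OF zero_le] for b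

definition filt_section :: "('x \<times> 'b => 'u => 'e) => nat => 'x \<times> 'b =>
  (('w list \<Rightarrow>\<^sub>0 complex) set \<times> ('u list \<Rightarrow>\<^sub>0 complex) set \<Rightarrow>\<^sub>0 complex) set => ('e list \<Rightarrow>\<^sub>0 complex) set" where
 "filt_section s b y w = wedgeY b 1 y (rext_map b 1 (fV y) (fW y) (fE y) (s y) w)"

text \<open>The difference is taken in the whole exterior power; that it lies in the next step of
  the filtration is seen from \<open>filt_retraction_wedge\<close>.\<close>

definition filt_retraction :: "('x \<times> 'b => 'u => 'e) => nat => 'x \<times> 'b => ('e list \<Rightarrow>\<^sub>0 complex) set => ('e list \<Rightarrow>\<^sub>0 complex) set" where
 "filt_retraction s b y v = v \<ominus>\<^bsub>ext_power (b + 1) (fE y)\<^esub> filt_section s b y (filt_quot \<Y> (b + 1) b y v)"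

lemma filt_incl_eq: "v \<in> carrier (fib (filt \<Y> (b + 1) (b + 1)) y) ==> filt_incl \<Y> (b + 1) (b + 1) y v = v"
 by (simp add: filt_incl_def)

lemma filt_incl_morphism:
 "morph_on Y (points Y) (filt \<Y> (b + 1) (b + 1)) (filt \<Y> (b + 1) b) (filt_incl \<Y> (b + 1) (b + 1))"
proof -
 have "morph_on Y (points Y) (image_bundle Y (tensor_bundle Y (XB (b + 1)) (ext_bundle Y 0 TY))
  (ext_bundle Y (b + 1) TY) (%y. wedgeY (b + 1) 0 y)) (filt \<Y> (b + 1) b) (filt_incl \<Y> (b + 1) (b + 1))"
 proof (rule morphism_from_image[OF source_presheaf lin_wedge'_0 filt_sheaf filt_step_morphism subset_refl])
  fix y t assume "t \<in> carrier (fib (tensor_bundle Y (XB (b + 1)) (ext_bundle Y 0 TY)) y)"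
  then show "filt_incl \<Y> (b + 1) (b + 1) y (wedgeY (b + 1) 0 y t) =
  wedgeY (b + 1) 0 y t"
  by (intro filt_incl_eq) (simp add: fib_filt_0 fib_source)
 qed
 then show ?thesis unfolding filt_eq_0 .
qed

text \<open>On generators the vector reread by \<open>wedge_last\<close> lies in the image of the
  inclusion and is killed by the projection; linearity does the rest.\<close>

lemma filt_quot_incl:
 assumes y: "y \<in> points Y" and v: "v \<in> carrier (fib (filt \<Y> (b + 1) (b + 1)) y)"
 shows "filt_quot \<Y> (b + 1) b y v = \<zero>\<^bsub>fib (graded_bundle \<Y> 1 b) y\<^esub>"
proof -
 let ?G = "ext_tensor b (fV y) 1 (fW y)"
 let ?w = "wedgeY (b + 1) 0 y"
 obtain U s \<rho> where U: "mopen Y U" "y \<in> U" "odd_split U s \<rho>"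
  by (rule splitting_exists[OF y])
 note sp = split_onD[OF U(3,2)]
 obtain t where t: "t \<in> carrier (ext_tensor (b + 1) (fV y) 0 (fE y))" "v = ?w t"
  using v by (auto simp: fib_filt_0)
 have "lin (ext_tensor (b + 1) (fV y) 0 (fE y)) ?G (%t. filt_quot \<Y> (b + 1) b y (?w t))"
  using lin_comp[OF morph_on_lin[OF filt_step_morphism y] morph_on_lin[OF filt_quot_morphism[OF order_refl] y]]
  by (simp add: fib_source fib_graded)
 then have "filt_quot \<Y> (b + 1) b y (?w t) = \<zero>\<^bsub>?G\<^esub>"
 proof (rule lin_eq_tensor_ext[OF _ lin_zero_map[OF cvs_tensor] cvs_tensor _ t(1)])
  fix vs ws assume vs: "vs \<in> ext_gens (b + 1) (fV y)" and ws: "ws \<in> ext_gens 0 (fE y)"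
  obtain us u where us: "vs = us @ [u]" "us \<in> ext_gens b (fV y)" "u \<in> carrier (fV y)" by (rule ext_gens_snocE[OF vs])
  have g: "[odd_incl \<Y> y u] \<in> ext_gens 1 (fE y)" using lin_closed[OF incl_lin[OF y] us(3)] unfolding ext_gens_1 by blast
  have ws: "ws = []" using ws by (simp add: ext_gens_0)
  have "ext_elem 1 (fW y) [\<zero>\<^bsub>fW y\<^esub>] = \<zero>\<^bsub>ext_power 1 (fW y)\<^esub>"
  by (rule lin_zero[OF lin_ext_elem_1 cvs_fibers(2)[OF y] cvs_ext])
  then show "filt_quot \<Y> (b + 1) b y (?w (ext_tensor_elem (b + 1) (fV y) 0 (fE y)
  (ext_elem (b + 1) (fV y) vs) (ext_elem 0 (fE y) ws))) = \<zero>\<^bsub>?G\<^esub>"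
  using rext_map_elem[OF cvs_fibers(3)[OF y] proj_lin[OF y] us(2) g]
  lin_zero[OF bilin_right[OF bilin_tensor_elem ext_elem_closed[OF us(2)]] cvs_ext cvs_tensor]
  by (simp add: us(1) ws wedge_last[OF y us(2,3)] sp(5)[OF us(3)]
  filt_quot_wedge[OF y order_refl tensor_elem_closed[OF ext_elem_closed[OF us(2)] ext_elem_closed[OF g]]])
 qed
 then show ?thesis by (simp add: t(2) fib_graded)
qed

section \<open>The splitting of the filtration induced by a splitting of the odd extension\<close>

context
 fixes U s \<rho>
 assumes U: "mopen Y U" and split: "odd_split U s \<rho>"
begin

lemma right_ext_section_closed:
 assumes y: "y \<in> U" and w: "w \<in> carrier (ext_tensor b (fV y) 1 (fW y))"
 shows "rext_map b 1 (fV y) (fW y) (fE y) (s y) w \<in> carrier (ext_tensor b (fV y) 1 (fE y))"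
 by (rule lin_closed[OF lin_rext_map[OF cvs_fibers(2)[OF mopenD[OF U y]] split_onD(1)[OF split y]] w])

text \<open>In \<open>fwedge_split\<close> the second summand is the section applied to the
  quotient. Subtracting it leaves the contraction by \<rho>, which shows that the retraction lands
  in the step \<open>b + 1\<close> and preserves sections.\<close>

lemma filt_retraction_wedge:
 assumes y: "y \<in> U" and t: "t \<in> carrier (ext_tensor b (fV y) 1 (fE y))"
 shows "filt_retraction s b y (wedgeY b 1 y t) =
  wedgeY (b + 1) 0 y (contr b (fV y) (fE y) (\<rho> y) t)"
proof -
 note yp = mopenD[OF U y]
 note sp = split_onD[OF split y]
 interpret P: cvs "ext_power (b + 1) (fE y)" by (simp add: cvs_iff cvs_ext)
 let ?r = "projY b 1 y t"
 have r: "?r \<in> carrier (ext_tensor b (fV y) 1 (fW y))"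
  by (rule lin_closed[OF lin_rext_map[OF cvs_fibers(3)[OF yp] proj_lin[OF yp]] t])
 have c: "wedgeY (b + 1) 0 y (contr b (fV y) (fE y) (\<rho> y) t) \<in> carrier (ext_power (b + 1) (fE y))"
  using lin_closed[OF lin_wedge[OF yp, of "b + 1" 0] lin_closed[OF lin_contr[OF cvs_fibers(1,3)[OF yp] sp(2)] t]] by simp
 have d: "filt_section s b y ?r \<in> carrier (ext_power (b + 1) (fE y))"
  unfolding filt_section_def by (rule lin_closed[OF lin_wedge[OF yp] right_ext_section_closed[OF y r]])
 have "wedgeY b 1 y t =
  wedgeY (b + 1) 0 y (contr b (fV y) (fE y) (\<rho> y) t)
  \<oplus>\<^bsub>ext_power (b + 1) (fE y)\<^esub> filt_section s b y ?r"
  unfolding filt_section_def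
  by (rule fwedge_split[OF cvs_fibers(1,3,2)[OF yp] incl_lin[OF yp] proj_lin[OF yp] sp(2,1) sp(6) t])
 then show ?thesis
  unfolding filt_retraction_def filt_quot_wedge[OF yp order_refl t] using c d by (simp add: P.minus_eq P.a_assoc P.r_neg)
qed

lemma filt_section_morphism: "morph_on Y U (graded_bundle \<Y> 1 b) (filt \<Y> (b + 1) b) (filt_section s b)"
proof -
 have Up: "U <= points Y" using mopenD[OF U] by blast
 have sm: "morph_on Y U TX TY s" using split by (simp add: split_on_def)
 have "morph_on Y U (tensor_bundle Y (XB b) (XX 1)) (tensor_bundle Y (XB b) (ext_bundle Y 1 TY))
  (%y. rext_map b 1 (fV y) (fib TX y) (fib TY y) (s y))"
 proof (rule rext_map_morphism[OF XX_presheaf ext_TY_presheaf TX_presheaf _ _ U])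
  show "lin (fib TX y) (fib TY y) (s y)" if "y \<in> U" for y using split_onD(1)[OF split that] by simp
  fix V \<xi> assume V: "mopen Y V" "V <= U" and \<xi>: "\<xi> \<in> sect (XX 1) V"
  obtain u where u: "u \<in> sect TX V" "\<forall>y\<in>V. \<xi> y = ext_elem 1 (fW y) [u y]" by (rule XX1_sectE[OF V(1) \<xi>])
  from ext_TY_1_sectI[OF V(1) morph_on_sect[OF sm V u(1)]]
  show "(\<lambda>y\<in>V. ext_map 1 (fib TX y) (fib TY y) (s y) (\<xi> y)) \<in> sect (ext_bundle Y 1 TY) V"
  proof (rule restrI)
  fix y assume y: "y \<in> V"
  have "[u y] \<in> ext_gens 1 (fW y)" using sect_closed[OF TX_presheaf V(1) u(1) y] unfolding ext_gens_1 by simp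
  from ext_map_elem[OF split_onD(1)[OF split subsetD[OF V(2) y]] cvs_fibers(2)[OF mopenD[OF V(1) y]] this]
  show "ext_map 1 (fib TX y) (fib TY y) (s y) (\<xi> y) = ext_elem 1 (fE y) [(\<lambda>y\<in>V. s y (u y)) y]"
  using y u(2) by simp
  qed
 qed (simp_all add: px.Y.ext_bundle_simps)
 from morph_on_comp[OF this morphism_into_image[OF source_presheaf lin_wedge' Up]]
 show ?thesis unfolding filt_eq graded_bundle_eq filt_section_def[abs_def] by simp
qed

lemma filt_retraction_morphism:
 "morph_on Y U (filt \<Y> (b + 1) b) (filt \<Y> (b + 1) (b + 1)) (filt_retraction s b)"
proof -
 have Up: "U <= points Y" using mopenD[OF U] by blast
 have \<rho>m: "morph_on Y U TY TB \<rho>" using split by (simp add: split_on_def)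
 have "morph_on Y U (tensor_bundle Y (XB b) (ext_bundle Y 1 TY)) (tensor_bundle Y (XB (b + 1)) (ext_bundle Y 0 TY))
  (%y. contr b (fV y) (fE y) (\<rho> y))"
 proof (rule contr_morphism[OF TY_presheaf ext_TY_presheaf ext_TY_presheaf _ _ _ ext_TY_0_sect U \<rho>m])
  fix V \<xi> assume "mopen Y V" "\<xi> \<in> sect (ext_bundle Y 1 TY) V"
  then show "\<exists>u\<in>sect TY V. \<forall>y\<in>V. \<xi> y = ext_elem 1 (fE y) [u y]" by (rule ext_TY_1_sectE) blast
 qed (simp_all add: px.Y.ext_bundle_simps)
 note g = morph_on_comp[OF this morphism_into_image[OF source_presheaf lin_wedge'_0 Up]]
 show ?thesis
  unfolding filt_eq[of b 1]
 proof (rule morphism_from_image[OF source_presheaf lin_wedge' filt_sheaf_0 g[folded filt_eq_0] Up])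
  fix y t assume "y \<in> U" "t \<in> carrier (fib (tensor_bundle Y (XB b) (ext_bundle Y 1 TY)) y)"
  then show "filt_retraction s b y (wedgeY b 1 y t) =
  wedgeY (b + 1) 0 y (contr b (fV y) (fE y) (\<rho> y) t)"
  by (simp add: fib_source filt_retraction_wedge)
 qed
qed

lemma filt_split:
 "split_on Y U (filt \<Y> (b + 1) (b + 1)) (filt \<Y> (b + 1) b) (graded_bundle \<Y> 1 b)
  (filt_incl \<Y> (b + 1) (b + 1)) (filt_quot \<Y> (b + 1) b) (filt_section s b) (filt_retraction s b)"
 unfolding split_on_def
proof (intro conjI ballI filt_section_morphism filt_retraction_morphism)
 fix y assume y: "y \<in> U"
 note yp = mopenD[OF U y]
 interpret P: cvs "ext_power (b + 1) (fE y)" by (simp add: cvs_iff cvs_ext)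
 note G = presheaf_cvs[OF graded_presheaf[of 1 b] yp]
 note F = presheaf_cvs[OF filt_presheaf[of b 1] yp]
 have sec: "filt_section s b y w \<in> carrier (ext_power (b + 1) (fE y))" if "w \<in> carrier (fib (graded_bundle \<Y> 1 b) y)" for w
  unfolding filt_section_def using that lin_closed[OF lin_wedge[OF yp] right_ext_section_closed[OF y]] by (simp add: fib_graded)
 show "filt_quot \<Y> (b + 1) b y (filt_section s b y w) = w" if "w \<in> carrier (fib (graded_bundle \<Y> 1 b) y)" for w
 proof -
  have w: "w \<in> carrier (ext_tensor b (fV y) 1 (fW y))" using that by (simp add: fib_graded)
  show ?thesis
  unfolding filt_section_def filt_quot_wedge[OF yp order_refl right_ext_section_closed[OF y w]]
  by (rule rext_map_cancel[OF cvs_fibers(3,2)[OF yp] proj_lin[OF yp] split_onD(1,3)[OF split y] w])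
 qed
 show zero: "filt_quot \<Y> (b + 1) b y (filt_incl \<Y> (b + 1) (b + 1) y v) = \<zero>\<^bsub>fib (graded_bundle \<Y> 1 b) y\<^esub>"
  if "v \<in> carrier (fib (filt \<Y> (b + 1) (b + 1)) y)" for v
  by (simp add: filt_incl_eq[OF that] filt_quot_incl[OF yp that])
 show "filt_retraction s b y (filt_incl \<Y> (b + 1) (b + 1) y v) = v" if v: "v \<in> carrier (fib (filt \<Y> (b + 1) (b + 1)) y)" for v
 proof -
  have "filt_section s b y \<zero>\<^bsub>fib (graded_bundle \<Y> 1 b) y\<^esub> = \<zero>\<^bsub>fib (filt \<Y> (b + 1) b) y\<^esub>"
  by (rule lin_zero[OF morph_on_lin[OF filt_section_morphism y] G F])
  moreover have "v \<in> carrier (ext_power (b + 1) (fE y))"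
  using v lin_closed[OF lin_wedge[OF yp, of "b + 1" 0]] by (auto simp: fib_filt_0)
  ultimately show ?thesis
  by (simp add: filt_incl_eq[OF v] filt_retraction_def filt_quot_incl[OF yp v] fib_filt P.minus_zero_right)
 qed
 show "filt_incl \<Y> (b + 1) (b + 1) y (filt_retraction s b y e) \<oplus>\<^bsub>fib (filt \<Y> (b + 1) b) y\<^esub>
  filt_section s b y (filt_quot \<Y> (b + 1) b y e) = e" if e: "e \<in> carrier (fib (filt \<Y> (b + 1) b) y)" for e
 proof -
  have "filt_section s b y (filt_quot \<Y> (b + 1) b y e) \<in> carrier (ext_power (b + 1) (fE y))"
  by (rule sec[OF lin_closed[OF morph_on_lin[OF filt_quot_morphism[OF order_refl] yp] e]])
  moreover have "e \<in> carrier (ext_power (b + 1) (fE y))"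
  using e lin_closed[OF lin_wedge[OF yp, of b 1]] by (auto simp: fib_filt)
  ultimately show ?thesis
  unfolding filt_incl_eq[OF lin_closed[OF morph_on_lin[OF filt_retraction_morphism y] e]]
  by (simp add: filt_retraction_def fib_filt P.add_minus_cancel)
 qed
qed

end

text \<open>The fibrewise heart of the comparison, for two different splittings at \<open>y\<close>:
  lift by \<open>s'\<close>, retract by the splitting with \<rho>, and pass to the last quotient.
  Retraction is contraction by \<rho>, so in total one contracts by \<rho> after \<open>s'\<close>,
  the value of the model cocycle.\<close>

lemma filt_quot_retraction_section:
 assumes U: "mopen Y U" "odd_split U s \<rho>" "y \<in> U"
  and U': "mopen Y U'" "split_on Y U' TB TY TX (odd_incl \<Y>) (odd_proj \<Y>) s' \<rho>'" "y \<in> U'"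
  and w: "w \<in> carrier (ext_tensor b (fV y) 1 (fW y))"
 shows "filt_quot \<Y> (b + 1) (b + 1) y (filt_retraction s b y (filt_section s' b y w)) =
  contr b (fV y) (fW y) (%w. \<rho> y (s' y w)) w"
proof -
 note yp = mopenD[OF U(1,3)]
 note sp = split_onD[OF U(2,3)] and sp' = split_onD[OF U'(2,3)]
 note r = right_ext_section_closed[OF U'(1,2,3) w]
 note c = lin_closed[OF lin_contr[OF cvs_fibers(1,3)[OF yp] sp(2)] r]
 show ?thesis
  unfolding filt_section_def[of s'] filt_retraction_wedge[OF U r] filt_quot_wedge_0[OF yp c]
  by (rule rext_map_contr[OF cvs_fibers(1,3,2)[OF yp] proj_lin[OF yp] sp(2) sp'(1) w])
qed

end

section \<open>Homomorphisms out of the parity bundle\<close>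

definition has_restrictions :: "'y manifold => ('y, 't) vbundle => bool" where
 "has_restrictions M T \<longleftrightarrow> (\<forall>U V t. mopen M U \<and> mopen M V \<and> V <= U \<and> t \<in> sect T U --> restrict t V \<in> sect T V)"

lemma presheaf_has_restrictions: "presheaf M T ==> has_restrictions M T"
 unfolding has_restrictions_def by (blast intro: sect_restrict)

lemma has_restrictionsD:
 "has_restrictions M T ==> mopen M U ==> mopen M V ==> V <= U ==> t \<in> sect T U ==> restrict t V \<in> sect T V"
 by (simp add: has_restrictions_def)

text \<open>Glueing matters for the target of the model class map, since sections of its tensor
  source are only locally sums of products. A glued family is tested on a section \<open>t\<close>
  piecewise, which uses restrictions of \<open>t\<close>.\<close>

lemma (in chart_space) sheaf_hom:
 assumes T: "hom_source M T" and R: "has_restrictions M T" and E: "sheaf M E"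
 shows "sheaf M (hom_bundle M T E)"
 unfolding sheaf_def
proof (intro conjI allI impI; (elim conjE)?)
 show "presheaf M (hom_bundle M T E)" by (rule presheaf_hom[OF T sheaf_presheaf[OF E]])
 fix U s assume U: "mopen M U" and s: "s \<in> extensional U"
  and loc: "\<forall>y\<in>U. \<exists>V. mopen M V \<and> y \<in> V \<and> V <= U \<and> restrict s V \<in> sect (hom_bundle M T E) V"
 have "s y \<in> linear_maps (fib T y) (fib E y)" if y: "y \<in> U" for y
 proof -
  obtain V where V: "mopen M V" "y \<in> V" "restrict s V \<in> sect (hom_bundle M T E) V" using loc y by blast
  have "restrict s V \<in> (\<Pi>\<^sub>E y\<in>V. linear_maps (fib T y) (fib E y))" using V(3) by (simp add: hom_bundle_def)
  from PiE_mem[OF this V(2)] show ?thesis using V(2) by simp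
 qed
 moreover have "(\<lambda>y\<in>V. s y (t y)) \<in> sect E V" if V: "mopen M V" "V <= U" and t: "t \<in> sect T V" for V t
 proof (rule sect_local[OF E V(1)])
  fix y assume y: "y \<in> V"
  obtain W where W: "mopen M W" "y \<in> W" "restrict s W \<in> sect (hom_bundle M T E) W" using loc y V(2) by blast
  have VW: "mopen M (V \<inter> W)" by (rule openin_Int[OF V(1) W(1)])
  have "(\<lambda>z\<in>V \<inter> W. restrict s W z (restrict t (V \<inter> W) z)) \<in> sect E (V \<inter> W)"
  by (rule morph_on_sect[OF hom_sect_morphism[OF W(3)] VW Int_lower2 has_restrictionsD[OF R V(1) VW Int_lower1 t]])
  then show "\<exists>W t'. mopen M W \<and> y \<in> W \<and> W <= V \<and> t' \<in> sect E W \<and> (\<forall>z\<in>W. (\<lambda>y\<in>V. s y (t y)) z = t' z)"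
  using VW y W(2) by (intro exI[of _ "V \<inter> W"] exI[of _ "\<lambda>z\<in>V \<inter> W. restrict s W z (restrict t (V \<inter> W) z)"]) simp
 qed simp
 ultimately show "s \<in> sect (hom_bundle M T E) U" using s by (simp add: hom_bundle_def PiE_iff)
qed

lemma hom_source_relabel:
 assumes T: "hom_source M T" and h: "inj h"
 shows "hom_source M (relabel_bundle h T)"
 unfolding hom_source_def
proof (intro conjI ballI allI impI)
 fix y assume "y \<in> points M"
 then have "closed_ops (fib T y)" by (rule hom_source_ops[OF T])
 then show "closed_ops (fib (relabel_bundle h T) y)"
  using h by (auto simp: closed_ops_def relabel_bundle_def)
next
 fix U assume "mopen M U"
 then show "sect (relabel_bundle h T) U <= (\<Pi>\<^sub>E y\<in>U. carrier (fib (relabel_bundle h T) y))"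
  using hom_source_sect[OF T] by (auto simp: relabel_bundle_def)
qed

lemma has_restrictions_relabel:
 assumes R: "has_restrictions M T"
 shows "has_restrictions M (relabel_bundle h T)"
 unfolding has_restrictions_def
proof (intro allI impI; elim conjE)
 fix U V t assume U: "mopen M U" "mopen M V" "V <= U" and "t \<in> sect (relabel_bundle h T) U"
 then obtain s where s: "s \<in> sect T U" "t = (\<lambda>y\<in>U. h (s y))" by (auto simp: relabel_bundle_def)
 have "restrict t V = (\<lambda>y\<in>V. h (restrict s V y))" unfolding s(2) using U(3) by (intro restrict_ext) (simp add: subset_iff)
 with has_restrictionsD[OF R U s(1)] show "restrict t V \<in> sect (relabel_bundle h T) V"
  unfolding relabel_bundle_def vbundle.simps by (intro CollectI exI[of _ "restrict s V"] conjI)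
qed

section \<open>Tangent vectors and the cotangent sheaf\<close>

lemma complex_vs_complex_line: "complex_vs complex_line"
proof (intro complex_vsI abelian_groupI)
 show "\<exists>y\<in>carrier complex_line. y \<oplus>\<^bsub>complex_line\<^esub> x = \<zero>\<^bsub>complex_line\<^esub>" for x
  by (auto simp: complex_line_def intro: exI[of _ "- x"])
qed (simp_all add: complex_line_def algebra_simps)

context chart_space
begin

lemma local_holE:
 assumes "f \<in> local_hol M y" "g \<in> local_hol M y"
 obtains U where "mopen M U" "y \<in> U" "restrict f U \<in> hol M U" "restrict g U \<in> hol M U"
proof -
 obtain U V where U: "mopen M U" "y \<in> U" "restrict f U \<in> hol M U" and V: "mopen M V" "y \<in> V" "restrict g V \<in> hol M V"
  using assms unfolding local_hol_def by blast
 show thesis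
  using that[of "U \<inter> V"] openin_Int[OF U(1) V(1)] U(2) V(2) hol_restrict[OF U(3), of "U \<inter> V"] hol_restrict[OF V(3), of "U \<inter> V"]
  by (simp add: Int_absorb1)
qed

lemma local_hol_add: "f \<in> local_hol M y ==> g \<in> local_hol M y ==> (%z. f z + g z) \<in> local_hol M y"
 and local_hol_mult: "f \<in> local_hol M y ==> g \<in> local_hol M y ==> (%z. f z * g z) \<in> local_hol M y"
proof -
 assume fg: "f \<in> local_hol M y" "g \<in> local_hol M y"
 obtain U where U: "mopen M U" "y \<in> U" and h: "restrict f U \<in> hol M U" "restrict g U \<in> hol M U" by (rule local_holE[OF fg])
 have "(\<lambda>z\<in>U. f z + g z) \<in> hol M U" by (rule restrI[OF hol_add[OF h]]) simp
 then show "(%z. f z + g z) \<in> local_hol M y" using U by (auto simp: local_hol_def)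
 have "(\<lambda>z\<in>U. f z * g z) \<in> hol M U" by (rule restrI[OF hol_mult[OF h]]) simp
 then show "(%z. f z * g z) \<in> local_hol M y" using U by (auto simp: local_hol_def)
qed

lemma local_hol_scale:
 assumes "f \<in> local_hol M y"
 shows "(%z. a * f z) \<in> local_hol M y"
proof -
 obtain U where U: "mopen M U" "y \<in> U" "restrict f U \<in> hol M U" using assms unfolding local_hol_def by blast
 have "(\<lambda>z\<in>U. a * f z) \<in> hol M U" by (rule restrI[OF hol_mult[OF hol_const U(3), of a]]) simp
 then show ?thesis using U by (auto simp: local_hol_def)
qed

lemma hol_local_hol:
 assumes "f \<in> hol M U" "mopen M U" "y \<in> U"
 shows "f \<in> local_hol M y"
 using assms hol_restrict[OF assms(1) subset_refl] by (auto simp: local_hol_def)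

lemma derivationD:
 assumes "D \<in> derivations M y" "f \<in> local_hol M y" "g \<in> local_hol M y"
 shows "mopen M U ==> y \<in> U ==> \<forall>z\<in>U. f z = g z ==> D f = D g"
  "D (%z. f z + g z) = D f + D g" "D (%z. a * f z) = a * D f" "D (%z. f z * g z) = f y * D g + g y * D f"
 using assms unfolding derivations_def by blast+

lemma derivationI:
 assumes "D \<in> extensional (local_hol M y)"
  and "!!f g U. f \<in> local_hol M y ==> g \<in> local_hol M y ==> mopen M U ==> y \<in> U ==> \<forall>z\<in>U. f z = g z ==> D f = D g"
  and "!!f g. f \<in> local_hol M y ==> g \<in> local_hol M y ==> D (%z. f z + g z) = D f + D g"
  and "!!f a. f \<in> local_hol M y ==> D (%z. a * f z) = a * D f"
  and "!!f g. f \<in> local_hol M y ==> g \<in> local_hol M y ==> D (%z. f z * g z) = f y * D g + g y * D f"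
 shows "D \<in> derivations M y"
 unfolding derivations_def
 by (intro CollectI conjI ballI allI impI assms(1); (elim exE conjE)?; rule assms(2-); assumption)

lemma closed_ops_tangent_space: "closed_ops (tangent_space M y)"
 unfolding closed_ops_def
proof (intro conjI ballI allI)
 fix D D' assume "D \<in> carrier (tangent_space M y)" "D' \<in> carrier (tangent_space M y)"
 then have D: "D \<in> derivations M y" "D' \<in> derivations M y" by (simp_all add: tangent_space_def)
 have "(\<lambda>f\<in>local_hol M y. D f + D' f) \<in> derivations M y"
 proof (rule derivationI)
  fix f g U assume fg: "f \<in> local_hol M y" "g \<in> local_hol M y"
  show "(\<lambda>f\<in>local_hol M y. D f + D' f) f = (\<lambda>f\<in>local_hol M y. D f + D' f) g"
  if "mopen M U" "y \<in> U" "\<forall>z\<in>U. f z = g z"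
  using derivationD(1)[OF D(1) fg that] derivationD(1)[OF D(2) fg that] fg by simp
 qed (simp_all add: local_hol_add local_hol_mult local_hol_scale derivationD(2-4)[OF D(1)] derivationD(2-4)[OF D(2)]
  algebra_simps)
 then show "D \<oplus>\<^bsub>tangent_space M y\<^esub> D' \<in> carrier (tangent_space M y)" by (simp add: tangent_space_def)
next
 fix a D assume "D \<in> carrier (tangent_space M y)"
 then have D: "D \<in> derivations M y" by (simp add: tangent_space_def)
 have "(\<lambda>f\<in>local_hol M y. a * D f) \<in> derivations M y"
 proof (rule derivationI)
  fix f g U assume fg: "f \<in> local_hol M y" "g \<in> local_hol M y"
  show "(\<lambda>f\<in>local_hol M y. a * D f) f = (\<lambda>f\<in>local_hol M y. a * D f) g" if "mopen M U" "y \<in> U" "\<forall>z\<in>U. f z = g z"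
  using derivationD(1)[OF D fg that] fg by simp
 qed (simp_all add: local_hol_add local_hol_mult local_hol_scale derivationD(2-4)[OF D] algebra_simps)
 then show "a \<odot>\<^bsub>tangent_space M y\<^esub> D \<in> carrier (tangent_space M y)" by (simp add: tangent_space_def)
qed

lemma sheaf_cotangent: "sheaf M (cotangent_bundle M)"
 unfolding cotangent_bundle_def
proof (rule sheaf_generated, unfold generator_family_def, intro conjI ballI allI impI; (elim conjE)?)
 show "complex_vs (hom_space (tangent_space M y) complex_line)" for y
  by (rule complex_vs_hom_space[OF closed_ops_tangent_space complex_vs_complex_line])
 fix U assume U: "mopen M U"
 have "(\<lambda>D\<in>derivations M y. D f) \<in> linear_maps (tangent_space M y) complex_line" if "f \<in> hol M U" "y \<in> U" for f y
 proof -
  have "restrict (%D. D f) (carrier (tangent_space M y)) \<in> linear_maps (tangent_space M y) complex_line"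
  by (rule restrict_linear_map[OF closed_ops_tangent_space linI])
  (use hol_local_hol[OF that(1) U that(2)] in \<open>simp_all add: tangent_space_def complex_line_def\<close>)
  then show ?thesis by (simp add: tangent_space_def)
 qed
 then show "{\<lambda>y\<in>U. \<lambda>D\<in>derivations M y. D f | f. f \<in> hol M U} <= (\<Pi>\<^sub>E y\<in>U. carrier (hom_space (tangent_space M y) complex_line))"
  by (auto simp del: hom_space_simps(2-4))
 fix V g assume V: "mopen M V" "V <= U" and "g \<in> {\<lambda>y\<in>U. \<lambda>D\<in>derivations M y. D f | f. f \<in> hol M U}"
 then obtain f where f: "f \<in> hol M U" "g = (\<lambda>y\<in>U. \<lambda>D\<in>derivations M y. D f)" by blast
 have fV: "restrict f V \<in> hol M V" by (rule hol_restrict[OF f(1) V(2)])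
 \<comment> \<open>\<open>f\<close> and its restriction agree near \<open>y\<close>, and a
   derivation depends only on the germ.\<close>
 have "D f = D (restrict f V)" if y: "y \<in> V" and D: "D \<in> derivations M y" for y D
  using V y hol_local_hol[OF f(1) U, of y] hol_local_hol[OF fV V(1) y] by (intro derivationD(1)[OF D _ _ V(1) y]) auto
 then have "restrict g V = (\<lambda>y\<in>V. \<lambda>D\<in>derivations M y. D (restrict f V))"
  unfolding f(2) using V(2) by (intro restrict_ext) (auto intro!: restrict_ext)
 then show "restrict g V \<in> {\<lambda>y\<in>V. \<lambda>D\<in>derivations M y. D f | f. f \<in> hol M V}" using fV by blast
qed

end

section \<open>The model class map on cochains\<close>

text \<open>The dependence of \<open>contr\<close> on \<open>f\<close>. Congruence reconciles an
  extensional cochain value with a plain composite; additivity and homogeneity hold because the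
  contracted vector occupies a single slot.\<close>

lemma
 assumes V: "complex_vs V" and W: "complex_vs W" and f: "lin W V f"
  and x: "x \<in> carrier (ext_tensor b V 1 W)"
 shows contr_cong: "(!!w. w \<in> carrier W ==> g w = f w) ==> contr b V W g x = contr b V W f x"
  and contr_add: "lin W V g ==> contr b V W (\<lambda>w\<in>carrier W. f w \<oplus>\<^bsub>V\<^esub> g w) x =
  contr b V W f x \<oplus>\<^bsub>ext_tensor (b + 1) V 0 W\<^esub> contr b V W g x"
  and contr_scale: "contr b V W (\<lambda>w\<in>carrier W. a \<odot>\<^bsub>V\<^esub> f w) x =
  a \<odot>\<^bsub>ext_tensor (b + 1) V 0 W\<^esub> contr b V W f x"
proof -
 interpret V: cvs V using V by (simp add: cvs_iff)
 let ?t = "ext_tensor_elem b V 1 W"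
 let ?u = "%us. ext_tensor_elem (b + 1) V 0 W (ext_elem (b + 1) V us) (ext_elem 0 W [])"
 note c = contr_elem[OF V W]
 have snoc: "vs @ [v] \<in> ext_gens (b + 1) V" if "vs \<in> ext_gens b V" "v \<in> carrier V" for vs v
  using that by (auto simp: ext_gens_def)
 have "[] \<in> ext_gens 0 W" by (simp add: ext_gens_0)
 note u = bilin_left[OF bilin_tensor_elem ext_elem_closed[OF this], of "ext_power (b + 1) V"]
 have one: "\<exists>w. ws = [w] \<and> w \<in> carrier W" if "ws \<in> ext_gens 1 W" for ws using that unfolding ext_gens_1 by blast
 show "contr b V W g x = contr b V W f x" if eq: "!!w. w \<in> carrier W ==> g w = f w"
 proof (rule lin_eq_tensor_ext[OF lin_contr[OF V W] lin_contr[OF V W f] cvs_tensor _ x])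
  show g: "lin W V g" by (rule lin_cong[THEN iffD2, OF eq W f])
  fix vs ws assume vs: "vs \<in> ext_gens b V" and "ws \<in> ext_gens 1 W"
  then obtain w where "ws = [w]" "w \<in> carrier W" using one by blast
  then show "contr b V W g (?t (ext_elem b V vs) (ext_elem 1 W ws)) = contr b V W f (?t (ext_elem b V vs) (ext_elem 1 W ws))"
  using c[OF g vs] c[OF f vs] eq by simp
 qed
 show "contr b V W (\<lambda>w\<in>carrier W. f w \<oplus>\<^bsub>V\<^esub> g w) x =
  contr b V W f x \<oplus>\<^bsub>ext_tensor (b + 1) V 0 W\<^esub> contr b V W g x" if g: "lin W V g"
 proof (rule lin_eq_tensor_ext[OF lin_contr[OF V W] lin_sum_map[OF lin_contr[OF V W f] lin_contr[OF V W g]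
  cvs_tensor] cvs_tensor _ x])
  show l: "lin W V (\<lambda>w\<in>carrier W. f w \<oplus>\<^bsub>V\<^esub> g w)"
  by (rule linear_map_lin[OF restrict_linear_map[OF complex_vs_closed_ops[OF W] lin_sum_map[OF f g V]]])
  fix vs ws assume vs: "vs \<in> ext_gens b V" and "ws \<in> ext_gens 1 W"
  then obtain w where w: "ws = [w]" "w \<in> carrier W" using one by blast
  note fw = lin_closed[OF f w(2)] and gw = lin_closed[OF g w(2)]
  have "?u (vs @ [f w \<oplus>\<^bsub>V\<^esub> g w]) = ?u (vs @ [f w]) \<oplus>\<^bsub>ext_tensor (b + 1) V 0 W\<^esub> ?u (vs @ [g w])"
  unfolding alternating_add[OF alternating_ext_elem snoc[OF vs fw] gw]
  by (rule lin_add[OF u ext_elem_closed[OF snoc[OF vs fw]] ext_elem_closed[OF snoc[OF vs gw]]])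
  then show "contr b V W (\<lambda>w\<in>carrier W. f w \<oplus>\<^bsub>V\<^esub> g w) (?t (ext_elem b V vs) (ext_elem 1 W ws)) =
  contr b V W f (?t (ext_elem b V vs) (ext_elem 1 W ws))
  \<oplus>\<^bsub>ext_tensor (b + 1) V 0 W\<^esub> contr b V W g (?t (ext_elem b V vs) (ext_elem 1 W ws))"
  using c[OF l vs w(2)] c[OF f vs w(2)] c[OF g vs w(2)] w by simp
 qed
 show "contr b V W (\<lambda>w\<in>carrier W. a \<odot>\<^bsub>V\<^esub> f w) x =
  a \<odot>\<^bsub>ext_tensor (b + 1) V 0 W\<^esub> contr b V W f x"
 proof (rule lin_eq_tensor_ext[OF lin_contr[OF V W] lin_scale_map[OF lin_contr[OF V W f]
  cvs_tensor] cvs_tensor _ x])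
  show l: "lin W V (\<lambda>w\<in>carrier W. a \<odot>\<^bsub>V\<^esub> f w)"
  by (rule linear_map_lin[OF restrict_linear_map[OF complex_vs_closed_ops[OF W] lin_scale_map[OF f V]]])
  fix vs ws assume vs: "vs \<in> ext_gens b V" and "ws \<in> ext_gens 1 W"
  then obtain w where w: "ws = [w]" "w \<in> carrier W" using one by blast
  note fw = lin_closed[OF f w(2)]
  have "?u (vs @ [a \<odot>\<^bsub>V\<^esub> f w]) = a \<odot>\<^bsub>ext_tensor (b + 1) V 0 W\<^esub> ?u (vs @ [f w])"
  unfolding alternating_scale[OF alternating_ext_elem snoc[OF vs fw]]
  by (rule lin_scale[OF u ext_elem_closed[OF snoc[OF vs fw]]])
  then show "contr b V W (\<lambda>w\<in>carrier W. a \<odot>\<^bsub>V\<^esub> f w) (?t (ext_elem b V vs) (ext_elem 1 W ws)) =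
  a \<odot>\<^bsub>ext_tensor (b + 1) V 0 W\<^esub> contr b V W f (?t (ext_elem b V vs) (ext_elem 1 W ws))"
  using c[OF l vs w(2)] c[OF f vs w(2)] w by simp
 qed
qed

text \<open>What the \<open>tensor_lift\<close> in \<open>model_class_map\<close> must satisfy in
  order to be determined by its values on products of \<open>f\<close> and \<open>g\<close>.\<close>

lemma bilin_contr_comp:
 fixes V :: "'v cvs" and W :: "'w cvs" and T :: "'t cvs" and b :: nat
 assumes V: "complex_vs V" and W: "complex_vs W" and T: "closed_ops T"
 defines "G \<equiv> ext_tensor b V 1 W" and "H \<equiv> ext_tensor (b + 1) V 0 W"
 shows "bilin (hom_space W V) (hom_space T G) (hom_space T H) (%f g. compose (carrier T) (contr b V W f) g)"
proof (rule bilinI)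
 have lc: "lin G H (contr b V W f)" if "f \<in> linear_maps W V" for f
  unfolding G_def H_def by (rule lin_contr[OF V W linear_map_lin[OF that]])
 have cl: "compose (carrier T) (contr b V W f) g \<in> linear_maps T H" if "f \<in> linear_maps W V" "g \<in> linear_maps T G" for f g
  unfolding compose_def by (rule restrict_linear_map[OF T lin_comp[OF linear_map_lin[OF that(2)] lc[OF that(1)]]])
 fix f assume "f \<in> carrier (hom_space W V)"
 then have f: "f \<in> linear_maps W V" by simp
 show "lin (hom_space T G) (hom_space T H) (compose (carrier T) (contr b V W f))"
 proof (rule linI)
  fix g g' a assume "g \<in> carrier (hom_space T G)"
  then have g: "g \<in> linear_maps T G" by simp
  show "compose (carrier T) (contr b V W f) g \<in> carrier (hom_space T H)" using cl[OF f g] by simp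
  show "compose (carrier T) (contr b V W f) (a \<odot>\<^bsub>hom_space T G\<^esub> g) =
  a \<odot>\<^bsub>hom_space T H\<^esub> compose (carrier T) (contr b V W f) g"
  unfolding compose_def hom_space_simps by (rule restrict_ext) (simp add: lin_scale[OF lc[OF f] lin_closed[OF linear_map_lin[OF g]]])
  assume "g' \<in> carrier (hom_space T G)"
  then have g': "g' \<in> linear_maps T G" by simp
  show "compose (carrier T) (contr b V W f) (g \<oplus>\<^bsub>hom_space T G\<^esub> g') =
  compose (carrier T) (contr b V W f) g \<oplus>\<^bsub>hom_space T H\<^esub> compose (carrier T) (contr b V W f) g'"
  unfolding compose_def hom_space_simps
  by (rule restrict_ext) (simp add: lin_add[OF lc[OF f] lin_closed[OF linear_map_lin[OF g]] lin_closed[OF linear_map_lin[OF g']]])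
 qed
next
 fix g assume "g \<in> carrier (hom_space T G)"
 then have g: "g \<in> linear_maps T G" by simp
 have gc: "g v \<in> carrier (ext_tensor b V 1 W)" if "v \<in> carrier T" for v
  using lin_closed[OF linear_map_lin[OF g] that] by (simp add: G_def)
 show "lin (hom_space W V) (hom_space T H) (%f. compose (carrier T) (contr b V W f) g)"
 proof (rule linI)
  fix f f' a assume "f \<in> carrier (hom_space W V)"
  then have f: "lin W V f" by (simp add: linear_map_lin)
  show "compose (carrier T) (contr b V W f) g \<in> carrier (hom_space T H)"
  unfolding compose_def hom_space_simps H_def
  by (rule restrict_linear_map[OF T lin_comp[OF linear_map_lin[OF g[unfolded G_def]] lin_contr[OF V W f]]])
  show "compose (carrier T) (contr b V W (a \<odot>\<^bsub>hom_space W V\<^esub> f)) g =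
  a \<odot>\<^bsub>hom_space T H\<^esub> compose (carrier T) (contr b V W f) g"
  unfolding compose_def hom_space_simps H_def by (rule restrict_ext) (simp add: contr_scale[OF V W f gc])
  assume "f' \<in> carrier (hom_space W V)"
  then have f': "lin W V f'" by (simp add: linear_map_lin)
  show "compose (carrier T) (contr b V W (f \<oplus>\<^bsub>hom_space W V\<^esub> f')) g =
  compose (carrier T) (contr b V W f) g \<oplus>\<^bsub>hom_space T H\<^esub> compose (carrier T) (contr b V W f') g"
  unfolding compose_def hom_space_simps H_def by (rule restrict_ext) (simp add: contr_add[OF V W f gc f'])
 qed
qed

section \<open>The contraction morphism and the comparison of the two maps\<close>

context gt
begin

lemma parity_bundle_source: "hom_source Y (parity_bundle \<Y> j)" "has_restrictions Y (parity_bundle \<Y> j)"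
proof -
 note c = sheaf_presheaf[OF px.Y.sheaf_cotangent]
 show "hom_source Y (parity_bundle \<Y> j)"
  unfolding parity_bundle_def
  by (simp add: hom_source_relabel presheaf_hom_source c TY_presheaf)
 show "has_restrictions Y (parity_bundle \<Y> j)"
  unfolding parity_bundle_def
  by (simp add: has_restrictions_relabel presheaf_has_restrictions c TY_presheaf)
qed

lemma contract_eq: "contract \<Y> b y f = contr b (fV y) (fW y) f"
 by (simp add: contract_def contr_def Let_def)

abbreviation "hA \<equiv> hom_bundle Y TX TB"

lemma hA_presheaf: "presheaf Y hA"
 by (rule px.Y.presheaf_hom[OF presheaf_hom_source[OF TX_presheaf] TB_presheaf])

context
 fixes T :: "('x \<times> 'b, 't) vbundle"
 assumes T: "hom_source Y T" and R: "has_restrictions Y T"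
begin

abbreviation "hC b \<equiv> hom_bundle Y T (graded_bundle \<Y> 1 b)"
abbreviation "hD b \<equiv> hom_bundle Y T (graded_bundle \<Y> 0 (b + 1))"
abbreviation "cmap b y \<equiv> tensor_lift (fib hA y) (fib (hC b) y) (fib (hD b) y)
 (%(f, g). compose (carrier (fib T y)) (contract \<Y> b y f) g)"

lemma hC_presheaf: "presheaf Y (hC b)" and hD_sheaf: "sheaf Y (hD b)"
 by (rule px.Y.presheaf_hom[OF T graded_presheaf] px.Y.sheaf_hom[OF T R graded_sheaf])+

lemma cmap_bilin:
 assumes y: "y \<in> points Y"
 shows "bilin (fib hA y) (fib (hC b) y) (fib (hD b) y) (%f g. compose (carrier (fib T y)) (contract \<Y> b y f) g)"
 using bilin_contr_comp[OF cvs_fibers(1,2)[OF y] hom_source_ops[OF T y]] by (simp add: contract_eq fib_graded)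

lemma cmap_cvs:
 assumes y: "y \<in> points Y"
 shows "complex_vs (fib hA y)" "complex_vs (fib (hC b) y)" "complex_vs (fib (hD b) y)"
 using presheaf_cvs[OF hA_presheaf y] presheaf_cvs[OF hC_presheaf y]
  presheaf_cvs[OF sheaf_presheaf[OF hD_sheaf] y] .

lemma cmap_elem:
 assumes "y \<in> points Y" "f \<in> carrier (fib hA y)" "g \<in> carrier (fib (hC b) y)"
 shows "cmap b y (tensor_elem (fib hA y) (fib (hC b) y) f g) = (\<lambda>v\<in>carrier (fib T y). contr b (fV y) (fW y) f (g v))"
 using tensor_lift_elem[OF cmap_cvs[OF assms(1)] cmap_bilin[OF assms(1)] assms(2,3)] by (simp add: contract_eq compose_def)

text \<open>On a product of sections \<open>f\<close> and \<open>g\<close> the value is the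
  contraction by \<open>f\<close> after \<open>g\<close>, which is a composite of morphisms by
  \<open>contr_morphism\<close> for \<open>TX\<close>; general sections are local combinations of
  these.\<close>

lemma cmap_morphism: "morph_on Y (points Y) (tensor_bundle Y hA (hC b)) (hD b) (cmap b)"
 unfolding morph_on_def px.Y.tensor_bundle_simps(1)
proof (intro conjI ballI allI impI; (elim conjE)?)
 show lin: "lin (tensor_space (fib hA y) (fib (hC b) y)) (fib (hD b) y) (cmap b y)" if "y \<in> points Y" for y
  by (rule lin_tensor_lift[OF cmap_cvs[OF that] cmap_bilin[OF that]])
 fix V s assume V: "mopen Y V" and s: "s \<in> sect (tensor_bundle Y hA (hC b)) V"
 show "(\<lambda>y\<in>V. cmap b y (s y)) \<in> sect (hD b) V"
 proof (rule px.Y.tensor_sect_map[OF hA_presheaf hC_presheaf hD_sheaf V lin[OF mopenD[OF V]] _ s])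
  fix V' f g assume V': "mopen Y V'" and f: "f \<in> sect hA V'" and g: "g \<in> sect (hC b) V'"
  have "morph_on Y V' (tensor_bundle Y (XB b) (XX 1)) (tensor_bundle Y (XB (b + 1)) (XX 0))
  (%y. contr b (fV y) (fib TX y) (f y))"
  proof (rule contr_morphism[OF TX_presheaf XX_presheaf XX_presheaf _ _ _ _ V' hom_sect_morphism[OF f]])
  fix V \<xi> assume "mopen Y V" "\<xi> \<in> sect (XX 1) V"
  then show "\<exists>u\<in>sect TX V. \<forall>y\<in>V. \<xi> y = ext_elem 1 (fib TX y) [u y]" unfolding fib_simps by (rule XX1_sectE) blast
  qed (simp_all add: XX0_sect)
  from morph_on_comp[OF hom_sect_morphism[OF g] this[folded graded_bundle_eq]]
  have "(\<lambda>y\<in>V'. \<lambda>v\<in>carrier (fib T y). contr b (fV y) (fib TX y) (f y) (g y v)) \<in> sect (hD b) V'" by (rule hom_sectI[OF T V'])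
  then show "(\<lambda>y\<in>V'. cmap b y (tensor_elem (fib hA y) (fib (hC b) y) (f y) (g y))) \<in> sect (hD b) V'"
  proof (rule restrI)
  fix y assume y: "y \<in> V'"
  show "cmap b y (tensor_elem (fib hA y) (fib (hC b) y) (f y) (g y)) =
  (\<lambda>v\<in>carrier (fib T y). contr b (fV y) (fib TX y) (f y) (g y v))"
  using cmap_elem[OF mopenD[OF V' y] sect_closed[OF hA_presheaf V' f y] sect_closed[OF hC_presheaf V' g y]] by simp
  qed
 qed
qed

end

text \<open>The value at a vertex does not depend on the vertex, so the two faces of an edge
  cancel.\<close>

lemma identity_cocycle:
 "(\<lambda>ys\<in>simplices Y 0. \<lambda>z\<in>points Y. \<lambda>v\<in>carrier (fib TX z). v) \<in> cocycles Y (hom_bundle Y TX TX) 0 (%_. points Y)"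
  (is "?c \<in> cocycles Y ?H 0 ?U")
proof -
 have T: "hom_source Y TX" by (rule presheaf_hom_source[OF TX_presheaf])
 have H: "presheaf Y ?H" by (rule px.Y.presheaf_hom[OF T TX_presheaf])
 have U: "is_cover Y ?U" by (simp add: is_cover_def)
 have ov: "overlap ?U ys = points Y" if "ys \<in> simplices Y n" for ys n
  using that by (cases ys) (auto simp: overlap_def simplices_def)
 have idm: "morph_on Y (points Y) TX TX (%y v. v)"
  unfolding morph_on_def
 proof (intro conjI ballI allI impI; (elim conjE)?)
  fix V s assume "mopen Y V" "s \<in> sect TX V"
  then show "(\<lambda>y\<in>V. s y) \<in> sect TX V" using sect_extensional[OF TX_presheaf] by (simp add: extensional_restrict)
 qed (rule lin_id)
 have "(\<lambda>z\<in>points Y. \<lambda>v\<in>carrier (fib TX z). v) \<in> sect ?H (points Y)" by (rule hom_sectI[OF T openin_topspace idm])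
 then have "(\<lambda>ys\<in>simplices Y 0. \<lambda>z\<in>overlap ?U ys. \<lambda>v\<in>carrier (fib TX z). v) \<in> cochains Y ?H 0 ?U"
  by (intro cochainI) (simp add: ov)
 moreover have "(\<lambda>ys\<in>simplices Y 0. \<lambda>z\<in>overlap ?U ys. \<lambda>v\<in>carrier (fib TX z). v) = ?c"
  by (rule restrict_ext) (simp add: ov)
 ultimately have c: "?c \<in> cochains Y ?H 0 ?U" by simp
 have "coboundary Y ?H 0 ?U ?c = zero_cochain Y ?H (Suc 0) ?U"
 proof (rule cochain_eqI[OF px.Y.coboundary_cochain[OF H U c] px.Y.zero_cochain_cochain[OF H U] H U])
  fix ys z assume ys: "ys \<in> simplices Y (Suc 0)" and z: "z \<in> overlap ?U ys"
  then have zp: "z \<in> points Y" using ov[OF ys] by simp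
  interpret H: cvs "fib ?H z" using presheaf_cvs[OF H zp] by (simp add: cvs_iff)
  obtain u v where uv: "ys = [u, v]" using ys by (auto simp: simplices_def length_Suc_conv)
  then have s: "[u] \<in> simplices Y 0" "[v] \<in> simplices Y 0" using ys by (auto simp: simplices_def)
  have "z \<in> overlap ?U [v]" using zp ov[OF s(2)] by simp
  note cl = px.Y.cochain_closed[OF H U c s(2) this]
  have eq: "?c [u] z = ?c [v] z" using s by simp
  have zero: "zero_cochain Y ?H (Suc 0) ?U ys z = \<zero>\<^bsub>fib ?H z\<^esub>" using ys z by (simp add: zero_cochain_def)
  show "coboundary Y ?H 0 ?U ?c ys z = zero_cochain Y ?H (Suc 0) ?U ys z"
  unfolding px.Y.coboundary_eq[OF H U c ys z] zero unfolding uv face_sum.simps eq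
  using cl by (simp only: H.minus_zero_right H.zero_closed H.minus_self)
 qed
 then show ?thesis using c by (simp add: cocycles_def)
qed

theorem boundary_map_eq_model_class_map:
 assumes \<nu>: "\<nu> \<in> H_group \<Y> p 1 b"
 shows "boundary_map \<Y> p 1 b \<nu> = model_class_map \<Y> p b \<nu>"
proof -
 define T where "T = parity_bundle \<Y> (b + 1)"
 have T: "hom_source Y T" unfolding T_def by (rule parity_bundle_source(1))
 have R: "has_restrictions Y T" unfolding T_def by (rule parity_bundle_source(2))
 let ?A = "hom_bundle Y TX TB" and ?C = "hom_bundle Y T (graded_bundle \<Y> 1 b)" and ?D = "hom_bundle Y T (graded_bundle \<Y> 0 (b + 1))"
 let ?F = "filt \<Y> (b + 1) b" and ?F' = "filt \<Y> (b + 1) (b + 1)"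
 have TXs: "hom_source Y TX" by (rule presheaf_hom_source[OF TX_presheaf])
 note hA = hA_presheaf and hC = hC_presheaf[OF T R, of b] and hD = sheaf_presheaf[OF hD_sheaf[OF T R, of b]]
 obtain \<W> d where \<W>: "is_cover Y \<W>" and d: "d \<in> cocycles Y ?C p \<W>" and \<nu>_eq: "\<nu> = coclass Y ?C p \<W> d"
  using \<nu> unfolding H_group_def cohomology_def T_def add.commute[of 1 b] by blast
 have "\<forall>y\<in>points Y. \<exists>N s \<rho>. mopen Y N \<and> y \<in> N \<and> odd_split N s \<rho>"
 proof
  fix y assume "y \<in> points Y"
  then show "\<exists>N s \<rho>. mopen Y N \<and> y \<in> N \<and> odd_split N s \<rho>"
  by (rule splitting_exists) blast
 qed
 from bchoice[OF this] obtain N where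
  "\<forall>y\<in>points Y. \<exists>s \<rho>. mopen Y (N y) \<and> y \<in> N y \<and> odd_split (N y) s \<rho>" ..
 from bchoice[OF this] obtain s where
  "\<forall>y\<in>points Y. \<exists>\<rho>. mopen Y (N y) \<and> y \<in> N y \<and> odd_split (N y) (s y) \<rho>" ..
 from bchoice[OF this] obtain \<rho> where
  N: "\<forall>y\<in>points Y. mopen Y (N y) \<and> y \<in> N y \<and> odd_split (N y) (s y) (\<rho> y)" ..
 \<comment> \<open>One cover for both purposes: \<W> carries the given cocycle and \<open>N\<close>
   the splittings.\<close>
 define \<U> where "\<U> y = \<W> y \<inter> N y" for y
 have \<U>: "is_cover Y \<U>" using \<W> N by (simp add: is_cover_def \<U>_def openin_Int)
 have \<U>\<W>: "refines Y \<U> \<W>" by (simp add: \<U>_def)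
 have \<U>o: "mopen Y (\<U> y)" if "y \<in> points Y" for y using \<U> that by (simp add: is_cover_def)
 have sp: "odd_split (\<U> y) (s y) (\<rho> y)" if "y \<in> points Y" for y
  by (rule split_on_subset[OF N[rule_format, OF that, THEN conjunct2, THEN conjunct2]]) (simp add: \<U>_def)
 define e where "e = cochain_restrict Y p \<U> d"
 have e: "e \<in> cocycles Y ?C p \<U>" unfolding e_def by (rule px.Y.cocycle_restrict[OF hC \<W> \<U> \<U>\<W> d])
 have \<nu>_e: "\<nu> = coclass Y ?C p \<U> e"
  unfolding \<nu>_eq e_def by (rule px.Y.coclass_restrict[OF hC \<W> \<U> \<U>\<W> cocycleD[OF d], symmetric])

 let ?F_split = "%y. split_on Y (\<U> y) (hom_bundle Y T ?F') (hom_bundle Y T ?F) ?C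
  (hom_post T ?F' (filt_incl \<Y> (b + 1) (b + 1))) (hom_post T ?F (filt_quot \<Y> (b + 1) b))
  (hom_post T (graded_bundle \<Y> 1 b) (filt_section (s y) b)) (hom_post T ?F (filt_retraction (s y) b))"
 have F_split: "\<forall>y\<in>points Y. ?F_split y"
 proof
  fix y assume y: "y \<in> points Y"
  show "?F_split y"
  by (rule split_on_hom_post[OF T filt_presheaf_0 filt_presheaf graded_presheaf filt_incl_morphism
  filt_quot_morphism[OF order_refl] \<U>o[OF y] filt_split[OF \<U>o[OF y] sp[OF y]]])
 qed
 have op: "mopen Y (points Y)" by simp
 note hF' = px.Y.presheaf_hom[OF T filt_presheaf_0[of b]] and hF = px.Y.presheaf_hom[OF T filt_presheaf[of b 1]]
 \<comment> \<open>The representative supplied by \<open>connecting_coclass\<close> for the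
   filtration: the section at the second vertex followed by the retraction at the first.\<close>
 define c1 where "c1 = (\<lambda>ys\<in>simplices Y (Suc p). \<lambda>z\<in>overlap \<U> ys.
  hom_post T ?F (filt_retraction (s (hd ys)) b) z
  (hom_post T (graded_bundle \<Y> 1 b) (filt_section (s (hd (tl ys))) b) z (e (tl ys) z)))"
 note conF = px.Y.connecting_coclass[OF hF' hF hC
  morph_on_hom_post[OF T filt_presheaf_0 op filt_incl_morphism]
  morph_on_hom_post[OF T filt_presheaf op filt_quot_morphism[OF order_refl]] \<U> F_split e, folded c1_def]
 have B: "boundary_map \<Y> p 1 b \<nu> = coclass Y ?D (Suc p) \<U>
  (cochain_map Y (Suc p) (hom_post T ?F' (filt_quot \<Y> (b + 1) (b + 1))) \<U> c1)"
  using px.Y.cohomology_map_coclass[OF hF' hD morph_on_hom_post[OF T filt_presheaf_0 op filt_quot_morphism_0] \<U> conF(1)]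
  unfolding boundary_map_def Let_def add.commute[of 1 b] T_def[symmetric] \<nu>_e conF(2) diff_self_eq_0 Suc_eq_plus1 .

 note hTY = px.Y.presheaf_hom[OF TXs TY_presheaf] and hTX = px.Y.presheaf_hom[OF TXs TX_presheaf]
 have M_split: "\<forall>y\<in>points Y. split_on Y (\<U> y) ?A (hom_bundle Y TX TY) (hom_bundle Y TX TX)
  (hom_post TX TB (odd_incl \<Y>)) (hom_post TX TY (odd_proj \<Y>)) (hom_post TX TX (s y)) (hom_post TX TY (\<rho> y))"
 proof
  fix y assume y: "y \<in> points Y"
  show "split_on Y (\<U> y) ?A (hom_bundle Y TX TY) (hom_bundle Y TX TX)
  (hom_post TX TB (odd_incl \<Y>)) (hom_post TX TY (odd_proj \<Y>)) (hom_post TX TX (s y)) (hom_post TX TY (\<rho> y))"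
  by (rule split_on_hom_post[OF TXs TB_presheaf TY_presheaf TX_presheaf incl proj \<U>o[OF y] sp[OF y]])
 qed
 let ?id = "\<lambda>ys\<in>simplices Y 0. \<lambda>z\<in>points Y. \<lambda>v\<in>carrier (fib TX z). v"
 have pc: "is_cover Y (%_. points Y)" and \<U>p: "\<forall>y\<in>points Y. \<U> y <= points Y"
  using mopenD[OF \<U>o] by (auto simp: is_cover_def)
 \<comment> \<open>The identity class is given on the trivial cover; its restriction to \<U> is the
   form in which the splittings apply.\<close>
 define i where "i = cochain_restrict Y 0 \<U> ?id"
 have i: "i \<in> cocycles Y (hom_bundle Y TX TX) 0 \<U>"
  unfolding i_def by (rule px.Y.cocycle_restrict[OF hTX pc \<U> \<U>p identity_cocycle])
 \<comment> \<open>The model cocycle, from the same theorem and the same choices \<open>s\<close>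
   and \<rho>, so that it can be compared with \<open>c1\<close> as a cochain and not only up to
   coboundaries.\<close>
 define \<theta> where "\<theta> = (\<lambda>ys\<in>simplices Y (Suc 0). \<lambda>z\<in>overlap \<U> ys.
  hom_post TX TY (\<rho> (hd ys)) z (hom_post TX TX (s (hd (tl ys))) z (i (tl ys) z)))"
 note conM = px.Y.connecting_coclass[OF hA hTY hTX morph_on_hom_post[OF TXs TB_presheaf op incl]
  morph_on_hom_post[OF TXs TY_presheaf op proj] \<U> M_split i, folded \<theta>_def One_nat_def]
 have model: "model_class \<Y> = coclass Y ?A 1 \<U> \<theta>"
  unfolding model_class_def Let_def
  px.Y.coclass_restrict[OF hTX pc \<U> \<U>p cocycleD[OF identity_cocycle], folded i_def, symmetric]
  by (rule conM(2))
 note TC = px.Y.T_presheaf[OF hA hC]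
 have M: "model_class_map \<Y> p b \<nu> = coclass Y ?D (1 + p) \<U> (cochain_map Y (1 + p) (%y. tensor_lift (fib ?A y) (fib ?C y) (fib ?D y)
  (%(f, g). compose (carrier (fib T y)) (contract \<Y> b y f) g)) \<U> (px.Y.cup_cochain ?A ?C 1 p \<U> \<theta> e))"
  unfolding model_class_map_def Let_def T_def[symmetric] model \<nu>_e px.Y.cup_coclass[OF hA hC \<U> conM(1) e]
  by (rule px.Y.cohomology_map_coclass[OF TC hD cmap_morphism[OF T R] \<U> px.Y.cup_cocycle[OF hA hC \<U> conM(1) e]])

 have "cochain_map Y (Suc p) (hom_post T ?F' (filt_quot \<Y> (b + 1) (b + 1))) \<U> c1 =
  cochain_map Y (Suc p) (%y. tensor_lift (fib ?A y) (fib ?C y) (fib ?D y)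
  (%(f, g). compose (carrier (fib T y)) (contract \<Y> b y f) g)) \<U> (px.Y.cup_cochain ?A ?C 1 p \<U> \<theta> e)"
  unfolding cochain_map_def
 proof (intro restrict_ext)
  fix ys z assume ys: "ys \<in> simplices Y (Suc p)" and z: "z \<in> overlap \<U> ys"
  \<comment> \<open>The cup product evaluates \<theta> on \<open>[y0, y1]\<close> and
    \<open>e\<close> on \<open>y1 # zs\<close>. The common vertex \<open>y1\<close> is the one whose
    section lifts \<open>e\<close> in \<open>c1\<close>.\<close>
  obtain y0 y1 zs where ysE: "ys = y0 # y1 # zs" and len: "length zs = p"
  using ys by (auto simp: simplices_def length_Suc_conv)
  have y0: "y0 \<in> points Y" and y1: "y1 \<in> points Y" and z0: "z \<in> \<U> y0" and z1: "z \<in> \<U> y1"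
  using ys z by (auto simp: ysE simplices_def overlap_def)
  have tl: "y1 # zs \<in> simplices Y p" "z \<in> overlap \<U> (y1 # zs)" and pr: "[y0, y1] \<in> simplices Y 1" "z \<in> overlap \<U> [y0, y1]"
  and s1: "[y1] \<in> simplices Y 0" "z \<in> overlap \<U> [y1]"
  using ys z by (auto simp: ysE simplices_def overlap_def One_nat_def)
  have zp: "z \<in> points Y" by (rule mopenD[OF \<U>o[OF y0] z0])
  note U0 = \<U>o[OF y0] sp[OF y0] z0 and U1 = \<U>o[OF y1] sp[OF y1] z1
  note cT = hom_source_ops[OF T zp]
  have ecl: "e (y1 # zs) z \<in> carrier (fib ?C z)"
  by (rule px.Y.cochain_closed[OF hC \<U> cocycleD[OF e] tl])
  then have g: "e (y1 # zs) z \<in> linear_maps (fib T z) (fib (graded_bundle \<Y> 1 b) z)" by simp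
  have gv: "e (y1 # zs) z v \<in> carrier (ext_tensor b (fV z) 1 (fW z))" if "v \<in> carrier (fib T z)" for v
  using lin_closed[OF linear_map_lin[OF g] that] by (simp add: fib_graded)
  note secl = morph_on_lin[OF filt_section_morphism[OF U1(1,2), of b] z1]
  note retl = morph_on_lin[OF filt_retraction_morphism[OF U0(1,2), of b] z0]
  define h where "h = hom_post T ?F (filt_retraction (s y0) b) z (hom_post T (graded_bundle \<Y> 1 b) (filt_section (s y1) b) z (e (y1 # zs) z))"
  have h_mem: "h \<in> linear_maps (fib T z) (fib ?F' z)"
  unfolding h_def by (rule hom_post_linear_map[where T = T and y = z and \<phi> = "filt_retraction (s y0) b", OF cT retl hom_post_linear_map[where T = T and y = z and \<phi> = "filt_section (s y1) b", OF cT secl g]])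
  have h: "h = (\<lambda>v\<in>carrier (fib T z). filt_retraction (s y0) b z (filt_section (s y1) b z (e (y1 # zs) z v)))"
  unfolding h_def by (rule hom_post_hom_post[where T = T and y = z and \<phi> = "filt_section (s y1) b", OF cT secl g])
  have i1: "i [y1] z = (\<lambda>v\<in>carrier (fW z). v)" using s1 zp by (simp add: i_def cochain_restrict_def)
  have im: "i [y1] z \<in> linear_maps (fib TX z) (fib TX z)"
  using px.Y.cochain_closed[OF hTX \<U> cocycleD[OF i] s1] by simp
  note sl = split_onD(1)[OF U1(2,3)] and \<rho>l = split_onD(2)[OF U0(2,3)]
  have "hom_post TX TY (\<rho> y0) z (hom_post TX TX (s y1) z (i [y1] z)) = (\<lambda>w\<in>carrier (fib TX z). \<rho> y0 z (s y1 z (i [y1] z w)))"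
  by (rule hom_post_hom_post[where T = TX and y = z and \<phi> = "s y1", OF hom_source_ops[OF TXs zp] _ im]) (simp add: sl)
  also have "... = (\<lambda>w\<in>carrier (fW z). \<rho> y0 z (s y1 z w))" unfolding fib_simps by (rule restrict_ext) (simp add: i1)
  finally have \<theta>1: "\<theta> [y0, y1] z = (\<lambda>w\<in>carrier (fW z). \<rho> y0 z (s y1 z w))"
  using pr by (simp add: \<theta>_def One_nat_def)
  have \<theta>cl: "\<theta> [y0, y1] z \<in> carrier (fib ?A z)" by (rule px.Y.cochain_closed[OF hA \<U> cocycleD[OF conM(1)] pr])
  have "hom_post T ?F' (filt_quot \<Y> (b + 1) (b + 1)) z (c1 ys z) = hom_post T ?F' (filt_quot \<Y> (b + 1) (b + 1)) z h"
  using ys z by (simp add: c1_def h_def ysE)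
  also have "... = (\<lambda>v\<in>carrier (fib T z). filt_quot \<Y> (b + 1) (b + 1) z (h v))" by (rule hom_post_eq[OF h_mem])
  also have "... = (\<lambda>v\<in>carrier (fib T z). contr b (fV z) (fW z) (\<theta> [y0, y1] z) (e (y1 # zs) z v))"
  proof (rule restrict_ext)
  fix v assume v: "v \<in> carrier (fib T z)"
  have "filt_quot \<Y> (b + 1) (b + 1) z (h v) = contr b (fV z) (fW z) (%w. \<rho> y0 z (s y1 z w)) (e (y1 # zs) z v)"
  using filt_quot_retraction_section[OF U0 U1 gv[OF v]] v by (simp add: h)
  \<comment> \<open>The value of \<theta> is the same composite cut down to the carrier, a
    difference that \<open>contr\<close> does not see.\<close>
  also have "... = contr b (fV z) (fW z) (\<theta> [y0, y1] z) (e (y1 # zs) z v)"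
  by (rule contr_cong[OF cvs_fibers(1,2)[OF zp] lin_comp[OF sl \<rho>l] gv[OF v], symmetric]) (simp add: \<theta>1)
  finally show "filt_quot \<Y> (b + 1) (b + 1) z (h v) = contr b (fV z) (fW z) (\<theta> [y0, y1] z) (e (y1 # zs) z v)" .
  qed
  also have "... = tensor_lift (fib ?A z) (fib ?C z) (fib ?D z) (%(f, g). compose (carrier (fib T z)) (contract \<Y> b z f) g)
  (tensor_elem (fib ?A z) (fib ?C z) (\<theta> [y0, y1] z) (e (y1 # zs) z))"
  by (rule cmap_elem[OF T R zp \<theta>cl ecl, symmetric])
  also have "tensor_elem (fib ?A z) (fib ?C z) (\<theta> [y0, y1] z) (e (y1 # zs) z) = px.Y.cup_cochain ?A ?C 1 p \<U> \<theta> e ys z"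
  using px.Y.cup_cochain_eq[OF hA hC, of ys 1 p z \<U> \<theta> e] ys z by (simp add: ysE One_nat_def)
  finally show "hom_post T ?F' (filt_quot \<Y> (b + 1) (b + 1)) z (c1 ys z) =
  tensor_lift (fib ?A z) (fib ?C z) (fib ?D z) (%(f, g). compose (carrier (fib T z)) (contract \<Y> b z f) g)
  (px.Y.cup_cochain ?A ?C 1 p \<U> \<theta> e ys z)" .
 qed
 then show ?thesis unfolding B M plus_1_eq_Suc by (rule arg_cong)
qed

end

theorem proposition2p3p4:
 fixes \<Y> :: "('x, 'b, 'u, 'w, 'e) gt_data" and b p :: nat
 assumes "gt_model \<Y>"
 shows "model_class_map \<Y> p b ` H_group \<Y> p 1 b \<subseteq> boundary_map \<Y> p 1 b ` H_group \<Y> p 1 b"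
proof -
 interpret gt \<Y> by unfold_locales (rule assms)
 show ?thesis
 proof (rule image_subsetI)
  fix \<nu> assume \<nu>: "\<nu> \<in> H_group \<Y> p 1 b"
  show "model_class_map \<Y> p b \<nu> \<in> boundary_map \<Y> p 1 b ` H_group \<Y> p 1 b"
  unfolding boundary_map_eq_model_class_map[OF \<nu>, symmetric] using \<nu> by (rule imageI)
 qed
qed

end
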